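(* Let $d\ge 1$ and $k\ge 1$ be integers, let $X_1,X_2,\dots$ be iid random points in $\mathbb{R}^d$ with a density $f$ that is a.e. continuous and bounded, and let $\mathcal{X}_n=\{X_1,\dots,X_n\}$. Let $(r_n)$ be a sequence of positive numbers with $n r_n^d\to 0$ and $n^{k+2}r_n^{d(k+1)}\to\infty$ as $n\to\infty$. Assume that $(r_n)$ is regularly varying with some exponent $\rho<0$, i.e. $\lim_{n\to\infty} r_{\lfloor an\rfloor}/r_n=a^\rho$ for all $a>0$, and that for some $\eta>0$ there is a constant $C>0$ with $n^{k+2}r_n^{d(k+1)}\ge C(\log n)^\eta$ for all $n\ge1$. Let $\xi_{k,n}$ be the $k$th persistence diagram of the scaled Čech filtration $\big(\check{C}(\mathcal{X}_n,r_nt),\,t\ge 0\big)$, viewed as a point process on $\Delta_L=\{(x,y):0\le x<y\le\infty\}$. Then there exists a unique Radon measure $\mu_k\in M_+(\Delta_L)$ such that $$\frac{\xi_{k,n}}{n^{k+2}r_n^{d(k+1)}}\stackrel{v}{\to}\mu_k\quad\text{almost surely in } M_+(\Delta_L),$$ and $$\frac{\mathbb{E}[\xi_{k,n}]}{n^{k+2}r_n^{d(k+1)}}\stackrel{v}{\to}\mu_k\quad\text{in } M_+(\Delta_L),$$ where $\mathbb{E}[\xi_{k,n}]$ is the mean measure of $\xi_{k,n}$, which itself is a Radon measure on $\Delta_L$. The measure $\mu_k$ satisfies $$\mu_k(R_{s,t,u,v})=C_k\int_{(\mathbb{R}^d)^{k+1}}H_{s,t,u,v}(0,y_1,\dots,y_{k+1})\,d\mathbf{y},$$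 except for at most countably many $R_{s,t,u,v}\in\mathcal{A}$.
   Context: **Čech complex and filtration.** $B(x,\rho)$ is the closed ball in $\mathbb{R}^d$ with center $x$ and radius $\rho$. For a finite set $\mathcal{X}\subset\mathbb{R}^d$ and $r\ge 0$, the Čech complex $\check{C}(\mathcal{X},r)$ has the points of $\mathcal{X}$ as $0$-simplices, and for $m\ge1$ the points $x_{i_0},\dots,x_{i_m}\in\mathcal{X}$ form an $m$-simplex iff $\bigcap_{j=0}^m B(x_{i_j},r/2)\ne\emptyset$. (For $r=\infty$ all simplices are present.) The Čech filtration over $r_n^{-1}\mathcal{X}_n$ is $\big(\check{C}(r_n^{-1}\mathcal{X}_n,t),t\ge0\big)=\big(\check{C}(\mathcal{X}_n,r_nt),t\ge0\big)$. Homology is taken with coefficients in a fixed field, and $\beta_k$ denotes the $k$th Betti number. **Persistence diagram as a point process.** $\Delta_L=\{(x,y):0\le x<y\le\infty\}$ carries the relative topology of $[0,\infty)\times[0,\infty]$. Let $\big((b_i,d_i)\big)_{i=1}^{n_k}$ be the list (with multiplicity) of the $k$th persistence birth–death pairs of the Čech filtration $\big(\check{C}(\mathcal{X}_n,r_nt),t\ge0\big)$: $b_i$ is the time at which a $k$-cycle first appears and $d_i$ the time at which it is filled in. Put $\xi_{k,n}=\sum_i\delta_{(b_i,d_i)}$, regarded as a random point measure on $\Delta_L$. Equivalently, with the persistent Betti numbers $$\beta_{k,n}(s,t)=\dim\frac{Z_k(\check{C}(\mathcal{X}_n,r_ns))}{Z_k(\check{C}(\mathcal{X}_n,r_ns))\cap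 B_k(\check{C}(\mathcal{X}_n,r_nt))},\quad 0\le s\le t\le\infty$$ ($Z_k$, $B_k$ being the groups of $k$-cycles and $k$-boundaries), one has $\xi_{k,n}(R_{s,t,u,v})=\beta_{k,n}(t,u)-\beta_{k,n}(t,v)-\beta_{k,n}(s,u)+\beta_{k,n}(s,v)$ for the rectangles below. **Rectangles.** $\mathcal{A}=\{(s,t]\times(u,v],\ [0,t]\times(u,v]:\ 0\le s\le t\le u\le v\le\infty,\ t<\infty\}$; an element of $\mathcal{A}$ is denoted $R_{s,t,u,v}$ (if $s=0$ it represents either $(0,t]\times(u,v]$ or $[0,t]\times(u,v]$). **Vague convergence.** $M_+(\Delta_L)$ is the space of Radon measures on $\Delta_L$ with the vague topology; $\nu_n\stackrel{v}{\to}\nu$ means $\int\varphi\,d\nu_n\to\int\varphi\,d\nu$ for every non-negative continuous $\varphi$ on $\Delta_L$ with compact support. **Indicators and constant.** For $\mathbf{x}=(x_1,\dots,x_{k+2})\in(\mathbb{R}^d)^{k+2}$, $$h_r(\mathbf{x})=\mathbf{1}\big\{\beta_k(\check{C}(\{x_1,\dots,x_{k+2}\},r))=1\big\},$$ so that $h_r(\mathbf x)=1$ iff every $k+1$ of the balls $B(x_j,r/2)$ have a common point but all $k+2$ do not ($h_\infty\equiv0$). For $0\le s\le t\le u\le v\le\infty$, $$H_{s,t,u,v}(\mathbf{x})=h_t(\mathbf{x})h_u(\mathbf{x})-h_t(\mathbf{x})h_v(\mathbf{x})-h_s(\mathbf{x})h_u(\mathbf{x})+h_s(\mathbf{x})h_v(\mathbf{x}).$$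 Finally $C_k=\frac{1}{(k+2)!}\int_{\mathbb{R}^d}f(x)^{k+2}dx$. *)

theory Defs
  imports "HOL-Probability.Probability" "HOL-Library.Function_Algebras"
begin

section \<open>Simplicial homology over a field\<close>

text \<open>A simplicial complex is a set of finite nonempty sets of vertices. To orient the simplices,
  one linear order on the vertex type is fixed once and for all; a \<open>k\<close>-chain then assigns a
  coefficient to every \<open>k\<close>-simplex, a set of \<open>k + 1\<close> vertices listed in increasing order.
  Dimensions of homology groups do not depend on the chosen order.\<close>

definition vertex_order :: "('a \<times> 'a) set" where
  "vertex_order = (SOME R. linear_order R)"

lemma linear_order_vertex_order: "linear_order (vertex_order :: ('a \<times> 'a) set)"
proof -
  obtain R :: "('a \<times> 'a) set" where "well_order_on UNIV R"
    using well_order_on by blast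
  then have "linear_order R"
    by (simp add: well_order_on_def)
  then show ?thesis
    unfolding vertex_order_def by (rule someI)
qed

definition simplicial_chains :: "nat \<Rightarrow> 'a set set \<Rightarrow> ('a set \<Rightarrow> 'f::field) set" where
  "simplicial_chains k K = {c. finite {\<sigma>. c \<sigma> \<noteq> 0} \<and> (\<forall>\<sigma>. c \<sigma> \<noteq> 0 \<longrightarrow> \<sigma> \<in> K \<and> card \<sigma> = Suc k)}"

text \<open>The coefficient of \<open>\<tau>\<close> in the boundary of the simplex \<open>\<sigma>\<close>. There is no empty
  simplex, so vertices have boundary 0 and homology is not reduced.\<close>

definition incidence :: "'a set \<Rightarrow> 'a set \<Rightarrow> 'f::field" where
  "incidence \<sigma> \<tau> =
     (\<Sum>v\<in>\<sigma>. if \<tau> = \<sigma> - {v} \<and> \<tau> \<noteq> {}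
             then (-1) ^ card {w \<in> \<sigma>. w \<noteq> v \<and> (w, v) \<in> vertex_order} else 0)"

definition boundary :: "('a set \<Rightarrow> 'f::field) \<Rightarrow> 'a set \<Rightarrow> 'f" where
  "boundary c \<tau> = (\<Sum>\<sigma> | c \<sigma> \<noteq> 0. c \<sigma> * incidence \<sigma> \<tau>)"

definition cycles :: "nat \<Rightarrow> 'a set set \<Rightarrow> ('a set \<Rightarrow> 'f::field) set" where
  "cycles k K = {c \<in> simplicial_chains k K. \<forall>\<tau>. boundary c \<tau> = 0}"

definition boundaries :: "nat \<Rightarrow> 'a set set \<Rightarrow> ('a set \<Rightarrow> 'f::field) set" where
  "boundaries k K = boundary ` simplicial_chains (Suc k) K"

definition chain_scale :: "'f::field \<Rightarrow> ('a set \<Rightarrow> 'f) \<Rightarrow> 'a set \<Rightarrow> 'f" where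
  "chain_scale a c = (\<lambda>\<sigma>. a * c \<sigma>)"

interpretation chain_space: vector_space "chain_scale :: 'f::field \<Rightarrow> ('a set \<Rightarrow> 'f) \<Rightarrow> 'a set \<Rightarrow> 'f"
  by unfold_locales (auto simp: chain_scale_def fun_eq_iff algebra_simps)

text \<open>The dimension of the quotient \<open>Z\<^sub>k(K) / (Z\<^sub>k(K) \<inter> B\<^sub>k(L))\<close> for finite complexes
  \<open>K \<subseteq> L\<close>; the chain spaces are finite-dimensional, so it is a difference of dimensions.
  The first argument selects the coefficient field.\<close>

definition persistent_betti ::
    "'f::field itself \<Rightarrow> nat \<Rightarrow> 'a set set \<Rightarrow> 'a set set \<Rightarrow> nat" where
  "persistent_betti _ k K L =
     chain_space.dim (cycles k K :: ('a set \<Rightarrow> 'f) set)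
     - chain_space.dim (cycles k K \<inter> boundaries k L :: ('a set \<Rightarrow> 'f) set)"

definition betti :: "'f::field itself \<Rightarrow> nat \<Rightarrow> 'a set set \<Rightarrow> nat" where
  "betti F k K = persistent_betti F k K K"


section \<open>The persistence diagram as a measure\<close>

definition Delta_L :: "(real \<times> ereal) set" where
  "Delta_L = {(x, y). 0 \<le> x \<and> ereal x < y}"

definition before :: "(ereal \<Rightarrow> 'a set set) \<Rightarrow> ereal \<Rightarrow> 'a set set" where
  "before F t = (\<Union>s\<in>{0..<t}. F s)"

text \<open>The number of \<open>k\<close>th birth--death pairs equal to \<open>(b, d)\<close>: the classes present at time
  \<open>b\<close> that die exactly at time \<open>d\<close>, minus those of them that were present before time \<open>b\<close>.
  This is the inclusion-exclusion expression
  \<open>\<beta>(t,u) - \<beta>(t,v) - \<beta>(s,u) + \<beta>(s,v)\<close> for the rectangle \<open>(s,t] \<times> (u,v]\<close> with \<open>t = b\<close>,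
  \<open>v = d\<close> and \<open>s\<close>, \<open>u\<close> just below \<open>b\<close>, \<open>d\<close>.
  For a filtration of finite complexes the integer is non-negative. The filtration is indexed by
  \<open>[0,\<infinity>]\<close> and is empty before time 0, so births at time 0 and deaths at time \<open>\<infinity>\<close>
  need no separate treatment.\<close>

definition pair_multiplicity ::
    "'f::field itself \<Rightarrow> nat \<Rightarrow> (ereal \<Rightarrow> 'a set set) \<Rightarrow> real \<times> ereal \<Rightarrow> nat" where
  "pair_multiplicity f k F = (\<lambda>(b, d). nat (
     (int (persistent_betti f k (F b) (before F d)) - int (persistent_betti f k (F b) (F d)))
     - (int (persistent_betti f k (before F b) (before F d))
        - int (persistent_betti f k (before F b) (F d)))))"

text \<open>The sum of the Dirac measures at the birth--death pairs, on the Borel sets of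
  \<open>\<Delta>\<^sub>L\<close>.\<close>

definition persistence_diagram ::
    "'f::field itself \<Rightarrow> nat \<Rightarrow> (ereal \<Rightarrow> 'a set set) \<Rightarrow> (real \<times> ereal) measure" where
  "persistence_diagram f k F =
     distr (point_measure Delta_L (\<lambda>p. of_nat (pair_multiplicity f k F p)))
       (restrict_space borel Delta_L) (\<lambda>p. p)"


section \<open>The Cech filtration\<close>

definition cech :: "'a::euclidean_space set \<Rightarrow> ereal \<Rightarrow> 'a set set" where
  "cech P r = {\<sigma>. \<sigma> \<noteq> {} \<and> finite \<sigma> \<and> \<sigma> \<subseteq> P \<and>
     (card \<sigma> = 1 \<or> r = \<infinity> \<or> (\<Inter>x\<in>\<sigma>. cball x (real_of_ereal r / 2)) \<noteq> {})}"

definition cech_diagram ::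
    "'f::field itself \<Rightarrow> nat \<Rightarrow> 'a::euclidean_space set \<Rightarrow> real \<Rightarrow> (real \<times> ereal) measure" where
  "cech_diagram f k P \<rho> = persistence_diagram f k (\<lambda>t. cech P (ereal \<rho> * t))"

text \<open>The \<open>k + 2\<close> points of the tuple are \<open>x 0, \<dots>, x (k + 1)\<close>.\<close>

definition h_ind :: "'f::field itself \<Rightarrow> nat \<Rightarrow> ereal \<Rightarrow> (nat \<Rightarrow> 'a::euclidean_space) \<Rightarrow> real" where
  "h_ind f k r x = (if betti f k (cech (x ` {0..k+1}) r) = 1 then 1 else 0)"

definition H_ind ::
    "'f::field itself \<Rightarrow> nat \<Rightarrow> ereal \<Rightarrow> ereal \<Rightarrow> ereal \<Rightarrow> ereal
      \<Rightarrow> (nat \<Rightarrow> 'a::euclidean_space) \<Rightarrow> real" where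
  "H_ind f k s t u v x =
     h_ind f k t x * h_ind f k u x - h_ind f k t x * h_ind f k v x
     - h_ind f k s x * h_ind f k u x + h_ind f k s x * h_ind f k v x"

definition C_const :: "('a::euclidean_space \<Rightarrow> real) \<Rightarrow> nat \<Rightarrow> real" where
  "C_const f k = (1 / fact (k + 2)) * (\<integral>x. f x ^ (k + 2) \<partial>lborel)"


section \<open>Rectangles\<close>

text \<open>\<open>R\<close> is one of the sets denoted \<open>R\<^sub>s\<^sub>,\<^sub>t\<^sub>,\<^sub>u\<^sub>,\<^sub>v\<close>; for \<open>s = 0\<close>
  there are two of them.\<close>

definition is_rectangle :: "real \<Rightarrow> real \<Rightarrow> ereal \<Rightarrow> ereal \<Rightarrow> (real \<times> ereal) set \<Rightarrow> bool" where
  "is_rectangle s t u v R \<longleftrightarrow> 0 \<le> s \<and> s \<le> t \<and> ereal t \<le> u \<and> u \<le> v \<and>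
     (R = {s<..t} \<times> {u<..v} \<or> s = 0 \<and> R = {0..t} \<times> {u<..v})"


section \<open>Radon measures, vague convergence and random measures\<close>

text \<open>For a subset \<open>S\<close> that is locally compact with a countable base, such as
  \<open>\<Delta>\<^sub>L\<close>, a Borel measure that is finite on compact sets is automatically regular.\<close>

definition radon_measure_on :: "'a::topological_space set \<Rightarrow> 'a measure \<Rightarrow> bool" where
  "radon_measure_on S \<nu> \<longleftrightarrow> sets \<nu> = sets (restrict_space borel S) \<and>
     (\<forall>K. compact K \<and> K \<subseteq> S \<longrightarrow> emeasure \<nu> K < \<infinity>)"

definition vague_tendsto ::
    "'a::topological_space set \<Rightarrow> (nat \<Rightarrow> 'a measure) \<Rightarrow> 'a measure \<Rightarrow> bool" where
  "vague_tendsto S \<nu>s \<nu> \<longleftrightarrow>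
     (\<forall>\<phi> :: 'a \<Rightarrow> real. continuous_on S \<phi> \<and> (\<forall>x\<in>S. 0 \<le> \<phi> x) \<and>
        (\<exists>K. compact K \<and> K \<subseteq> S \<and> (\<forall>x\<in>S - K. \<phi> x = 0)) \<longrightarrow>
        (\<lambda>n. \<integral>x. \<phi> x \<partial>\<nu>s n) \<longlonglongrightarrow> (\<integral>x. \<phi> x \<partial>\<nu>))"

definition random_measure_on ::
    "'w measure \<Rightarrow> 'a::topological_space set \<Rightarrow> ('w \<Rightarrow> 'a measure) \<Rightarrow> bool" where
  "random_measure_on M S \<xi> \<longleftrightarrow> (\<forall>\<omega>\<in>space M. radon_measure_on S (\<xi> \<omega>)) \<and>
     (\<forall>B\<in>sets (restrict_space borel S). (\<lambda>\<omega>. emeasure (\<xi> \<omega>) B) \<in> borel_measurable M)"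

text \<open>By monotone convergence \<open>B \<mapsto> E[\<xi>(B)]\<close> is countably additive as soon as \<open>\<xi>\<close> is a
  random measure, so that \<^const>\<open>measure_of\<close> returns the measure with these values.\<close>

definition mean_measure ::
    "'w measure \<Rightarrow> 'a::topological_space set \<Rightarrow> ('w \<Rightarrow> 'a measure) \<Rightarrow> 'a measure" where
  "mean_measure M S \<xi> =
     measure_of S (sets (restrict_space borel S)) (\<lambda>B. \<integral>\<^sup>+\<omega>. emeasure (\<xi> \<omega>) B \<partial>M)"

end

theory Submission
  imports Defs
begin

text \<open>In the sparse regime \<open>n r\<^sub>n\<^sup>d \<rightarrow> 0\<close> almost every feature of dimension \<open>k\<close> is created by \<open>k + 2\<close>
  isolated points: the hollow simplex on them is born when its last facet appears and is filled when
  the simplex itself appears. Cutting the filtration at its isolated and its crowded simplices shows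
  that \<open>\<integral>\<phi> d\<xi>\<^sub>n\<close> differs from the sum of \<open>\<phi>(birth, death)\<close> over all \<open>(k + 2)\<close>-subsets of the sample by
  at most a constant times the number of \<open>(k + 3)\<close>-subsets of diameter \<open>O(r\<^sub>n)\<close>, which is of smaller
  order. The mean of the sum is computed by rescaling around one of its points; the limit measure is
  \<open>C\<^sub>k\<close> times the law of the two times of \<open>k + 2\<close> points, one of them 0, under Lebesgue measure.

  For almost sure convergence, high central moments of such local sums are bounded by powers of
  the mean, so a Borel--Cantelli argument works along geometric subsequences, where the scaling grows
  like a power of the index. The number of subsets that are born before \<open>s r\<^sub>n\<close> and filled before
  \<open>u r\<^sub>n\<close> is monotone in \<open>n\<close> and in \<open>r\<^sub>n\<close>, so regular variation transfers the convergence to the full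
  sequence. These counts determine the integrals of continuous functions by approximation with combinations
  of quadrants.\<close>

section \<open>Linear algebra\<close>

text \<open>A persistence diagram is neither a local nor a monotone functional of the sample. The
  comparison with local sums therefore avoids describing it: each multiplicity is at least the
  number of isolated groups with these two times, while the total number of pairs born by time
  \<open>T\<close> is at most the dimension of the cycle space, which exceeds the number of isolated
  groups by at most a multiple of the crowded ones. As no multiplicity falls below its lower bound,
  the two estimates control all bounded test functions at once.

  The normalization is only known to grow at least like \<open>ln n\<close> to the power
  \<open>\<eta>\<close>. At indices of geometric growth this is a possibly small power of the
  running index, so moments of order above \<open>4 / \<eta>\<close> are taken for summability.
  Interpolation then requires counts that are monotone in the number of points and in the scale,
  whence the quadrants; because a death is at most twice the birth, finitely many of them
  approximate a test function whose births are bounded.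

  No rectangle turns out to be exceptional: the two readings of one with \<open>s = 0\<close> differ
  by a set of limit measure 0.\<close>

lemma (in vector_space) span_Int_independent:
  assumes "independent B" "A \<subseteq> B" "x \<in> span A" "x \<in> span (B - A)"
  shows "x = 0"
proof -
  have "representation B x = representation A x"
    by (rule representation_extend) (use assms in auto)
  moreover have "representation B x = representation (B - A) x"
    by (rule representation_extend) (use assms in auto)
  ultimately have "representation B x v = 0" for v
    by (metis DiffD2 representation_ne_zero)
  moreover have "x \<in> span B"
    using assms(2,3) span_mono by blast
  ultimately show ?thesis
    using sum_nonzero_representation_eq[OF assms(1)] by fastforce
qed

text \<open>If a new vector \<open>b\<close> lay in \<open>span (A \<union> B)\<close>, subtracting
  its part in \<open>span B\<close> would leave a vector common to both spans, hence 0, and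
  \<open>b\<close> would already be in \<open>span B\<close>.\<close>

lemma (in vector_space) independent_Un_span_Int:
  assumes "independent A" "finite B" "independent B" "span A \<inter> span B \<subseteq> {0}"
  shows "independent (A \<union> B) \<and> A \<inter> B = {}"
  using assms(2-)
proof (induction B rule: finite_induct)
  case empty
  then show ?case using assms(1) by simp
next
  case (insert b B)
  have indB: "independent B" and bB: "b \<notin> span B"
    using insert.prems(1) insert.hyps(2) by (auto simp: independent_insert)
  have "span B \<subseteq> span (insert b B)"
    by (simp add: span_mono subset_insertI)
  then have IH: "independent (A \<union> B)" "A \<inter> B = {}"
    using insert.IH[OF indB] insert.prems(2) by blast+
  have "b \<notin> span (A \<union> B)"
  proof
    assume "b \<in> span (A \<union> B)"
    then obtain x y where xy: "x \<in> span A" "y \<in> span B" "b = x + y"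
      unfolding span_Un by blast
    then have "x = b - y" by simp
    also have "\<dots> \<in> span (insert b B)"
      by (meson insert_subset span_diff span_superset subset_insertI xy(2) span_mono in_mono)
    finally have "x = 0" using insert.prems(2) xy(1) by blast
    then show False using xy bB by simp
  qed
  then show ?case
    using IH by (auto simp: independent_insert span_base)
qed

text \<open>\<open>dim\<close> is the cardinality of a basis and so 0 in infinite dimension, as for
  the space of all chains over an infinite vertex type; monotonicity therefore asks for a finite
  spanning set.\<close>

lemma (in vector_space) dim_subset_finite:
  assumes "V \<subseteq> W" "W \<subseteq> span T" "finite T"
  shows "dim V \<le> dim W"
proof -
  obtain B where B: "B \<subseteq> V" "independent B" "card B = dim V"
    using basis_exists by metis
  obtain C where C: "C \<subseteq> W" "independent C" "W \<subseteq> span C" "card C = dim W"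
    using basis_exists by metis
  have "finite C"
    using C assms independent_span_bound by blast
  moreover have "B \<subseteq> span C" using B C assms by blast
  ultimately show ?thesis
    using independent_span_bound B C by metis
qed

text \<open>The dimension of \<open>A / (A1 + A2)\<close> is at least the number of the vectors \<open>z i\<close>.\<close>

lemma (in vector_space) dim_Int_ge:
  fixes z :: "'i \<Rightarrow> 'b"
  assumes sub: "subspace A1" "subspace A2" "A1 \<subseteq> A" "A2 \<subseteq> A"
    and fin: "A \<subseteq> span T" "finite T" and I: "finite I"
    and zA: "\<And>i. i \<in> I \<Longrightarrow> z i \<in> A"
    and N: "\<And>i. i \<in> I \<Longrightarrow> subspace (N i) \<and> A1 \<subseteq> N i \<and> A2 \<subseteq> N i \<and> z i \<notin> N i"
    and zN: "\<And>i j. i \<in> I \<Longrightarrow> j \<in> I \<Longrightarrow> i \<noteq> j \<Longrightarrow> z j \<in> N i"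
  shows "dim A1 + dim A2 + card I \<le> dim A + dim (A1 \<inter> A2)"
proof -
  \<comment> \<open>A basis of the intersection is extended separately to \<open>A1\<close> and to
    \<open>A2\<close>. Together the extensions, called \<open>E\<close> below, form a basis of the
    sum, which gives its size by inclusion-exclusion.\<close>
  obtain B0 where B0: "B0 \<subseteq> A1 \<inter> A2" "independent B0" "A1 \<inter> A2 \<subseteq> span B0" "card B0 = dim (A1 \<inter> A2)"
    using basis_exists by metis
  obtain B1 where B1: "B0 \<subseteq> B1" "B1 \<subseteq> A1" "independent B1" "A1 \<subseteq> span B1"
    using maximal_independent_subset_extend[of B0 A1] B0 by (metis le_inf_iff)
  obtain B2 where B2: "B0 \<subseteq> B2" "B2 \<subseteq> A2" "independent B2" "A2 \<subseteq> span B2"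
    using maximal_independent_subset_extend[of B0 A2] B0 by (metis le_inf_iff)
  have fB: "finite B" if "independent B" "B \<subseteq> A" for B
    using independent_span_bound[of T B] fin that by blast
  have f: "finite B0" "finite B1" "finite B2"
    using fB[OF B1(3)] fB[OF B2(3)] B1(1,2) B2(2) sub(3,4) finite_subset[OF B1(1)] by auto
  have U: "independent (B1 \<union> (B2 - B0)) \<and> B1 \<inter> (B2 - B0) = {}"
  proof (rule independent_Un_span_Int)
    show "independent (B2 - B0)" using B2 independent_mono by blast
    show "span B1 \<inter> span (B2 - B0) \<subseteq> {0}"
    proof
      fix x assume x: "x \<in> span B1 \<inter> span (B2 - B0)"
      have "x \<in> A1" using x B1 sub(1) span_minimal by blast
      moreover have "x \<in> A2" using x B2 sub(2) span_minimal[of "B2 - B0" A2] by blast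
      ultimately have "x \<in> span B0" using B0 by blast
      then show "x \<in> {0}" using span_Int_independent[of B2 B0 x] B2 x by auto
    qed
  qed (use f B1 in auto)
  define E where "E = B1 \<union> (B2 - B0)"
  have E: "independent E" "E \<subseteq> A" "E \<subseteq> A1 \<union> A2" "finite E"
    using U B1 B2 sub f by (auto simp: E_def)
  have cE: "card E + card B0 = card B1 + card B2"
  proof -
    have "card E = card B1 + card (B2 - B0)"
      unfolding E_def using U f by (simp add: card_Un_disjoint)
    moreover have "card B0 \<le> card B2" using B2 f by (simp add: card_mono)
    ultimately show ?thesis using B2 f by (simp add: card_Diff_subset)
  qed
  \<comment> \<open>\<open>N i\<close> contains \<open>E\<close> and every other \<open>z j\<close>,
    but not \<open>z i\<close>; so each new vector leaves the span of the earlier ones.\<close>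
  have "independent (E \<union> z ` J) \<and> card (E \<union> z ` J) = card E + card J" if "J \<subseteq> I" for J
    using finite_subset[OF that I] that
  proof (induction J rule: finite_induct)
    case empty
    then show ?case using E by simp
  next
    case (insert i J)
    have "E \<union> z ` J \<subseteq> N i"
      using E(3) N[of i] zN[of i] insert by auto
    then have "z i \<notin> span (E \<union> z ` J)"
      using N[of i] insert.prems span_minimal by blast
    moreover have "finite (E \<union> z ` J)" using E insert by simp
    ultimately show ?case using insert span_base
      by (auto simp: independent_insert)
  qed
  from this[of I] have "independent (E \<union> z ` I)" "card (E \<union> z ` I) = card E + card I" by auto
  moreover have "E \<union> z ` I \<subseteq> A" using E zA by auto
  moreover have "card B \<le> dim A" if "independent B" "B \<subseteq> A" for B
    using dim_subset_finite[of B A T] that fin by (simp add: dim_eq_card_independent)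
  ultimately have "card E + card I \<le> dim A" by metis
  moreover have "card B1 = dim A1" "card B2 = dim A2"
    using B1 B2 by (auto intro: basis_card_eq_dim)
  ultimately show ?thesis using cE B0 by linarith
qed

section \<open>Chains, cycles and boundaries\<close>

abbreviation position :: "'a set \<Rightarrow> 'a \<Rightarrow> nat" where
  "position s v \<equiv> card {w \<in> s. w \<noteq> v \<and> (w, v) \<in> vertex_order}"

lemma vertex_order_cases: "v \<noteq> w \<Longrightarrow> ((v, w) \<in> vertex_order) = ((w, v) \<notin> vertex_order)"
  using linear_order_vertex_order
  unfolding linear_order_on_def partial_order_on_def total_on_def antisym_def
  by (metis UNIV_I)

lemma incidence_face:
  assumes "finite s" "v \<in> s" "s - {v} \<noteq> {}"
  shows "(incidence s (s - {v}) :: 'f::field) = (-1) ^ position s v"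
proof -
  have eq: "s - {v} = s - {u} \<longleftrightarrow> u = v" if "u \<in> s" for u
    using that assms(2) by auto
  have "(incidence s (s - {v}) :: 'f) = (\<Sum>u\<in>s. if u = v then (-1) ^ position s u else 0)"
    unfolding incidence_def by (intro sum.cong refl if_cong) (use eq assms in auto)
  then show ?thesis using assms by (simp add: sum.delta)
qed

lemma incidence_nonzeroD:
  assumes "(incidence s t :: 'f::field) \<noteq> 0"
  shows "\<exists>v\<in>s. t = s - {v} \<and> t \<noteq> {}"
proof (rule ccontr)
  assume "\<not> ?thesis"
  then have "(incidence s t :: 'f) = 0"
    unfolding incidence_def by (intro sum.neutral) auto
  with assms show False by simp
qed

lemma incidence_nonzero:
  assumes "finite s" "v \<in> s" "s - {v} \<noteq> {}"
  shows "(incidence s (s - {v}) :: 'f::field) \<noteq> 0"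
  by (simp add: incidence_face[OF assms])

lemma boundary_eq_sum:
  assumes "finite S" "\<And>s. c s \<noteq> 0 \<Longrightarrow> s \<in> S"
  shows "boundary c t = (\<Sum>s\<in>S. c s * incidence s t)"
  unfolding boundary_def
  by (rule sum.mono_neutral_left) (use assms in \<open>auto intro: finite_subset\<close>)

text \<open>\<open>incidence Y\<close> is the boundary of the simplex \<open>Y\<close>, so this is
  the identity that boundaries are cycles. A face of codimension two is reached by deleting its two
  missing vertices in either order, and the two contributions cancel.\<close>

lemma boundary_incidence:
  assumes "finite Y"
  shows "boundary (incidence Y :: 'a set \<Rightarrow> 'f::field) r = 0"
proof (cases "\<exists>v w. v \<in> Y \<and> w \<in> Y \<and> v \<noteq> w \<and> r = Y - {v, w} \<and> r \<noteq> {}")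
  case False
  have "incidence Y s * incidence s r = (0::'f)" for s
  proof (rule ccontr)
    assume "incidence Y s * incidence s r \<noteq> (0::'f)"
    then have n: "incidence Y s \<noteq> (0::'f)" "incidence s r \<noteq> (0::'f)" by auto
    then obtain v w where "v \<in> Y" "s = Y - {v}" "w \<in> s" "r = s - {w}" "r \<noteq> {}"
      using incidence_nonzeroD[OF n(1)] incidence_nonzeroD[OF n(2)] by blast
    then have "v \<in> Y \<and> w \<in> Y \<and> v \<noteq> w \<and> r = Y - {v, w} \<and> r \<noteq> {}" by auto
    with False show False by blast
  qed
  then have "\<forall>s\<in>{s. incidence Y s \<noteq> (0::'f)}. incidence Y s * incidence s r = (0::'f)"
    by blast
  then show ?thesis unfolding boundary_def by (rule sum.neutral)
next
  case True
  then obtain v w where vw: "v \<in> Y" "w \<in> Y" "v \<noteq> w" "r = Y - {v, w}" "r \<noteq> {}" by blast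
  have "boundary (incidence Y :: 'a set \<Rightarrow> 'f) r = (\<Sum>s\<in>{Y - {v}, Y - {w}}. incidence Y s * incidence s r)"
    unfolding boundary_def
  proof (rule sum.mono_neutral_cong)
    have "s \<in> (\<lambda>v. Y - {v}) ` Y" if "incidence Y s \<noteq> (0::'f)" for s
      using incidence_nonzeroD[OF that] by blast
    then have "{s. incidence Y s \<noteq> (0::'f)} \<subseteq> (\<lambda>v. Y - {v}) ` Y"
      by blast
    then show "finite {s. incidence Y s \<noteq> (0::'f)}"
      using assms finite_surj by blast
    show "incidence Y s * incidence s r = (0::'f)"
      if "s \<in> {s. incidence Y s \<noteq> (0::'f)} - {Y - {v}, Y - {w}}" for s
    proof (rule ccontr)
      assume "incidence Y s * incidence s r \<noteq> (0::'f)"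
      then have n: "incidence Y s \<noteq> (0::'f)" "incidence s r \<noteq> (0::'f)" by auto
      then obtain v' w' where "v' \<in> Y" "s = Y - {v'}" "w' \<in> s" "r = s - {w'}"
        using incidence_nonzeroD[OF n(1)] incidence_nonzeroD[OF n(2)] by blast
      then show False using that vw by auto
    qed
  qed auto
  moreover have "Y - {v} \<noteq> Y - {w}" using vw by auto
  ultimately have b: "boundary (incidence Y :: 'a set \<Rightarrow> 'f) r =
      incidence Y (Y - {v}) * incidence (Y - {v}) r + incidence Y (Y - {w}) * incidence (Y - {w}) r"
    by simp
  have rho: "r = (Y - {v}) - {w}" "r = (Y - {w}) - {v}" using vw by auto
  have e: "incidence (Y - {v}) r = ((-1) ^ position (Y - {v}) w :: 'f)"
    "incidence (Y - {w}) r = ((-1) ^ position (Y - {w}) v :: 'f)"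
    "incidence Y (Y - {v}) = ((-1) ^ position Y v :: 'f)"
    "incidence Y (Y - {w}) = ((-1) ^ position Y w :: 'f)"
    using incidence_face[of "Y - {v}" w, where 'f = 'f] incidence_face[of "Y - {w}" v, where 'f = 'f]
      incidence_face[of Y v, where 'f = 'f] incidence_face[of Y w, where 'f = 'f] assms vw rho by auto
  \<comment> \<open>Deleting \<open>a\<close> shifts the position of \<open>b\<close> by one exactly
    if \<open>a\<close> precedes \<open>b\<close>. This happens in one of the two orders of deletion
    only, so the signs are opposite.\<close>
  have *: "position Y b = position (Y - {a}) b + (if (a, b) \<in> vertex_order then 1 else 0)"
    if "a \<in> Y" "a \<noteq> b" for a b
  proof -
    have "{x \<in> Y. x \<noteq> b \<and> (x, b) \<in> vertex_order} =
        (if (a, b) \<in> vertex_order then insert a {x \<in> Y - {a}. x \<noteq> b \<and> (x, b) \<in> vertex_order}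
         else {x \<in> Y - {a}. x \<noteq> b \<and> (x, b) \<in> vertex_order})"
      using that by auto
    then show ?thesis using assms by auto
  qed
  show ?thesis
    using *[of v w] *[of w v] vw vertex_order_cases[of v w]
    unfolding b e by (auto simp: algebra_simps)
qed

text \<open>The face \<open>s - {v}\<close> receives a nonzero contribution from \<open>s\<close>,
  which only another simplex of the cycle can cancel. For \<open>k \<ge> 1\<close> this face is
  nonempty and does count in the boundary.\<close>

lemma cycle_adjacent:
  fixes c :: "'a set \<Rightarrow> 'f::field"
  assumes c: "c \<in> cycles k K" and "k \<ge> 1" "c s \<noteq> 0" "v \<in> s"
  shows "\<exists>u. u \<notin> s \<and> c (insert u (s - {v})) \<noteq> 0"
proof -
  define S where "S = {s. c s \<noteq> 0}"
  have S: "finite S" and cardS: "\<And>s. s \<in> S \<Longrightarrow> card s = Suc k"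
    using c by (auto simp: S_def cycles_def simplicial_chains_def)
  have s: "finite s" "card s = Suc k"
    using cardS[of s] assms(3) card_ge_0_finite[of s] by (auto simp: S_def)
  define t where "t = s - {v}"
  have ct: "card t = k" using s assms by (simp add: t_def)
  then have tne: "t \<noteq> {}" using assms by auto
  have "(\<Sum>r\<in>S. c r * incidence r t) = boundary c t"
    by (rule boundary_eq_sum[symmetric]) (auto simp: S S_def[symmetric], auto simp: S_def)
  also have "\<dots> = 0" using c by (simp add: cycles_def)
  finally have 0: "(\<Sum>r\<in>S. c r * incidence r t) = 0" .
  have "\<exists>r\<in>S - {s}. c r * incidence r t \<noteq> 0"
  proof (rule ccontr)
    assume "\<not> ?thesis"
    then have "(\<Sum>r\<in>S. c r * incidence r t) = c s * incidence s t"
      using S assms(3) by (subst sum.remove[of _ s]) (auto simp: S_def)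
    moreover have "incidence s t \<noteq> (0::'f)"
      unfolding t_def by (rule incidence_nonzero) (use s assms(4) tne in \<open>auto simp: t_def\<close>)
    ultimately show False using 0 assms(3) by simp
  qed
  then obtain r where r: "r \<in> S" "r \<noteq> s" "incidence r t \<noteq> (0::'f)" by auto
  then obtain u where u: "u \<in> r" "t = r - {u}"
    using incidence_nonzeroD[OF r(3)] by blast
  then have ru: "r = insert u t" by auto
  moreover have "u \<notin> s"
  proof
    assume "u \<in> s"
    moreover have "u \<notin> t" using u by blast
    ultimately have "u = v" by (simp add: t_def)
    then have "r = s" using ru assms(4) by (auto simp: t_def)
    with r(2) show False by simp
  qed
  moreover have "c r \<noteq> 0" using r(1) by (simp add: S_def)
  ultimately show ?thesis unfolding t_def by metis
qed

abbreviation unit_chain :: "'a set \<Rightarrow> 'a set \<Rightarrow> 'f::field" where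
  "unit_chain s \<equiv> (\<lambda>t. if t = s then 1 else 0)"

lemma in_span_unit_chains:
  fixes c :: "'a set \<Rightarrow> 'f::field"
  assumes "finite S" "\<And>s. c s \<noteq> 0 \<Longrightarrow> s \<in> S"
  shows "c \<in> chain_space.span (unit_chain ` S)"
proof -
  have "c = (\<Sum>s\<in>S. chain_scale (c s) (unit_chain s))"
  proof
    fix t
    have "(\<Sum>s\<in>S. chain_scale (c s) (unit_chain s)) t = (\<Sum>s\<in>S. chain_scale (c s) (unit_chain s) t)"
      by (induction S rule: infinite_finite_induct) auto
    also have "\<dots> = (\<Sum>s\<in>S. if s = t then c s else 0)"
      by (intro sum.cong) (auto simp: chain_scale_def)
    also have "\<dots> = c t" using assms by (auto simp: sum.delta)
    finally show "c t = (\<Sum>s\<in>S. chain_scale (c s) (unit_chain s)) t" by simp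
  qed
  also have "\<dots> \<in> chain_space.span (unit_chain ` S)"
    by (intro chain_space.span_sum chain_space.span_scale chain_space.span_base) auto
  finally show ?thesis .
qed

lemma subspace_vanishing: "chain_space.subspace {c :: 'a set \<Rightarrow> 'f::field. c s = 0}"
  by (auto simp: chain_space.subspace_def chain_scale_def)

lemma boundary_add:
  assumes "finite {s. c s \<noteq> 0}" "finite {s. e s \<noteq> 0}"
  shows "boundary (c + e) = boundary c + boundary e"
proof
  fix t
  define S where "S = {s. c s \<noteq> 0} \<union> {s. e s \<noteq> 0}"
  have S: "finite S" using assms by (simp add: S_def)
  have "boundary (c + e) t = (\<Sum>s\<in>S. (c + e) s * incidence s t)"
    by (rule boundary_eq_sum[OF S]) (auto simp: S_def)
  also have "\<dots> = (\<Sum>s\<in>S. c s * incidence s t) + (\<Sum>s\<in>S. e s * incidence s t)"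
    by (simp add: sum.distrib algebra_simps)
  also have "\<dots> = boundary c t + boundary e t"
    by (intro arg_cong2[where f = "(+)"] boundary_eq_sum[symmetric] S) (auto simp: S_def)
  finally show "boundary (c + e) t = (boundary c + boundary e) t" by simp
qed

lemma boundary_scale: "boundary (chain_scale a c) = chain_scale a (boundary c)"
  by (cases "a = 0") (auto simp: fun_eq_iff boundary_def chain_scale_def sum_distrib_left mult.assoc)

section \<open>Subspaces of cycles and boundaries and their dimensions\<close>

lemma subspace_simplicial_chains: "chain_space.subspace (simplicial_chains k K :: ('a set \<Rightarrow> 'f::field) set)"
proof -
  have "finite {s. x s + y s \<noteq> 0}" if "finite {s. x s \<noteq> 0}" "finite {s. y s \<noteq> 0}" for x y :: "'a set \<Rightarrow> 'f"
    by (rule finite_subset[OF _ finite_UnI[OF that]]) auto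
  moreover have "finite {s. a * x s \<noteq> 0}" if "finite {s. x s \<noteq> 0}" for x :: "'a set \<Rightarrow> 'f" and a
    by (rule finite_subset[OF _ that]) auto
  ultimately show ?thesis
    unfolding chain_space.subspace_def simplicial_chains_def chain_scale_def mem_Collect_eq
    by (intro conjI allI impI ballI) (simp_all, (metis add.right_neutral add_0)+)
qed

lemma simplicial_chains_finite: "c \<in> simplicial_chains k K \<Longrightarrow> finite {s. c s \<noteq> 0}"
  by (simp add: simplicial_chains_def)

lemma subspace_cycles: "chain_space.subspace (cycles k K :: ('a set \<Rightarrow> 'f::field) set)"
proof -
  have eq: "cycles k K = {c \<in> simplicial_chains k K. boundary c = (0 :: 'a set \<Rightarrow> 'f)}"
    by (auto simp: cycles_def fun_eq_iff)
  have "boundary 0 = (0 :: 'a set \<Rightarrow> 'f)"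
    by (auto simp: boundary_def fun_eq_iff)
  then show ?thesis
    using subspace_simplicial_chains[of k K, where 'f = 'f]
    unfolding eq chain_space.subspace_def
    by (auto simp: boundary_add boundary_scale simplicial_chains_finite)
qed

lemma subspace_boundaries: "chain_space.subspace (boundaries k K :: ('a set \<Rightarrow> 'f::field) set)"
proof -
  have sub: "chain_space.subspace (simplicial_chains (Suc k) K :: ('a set \<Rightarrow> 'f::field) set)"
    by (rule subspace_simplicial_chains)
  have "boundary 0 = (0 :: 'a set \<Rightarrow> 'f)"
    by (auto simp: boundary_def fun_eq_iff)
  then have "(0 :: 'a set \<Rightarrow> 'f) \<in> boundaries k K"
    unfolding boundaries_def using chain_space.subspace_0[OF sub] by (metis image_eqI)
  moreover have "x + y \<in> boundaries k K" if "x \<in> boundaries k K" "y \<in> boundaries k K" for x y :: "'a set \<Rightarrow> 'f"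
    using that chain_space.subspace_add[OF sub] unfolding boundaries_def
    by (auto simp: boundary_add[symmetric] simplicial_chains_finite)
  moreover have "chain_scale a x \<in> boundaries k K" if "x \<in> boundaries k K" for x :: "'a set \<Rightarrow> 'f" and a
    using that chain_space.subspace_scale[OF sub] unfolding boundaries_def
    by (auto simp: boundary_scale[symmetric])
  ultimately show ?thesis by (auto simp: chain_space.subspace_def)
qed

lemma cycles_mono: "K \<subseteq> L \<Longrightarrow> cycles k K \<subseteq> cycles k L"
  by (auto simp: cycles_def simplicial_chains_def)

lemma boundaries_mono: "K \<subseteq> L \<Longrightarrow> boundaries k K \<subseteq> boundaries k L"
  unfolding boundaries_def by (intro image_mono) (auto simp: simplicial_chains_def)

lemma cycles_subset_span:
  assumes "finite K"
  shows "(cycles k K :: ('a set \<Rightarrow> 'f::field) set) \<subseteq> chain_space.span (unit_chain ` K)"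
  by (intro subsetI in_span_unit_chains assms) (auto simp: cycles_def simplicial_chains_def)

lemma dim_cycles_mono:
  assumes "finite K" "V \<subseteq> W" "W \<subseteq> (cycles k K :: ('a set \<Rightarrow> 'f::field) set)"
  shows "chain_space.dim V \<le> chain_space.dim W"
  using chain_space.dim_subset_finite[of V W "unit_chain ` K"] assms cycles_subset_span[OF assms(1)]
  by blast

text \<open>Restriction to the coordinates in \<open>S\<close> is linear and injective on
  \<open>V\<close>, and the chains supported in \<open>S\<close> have dimension at most
  \<open>card S\<close>. Bounding a cycle space thus means finding simplices on which no nonzero
  cycle vanishes entirely.\<close>

lemma dim_le_card_coordinates:
  assumes V: "chain_space.subspace V" "V \<subseteq> (cycles k K :: ('a set \<Rightarrow> 'f::field) set)" "finite K" "finite S"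
    and inj: "\<And>c. c \<in> V \<Longrightarrow> (\<And>s. s \<in> S \<Longrightarrow> c s = 0) \<Longrightarrow> c = 0"
  shows "chain_space.dim V \<le> card S"
proof -
  define \<pi> :: "('a set \<Rightarrow> 'f) \<Rightarrow> 'a set \<Rightarrow> 'f" where "\<pi> = (\<lambda>c s. if s \<in> S then c s else 0)"
  interpret vp: vector_space_pair "chain_scale :: 'f \<Rightarrow> ('a set \<Rightarrow> 'f) \<Rightarrow> 'a set \<Rightarrow> 'f" chain_scale
    by unfold_locales
  have lin: "Vector_Spaces.linear chain_scale chain_scale \<pi>"
    by unfold_locales (auto simp: \<pi>_def chain_scale_def fun_eq_iff)
  obtain B where B: "B \<subseteq> V" "chain_space.independent B" "V \<subseteq> chain_space.span B" "card B = chain_space.dim V"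
    using chain_space.basis_exists by metis
  have injV: "inj_on \<pi> V"
  proof
    fix x y assume xy: "x \<in> V" "y \<in> V" "\<pi> x = \<pi> y"
    then have "(x - y) s = 0" if "s \<in> S" for s
      using that by (auto simp: \<pi>_def fun_eq_iff) metis
    then have "x - y = 0"
      using inj[of "x - y"] xy V(1) chain_space.subspace_diff by blast
    then show "x = y" by simp
  qed
  moreover have "chain_space.span B \<subseteq> V"
    using B V(1) chain_space.span_minimal by blast
  ultimately have "chain_space.independent (\<pi> ` B)"
    using vp.linear_independent_injective_image[OF lin B(2)] inj_on_subset by blast
  moreover have "\<pi> ` B \<subseteq> chain_space.span (unit_chain ` S)"
    by (intro subsetI in_span_unit_chains V(4)) (auto simp: \<pi>_def split: if_splits)
  ultimately have "card (\<pi> ` B) \<le> card (unit_chain ` S :: ('a set \<Rightarrow> 'f) set)"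
    using chain_space.independent_span_bound V(4) by blast
  also have "\<dots> \<le> card S" using V(4) card_image_le by blast
  also have "card (\<pi> ` B) = card B"
    using injV B inj_on_subset card_image by metis
  finally show ?thesis using B by simp
qed

lemma incidence_in_boundaries:
  assumes "Y \<in> K" "card Y = Suc (Suc k)"
  shows "(incidence Y :: 'a set \<Rightarrow> 'f::field) \<in> boundaries k K"
proof -
  have "(incidence Y :: 'a set \<Rightarrow> 'f) = boundary (unit_chain Y)"
  proof
    fix t
    have "boundary (unit_chain Y) t = (\<Sum>s\<in>{Y}. unit_chain Y s * (incidence s t :: 'f))"
      by (rule boundary_eq_sum) (auto split: if_splits)
    then show "(incidence Y t :: 'f) = boundary (unit_chain Y) t" by simp
  qed
  moreover have "(unit_chain Y :: 'a set \<Rightarrow> 'f) \<in> simplicial_chains (Suc k) K"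
    using assms by (auto simp: simplicial_chains_def)
  ultimately show ?thesis unfolding boundaries_def by blast
qed

text \<open>The hollow simplex is a cycle as soon as its facets are present, whether or not
  \<open>Y\<close> itself belongs to \<open>K\<close>.\<close>

lemma incidence_in_cycles:
  assumes "finite Y" "card Y = Suc (Suc k)" "\<And>v. v \<in> Y \<Longrightarrow> Y - {v} \<in> K"
  shows "(incidence Y :: 'a set \<Rightarrow> 'f::field) \<in> cycles k K"
proof -
  have *: "s \<in> (\<lambda>v. Y - {v}) ` Y" if "incidence Y s \<noteq> (0::'f)" for s
    using incidence_nonzeroD[OF that] by blast
  then have "{s. incidence Y s \<noteq> (0::'f)} \<subseteq> (\<lambda>v. Y - {v}) ` Y"
    by blast
  then have "finite {s. incidence Y s \<noteq> (0::'f)}"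
    using assms finite_surj by blast
  moreover have "s \<in> K \<and> card s = Suc k" if "incidence Y s \<noteq> (0::'f)" for s
    using *[OF that] assms by auto
  ultimately show ?thesis
    using boundary_incidence[OF assms(1)] by (auto simp: cycles_def simplicial_chains_def)
qed

text \<open>A simplex that is a face of no \<open>(k + 1)\<close>-simplex cannot occur in a
  boundary. Its coefficient is then a linear functional that separates cycles from
  boundaries.\<close>

lemma boundaries_vanish:
  assumes "c \<in> boundaries k K" "\<And>s. s \<in> K \<Longrightarrow> card s = Suc (Suc k) \<Longrightarrow> t \<subseteq> s \<Longrightarrow> False"
  shows "c t = (0::'f::field)"
proof -
  obtain e where e: "e \<in> simplicial_chains (Suc k) K" "c = boundary e"
    using assms by (auto simp: boundaries_def)
  have "e s * incidence s t = 0" if "e s \<noteq> 0" for s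
  proof -
    have "s \<in> K" "card s = Suc (Suc k)" using e that by (auto simp: simplicial_chains_def)
    then have "\<not> t \<subseteq> s" using assms(2) by blast
    then have "incidence s t = (0::'f)" using incidence_nonzeroD[of s t, where 'f = 'f] by auto
    then show ?thesis by simp
  qed
  then show ?thesis by (simp add: e(2) boundary_def)
qed

section \<open>Independence of the vertex order\<close>

text \<open>A bijection of vertices need not respect the arbitrary \<open>vertex_order\<close>. The
  parity of this number is the sign of the permutation induced on a simplex, and twisting by it
  makes the transport of chains a chain map. The transport compares samples in the same
  combinatorial position, on which the measurability of the diagram rests.\<close>

definition inversions :: "('a \<Rightarrow> 'b) \<Rightarrow> 'a set \<Rightarrow> nat" where
  "inversions f p = card {(v, w). v \<in> p \<and> w \<in> p \<and> v \<noteq> w \<and> (v, w) \<in> vertex_order \<and> (f w, f v) \<in> vertex_order}"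

definition pullback :: "'a set \<Rightarrow> ('a \<Rightarrow> 'b) \<Rightarrow> ('b set \<Rightarrow> 'f::field) \<Rightarrow> 'a set \<Rightarrow> 'f" where
  "pullback V f c = (\<lambda>p. if p \<subseteq> V then (-1) ^ inversions f p * c (f ` p) else 0)"

lemma incidence_image:
  assumes "finite V" "inj_on f V" "p \<subseteq> V" "q \<subseteq> V"
  shows "(-1) ^ inversions f p * (incidence p q :: 'f::field) = (-1) ^ inversions f q * incidence (f ` p) (f ` q)"
proof (cases "\<exists>v\<in>p. q = p - {v} \<and> q \<noteq> {}")
  case False
  then have "(incidence p q :: 'f) = 0" using incidence_nonzeroD by blast
  moreover have "(incidence (f ` p) (f ` q) :: 'f) = 0"
  proof (rule ccontr)
    assume "(incidence (f ` p) (f ` q) :: 'f) \<noteq> 0"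
    then obtain v where v: "v \<in> p" "f ` q = f ` p - {f v}" "q \<noteq> {}"
      using incidence_nonzeroD by blast
    then have "f ` q = f ` (p - {v})"
      using assms inj_on_image_set_diff[of f V p "{v}"] by auto
    then have "q = p - {v}"
      using assms inj_on_image_eq_iff[of f V q "p - {v}"] by blast
    with False v show False by blast
  qed
  ultimately show ?thesis by simp
next
  case True
  then obtain v where v: "v \<in> p" "q = p - {v}" "q \<noteq> {}" by blast
  have fin: "finite p" using assms finite_subset by blast
  have inj: "inj_on f p" using assms inj_on_subset by blast
  have fne: "f x \<noteq> f y" if "x \<in> p" "y \<in> p" "x \<noteq> y" for x y using inj that by (auto dest: inj_onD)
  \<comment> \<open>The other vertices are sorted by whether they precede \<open>v\<close> and
    whether \<open>f\<close> keeps this: those in \<open>A\<close> precede on both sides, those in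
    \<open>B\<close> only before and those in \<open>C\<close> only after applying \<open>f\<close>.
    The inversions involving \<open>v\<close> come from \<open>B\<close> and \<open>C\<close>, its
    positions are \<open>card A + card B\<close> and \<open>card A + card C\<close>, and the
    parities match.\<close>
  define A where "A = {w \<in> p. w \<noteq> v \<and> (w, v) \<in> vertex_order \<and> (f w, f v) \<in> vertex_order}"
  define B where "B = {w \<in> p. w \<noteq> v \<and> (w, v) \<in> vertex_order \<and> (f v, f w) \<in> vertex_order}"
  define C where "C = {w \<in> p. w \<noteq> v \<and> (v, w) \<in> vertex_order \<and> (f w, f v) \<in> vertex_order}"
  have finABC: "finite A" "finite B" "finite C" using fin by (auto simp: A_def B_def C_def)
  have fvw: "(f v, f w) \<in> vertex_order \<longleftrightarrow> (f w, f v) \<notin> vertex_order" if "w \<in> p" "w \<noteq> v" for w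
    using vertex_order_cases fne that v(1) by metis
  have "{w \<in> p. w \<noteq> v \<and> (w, v) \<in> vertex_order} = A \<union> B" "A \<inter> B = {}"
    unfolding A_def B_def using fvw by auto
  then have p1: "position p v = card A + card B" using finABC by (simp add: card_Un_disjoint)
  have "{w \<in> f ` p. w \<noteq> f v \<and> (w, f v) \<in> vertex_order} = f ` {w \<in> p. w \<noteq> v \<and> (f w, f v) \<in> vertex_order}"
    using fne v(1) by auto
  moreover have vw: "(v, w) \<in> vertex_order \<longleftrightarrow> (w, v) \<notin> vertex_order" if "w \<noteq> v" for w
    using vertex_order_cases that by metis
  then have "{w \<in> p. w \<noteq> v \<and> (f w, f v) \<in> vertex_order} = A \<union> C" "A \<inter> C = {}"
    unfolding A_def C_def by auto
  ultimately have "{w \<in> f ` p. w \<noteq> f v \<and> (w, f v) \<in> vertex_order} = f ` (A \<union> C)" "A \<inter> C = {}"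
    by simp_all
  moreover have "inj_on f (A \<union> C)" by (rule inj_on_subset[OF inj]) (auto simp: A_def C_def)
  ultimately have p2: "position (f ` p) (f v) = card A + card C"
    using finABC by (simp add: card_image card_Un_disjoint)
  let ?I = "\<lambda>p. {(v, w). v \<in> p \<and> w \<in> p \<and> v \<noteq> w \<and> (v, w) \<in> vertex_order \<and> (f w, f v) \<in> vertex_order}"
  have finI: "finite (?I q)"
    by (rule finite_subset[of _ "p \<times> p"]) (use fin v in auto)
  have "?I p = ?I q \<union> ((\<lambda>w. (w, v)) ` B \<union> (\<lambda>w. (v, w)) ` C)"
    unfolding v(2) B_def C_def using v(1) by auto
  moreover have "?I q \<inter> ((\<lambda>w. (w, v)) ` B \<union> (\<lambda>w. (v, w)) ` C) = {}" "(\<lambda>w. (w, v)) ` B \<inter> (\<lambda>w. (v, w)) ` C = {}"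
    unfolding v(2) B_def C_def by auto
  ultimately have inv: "inversions f p = inversions f q + (card B + card C)"
    unfolding inversions_def using finI finABC
    by (simp add: card_Un_disjoint card_image inj_on_def)
  have i1: "(incidence p q :: 'f) = (-1) ^ position p v"
    using incidence_face[OF fin v(1)] v by simp
  have ft: "f ` q = f ` p - {f v}" unfolding v(2)
    using inj_on_image_set_diff[OF inj, of p "{v}"] v by auto
  have i2: "(incidence (f ` p) (f ` q) :: 'f) = (-1) ^ position (f ` p) (f v)"
    unfolding ft by (rule incidence_face) (use fin v ft in auto)
  show ?thesis
    unfolding i1 i2 p1 p2 inv by (simp add: power_add algebra_simps flip: power_mult_distrib)
qed

lemma boundary_pullback:
  fixes c :: "'b set \<Rightarrow> 'f::field"
  assumes V: "finite V" "inj_on f V" and c: "\<And>p. c p \<noteq> 0 \<Longrightarrow> p \<subseteq> f ` V"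
  shows "boundary (pullback V f c) = pullback V f (boundary c)"
proof
  fix q
  have e: "boundary (pullback V f c) q = (\<Sum>p\<in>Pow V. pullback V f c p * incidence p q)"
    by (rule boundary_eq_sum) (use V in \<open>auto simp: pullback_def split: if_splits\<close>)
  show "boundary (pullback V f c) q = pullback V f (boundary c) q"
  proof (cases "q \<subseteq> V")
    case True
    have "boundary c (f ` q) = (\<Sum>p\<in>(`) f ` Pow V. c p * incidence p (f ` q))"
      by (rule boundary_eq_sum) (use V c in \<open>auto simp: image_Pow_surj\<close>)
    also have "\<dots> = (\<Sum>p\<in>Pow V. c (f ` p) * incidence (f ` p) (f ` q))"
      by (subst sum.reindex) (use V in \<open>auto intro: inj_on_image_Pow\<close>)
    finally have "pullback V f (boundary c) q =
        (\<Sum>p\<in>Pow V. c (f ` p) * ((-1) ^ inversions f q * incidence (f ` p) (f ` q)))"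
      using True by (simp add: pullback_def sum_distrib_left algebra_simps)
    also have "\<dots> = (\<Sum>p\<in>Pow V. pullback V f c p * incidence p q)"
    proof (rule sum.cong[OF refl])
      fix p assume "p \<in> Pow V"
      then show "c (f ` p) * ((-1) ^ inversions f q * incidence (f ` p) (f ` q)) =
          pullback V f c p * incidence p q"
        using incidence_image[OF V, of p q, where 'f = 'f] True
        by (simp add: pullback_def algebra_simps)
    qed
    finally show ?thesis using e by simp
  next
    case False
    have "pullback V f c p * incidence p q = 0" if "p \<in> Pow V" for p
      using incidence_nonzeroD[of p q, where 'f = 'f] that False by auto
    then have "(\<Sum>p\<in>Pow V. pullback V f c p * incidence p q) = 0" by (intro sum.neutral ballI)
    then show ?thesis using e False by (simp add: pullback_def)
  qed
qed

lemma pullback_chains: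
  fixes c :: "'b set \<Rightarrow> 'f::field"
  assumes V: "finite V" "inj_on f V" and K: "K \<subseteq> Pow V" and c: "c \<in> simplicial_chains k ((`) f ` K)"
  shows "pullback V f c \<in> simplicial_chains k K"
proof -
  have "finite {p. pullback V f c p \<noteq> 0}"
    by (rule finite_subset[of _ "Pow V"]) (use V in \<open>auto simp: pullback_def split: if_splits\<close>)
  moreover have "p \<in> K \<and> card p = Suc k" if "pullback V f c p \<noteq> 0" for p
  proof -
    have p: "p \<subseteq> V" "c (f ` p) \<noteq> 0" using that by (auto simp: pullback_def split: if_splits)
    then have "f ` p \<in> (`) f ` K" "card (f ` p) = Suc k"
      using c by (auto simp: simplicial_chains_def)
    moreover have "card (f ` p) = card p"
      using p V inj_on_subset card_image by metis
    moreover have "p \<in> K"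
    proof -
      obtain \<rho> where "\<rho> \<in> K" "f ` p = f ` \<rho>" using \<open>f ` p \<in> (`) f ` K\<close> by blast
      then show ?thesis using K p(1) inj_on_image_eq_iff[OF V(2), of p \<rho>] by auto
    qed
    ultimately show ?thesis by simp
  qed
  ultimately show ?thesis by (simp add: simplicial_chains_def)
qed

text \<open>The pullback is linear, injective on cycles and commutes with the boundary. Inequalities
  are enough, since the inverse bijection supplies the converse ones.\<close>

lemma dim_cycles_Int_boundaries_image_le:
  assumes V: "finite V" "inj_on f V" and K: "K \<subseteq> Pow V" "L \<subseteq> Pow V"
  shows "chain_space.dim (cycles k ((`) f ` K) :: ('b set \<Rightarrow> 'f::field) set) \<le> chain_space.dim (cycles k K :: ('a set \<Rightarrow> 'f) set)"
    and "chain_space.dim (cycles k ((`) f ` K) \<inter> boundaries k ((`) f ` L) :: ('b set \<Rightarrow> 'f::field) set)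
      \<le> chain_space.dim (cycles k K \<inter> boundaries k L :: ('a set \<Rightarrow> 'f) set)"
proof -
  let ?\<Phi> = "pullback V f :: ('b set \<Rightarrow> 'f) \<Rightarrow> 'a set \<Rightarrow> 'f"
  interpret vp: vector_space_pair "chain_scale :: 'f \<Rightarrow> ('b set \<Rightarrow> 'f) \<Rightarrow> 'b set \<Rightarrow> 'f" "chain_scale :: 'f \<Rightarrow> ('a set \<Rightarrow> 'f) \<Rightarrow> 'a set \<Rightarrow> 'f"
    by unfold_locales
  have lin: "Vector_Spaces.linear chain_scale chain_scale ?\<Phi>"
    by unfold_locales (auto simp: pullback_def chain_scale_def fun_eq_iff algebra_simps)
  have supp: "p \<subseteq> f ` V" if "c \<in> simplicial_chains j ((`) f ` M)" "M \<subseteq> Pow V" "c p \<noteq> 0" for c :: "'b set \<Rightarrow> 'f" and p M j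
    using that unfolding simplicial_chains_def by blast
  have bd: "boundary (?\<Phi> c) = ?\<Phi> (boundary c)" if "c \<in> simplicial_chains j ((`) f ` M)" "M \<subseteq> Pow V" for c j M
    using boundary_pullback[OF V] supp[OF that] by blast
  have cyc: "?\<Phi> c \<in> cycles k K" if "c \<in> cycles k ((`) f ` K)" for c
  proof -
    have c: "c \<in> simplicial_chains k ((`) f ` K)" "\<And>q. boundary c q = 0"
      using that by (auto simp: cycles_def)
    have "boundary (?\<Phi> c) q = 0" for q
      using bd[OF c(1) K(1)] c(2) by (simp add: pullback_def)
    then show ?thesis using pullback_chains[OF V K(1) c(1)] by (simp add: cycles_def)
  qed
  have bnd: "?\<Phi> c \<in> boundaries k L" if "c \<in> boundaries k ((`) f ` L)" for c
  proof -
    obtain e where e: "e \<in> simplicial_chains (Suc k) ((`) f ` L)" "c = boundary e"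
      using \<open>c \<in> boundaries k ((`) f ` L)\<close> by (auto simp: boundaries_def)
    then show ?thesis
      using bd[OF e(1) K(2), symmetric] pullback_chains[OF V K(2) e(1)] by (auto simp: boundaries_def)
  qed
  have inj: "inj_on ?\<Phi> (cycles k ((`) f ` K))"
  proof
    fix x y assume xy: "x \<in> cycles k ((`) f ` K)" "y \<in> cycles k ((`) f ` K)" and eq: "?\<Phi> x = ?\<Phi> y"
    have *: "x p = 0 \<and> y p = 0" if "\<not> p \<subseteq> f ` V" for p
      using supp[of _ k K p] xy that K(1) unfolding cycles_def by blast
    show "x = y"
    proof
      fix p
      show "x p = y p"
      proof (cases "p \<subseteq> f ` V")
        case True
        then obtain \<rho> where "\<rho> \<subseteq> V" "p = f ` \<rho>" by (metis subset_imageE)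
        then show ?thesis using fun_cong[OF eq, of \<rho>] by (simp add: pullback_def)
      qed (use * in auto)
    qed
  qed
  have fin: "finite ((`) f ` K)" "finite K" using K V finite_subset[of K "Pow V"] by auto
  have le: "chain_space.dim X \<le> chain_space.dim Y"
    if X: "chain_space.subspace X" "X \<subseteq> cycles k ((`) f ` K)" and Y: "Y \<subseteq> cycles k K" "?\<Phi> ` X \<subseteq> Y" for X Y
  proof -
    obtain B where B: "B \<subseteq> X" "chain_space.independent B" "X \<subseteq> chain_space.span B" "card B = chain_space.dim X"
      using chain_space.basis_exists by metis
    have sB: "chain_space.span B \<subseteq> X" using B X chain_space.span_minimal by blast
    have "chain_space.independent (?\<Phi> ` B)"
      by (rule vp.linear_independent_injective_image[OF lin B(2)])
        (rule inj_on_subset[OF inj], use sB X in auto)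
    then have "card (?\<Phi> ` B) = chain_space.dim (?\<Phi> ` B)"
      by (simp add: chain_space.dim_eq_card_independent)
    also have "\<dots> \<le> chain_space.dim Y"
      by (rule dim_cycles_mono[OF fin(2) _ Y(1)]) (use B(1) Y(2) in blast)
    also have "card (?\<Phi> ` B) = card B"
      by (rule card_image, rule inj_on_subset[OF inj]) (use B X in auto)
    finally show ?thesis using B by simp
  qed
  show "chain_space.dim (cycles k ((`) f ` K) :: ('b set \<Rightarrow> 'f::field) set) \<le> chain_space.dim (cycles k K :: ('a set \<Rightarrow> 'f) set)"
    by (rule le) (use cyc in \<open>auto simp: subspace_cycles\<close>)
  show "chain_space.dim (cycles k ((`) f ` K) \<inter> boundaries k ((`) f ` L) :: ('b set \<Rightarrow> 'f::field) set)
      \<le> chain_space.dim (cycles k K \<inter> boundaries k L :: ('a set \<Rightarrow> 'f) set)"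
    by (rule le) (use cyc bnd in \<open>auto simp: subspace_cycles subspace_boundaries chain_space.subspace_inter\<close>)
qed

lemma persistent_betti_image:
  assumes V: "finite V" "inj_on f V" and K: "K \<subseteq> Pow V" "L \<subseteq> Pow V"
  shows "persistent_betti F k ((`) f ` K) ((`) f ` L) = persistent_betti F k K L"
proof -
  define g where "g = inv_into V f"
  have g: "finite (f ` V)" "inj_on g (f ` V)" "(`) f ` K \<subseteq> Pow (f ` V)" "(`) f ` L \<subseteq> Pow (f ` V)"
    using V K by (auto simp: g_def inj_on_inv_into)
  have gf: "(`) g ` (`) f ` M = M" if "M \<subseteq> Pow V" for M
  proof -
    have "g ` f ` p = p" if "p \<in> M" for p
      unfolding g_def using V(2) that \<open>M \<subseteq> Pow V\<close> by (intro inv_into_image_cancel) auto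
    then show ?thesis by (auto simp: image_image)
  qed
  show ?thesis
    unfolding persistent_betti_def
    using dim_cycles_Int_boundaries_image_le[OF V K, of k] dim_cycles_Int_boundaries_image_le[OF g, of k]
    unfolding gf[OF K(1)] gf[OF K(2)] by (metis le_antisym)
qed

section \<open>Sublevel filtrations\<close>

definition sublevel :: "'a set \<Rightarrow> ('a set \<Rightarrow> real) \<Rightarrow> ereal \<Rightarrow> 'a set set" where
  "sublevel P w t = {p. p \<noteq> {} \<and> p \<subseteq> P \<and> ereal (w p) \<le> t}"

text \<open>Because \<open>D\<close> is downward closed among the values of \<open>w\<close>, the
  strict sublevel set at a value is the closed one at its predecessor in \<open>D\<close>, and the
  jumps of \<open>f\<close> telescope.\<close>

lemma telescope_sublevel:
  fixes f :: "'a set set \<Rightarrow> int" and w :: "'a set \<Rightarrow> real"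
  assumes "finite D" "\<And>c p. c \<in> D \<Longrightarrow> p \<in> S \<Longrightarrow> w p < c \<Longrightarrow> w p \<in> D"
  shows "(\<Sum>c\<in>D. f {p\<in>S. w p \<le> c} - f {p\<in>S. w p < c}) = f {p\<in>S. w p \<in> D} - f {}"
  using assms
proof (induction D rule: finite_linorder_max_induct)
  case empty
  then show ?case by simp
next
  case (insert m D)
  have nm: "m \<notin> D" using insert.hyps by auto
  have down: "w p \<in> D" if "c \<in> D" "p \<in> S" "w p < c" for c p
    using insert.prems[of c p] insert.hyps(2) that by fastforce
  have lt: "{p\<in>S. w p < m} = {p\<in>S. w p \<in> D}"
    using insert.prems[of m] insert.hyps(2) by fastforce
  have le: "{p\<in>S. w p \<le> m} = {p\<in>S. w p \<in> insert m D}"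
    using lt by (auto simp: le_less)
  have "(\<Sum>c\<in>insert m D. f {p\<in>S. w p \<le> c} - f {p\<in>S. w p < c}) =
      f {p\<in>S. w p \<in> insert m D} - f {p\<in>S. w p \<in> D} + (f {p\<in>S. w p \<in> D} - f {})"
    using insert.IH down insert.hyps(1) nm by (simp add: lt le)
  then show ?case by simp
qed

text \<open>Dropping \<open>u\<close> from the facet \<open>Y - {v}\<close> leaves a nonempty face
  that a second simplex of the cycle must share. Isolation keeps this simplex inside
  \<open>Y\<close>, where \<open>Y - {u}\<close> is the only candidate. So a cycle that uses one
  facet of an isolated \<open>Y\<close> uses them all.\<close>

lemma cycle_isolated_faces:
  fixes c :: "'a set \<Rightarrow> 'f::field"
  assumes c: "c \<in> cycles k K" "k \<ge> 1" and Y: "finite Y" "card Y = k + 2"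
    and iso: "\<And>p. p \<in> K \<Longrightarrow> p \<inter> Y \<noteq> {} \<Longrightarrow> p \<subseteq> Y"
    and v: "v \<in> Y" "c (Y - {v}) \<noteq> 0" and u: "u \<in> Y"
  shows "c (Y - {u}) \<noteq> 0"
proof (cases "u = v")
  case False
  then have "u \<in> Y - {v}" using u by auto
  then obtain x where x: "x \<notin> Y - {v}" "c (insert x (Y - {v} - {u})) \<noteq> 0"
    using cycle_adjacent[OF c v(2)] by blast
  have "card (Y - {v} - {u}) = k" using Y u v False by simp
  then have "Y - {v} - {u} \<noteq> {}" using c(2) by (metis card.empty not_one_le_zero)
  moreover have "insert x (Y - {v} - {u}) \<in> K"
    using c(1) x(2) by (auto simp: cycles_def simplicial_chains_def)
  ultimately have "x \<in> Y" using iso by blast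
  then have "insert x (Y - {v} - {u}) = Y - {u}" using x(1) v False by auto
  then show ?thesis using x by simp
qed (use v in simp)

text \<open>Monotone weights stand in for enclosing radii, so that the bounds on multiplicities are
  purely homological.\<close>

locale weighted_points =
  fixes P :: "'a set" and w :: "'a set \<Rightarrow> real"
  assumes finite_points: "finite P"
    and weight_nonneg: "\<And>p. p \<subseteq> P \<Longrightarrow> p \<noteq> {} \<Longrightarrow> 0 \<le> w p"
    and weight_mono: "\<And>p q. p \<subseteq> q \<Longrightarrow> q \<subseteq> P \<Longrightarrow> p \<noteq> {} \<Longrightarrow> w p \<le> w q"
begin

abbreviation simplices :: "'a set set" where "simplices \<equiv> Pow P - {{}}"

lemma before_sublevel: "before (sublevel P w) t = {p\<in>simplices. ereal (w p) < t}"
proof (rule set_eqI, rule iffI)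
  fix p assume "p \<in> before (sublevel P w) t"
  then obtain s where "s < t" "p \<in> sublevel P w s" unfolding before_def UN_iff by auto
  then show "p \<in> {p\<in>simplices. ereal (w p) < t}" by (auto simp: sublevel_def intro: le_less_trans)
next
  fix p assume "p \<in> {p\<in>simplices. ereal (w p) < t}"
  \<comment> \<open>The witness is the weight of the simplex itself, a time in the range of
    \<open>before\<close> since weights are nonnegative.\<close>
  then have "ereal (w p) \<in> {0..<t}" "p \<in> sublevel P w (ereal (w p))"
    using weight_nonneg[of p] by (auto simp: sublevel_def)
  then show "p \<in> before (sublevel P w) t" unfolding before_def by blast
qed

lemma sublevel_eq: "sublevel P w t = {p\<in>simplices. ereal (w p) \<le> t}"
  by (auto simp: sublevel_def)

lemma finite_sublevel: "finite (sublevel P w t)" "finite (before (sublevel P w) t)"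
  using finite_points by (auto simp: sublevel_eq before_sublevel)

lemma before_subset: "before (sublevel P w) t \<subseteq> sublevel P w t"
  by (auto simp: sublevel_eq before_sublevel)

text \<open>Each difference of persistent Betti numbers in \<open>pair_multiplicity\<close> fixes
  its first complex, so the dimensions of the cycle spaces cancel and only these dimensions
  remain.\<close>

definition rank :: "'f::field itself \<Rightarrow> nat \<Rightarrow> 'a set set \<Rightarrow> 'a set set \<Rightarrow> int" where
  "rank F k K L = int (chain_space.dim (cycles k K \<inter> boundaries k L :: ('a set \<Rightarrow> 'f) set))"

lemma persistent_betti_rank:
  assumes "finite K"
  shows "int (persistent_betti (F :: 'f::field itself) k K L) =
    int (chain_space.dim (cycles k K :: ('a set \<Rightarrow> 'f) set)) - rank F k K L"
proof -
  have "chain_space.dim (cycles k K \<inter> boundaries k L :: ('a set \<Rightarrow> 'f) set) \<le>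
      chain_space.dim (cycles k K :: ('a set \<Rightarrow> 'f) set)"
    by (rule dim_cycles_mono[OF assms]) auto
  then show ?thesis by (simp add: persistent_betti_def rank_def)
qed

text \<open>Kept as an integer, because the truncation by \<open>nat\<close> would obstruct
  telescoping as long as nonnegativity is not known.\<close>

definition signed_mult :: "'f::field itself \<Rightarrow> nat \<Rightarrow> real \<Rightarrow> ereal \<Rightarrow> int" where
  "signed_mult F k b d =
     (rank F k (sublevel P w b) (sublevel P w d) - rank F k (sublevel P w b) (before (sublevel P w) d))
     - (rank F k (before (sublevel P w) b) (sublevel P w d) - rank F k (before (sublevel P w) b) (before (sublevel P w) d))"

lemma pair_multiplicity_eq_nat:
  "pair_multiplicity F k (sublevel P w) (b, d) = nat (signed_mult F k b d)"
  unfolding pair_multiplicity_def signed_mult_def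
  by (simp add: persistent_betti_rank finite_sublevel)

text \<open>The last clause makes \<open>Y\<close> a separate piece of the complex up to and
  including its death time.\<close>

definition lone_cycle :: "nat \<Rightarrow> real \<Rightarrow> real \<Rightarrow> 'a set \<Rightarrow> bool" where
  "lone_cycle k b d Y \<longleftrightarrow> Y \<subseteq> P \<and> card Y = k + 2 \<and> w Y = d \<and> (\<forall>v\<in>Y. w (Y - {v}) \<le> b) \<and> (\<exists>v\<in>Y. w (Y - {v}) = b) \<and>
     (\<forall>p. p \<subseteq> P \<longrightarrow> w p \<le> d \<longrightarrow> p \<inter> Y \<noteq> {} \<longrightarrow> p \<subseteq> Y)"

text \<open>The four ranks belong to \<open>?Zb \<inter> ?Bd\<close>, to its subspaces of chains
  that bound before \<open>d\<close> or exist before \<open>b\<close>, and to the intersection of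
  the two; the multiplicity is thus the dimension of a quotient. Lone cycles are independent in it,
  each detected by its coefficient on one of its own facets. The empty family yields
  nonnegativity.\<close>

lemma signed_mult_ge:
  assumes k: "k \<ge> 1" and I: "finite I" "\<And>Y. Y \<in> I \<Longrightarrow> \<exists>d'. d = ereal d' \<and> lone_cycle k b d' Y"
  shows "int (card I) \<le> signed_mult (F :: 'f::field itself) k b d"
proof -
  let ?Zb = "cycles k (sublevel P w b) :: ('a set \<Rightarrow> 'f) set"
  let ?Zb' = "cycles k (before (sublevel P w) b) :: ('a set \<Rightarrow> 'f) set"
  let ?Bd = "boundaries k (sublevel P w d) :: ('a set \<Rightarrow> 'f) set"
  let ?Bd' = "boundaries k (before (sublevel P w) d) :: ('a set \<Rightarrow> 'f) set"
  have mono: "?Zb' \<subseteq> ?Zb" "?Bd' \<subseteq> ?Bd"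
    by (intro cycles_mono boundaries_mono before_subset)+
  define vtx where "vtx Y = (SOME v. v \<in> Y)" for Y :: "'a set"
  have vtx: "vtx Y \<in> Y" if "Y \<in> I" for Y
    unfolding vtx_def by (rule someI_ex) (use I(2)[OF that] lone_cycle_def in auto)
  have finY: "finite Y" if "Y \<subseteq> P" for Y using that finite_points finite_subset by blast
  have Yne: "Y - {v} \<noteq> {}" if "card Y = k + 2" for Y and v :: 'a
  proof
    assume "Y - {v} = {}"
    then have "card Y \<le> card {v}" by (intro card_mono) auto
    with that show False by simp
  qed
  have "chain_space.dim (?Zb \<inter> ?Bd') + chain_space.dim (?Zb' \<inter> ?Bd) + card I \<le>
      chain_space.dim (?Zb \<inter> ?Bd) + chain_space.dim ((?Zb \<inter> ?Bd') \<inter> (?Zb' \<inter> ?Bd))"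
  proof (rule chain_space.dim_Int_ge[where z = "incidence" and N = "\<lambda>Y. {c. c (Y - {vtx Y}) = 0}"
        and T = "unit_chain ` sublevel P w b"])
    show "chain_space.subspace (?Zb \<inter> ?Bd')" "chain_space.subspace (?Zb' \<inter> ?Bd)"
      by (intro chain_space.subspace_inter subspace_cycles subspace_boundaries)+
    show "?Zb \<inter> ?Bd \<subseteq> chain_space.span (unit_chain ` sublevel P w b)"
      using cycles_subset_span[OF finite_sublevel(1)] by blast
    show "finite (unit_chain ` sublevel P w b :: ('a set \<Rightarrow> 'f) set)"
      using finite_sublevel by simp
  next
    fix Y assume Y: "Y \<in> I"
    obtain d' where d': "d = ereal d'" and l: "lone_cycle k b d' Y" using I(2)[OF Y] by blast
    have YP: "Y \<subseteq> P" "card Y = k + 2" "finite Y" using l finY by (auto simp: lone_cycle_def)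
    have iso: "p \<subseteq> Y" if "p \<in> simplices" "ereal (w p) \<le> d" "p \<inter> Y \<noteq> {}" for p
      using l that d' by (auto simp: lone_cycle_def)
    have faces: "Y - {v} \<in> sublevel P w b" if "v \<in> Y" for v
      using l that Yne[OF YP(2), of v] by (auto simp: lone_cycle_def sublevel_def)
    have YF: "Y \<in> sublevel P w d" using l YP d' by (auto simp: lone_cycle_def sublevel_def)
    show "incidence Y \<in> ?Zb \<inter> ?Bd"
      using incidence_in_cycles[OF YP(3), of k] faces incidence_in_boundaries[OF YF] YP(2) by auto
    obtain v0 where v0: "v0 \<in> Y" "w (Y - {v0}) = b" using l by (auto simp: lone_cycle_def)
    have bd: "b \<le> d'"
      using weight_mono[of "Y - {v0}" Y] v0 YP Yne[OF YP(2)] l by (auto simp: lone_cycle_def)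
    \<comment> \<open>Up to time \<open>d\<close> the only simplex with \<open>k + 2\<close>
      vertices containing this facet is \<open>Y\<close>, which enters at \<open>d\<close> and not
      before.\<close>
    have A1: "c (Y - {vtx Y}) = 0" if "c \<in> ?Bd'" for c
    proof (rule boundaries_vanish[OF that])
      fix p assume p: "p \<in> before (sublevel P w) d" "card p = Suc (Suc k)" "Y - {vtx Y} \<subseteq> p"
      have s: "p \<in> simplices" "ereal (w p) < d" using p(1) by (auto simp: before_sublevel)
      have "p \<subseteq> Y" by (rule iso) (use s p(3) Yne[OF YP(2), of "vtx Y"] in auto)
      then have "p = Y" using card_subset_eq[OF YP(3)] p(2) YP(2) by simp
      then show False using s d' l by (simp add: lone_cycle_def)
    qed
    \<comment> \<open>A cycle that existed before \<open>b\<close> and used one facet of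
      \<open>Y\<close> would use all of them, also the one that appears at \<open>b\<close>.\<close>
    have A2: "c (Y - {vtx Y}) = 0" if c: "c \<in> ?Zb'" for c
    proof (rule ccontr)
      assume n: "c (Y - {vtx Y}) \<noteq> 0"
      have "c (Y - {v0}) \<noteq> 0"
      proof (rule cycle_isolated_faces[OF c k YP(3,2) _ vtx[OF Y] n v0(1)])
        fix p assume s: "p \<in> before (sublevel P w) b" "p \<inter> Y \<noteq> {}"
        then have "ereal (w p) < ereal d'" using bd by (auto simp: before_sublevel)
        then show "p \<subseteq> Y" using s iso d' by (auto simp: before_sublevel)
      qed
      then have "Y - {v0} \<in> before (sublevel P w) b"
        using c by (auto simp: cycles_def simplicial_chains_def)
      then show False using v0 by (simp add: before_sublevel)
    qed
    have "incidence Y (Y - {vtx Y}) \<noteq> (0::'f)"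
      by (rule incidence_nonzero) (use YP vtx[OF Y] Yne in auto)
    then show "chain_space.subspace {c. c (Y - {vtx Y}) = (0::'f)} \<and> ?Zb \<inter> ?Bd' \<subseteq> {c. c (Y - {vtx Y}) = 0} \<and>
        ?Zb' \<inter> ?Bd \<subseteq> {c. c (Y - {vtx Y}) = 0} \<and> incidence Y \<notin> {c. c (Y - {vtx Y}) = (0::'f)}"
      using A1 A2 subspace_vanishing[where 'f = 'f] by blast
    fix Y' assume Y': "Y' \<in> I" "Y \<noteq> Y'"
    have l': "lone_cycle k b d' Y'" using I(2)[OF Y'(1)] d' by auto
    show "incidence Y' \<in> {c. c (Y - {vtx Y}) = (0::'f)}"
    proof (rule ccontr)
      assume "incidence Y' \<notin> {c. c (Y - {vtx Y}) = (0::'f)}"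
      then have "Y - {vtx Y} \<subseteq> Y'" using incidence_nonzeroD[of Y' "Y - {vtx Y}", where 'f = 'f] by auto
      then have "Y' \<inter> Y \<noteq> {}" using Yne[OF YP(2), of "vtx Y"] by blast
      then have "Y' \<subseteq> Y" using iso[of Y'] l' d' by (auto simp: lone_cycle_def)
      then have "Y' = Y" using card_subset_eq[OF YP(3)] l' YP(2) by (simp add: lone_cycle_def)
      with Y' show False by simp
    qed
  qed (use mono I in auto)
  moreover have "(?Zb \<inter> ?Bd') \<inter> (?Zb' \<inter> ?Bd) = ?Zb' \<inter> ?Bd'" using mono by blast
  ultimately show ?thesis unfolding signed_mult_def rank_def by simp
qed

lemma signed_mult_nonneg: "k \<ge> 1 \<Longrightarrow> 0 \<le> signed_mult F k b d"
  using signed_mult_ge[of k "{}"] by simp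

lemma pair_multiplicity_eq:
  "k \<ge> 1 \<Longrightarrow> int (pair_multiplicity F k (sublevel P w) (b, d)) = signed_mult F k b d"
  by (simp add: pair_multiplicity_eq_nat signed_mult_nonneg)

lemma pair_multiplicity_ge:
  assumes "k \<ge> 1" "finite I" "\<And>Y. Y \<in> I \<Longrightarrow> lone_cycle k b d Y"
  shows "card I \<le> pair_multiplicity F k (sublevel P w) (b, ereal d)"
  using signed_mult_ge[of k I "ereal d" b F] pair_multiplicity_eq[of k F b "ereal d"] assms by auto

definition weights :: "real set" where "weights = w ` simplices"

lemma finite_weights: "finite weights"
  using finite_points by (simp add: weights_def)

text \<open>The complex changes only at weights. In particular no class dies at
  \<open>\<infinity>\<close>: all weights are finite, so nothing is left to be added there.\<close>

lemma pair_multiplicity_support: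
  assumes "pair_multiplicity F k (sublevel P w) (b, d) \<noteq> 0"
  shows "b \<in> weights \<and> (\<exists>d'\<in>weights. d = ereal d')"
proof (rule ccontr)
  assume "\<not> ?thesis"
  then consider "b \<notin> weights" | "\<forall>d'\<in>weights. d \<noteq> ereal d'" by blast
  then have "signed_mult F k b d = 0"
  proof cases
    case 1
    then have "sublevel P w b = before (sublevel P w) b"
      by (auto simp: sublevel_eq before_sublevel weights_def less_le)
    then show ?thesis by (simp add: signed_mult_def)
  next
    case 2
    then have "sublevel P w d = before (sublevel P w) d"
      by (auto simp: sublevel_eq before_sublevel weights_def less_le)
    then show ?thesis by (simp add: signed_mult_def)
  qed
  then show False using assms by (simp add: pair_multiplicity_eq_nat)
qed

text \<open>Telescoping over the deaths and then over the births leaves the dimension of the cycles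
  at time \<open>t\<close> that bound in the full complex. A bound on the cycle space thereby limits
  the sum of all multiplicities up to \<open>t\<close>.\<close>

lemma sum_pair_multiplicity_le:
  assumes k: "k \<ge> 1"
  shows "(\<Sum>b\<in>{c\<in>weights. c \<le> t}. \<Sum>d\<in>weights. pair_multiplicity (F :: 'f::field itself) k (sublevel P w) (b, ereal d))
    \<le> chain_space.dim (cycles k (sublevel P w t) :: ('a set \<Rightarrow> 'f) set)"
proof -
  let ?S = simplices
  let ?D = "{c\<in>weights. c \<le> t}"
  have sl: "sublevel P w (ereal c) = {p\<in>?S. w p \<le> c}" "before (sublevel P w) (ereal c) = {p\<in>?S. w p < c}" for c
    by (auto simp: sublevel_eq before_sublevel)
  define g where "g b = (\<lambda>L. rank F k (sublevel P w (ereal b)) L - rank F k (before (sublevel P w) (ereal b)) L)" for b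
  define h where "h = (\<lambda>K. rank F k K {p\<in>?S. w p \<in> weights} - rank F k K {})"
  have "int (\<Sum>b\<in>?D. \<Sum>d\<in>weights. pair_multiplicity F k (sublevel P w) (b, ereal d)) =
      (\<Sum>b\<in>?D. \<Sum>d\<in>weights. signed_mult F k b (ereal d))"
    using k by (simp add: pair_multiplicity_eq)
  also have "\<dots> = (\<Sum>b\<in>?D. \<Sum>d\<in>weights. g b {p\<in>?S. w p \<le> d} - g b {p\<in>?S. w p < d})"
    unfolding signed_mult_def g_def sl by (intro sum.cong refl) simp
  also have "\<dots> = (\<Sum>b\<in>?D. g b {p\<in>?S. w p \<in> weights} - g b {})"
    by (intro sum.cong refl telescope_sublevel finite_weights) (auto simp: weights_def)
  also have "\<dots> = (\<Sum>b\<in>?D. h {p\<in>?S. w p \<le> b} - h {p\<in>?S. w p < b})"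
    unfolding g_def h_def sl by (intro sum.cong refl) simp
  also have "\<dots> = h {p\<in>?S. w p \<in> ?D} - h {}"
    by (rule telescope_sublevel) (use finite_weights in \<open>auto simp: weights_def\<close>)
  also have "{p\<in>?S. w p \<in> ?D} = sublevel P w t"
    by (auto simp: sl weights_def)
  also have "h (sublevel P w t) - h {} \<le> int (chain_space.dim (cycles k (sublevel P w t) :: ('a set \<Rightarrow> 'f) set))"
  proof -
    have "(cycles k {} :: ('a set \<Rightarrow> 'f) set) = {0}"
    proof -
      have "(simplicial_chains k {} :: ('a set \<Rightarrow> 'f) set) = {0}"
        by (auto simp: simplicial_chains_def fun_eq_iff)
      moreover have "boundary (0 :: 'a set \<Rightarrow> 'f) q = 0" for q by (simp add: boundary_def)
      ultimately show ?thesis by (auto simp: cycles_def)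
    qed
    then have "cycles k {} \<inter> boundaries k L = ({0} :: ('a set \<Rightarrow> 'f) set)" for L
      using chain_space.subspace_0[OF subspace_boundaries[of k L, where 'f = 'f]] by auto
    then have "h {} = 0" by (simp add: h_def rank_def)
    moreover have "h (sublevel P w t) \<le> rank F k (sublevel P w t) {p\<in>?S. w p \<in> weights}"
      by (simp add: h_def rank_def)
    moreover have "rank F k (sublevel P w t) L \<le> int (chain_space.dim (cycles k (sublevel P w t) :: ('a set \<Rightarrow> 'f) set))" for L
      unfolding rank_def using dim_cycles_mono[OF finite_sublevel(1) Int_lower1 order_refl]
      by (simp only: of_nat_le_iff)
    ultimately show ?thesis using order_trans by fastforce
  qed
  finally show ?thesis by (simp only: of_nat_le_iff)
qed

end

section \<open>Smallest enclosing balls\<close>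

definition enclosing_radius :: "'a::euclidean_space set \<Rightarrow> real" where
  "enclosing_radius S = Inf {s. \<exists>c. \<forall>x\<in>S. dist c x \<le> s}"

text \<open>The infimum is attained: centres of nearly optimal balls stay in a compact ball around a
  point of \<open>S\<close>, and a limit point of them is an optimal centre. Attainment is what
  matches the closed balls in \<open>cech\<close>.\<close>

lemma enclosing_radius_le_iff:
  fixes S :: "'a::euclidean_space set"
  assumes "finite S" "S \<noteq> {}"
  shows "enclosing_radius S \<le> s \<longleftrightarrow> (\<exists>c. \<forall>x\<in>S. dist c x \<le> s)"
proof -
  let ?T = "{s. \<exists>c. \<forall>x\<in>S. dist c x \<le> s}"
  obtain x0 where x0: "x0 \<in> S" using assms by blast
  have nonneg: "0 \<le> s" if "s \<in> ?T" for s
    using that x0 zero_le_dist order_trans by blast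
  have bdd: "bdd_below ?T" using nonneg by (meson bdd_below.I)
  have ne: "?T \<noteq> {}"
  proof -
    have "\<forall>x\<in>S. dist x0 x \<le> Max (dist x0 ` S)" using assms by simp
    then show ?thesis by blast
  qed
  have "\<exists>c. \<forall>x\<in>S. dist c x \<le> Inf ?T"
  proof -
    have ex: "\<exists>c. \<forall>x\<in>S. dist c x \<le> Inf ?T + 1 / Suc n" for n
    proof -
      obtain s where s: "s \<in> ?T" "s < Inf ?T + 1 / Suc n"
        using cInf_lessD[OF ne, of "Inf ?T + 1 / Suc n"] by auto
      from s(1) obtain c where "\<forall>x\<in>S. dist c x \<le> s" by blast
      with s(2) have "\<forall>x\<in>S. dist c x \<le> Inf ?T + 1 / Suc n" by (meson less_imp_le order_trans)
      then show ?thesis by blast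
    qed

    define c where "c n = (SOME c. \<forall>x\<in>S. dist c x \<le> Inf ?T + 1 / Suc n)" for n
    have c: "dist (c n) x \<le> Inf ?T + 1 / Suc n" if "x \<in> S" for n x
    proof -
      have "\<forall>x\<in>S. dist (c n) x \<le> Inf ?T + 1 / Suc n"
        unfolding c_def by (rule someI_ex[OF ex])
      then show ?thesis using that by (rule bspec)
    qed
    have cb: "c n \<in> cball x0 (Inf ?T + 1)" for n
    proof -
      have "dist x0 (c n) \<le> Inf ?T + 1 / Suc n" using c[OF x0, of n] by (simp add: dist_commute)
      moreover have "1 / real (Suc n) \<le> 1" by simp
      ultimately show ?thesis unfolding mem_cball by linarith
    qed
    obtain l p where l: "strict_mono p" "(c \<circ> p) \<longlonglongrightarrow> l"
      by (rule seq_compactE[OF compact_imp_seq_compact[OF compact_cball[of x0 "Inf ?T + 1"]]])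
        (use cb in auto)
    have "dist l x \<le> Inf ?T" if x: "x \<in> S" for x
    proof (rule LIMSEQ_le)
      show "(\<lambda>n. dist ((c \<circ> p) n) x) \<longlonglongrightarrow> dist l x" by (intro tendsto_intros l)
      have "(\<lambda>n. 1 / real (Suc (p n))) \<longlonglongrightarrow> 0"
        using LIMSEQ_subseq_LIMSEQ[OF LIMSEQ_inverse_real_of_nat l(1)] by (simp add: o_def inverse_eq_divide)
      then have "(\<lambda>n. Inf ?T + 1 / Suc (p n)) \<longlonglongrightarrow> Inf ?T + 0" by (intro tendsto_intros)
      then show "(\<lambda>n. Inf ?T + 1 / Suc (p n)) \<longlonglongrightarrow> Inf ?T" by simp
      show "\<exists>N. \<forall>n\<ge>N. dist ((c \<circ> p) n) x \<le> Inf ?T + 1 / Suc (p n)" using c x by auto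
    qed
    then show ?thesis by (intro exI ballI)
  qed
  then obtain c where c: "\<And>x. x \<in> S \<Longrightarrow> dist c x \<le> Inf ?T" by auto
  show ?thesis
    unfolding enclosing_radius_def
  proof
    assume le: "Inf ?T \<le> s"
    have "\<forall>x\<in>S. dist c x \<le> s" using c le order_trans by blast
    then show "\<exists>c. \<forall>x\<in>S. dist c x \<le> s" ..
  next
    assume "\<exists>c. \<forall>x\<in>S. dist c x \<le> s"
    then show "Inf ?T \<le> s" using bdd by (intro cInf_lower) auto
  qed
qed

lemma enclosing_radius_eqI:
  fixes S :: "'a::euclidean_space set" and S' :: "'b::euclidean_space set"
  assumes "finite S" "S \<noteq> {}" "finite S'" "S' \<noteq> {}" "r > 0"
    and "\<And>s. (\<exists>c. \<forall>x\<in>S. dist c x \<le> r * s) \<longleftrightarrow> (\<exists>c. \<forall>x\<in>S'. dist c x \<le> s)"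
  shows "enclosing_radius S = r * enclosing_radius S'"
proof -
  have *: "enclosing_radius S \<le> r * s \<longleftrightarrow> enclosing_radius S' \<le> s" for s
    using assms by (simp add: enclosing_radius_le_iff)
  have "enclosing_radius S \<le> r * enclosing_radius S'" using * by blast
  moreover have "enclosing_radius S' \<le> enclosing_radius S / r"
    using *[of "enclosing_radius S / r"] assms(5) by simp
  ultimately show ?thesis using assms(5) by (simp add: field_simps)
qed

lemma enclosing_radius_nonneg:
  assumes "finite S" "S \<noteq> {}"
  shows "0 \<le> enclosing_radius S"
proof -
  obtain c where "\<forall>x\<in>S. dist c x \<le> enclosing_radius S"
    using enclosing_radius_le_iff[OF assms] by blast
  then show ?thesis using assms zero_le_dist order_trans by blast
qed

lemma enclosing_radius_mono:
  assumes "finite T" "S \<noteq> {}" "S \<subseteq> T"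
  shows "enclosing_radius S \<le> enclosing_radius T"
proof -
  obtain c where "\<forall>x\<in>T. dist c x \<le> enclosing_radius T"
    using enclosing_radius_le_iff[of T] assms by blast
  then show ?thesis using enclosing_radius_le_iff[of S] assms finite_subset by blast
qed

lemma enclosing_radius_singleton: "enclosing_radius {x} = 0"
proof -
  have "enclosing_radius {x} \<le> 0" by (subst enclosing_radius_le_iff) auto
  then show ?thesis using enclosing_radius_nonneg[of "{x}"] by simp
qed

lemma dist_le_enclosing_radius:
  assumes "finite S" "x \<in> S" "y \<in> S"
  shows "dist x y \<le> 2 * enclosing_radius S"
proof -
  obtain c where "\<forall>x\<in>S. dist c x \<le> enclosing_radius S"
    using enclosing_radius_le_iff[of S] assms by blast
  then have "dist c x \<le> enclosing_radius S" "dist c y \<le> enclosing_radius S" using assms by auto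
  then show ?thesis using dist_triangle3[of x y c] by simp
qed

lemma enclosing_radius_le:
  assumes "finite S" "x \<in> S" "\<And>y. y \<in> S \<Longrightarrow> dist x y \<le> s"
  shows "enclosing_radius S \<le> s"
  using enclosing_radius_le_iff[of S s] assms by blast

lemma enclosing_radius_affine:
  fixes a :: "'a::euclidean_space"
  assumes "finite S" "S \<noteq> {}" "r > 0"
  shows "enclosing_radius ((\<lambda>x. a + r *\<^sub>R x) ` S) = r * enclosing_radius S"
proof (rule enclosing_radius_eqI)
  fix s
  have d: "dist (a + r *\<^sub>R c) (a + r *\<^sub>R x) = r * dist c x" for c x :: 'a
    using assms(3) by (simp add: dist_norm flip: scaleR_diff_right)
  have "(\<exists>c. \<forall>x\<in>(\<lambda>x. a + r *\<^sub>R x) ` S. dist c x \<le> r * s) \<longleftrightarrow> (\<exists>c. \<forall>x\<in>S. dist (a + r *\<^sub>R c) (a + r *\<^sub>R x) \<le> r * s)"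
  proof
    assume "\<exists>c. \<forall>x\<in>(\<lambda>x. a + r *\<^sub>R x) ` S. dist c x \<le> r * s"
    then obtain c where c: "\<forall>x\<in>S. dist c (a + r *\<^sub>R x) \<le> r * s" by auto
    have "a + r *\<^sub>R ((c - a) /\<^sub>R r) = c" using assms(3) by simp
    with c show "\<exists>c. \<forall>x\<in>S. dist (a + r *\<^sub>R c) (a + r *\<^sub>R x) \<le> r * s" by metis
  next
    assume "\<exists>c. \<forall>x\<in>S. dist (a + r *\<^sub>R c) (a + r *\<^sub>R x) \<le> r * s"
    then obtain c where "\<forall>x\<in>S. dist (a + r *\<^sub>R c) (a + r *\<^sub>R x) \<le> r * s" by blast
    then show "\<exists>c. \<forall>x\<in>(\<lambda>x. a + r *\<^sub>R x) ` S. dist c x \<le> r * s"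
      by (intro exI[of _ "a + r *\<^sub>R c"]) simp
  qed
  then show "(\<exists>c. \<forall>x\<in>(\<lambda>x. a + r *\<^sub>R x) ` S. dist c x \<le> r * s) \<longleftrightarrow> (\<exists>c. \<forall>x\<in>S. dist c x \<le> s)"
    using assms(3) unfolding d by simp
qed (use assms in auto)

text \<open>For a strict inequality the centre can be moved into a countable dense set, which turns
  the event into a countable union of finite intersections.\<close>

lemma enclosing_radius_image_measurable [measurable]:
  assumes "finite A" "A \<noteq> {}" "\<And>i. i \<in> A \<Longrightarrow> (\<lambda>w. X i w) \<in> borel_measurable M"
  shows "(\<lambda>w. enclosing_radius ((\<lambda>i. X i w) ` A :: 'a::euclidean_space set)) \<in> borel_measurable M"
proof -
  obtain D :: "'a set" where D: "countable D" "\<And>U. open U \<Longrightarrow> U \<noteq> {} \<Longrightarrow> \<exists>d\<in>D. d \<in> U"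
    using countable_dense_setE by blast
  have iff: "enclosing_radius ((\<lambda>i. X i w) ` A) < s \<longleftrightarrow> (\<exists>c\<in>D. \<forall>i\<in>A. dist c (X i w) < s)" for w s
  proof
    assume lt: "enclosing_radius ((\<lambda>i. X i w) ` A) < s"
    obtain c where c: "\<forall>i\<in>A. dist c (X i w) \<le> enclosing_radius ((\<lambda>i. X i w) ` A)"
      using enclosing_radius_le_iff[of "(\<lambda>i. X i w) ` A" "enclosing_radius ((\<lambda>i. X i w) ` A)"] assms(1,2) by auto
    let ?e = "s - enclosing_radius ((\<lambda>i. X i w) ` A)"
    have "ball c ?e \<noteq> {}" using lt by simp
    then obtain d where d: "d \<in> D" "d \<in> ball c ?e" using D(2)[OF open_ball] by blast
    have "dist d (X i w) < s" if "i \<in> A" for i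
      using dist_triangle[of d "X i w" c] c that d(2) by (fastforce simp: dist_commute)
    then show "\<exists>c\<in>D. \<forall>i\<in>A. dist c (X i w) < s" using d by blast
  next
    assume "\<exists>c\<in>D. \<forall>i\<in>A. dist c (X i w) < s"
    then obtain c where c: "\<forall>i\<in>A. dist c (X i w) < s" by blast
    let ?m = "Max ((\<lambda>i. dist c (X i w)) ` A)"
    have "enclosing_radius ((\<lambda>i. X i w) ` A) \<le> ?m"
    proof -
      have "\<forall>i\<in>A. dist c (X i w) \<le> ?m" using assms(1) by simp
      then show ?thesis using enclosing_radius_le_iff[of "(\<lambda>i. X i w) ` A" ?m] assms(1,2) by blast
    qed
    also have "?m < s" using assms c by simp
    finally show "enclosing_radius ((\<lambda>i. X i w) ` A) < s" .
  qed
  show ?thesis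
    unfolding borel_measurable_iff_less iff
    using assms D(1) by (intro allI sets.sets_Collect_countable_Bex sets.sets_Collect_finite_All') auto
qed

section \<open>The Cech filtration as a sublevel filtration\<close>

text \<open>Closed balls of radius \<open>\<rho> * t / 2\<close> have a common point iff their
  centres fit into one ball of this radius, that is, iff the enclosing radius is at most
  \<open>\<rho> * t / 2\<close>; the formula solves this for \<open>t\<close>.\<close>

definition cech_weight :: "real \<Rightarrow> 'a::euclidean_space set \<Rightarrow> real" where
  "cech_weight \<rho> p = 2 * enclosing_radius p / \<rho>"

lemma cech_eq_sublevel:
  assumes "finite P" "\<rho> > 0" "0 \<le> t"
  shows "cech P (ereal \<rho> * t) = sublevel P (cech_weight \<rho>) t"
proof -
  have "card p = 1 \<or> ereal \<rho> * t = \<infinity> \<or> (\<Inter>x\<in>p. cball x (real_of_ereal (ereal \<rho> * t) / 2)) \<noteq> {} \<longleftrightarrow>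
      ereal (cech_weight \<rho> p) \<le> t" if p: "p \<noteq> {}" "p \<subseteq> P" for p
  proof (cases t)
    case (real s)
    have fin: "finite p" using p assms finite_subset by blast
    have "ereal (cech_weight \<rho> p) \<le> t \<longleftrightarrow> enclosing_radius p \<le> \<rho> * s / 2"
      using assms(2) real by (simp add: cech_weight_def field_simps)
    also have "\<dots> \<longleftrightarrow> (\<Inter>x\<in>p. cball x (real_of_ereal (ereal \<rho> * t) / 2)) \<noteq> {}"
    proof -
      have "(\<Inter>x\<in>p. cball x (real_of_ereal (ereal \<rho> * t) / 2)) = {c. \<forall>x\<in>p. dist c x \<le> \<rho> * s / 2}"
        using real by (auto simp: dist_commute)
      then show ?thesis using enclosing_radius_le_iff[OF fin p(1), of "\<rho> * s / 2"] by (simp add: ex_in_conv[symmetric])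
    qed
    moreover have "ereal (cech_weight \<rho> p) \<le> t" if "card p = 1"
      using that assms real by (auto simp: card_1_singleton_iff cech_weight_def enclosing_radius_singleton)
    ultimately show ?thesis using real by auto
  qed (use assms in auto)
  moreover have "finite p" if "p \<subseteq> P" for p using that assms(1) finite_subset by blast
  ultimately show ?thesis
    unfolding cech_def sublevel_def by (intro Collect_cong) meson
qed

lemma weighted_points_cech:
  assumes "finite P" "\<rho> > 0"
  shows "weighted_points P (cech_weight \<rho>)"
proof
  fix p :: "'a set" assume p: "p \<subseteq> P" "p \<noteq> {}"
  then show "0 \<le> cech_weight \<rho> p"
    using enclosing_radius_nonneg[of p] assms finite_subset[of p P] by (simp add: cech_weight_def)
next
  fix p \<tau> :: "'a set" assume "p \<subseteq> \<tau>" "\<tau> \<subseteq> P" "p \<noteq> {}"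
  then show "cech_weight \<rho> p \<le> cech_weight \<rho> \<tau>"
    using enclosing_radius_mono[of \<tau> p] assms finite_subset[of \<tau> P] by (auto simp: cech_weight_def divide_right_mono)
qed (fact assms)

lemma pair_multiplicity_cech:
  assumes "finite P" "\<rho> > 0" "(b, d) \<in> Delta_L"
  shows "pair_multiplicity F k (\<lambda>t. cech P (ereal \<rho> * t)) (b, d) =
    pair_multiplicity F k (sublevel P (cech_weight \<rho>)) (b, d)"
proof -
  have b: "0 \<le> ereal b" and "ereal b < d" using assms(3) by (auto simp: Delta_L_def)
  then have "0 \<le> d" by (meson le_less_trans less_imp_le)
  moreover have "before (\<lambda>t. cech P (ereal \<rho> * t)) s = before (sublevel P (cech_weight \<rho>)) s" for s
    unfolding before_def by (intro SUP_cong refl) (use assms cech_eq_sublevel in auto)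
  ultimately show ?thesis
    using cech_eq_sublevel[OF assms(1,2) b] cech_eq_sublevel[OF assms(1,2), of d]
    by (simp add: pair_multiplicity_def del: times_ereal.simps)
qed

section \<open>Integration against a persistence diagram\<close>

lemma persistence_diagram_sets [simp, measurable_cong]:
  "sets (persistence_diagram F k G) = sets (restrict_space borel Delta_L)"
  by (simp add: persistence_diagram_def)

lemma space_persistence_diagram [simp]: "space (persistence_diagram F k G) = Delta_L"
  by (simp add: persistence_diagram_def space_restrict_space)

lemma nn_integral_persistence_diagram:
  assumes S: "finite S" "S \<subseteq> Delta_L" "\<And>p. p \<in> Delta_L \<Longrightarrow> pair_multiplicity F k G p \<noteq> 0 \<Longrightarrow> p \<in> S"
    and \<phi>: "\<phi> \<in> borel_measurable (restrict_space borel Delta_L)"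
  shows "(\<integral>\<^sup>+p. \<phi> p \<partial>persistence_diagram F k G) = (\<Sum>p\<in>S. of_nat (pair_multiplicity F k G p) * \<phi> p)"
proof -
  have m: "(\<lambda>p. p) \<in> measurable (point_measure Delta_L (\<lambda>p. of_nat (pair_multiplicity F k G p))) (restrict_space borel Delta_L)"
    by (auto simp: measurable_def space_point_measure sets_point_measure space_restrict_space)
  have "(\<integral>\<^sup>+p. \<phi> p \<partial>persistence_diagram F k G) =
      (\<integral>\<^sup>+p. \<phi> p \<partial>point_measure Delta_L (\<lambda>p. of_nat (pair_multiplicity F k G p)))"
    unfolding persistence_diagram_def by (rule nn_integral_distr[OF m]) (use \<phi> in simp)
  also have "\<dots> = (\<Sum>p\<in>{p\<in>Delta_L. 0 < (of_nat (pair_multiplicity F k G p) :: ennreal) \<and> 0 < \<phi> p}. of_nat (pair_multiplicity F k G p) * \<phi> p)"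
  proof (rule nn_integral_point_measure, rule finite_subset[OF _ S(1)])
    show "{p \<in> Delta_L. (0::ennreal) < of_nat (pair_multiplicity F k G p) \<and> 0 < \<phi> p} \<subseteq> S"
      using S(3) by (auto simp: ennreal_of_nat_eq_real_of_nat)
  qed
  also have "\<dots> = (\<Sum>p\<in>S. of_nat (pair_multiplicity F k G p) * \<phi> p)"
  proof (rule sum.mono_neutral_left[OF S(1)])
    show "{p\<in>Delta_L. (0::ennreal) < of_nat (pair_multiplicity F k G p) \<and> 0 < \<phi> p} \<subseteq> S"
      using S(3) by (auto simp: ennreal_of_nat_eq_real_of_nat)
    show "\<forall>p\<in>S - {p\<in>Delta_L. (0::ennreal) < of_nat (pair_multiplicity F k G p) \<and> 0 < \<phi> p}.
        of_nat (pair_multiplicity F k G p) * \<phi> p = 0"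
    proof
      fix p assume p: "p \<in> S - {p\<in>Delta_L. (0::ennreal) < of_nat (pair_multiplicity F k G p) \<and> 0 < \<phi> p}"
      then have "p \<in> Delta_L" using S(2) by blast
      then have "(of_nat (pair_multiplicity F k G p) :: ennreal) = 0 \<or> \<phi> p = 0"
        using p unfolding zero_less_iff_neq_zero by blast
      then show "of_nat (pair_multiplicity F k G p) * \<phi> p = 0" by (rule disjE) simp_all
    qed
  qed
  finally show ?thesis .
qed

text \<open>A finite set carrying the diagram, although many of its points may have multiplicity
  0.\<close>

definition cech_pairs :: "'a::euclidean_space set \<Rightarrow> real \<Rightarrow> (real \<times> ereal) set" where
  "cech_pairs P r = {(b, ereal d) | b d. b \<in> cech_weight r ` (Pow P - {{}}) \<and> d \<in> cech_weight r ` (Pow P - {{}}) \<and> b < d}"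

abbreviation cech_mult :: "'f::field itself \<Rightarrow> nat \<Rightarrow> 'a::euclidean_space set \<Rightarrow> real \<Rightarrow> real \<times> ereal \<Rightarrow> nat" where
  "cech_mult F k P r \<equiv> pair_multiplicity F k (sublevel P (cech_weight r))"

lemma finite_cech_pairs: "finite P \<Longrightarrow> finite (cech_pairs P r)"
  unfolding cech_pairs_def
  by (rule finite_subset[of _ "(\<lambda>(b, d). (b, ereal d)) ` (cech_weight r ` (Pow P - {{}}) \<times> cech_weight r ` (Pow P - {{}}))"]) auto

lemma nn_integral_cech_diagram:
  assumes P: "finite P" "r > 0"
    and \<phi>: "\<phi> \<in> borel_measurable (restrict_space borel Delta_L)"
  shows "(\<integral>\<^sup>+p. \<phi> p \<partial>cech_diagram F k P r) = (\<Sum>p\<in>cech_pairs P r. of_nat (cech_mult F k P r p) * \<phi> p)"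
proof -
  interpret weighted_points P "cech_weight r" using weighted_points_cech[OF P] .
  have sub: "cech_pairs P r \<subseteq> Delta_L"
  proof
    fix p assume "p \<in> cech_pairs P r"
    then obtain b d where p: "p = (b, ereal d)" "b \<in> cech_weight r ` (Pow P - {{}})" "b < d"
      by (auto simp: cech_pairs_def)
    then have "0 \<le> b" using weight_nonneg by auto
    then show "p \<in> Delta_L" using p by (simp add: Delta_L_def)
  qed
  have eq: "pair_multiplicity F k (\<lambda>t. cech P (ereal r * t)) p = cech_mult F k P r p" if "p \<in> Delta_L" for p
    using pair_multiplicity_cech[OF P, of "fst p" "snd p"] that by simp
  have "(\<integral>\<^sup>+p. \<phi> p \<partial>cech_diagram F k P r) =
      (\<Sum>p\<in>cech_pairs P r. of_nat (pair_multiplicity F k (\<lambda>t. cech P (ereal r * t)) p) * \<phi> p)"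
    unfolding cech_diagram_def
  proof (rule nn_integral_persistence_diagram[OF finite_cech_pairs[OF P(1)] sub _ \<phi>])
    fix p assume p: "p \<in> Delta_L" "pair_multiplicity F k (\<lambda>t. cech P (ereal r * t)) p \<noteq> 0"
    obtain b d where bd: "p = (b, d)" by (cases p)
    have "cech_mult F k P r (b, d) \<noteq> 0" using p eq bd by simp
    from pair_multiplicity_support[OF this] show "p \<in> cech_pairs P r"
      using p(1) bd by (auto simp: cech_pairs_def weights_def Delta_L_def)
  qed
  also have "\<dots> = (\<Sum>p\<in>cech_pairs P r. of_nat (cech_mult F k P r p) * \<phi> p)"
    using sub eq by (intro sum.cong) auto
  finally show ?thesis .
qed

lemma sets_cech_diagram [simp, measurable_cong]: "sets (cech_diagram F k P r) = sets (restrict_space borel Delta_L)"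
  by (simp add: cech_diagram_def)

lemma space_cech_diagram [simp]: "space (cech_diagram F k P r) = Delta_L"
  by (simp add: cech_diagram_def)

lemma emeasure_cech_diagram:
  assumes "finite P" "r > 0" "B \<in> sets (restrict_space borel Delta_L)"
  shows "emeasure (cech_diagram F k P r) B = of_nat (\<Sum>p\<in>cech_pairs P r \<inter> B. cech_mult F k P r p)"
proof -
  have "emeasure (cech_diagram F k P r) B = (\<integral>\<^sup>+p. indicator B p \<partial>cech_diagram F k P r)"
    using assms by simp
  also have "\<dots> = (\<Sum>p\<in>cech_pairs P r. of_nat (cech_mult F k P r p) * indicator B p)"
    by (rule nn_integral_cech_diagram) (use assms in auto)
  also have "\<dots> = (\<Sum>p\<in>cech_pairs P r \<inter> B. of_nat (cech_mult F k P r p))"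
    by (rule sum.mono_neutral_cong_right) (use finite_cech_pairs assms in \<open>auto split: split_indicator\<close>)
  finally show ?thesis by simp
qed

lemma (in weighted_points) dim_cycles_sublevel_le:
  "chain_space.dim (cycles k (sublevel P w t) :: ('a set \<Rightarrow> 'f::field) set) \<le> 2 ^ card P"
proof -
  have "chain_space.dim (cycles k (sublevel P w t) :: ('a set \<Rightarrow> 'f) set) \<le> card (unit_chain ` sublevel P w t :: ('a set \<Rightarrow> 'f) set)"
    by (rule chain_space.dim_le_card[OF cycles_subset_span]) (use finite_sublevel in auto)
  also have "\<dots> \<le> card (sublevel P w t)" by (rule card_image_le) (rule finite_sublevel)
  also have "\<dots> \<le> card (Pow P)" by (rule card_mono) (use finite_points in \<open>auto simp: sublevel_def\<close>)
  finally show ?thesis by (simp add: card_Pow finite_points)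
qed

lemma sum_cech_pairs:
  fixes g :: "real \<times> ereal \<Rightarrow> 'b::comm_monoid_add" and P :: "'a::euclidean_space set" and r :: real
  assumes "finite P"
  defines "W \<equiv> cech_weight r ` (Pow P - {{}})"
  shows "(\<Sum>p\<in>cech_pairs P r. g p) = (\<Sum>b\<in>W. \<Sum>d\<in>W. if b < d then g (b, ereal d) else 0)"
proof -
  have W: "finite W" using assms by (simp add: W_def)
  have "cech_pairs P r = (\<lambda>(b, d). (b, ereal d)) ` {p \<in> W \<times> W. fst p < snd p}"
    by (auto simp: cech_pairs_def W_def)
  moreover have "inj (\<lambda>(b :: real, d). (b, ereal d))" by (auto simp: inj_on_def)
  ultimately have "(\<Sum>p\<in>cech_pairs P r. g p) = (\<Sum>p\<in>{p \<in> W \<times> W. fst p < snd p}. g (fst p, ereal (snd p)))"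
    by (simp only: sum.reindex[OF inj_on_subset[OF _ subset_UNIV]]) (simp add: case_prod_beta)
  also have "\<dots> = (\<Sum>p\<in>W \<times> W. if fst p < snd p then g (fst p, ereal (snd p)) else 0)"
    using W by (subst sum.inter_filter) auto
  finally show ?thesis using W by (simp add: sum.cartesian_product case_prod_beta)
qed

text \<open>A crude bound by the number of simplices, uniform in the position of the points; it
  makes the diagrams Radon and keeps their mean measure finite.\<close>

lemma emeasure_cech_diagram_le:
  fixes F :: "'f::field itself" and P :: "'a::euclidean_space set"
  assumes P: "finite P" "r > 0" and B: "B \<in> sets (restrict_space borel Delta_L)" and "k \<ge> 1"
  shows "emeasure (cech_diagram F k P r) B \<le> of_nat (2 ^ card P)"
proof -
  interpret weighted_points P "cech_weight r" using weighted_points_cech[OF P] .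
  have "bdd_above weights" using finite_weights by simp
  then obtain t where t: "\<And>c. c \<in> weights \<Longrightarrow> c \<le> t" by (auto simp: bdd_above_def)
  have all: "{c\<in>weights. c \<le> t} = weights" using t by blast
  have "(\<Sum>p\<in>cech_pairs P r \<inter> B. cech_mult F k P r p) \<le> (\<Sum>p\<in>cech_pairs P r. cech_mult F k P r p)"
    by (rule sum_mono2) (use finite_cech_pairs P in auto)
  also have "\<dots> \<le> (\<Sum>b\<in>weights. \<Sum>d\<in>weights. cech_mult F k P r (b, ereal d))"
    unfolding sum_cech_pairs[OF P(1)] weights_def by (intro sum_mono) auto
  also have "\<dots> \<le> chain_space.dim (cycles k (sublevel P (cech_weight r) t) :: ('a set \<Rightarrow> 'f) set)"
    using sum_pair_multiplicity_le[OF assms(4), where t = t and F = F] all by simp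
  also have "\<dots> \<le> 2 ^ card P" by (rule dim_cycles_sublevel_le)
  finally show ?thesis unfolding emeasure_cech_diagram[OF P B] by (simp only: of_nat_le_iff)
qed

section \<open>Comparison with a sum over tuples of points\<close>

definition birth_time :: "('i \<Rightarrow> 'a::euclidean_space) \<Rightarrow> 'i set \<Rightarrow> real" where
  "birth_time x A = Max ((\<lambda>i. 2 * enclosing_radius (x ` (A - {i}))) ` A)"

definition death_time :: "('i \<Rightarrow> 'a::euclidean_space) \<Rightarrow> 'i set \<Rightarrow> real" where
  "death_time x A = 2 * enclosing_radius (x ` A)"

definition diameter_le :: "('i \<Rightarrow> 'a::metric_space) \<Rightarrow> real \<Rightarrow> 'i set \<Rightarrow> bool" where
  "diameter_le x R A \<longleftrightarrow> (\<forall>i\<in>A. \<forall>j\<in>A. dist (x i) (x j) \<le> R)"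

definition subsets_of_card :: "nat \<Rightarrow> 'i set \<Rightarrow> 'i set set" where
  "subsets_of_card q I = {A. A \<subseteq> I \<and> card A = q}"

lemma finite_subsets_of_card: "finite I \<Longrightarrow> finite (subsets_of_card q I)"
  by (simp add: subsets_of_card_def)

lemma birth_time_ge:
  assumes "finite A" "i \<in> A"
  shows "2 * enclosing_radius (x ` (A - {i})) \<le> birth_time x A"
  unfolding birth_time_def using assms by (intro Max_ge) auto

text \<open>With at least three points, any two of them lie in a common facet, whose diameter is at
  most twice its enclosing radius.\<close>

lemma diameter_le_birth_time:
  assumes "finite A" "card A \<ge> 3"
  shows "diameter_le x (birth_time x A) A"
  unfolding diameter_le_def
proof (intro ballI)
  fix i j assume ij: "i \<in> A" "j \<in> A"
  have "card {i, j} \<le> 2" by (cases "i = j") auto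
  then have "\<not> A \<subseteq> {i, j}" using card_mono[of "{i, j}" A] assms(2) by auto
  then obtain l where l: "l \<in> A" "l \<noteq> i" "l \<noteq> j" by blast
  have "dist (x i) (x j) \<le> 2 * enclosing_radius (x ` (A - {l}))"
    by (rule dist_le_enclosing_radius) (use assms ij l in auto)
  also have "\<dots> \<le> birth_time x A" by (rule birth_time_ge) (use assms l in auto)
  finally show "dist (x i) (x j) \<le> birth_time x A" .
qed

text \<open>A ball around one of the points with the diameter as radius contains them all. Hence a
  bound on births alone confines the two times of a group to a bounded set.\<close>

lemma death_time_le:
  assumes "finite A" "card A \<ge> 3"
  shows "death_time x A \<le> 2 * birth_time x A"
proof -
  obtain i where "i \<in> A" using assms by fastforce
  then have "enclosing_radius (x ` A) \<le> birth_time x A"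
    using diameter_le_birth_time[OF assms, of x] assms(1)
    by (intro enclosing_radius_le[of _ "x i"]) (auto simp: diameter_le_def)
  then show ?thesis by (simp add: death_time_def)
qed

lemma birth_time_nonneg:
  assumes "finite A" "card A \<ge> 3"
  shows "0 \<le> birth_time x A"
proof -
  obtain i where "i \<in> A" using assms by fastforce
  then have "dist (x i) (x i) \<le> birth_time x A"
    using diameter_le_birth_time[OF assms, of x] unfolding diameter_le_def by blast
  then show ?thesis by simp
qed

lemma birth_time_image:
  assumes "inj_on x A"
  shows "birth_time id (x ` A) = birth_time x A" "death_time id (x ` A) = death_time x A"
proof -
  have "x ` A - {x i} = x ` (A - {i})" if "i \<in> A" for i
    using inj_on_image_set_diff[OF assms, of A "{i}"] that by auto
  then have "(\<lambda>v. 2 * enclosing_radius (id ` (x ` A - {v}))) ` (x ` A) = (\<lambda>i. 2 * enclosing_radius (x ` (A - {i}))) ` A"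
    by (auto simp: image_iff)
  then show "birth_time id (x ` A) = birth_time x A" unfolding birth_time_def by simp
qed (simp add: death_time_def)

locale cech_points =
  fixes P :: "'a::euclidean_space set" and r T :: real and k :: nat
  assumes finP: "finite P" and r: "r > 0" and T: "T > 0" and k: "k \<ge> 1"
begin

sublocale weighted_points P "cech_weight r"
  using weighted_points_cech[OF finP r] .

text \<open>The distance \<open>2 * T * r\<close> comes from \<open>death_time_le\<close>: a simplex
  present when \<open>Y\<close> is filled has diameter at most twice the birth time of
  \<open>Y\<close>, so it cannot reach a point outside.\<close>

definition isolated :: "'a set set" where
  "isolated = {Y \<in> subsets_of_card (k + 2) P. birth_time id Y \<le> T * r \<and> (\<forall>y\<in>Y. \<forall>z\<in>P - Y. 2 * T * r < dist y z)}"

text \<open>A point within \<open>2 * T * r\<close> of a group of diameter at most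
  \<open>2 * T * r\<close> is within \<open>4 * T * r\<close> of all its members; the factor 5
  leaves some room.\<close>

definition crowded :: "'a set set" where
  "crowded = {W \<in> subsets_of_card (k + 3) P. diameter_le id (5 * T * r) W}"

lemma finite_isolated: "finite isolated" and finite_crowded: "finite crowded"
  using finite_subsets_of_card[OF finP] by (auto simp: isolated_def crowded_def)

lemma finite_sub: "A \<subseteq> P \<Longrightarrow> finite A"
  using finP finite_subset by blast

lemma isolated_lone_cycle:
  assumes "Y \<in> isolated"
  shows "lone_cycle k (birth_time id Y / r) (death_time id Y / r) Y"
proof -
  have Y: "Y \<subseteq> P" "card Y = k + 2" "finite Y" "birth_time id Y \<le> T * r"
    and iso: "\<And>y z. y \<in> Y \<Longrightarrow> z \<in> P - Y \<Longrightarrow> 2 * T * r < dist y z"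
    using assms finite_sub by (auto simp: isolated_def subsets_of_card_def)
  have "birth_time id Y \<in> (\<lambda>i. 2 * enclosing_radius (id ` (Y - {i}))) ` Y"
    unfolding birth_time_def by (rule Max_in) (use Y in auto)
  then have ex: "\<exists>v\<in>Y. cech_weight r (Y - {v}) = birth_time id Y / r"
    by (auto simp: cech_weight_def)
  have le: "cech_weight r (Y - {v}) \<le> birth_time id Y / r" if "v \<in> Y" for v
    using birth_time_ge[OF Y(3) that, of id] r by (simp add: cech_weight_def divide_right_mono)
  have d: "death_time id Y \<le> 2 * T * r"
    using death_time_le[OF Y(3), of id] Y(2,4) k by simp
  have "\<sigma> \<subseteq> Y" if \<sigma>: "\<sigma> \<subseteq> P" "cech_weight r \<sigma> \<le> death_time id Y / r" "\<sigma> \<inter> Y \<noteq> {}" for \<sigma>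
  proof
    fix z assume z: "z \<in> \<sigma>"
    obtain y where y: "y \<in> \<sigma>" "y \<in> Y" using \<sigma> by blast
    have "dist y z \<le> 2 * enclosing_radius \<sigma>"
      using dist_le_enclosing_radius[OF finite_sub[OF \<sigma>(1)] y(1) z] .
    also have "\<dots> \<le> death_time id Y" using \<sigma>(2) r by (simp add: cech_weight_def divide_le_cancel)
    finally have "dist y z \<le> 2 * T * r" using d by simp
    then show "z \<in> Y" using iso[OF y(2), of z] z \<sigma>(1) by force
  qed
  then show ?thesis
    unfolding lone_cycle_def using Y ex le by (simp add: cech_weight_def death_time_def)
qed

lemma card_bad_le:
  assumes "\<And>Y. Y \<in> \<Y> \<Longrightarrow> \<exists>W\<in>crowded. Y \<subseteq> W"
  shows "card \<Y> \<le> 2 ^ (k + 3) * card crowded"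
proof -
  have "card \<Y> \<le> card (\<Union>W\<in>crowded. Pow W)"
    by (rule card_mono) (use assms finite_crowded finite_sub in \<open>auto simp: crowded_def subsets_of_card_def\<close>)
  also have "\<dots> \<le> (\<Sum>W\<in>crowded. card (Pow W))" by (rule card_UN_le[OF finite_crowded])
  also have "\<dots> = (\<Sum>W\<in>crowded. 2 ^ (k + 3))"
    by (intro sum.cong refl) (use finite_sub in \<open>auto simp: crowded_def subsets_of_card_def card_Pow\<close>)
  finally show ?thesis by (simp add: mult.commute)
qed

text \<open>A cycle is determined by its coefficients on the simplices inside crowded sets and on
  one marked facet of each isolated group. Indeed a simplex in its support is joined by a
  neighbouring simplex with one new vertex; if these \<open>k + 2\<close> points are not crowded by
  a further one, they form an isolated group, and the cycle uses all facets of it, also the marked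
  one.\<close>

lemma dim_cycles_le:
  "chain_space.dim (cycles k (sublevel P (cech_weight r) T) :: ('a set \<Rightarrow> 'f::field) set) \<le> card isolated + 2 ^ (k + 3) * card crowded"
proof -
  define bad where "bad = {\<sigma>. \<sigma> \<subseteq> P \<and> (\<exists>W\<in>crowded. \<sigma> \<subseteq> W)}"
  define vtx where "vtx Y = (SOME v. v \<in> Y)" for Y :: "'a set"
  define S where "S = bad \<union> (\<lambda>Y. Y - {vtx Y}) ` isolated"
  have fbad: "finite bad" by (rule finite_subset[of _ "Pow P"]) (use finP in \<open>auto simp: bad_def\<close>)
  have "chain_space.dim (cycles k (sublevel P (cech_weight r) T) :: ('a set \<Rightarrow> 'f) set) \<le> card S"
  proof (rule dim_le_card_coordinates[OF subspace_cycles order_refl finite_sublevel(1)])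
    show "finite S" using fbad finite_isolated by (simp add: S_def)
    fix c :: "'a set \<Rightarrow> 'f" assume c: "c \<in> cycles k (sublevel P (cech_weight r) T)" and van: "\<And>\<sigma>. \<sigma> \<in> S \<Longrightarrow> c \<sigma> = 0"
    have sl: "\<sigma> \<subseteq> P \<and> \<sigma> \<noteq> {} \<and> 2 * enclosing_radius \<sigma> \<le> T * r \<and> card \<sigma> = Suc k" if "c \<sigma> \<noteq> 0" for \<sigma>
    proof -
      have "\<sigma> \<in> sublevel P (cech_weight r) T" "card \<sigma> = Suc k"
        using c that by (auto simp: cycles_def simplicial_chains_def)
      then show ?thesis using r by (auto simp: sublevel_def cech_weight_def field_simps)
    qed
    have dist1: "dist x y \<le> T * r" if "c \<sigma> \<noteq> 0" "x \<in> \<sigma>" "y \<in> \<sigma>" for \<sigma> x y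
      using dist_le_enclosing_radius[of \<sigma> x y] finite_sub[of \<sigma>] sl[OF that(1)] that(2,3) by auto
    have "c \<sigma> = 0" for \<sigma>
    proof (rule ccontr)
      assume n: "c \<sigma> \<noteq> 0"
      note s = sl[OF n]
      have fs: "finite \<sigma>" using s finite_sub by blast
      have ne: "\<sigma> - {v} \<noteq> {}" for v
      proof
        assume "\<sigma> - {v} = {}"
        then have "card \<sigma> \<le> card {v}" by (intro card_mono) auto
        with s k show False by simp
      qed
      obtain v0 where v0: "v0 \<in> \<sigma>" using s by blast
      obtain u where u: "u \<notin> \<sigma>" "c (insert u (\<sigma> - {v0})) \<noteq> 0"
        using cycle_adjacent[OF c k n v0] by blast
      define Y where "Y = insert u \<sigma>"
      have Y: "Y \<subseteq> P" "finite Y" "card Y = k + 2"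
        using sl[OF u(2)] s u(1) fs by (auto simp: Y_def)
      obtain y1 where y1: "y1 \<in> \<sigma> - {v0}" using ne by blast
      have du: "dist u x \<le> 2 * T * r" if "x \<in> \<sigma>" for x
      proof -
        have "dist u y1 \<le> T * r" using dist1[OF u(2), of u y1] y1 by simp
        moreover have "dist y1 x \<le> T * r" using dist1[OF n] y1 that by simp
        ultimately show ?thesis using dist_triangle[of u x y1] by simp
      qed
      have Tr: "0 \<le> T * r" using T r by simp
      have dY: "dist x y \<le> 2 * T * r" if "x \<in> Y" "y \<in> Y" for x y
        using that du[of x] du[of y] dist1[OF n, of x y] Tr by (auto simp: Y_def dist_commute)
      \<comment> \<open>A further point this close would put \<open>\<sigma>\<close> inside a
        crowded set, where \<open>c\<close> vanishes by assumption.\<close>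
      have iso: "2 * T * r < dist y z" if yz: "y \<in> Y" "z \<in> P - Y" for y z
      proof (rule ccontr)
        assume "\<not> ?thesis"
        then have yz': "dist y z \<le> 2 * T * r" by simp
        have "diameter_le id (5 * T * r) (insert z Y)"
          unfolding diameter_le_def
        proof (intro ballI)
          fix a b assume ab: "a \<in> insert z Y" "b \<in> insert z Y"
          have dz: "dist x z \<le> 4 * T * r" if "x \<in> Y" for x
            using dist_triangle[of x z y] dY[OF that yz(1)] yz' by simp
          show "dist (id a) (id b) \<le> 5 * T * r"
            using ab dz[of a] dz[of b] dY[of a b] Tr by (auto simp: dist_commute)
        qed
        moreover have "insert z Y \<in> subsets_of_card (k + 3) P"
          using Y yz by (simp add: subsets_of_card_def)
        ultimately have "insert z Y \<in> crowded" by (simp add: crowded_def)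
        moreover have "\<sigma> \<subseteq> insert z Y" by (auto simp: Y_def)
        ultimately have "\<sigma> \<in> bad" using s unfolding bad_def by blast
        then show False using van[of \<sigma>] n by (simp add: S_def)
      qed
      \<comment> \<open>The replacement for \<open>v\<close> lies close to the rest of
        \<open>\<sigma>\<close>, so it belongs to \<open>Y\<close>; being outside
        \<open>\<sigma>\<close> it must be \<open>u\<close>.\<close>
      have faces: "c (Y - {v}) \<noteq> 0" if "v \<in> Y" for v
      proof (cases "v = u")
        case True
        then show ?thesis using n u(1) by (simp add: Y_def)
      next
        case False
        then have v: "v \<in> \<sigma>" using that by (simp add: Y_def)
        obtain x where x: "x \<notin> \<sigma>" "c (insert x (\<sigma> - {v})) \<noteq> 0"
          using cycle_adjacent[OF c k n v] by blast
        obtain y2 where y2: "y2 \<in> \<sigma> - {v}" using ne by blast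
        have "dist y2 x \<le> T * r" using dist1[OF x(2), of y2 x] y2 by simp
        then have "\<not> 2 * T * r < dist y2 x" using Tr by simp
        moreover have "x \<in> P" using sl[OF x(2)] by simp
        ultimately have "x \<in> Y" using iso[of y2 x] y2 by (auto simp: Y_def)
        then have "x = u" using x(1) by (simp add: Y_def)
        moreover have "insert u (\<sigma> - {v}) = Y - {v}" using False by (auto simp: Y_def)
        ultimately show ?thesis using x(2) by simp
      qed
      have "birth_time id Y \<le> T * r"
        unfolding birth_time_def using Y sl[OF faces] by (subst Max_le_iff) auto
      then have "Y \<in> isolated" using Y iso by (simp add: isolated_def subsets_of_card_def)
      then have "c (Y - {vtx Y}) = 0" using van by (simp add: S_def)
      moreover have "vtx Y \<in> Y" unfolding vtx_def by (rule someI[of _ u]) (simp add: Y_def)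
      ultimately show False using faces by blast
    qed
    then show "c = 0" by (simp add: fun_eq_iff)
  qed
  also have "card S \<le> card bad + card ((\<lambda>Y. Y - {vtx Y}) ` isolated)" unfolding S_def by (rule card_Un_le)
  also have "card bad \<le> 2 ^ (k + 3) * card crowded" by (rule card_bad_le) (auto simp: bad_def)
  also have "card ((\<lambda>Y. Y - {vtx Y}) ` isolated) \<le> card isolated" by (rule card_image_le[OF finite_isolated])
  finally show ?thesis by simp
qed

text \<open>Each multiplicity dominates the number of isolated groups with the same two times, while
  the totals for births up to \<open>T\<close> differ by at most
  \<open>2 ^ (k + 3) * card crowded\<close>. The defects are nonnegative, so this also bounds the
  error after weighting by \<open>\<psi> \<le> B\<close>. Groups that are not isolated cost the same
  amount once more, which explains \<open>k + 4\<close>.\<close>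

lemma diagram_sum_approx:
  fixes \<phi> :: "real \<times> ereal \<Rightarrow> real"
  assumes \<phi>: "\<And>p. p \<in> Delta_L \<Longrightarrow> 0 \<le> \<phi> p \<and> \<phi> p \<le> B" "\<And>b d. (b, d) \<in> Delta_L \<Longrightarrow> b > T \<Longrightarrow> \<phi> (b, d) = 0"
  defines "\<psi> \<equiv> \<lambda>(b, d). if b < d then \<phi> (b, ereal d) else 0"
  shows "\<bar>(\<Sum>p\<in>cech_pairs P r. real (cech_mult F k P r p) * \<phi> p)
      - (\<Sum>Y\<in>subsets_of_card (k + 2) P. \<psi> (birth_time id Y / r, death_time id Y / r))\<bar>
    \<le> B * 2 ^ (k + 4) * card crowded"
proof -
  define m where "m b d = cech_mult F k P r (b, ereal d)" for b d
  define I where "I b d = {Y\<in>isolated. birth_time id Y / r = b \<and> death_time id Y / r = d}" for b d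
  let ?W = weights and ?WT = "{c\<in>weights. c \<le> T}"
  have W0: "0 \<le> b" if "b \<in> ?W" for b using that weight_nonneg by (auto simp: weights_def)
  have \<psi>: "0 \<le> \<psi> (b, d)" "\<psi> (b, d) \<le> B" "b > T \<Longrightarrow> \<psi> (b, d) = 0" if "0 \<le> b" for b d
  proof -
    have "0 \<le> B" using \<phi>(1)[of "(0, 1)"] by (auto simp: Delta_L_def)
    then show "0 \<le> \<psi> (b, d)" "\<psi> (b, d) \<le> B" "b > T \<Longrightarrow> \<psi> (b, d) = 0"
      using \<phi>(1)[of "(b, ereal d)"] \<phi>(2)[of b "ereal d"] that by (auto simp: \<psi>_def Delta_L_def)
  qed
  have B0: "0 \<le> B" using \<psi>(1,2)[of 0 0] by simp
  have bd_nonneg: "0 \<le> birth_time id Y / r" if "Y \<in> subsets_of_card (k + 2) P" for Y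
    using birth_time_nonneg[of Y id] that k r finite_sub by (auto simp: subsets_of_card_def)
  have finI: "finite (I b d)" for b d using finite_isolated by (simp add: I_def)
  have le: "card (I b d) \<le> m b d" for b d
    unfolding m_def
    by (rule pair_multiplicity_ge[OF k finI]) (use isolated_lone_cycle in \<open>auto simp: I_def\<close>)
  have mem: "birth_time id Y / r \<in> ?WT" "death_time id Y / r \<in> ?W" if "Y \<in> isolated" for Y
  proof -
    have l: "lone_cycle k (birth_time id Y / r) (death_time id Y / r) Y" by (rule isolated_lone_cycle[OF that])
    have "Y \<noteq> {}" using l by (auto simp: lone_cycle_def)
    have "cech_weight r Y \<in> ?W" unfolding weights_def using l \<open>Y \<noteq> {}\<close> by (intro imageI) (simp add: lone_cycle_def)
    then show "death_time id Y / r \<in> ?W" using l by (simp add: lone_cycle_def)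
    obtain v where v: "v \<in> Y" "cech_weight r (Y - {v}) = birth_time id Y / r" using l by (auto simp: lone_cycle_def)
    have "card (Y - {v}) = k + 1" using l v finite_sub[of Y] by (simp add: lone_cycle_def)
    then have "Y - {v} \<noteq> {}" by (metis Suc_eq_plus1 card.empty nat.simps(3))
    then have "cech_weight r (Y - {v}) \<in> ?W"
      unfolding weights_def using l by (intro imageI) (auto simp: lone_cycle_def)
    then have "birth_time id Y / r \<in> ?W" using v(2) by simp
    moreover have "birth_time id Y / r \<le> T" using that r by (simp add: isolated_def field_simps)
    ultimately show "birth_time id Y / r \<in> ?WT" by simp
  qed
  have sumI: "(\<Sum>b\<in>?WT. \<Sum>d\<in>?W. \<Sum>Y\<in>I b d. g Y) = (\<Sum>Y\<in>isolated. g Y)" for g :: "'a set \<Rightarrow> real"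
  proof -
    have "(\<Sum>b\<in>?WT. \<Sum>d\<in>?W. \<Sum>Y\<in>I b d. g Y) = (\<Sum>p\<in>?WT \<times> ?W. \<Sum>Y\<in>{Y\<in>isolated. (birth_time id Y / r, death_time id Y / r) = p}. g Y)"
      by (simp add: sum.cartesian_product case_prod_beta I_def prod_eq_iff)
    also have "\<dots> = (\<Sum>Y\<in>isolated. g Y)"
      by (rule sum.group) (use finite_isolated finite_weights mem in auto)
    finally show ?thesis .
  qed
  have "(\<Sum>b\<in>?WT. \<Sum>d\<in>?W. m b d) \<le> card isolated + 2 ^ (k + 3) * card crowded"
    unfolding m_def by (rule order_trans[OF sum_pair_multiplicity_le[OF k] dim_cycles_le])
  then have "real (\<Sum>b\<in>?WT. \<Sum>d\<in>?W. m b d) \<le> real (card isolated + 2 ^ (k + 3) * card crowded)"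
    by (simp only: of_nat_le_iff)
  moreover have "(\<Sum>b\<in>?WT. \<Sum>d\<in>?W. real (card (I b d))) = real (card isolated)"
    using sumI[of "\<lambda>_. 1"] by simp
  ultimately have total: "(\<Sum>b\<in>?WT. \<Sum>d\<in>?W. real (m b d) - real (card (I b d))) \<le> 2 ^ (k + 3) * card crowded"
    by (simp add: sum_subtractf)
  let ?s1 = "\<Sum>p\<in>cech_pairs P r. real (cech_mult F k P r p) * \<phi> p"
  let ?s2 = "\<Sum>Y\<in>isolated. \<psi> (birth_time id Y / r, death_time id Y / r)"
  let ?s3 = "\<Sum>Y\<in>subsets_of_card (k + 2) P. \<psi> (birth_time id Y / r, death_time id Y / r)"
  have "?s1 = (\<Sum>b\<in>?W. \<Sum>d\<in>?W. real (m b d) * \<psi> (b, d))"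
    unfolding sum_cech_pairs[OF finP] weights_def m_def \<psi>_def by (intro sum.cong refl) auto
  also have "\<dots> = (\<Sum>b\<in>?WT. \<Sum>d\<in>?W. real (m b d) * \<psi> (b, d))"
  proof (rule sum.mono_neutral_right)
    show "\<forall>b\<in>?W - ?WT. (\<Sum>d\<in>?W. real (m b d) * \<psi> (b, d)) = 0"
    proof
      fix b assume b: "b \<in> ?W - ?WT"
      then have "b > T" by auto
      then show "(\<Sum>d\<in>?W. real (m b d) * \<psi> (b, d)) = 0" using b W0 by (simp add: \<psi>(3))
    qed
  qed (use finite_weights in auto)
  finally have s1: "?s1 = (\<Sum>b\<in>?WT. \<Sum>d\<in>?W. real (m b d) * \<psi> (b, d))" .
  have "?s2 = (\<Sum>b\<in>?WT. \<Sum>d\<in>?W. \<Sum>Y\<in>I b d. \<psi> (birth_time id Y / r, death_time id Y / r))"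
    by (rule sumI[symmetric])
  also have "\<dots> = (\<Sum>b\<in>?WT. \<Sum>d\<in>?W. real (card (I b d)) * \<psi> (b, d))"
    by (intro sum.cong refl) (auto simp: I_def)
  finally have s12: "?s1 - ?s2 = (\<Sum>b\<in>?WT. \<Sum>d\<in>?W. (real (m b d) - real (card (I b d))) * \<psi> (b, d))"
    unfolding s1 by (simp add: sum_subtractf left_diff_distrib)
  have "0 \<le> ?s1 - ?s2"
    unfolding s12 by (intro sum_nonneg mult_nonneg_nonneg) (use le \<psi>(1) W0 in auto)
  moreover have "?s1 - ?s2 \<le> (\<Sum>b\<in>?WT. \<Sum>d\<in>?W. (real (m b d) - real (card (I b d))) * B)"
    unfolding s12 by (intro sum_mono mult_left_mono) (use le \<psi>(2) W0 in auto)
  moreover have "\<dots> = (\<Sum>b\<in>?WT. \<Sum>d\<in>?W. real (m b d) - real (card (I b d))) * B"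
    by (simp add: sum_distrib_right)
  moreover have "\<dots> \<le> (2 ^ (k + 3) * card crowded) * B"
    using total B0 by (rule mult_right_mono)
  ultimately have d1: "\<bar>?s1 - ?s2\<bar> \<le> 2 ^ (k + 3) * card crowded * B" by linarith
  \<comment> \<open>Groups born in time but with an outsider nearby; together with it each of them
    forms a crowded set.\<close>
  define bad where "bad = {Y \<in> subsets_of_card (k + 2) P - isolated. birth_time id Y \<le> T * r}"
  have iso_sub: "isolated \<subseteq> subsets_of_card (k + 2) P" by (auto simp: isolated_def)
  have "?s3 - ?s2 = (\<Sum>Y\<in>subsets_of_card (k + 2) P - isolated. \<psi> (birth_time id Y / r, death_time id Y / r))"
    by (rule sum_diff[OF finite_subsets_of_card[OF finP] iso_sub, symmetric])
  also have "\<dots> = (\<Sum>Y\<in>bad. \<psi> (birth_time id Y / r, death_time id Y / r))"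
  proof (rule sum.mono_neutral_right)
    show "\<forall>Y\<in>subsets_of_card (k + 2) P - isolated - bad. \<psi> (birth_time id Y / r, death_time id Y / r) = 0"
    proof
      fix Y assume Y: "Y \<in> subsets_of_card (k + 2) P - isolated - bad"
      then have "birth_time id Y / r > T" using r by (auto simp: bad_def field_simps)
      then show "\<psi> (birth_time id Y / r, death_time id Y / r) = 0" using \<psi>(3) bd_nonneg Y by blast
    qed
  qed (use finite_subsets_of_card[OF finP] in \<open>auto simp: bad_def\<close>)
  finally have s32: "?s3 - ?s2 = (\<Sum>Y\<in>bad. \<psi> (birth_time id Y / r, death_time id Y / r))" .
  have "0 \<le> ?s3 - ?s2"
    unfolding s32 by (intro sum_nonneg \<psi>(1) bd_nonneg) (auto simp: bad_def)
  moreover have "?s3 - ?s2 \<le> (\<Sum>Y\<in>bad. B)"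
    unfolding s32 by (intro sum_mono \<psi>(2) bd_nonneg) (auto simp: bad_def)
  moreover have "card bad \<le> 2 ^ (k + 3) * card crowded"
  proof (rule card_bad_le)
    fix Y assume "Y \<in> bad"
    then have Y: "Y \<subseteq> P" "card Y = k + 2" "birth_time id Y \<le> T * r" "Y \<notin> isolated"
      by (auto simp: bad_def subsets_of_card_def)
    then obtain y z where yz: "y \<in> Y" "z \<in> P - Y" "dist y z \<le> 2 * T * r"
      by (auto simp: isolated_def subsets_of_card_def not_less)
    have Tr: "0 \<le> T * r" using T r by simp
    have "diameter_le id (birth_time id Y) Y"
      by (rule diameter_le_birth_time) (use Y k finite_sub in auto)
    then have dY: "dist a b \<le> T * r" if "a \<in> Y" "b \<in> Y" for a b
      using that Y(3) order_trans unfolding diameter_le_def id_apply by blast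
    have dz: "dist x z \<le> 3 * T * r" if "x \<in> Y" for x
      using dist_triangle[of x z y] dY[OF that yz(1)] yz(3) by simp
    have "diameter_le id (5 * T * r) (insert z Y)"
      unfolding diameter_le_def
    proof (intro ballI)
      fix a b assume "a \<in> insert z Y" "b \<in> insert z Y"
      then show "dist (id a) (id b) \<le> 5 * T * r"
        using dz[of a] dz[of b] dY[of a b] Tr by (auto simp: dist_commute)
    qed
    moreover have "insert z Y \<in> subsets_of_card (k + 3) P"
      using Y yz finite_sub by (simp add: subsets_of_card_def)
    ultimately show "\<exists>W\<in>crowded. Y \<subseteq> W" unfolding crowded_def by blast
  qed
  then have "real (card bad) \<le> real (2 ^ (k + 3) * card crowded)" by (simp only: of_nat_le_iff)
  then have "real (card bad) * B \<le> 2 ^ (k + 3) * card crowded * B" using B0 by (intro mult_right_mono) auto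
  ultimately have d2: "\<bar>?s3 - ?s2\<bar> \<le> 2 ^ (k + 3) * card crowded * B" by simp
  have "\<bar>?s1 - ?s3\<bar> \<le> 2 ^ (k + 3) * card crowded * B + 2 ^ (k + 3) * card crowded * B"
    using d1 d2 by linarith
  also have "\<dots> = B * 2 ^ (k + 4) * card crowded" by (simp add: power_add)
  finally show ?thesis .
qed

end

lemma subsets_of_card_image:
  assumes "inj_on x I"
  shows "bij_betw ((`) x) (subsets_of_card q I) (subsets_of_card q (x ` I))"
proof (rule bij_betw_imageI)
  show "inj_on ((`) x) (subsets_of_card q I)"
    by (rule inj_on_subset[OF inj_on_image_Pow[OF assms]]) (auto simp: subsets_of_card_def)
  have c: "card (x ` A) = card A" if "A \<subseteq> I" for A
    using that assms inj_on_subset card_image by metis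
  show "(`) x ` subsets_of_card q I = subsets_of_card q (x ` I)"
  proof
    show "subsets_of_card q (x ` I) \<subseteq> (`) x ` subsets_of_card q I"
    proof
      fix S assume S: "S \<in> subsets_of_card q (x ` I)"
      then obtain A where "A \<subseteq> I" "S = x ` A" by (metis (lifting) mem_Collect_eq subset_imageE subsets_of_card_def)
      then show "S \<in> (`) x ` subsets_of_card q I" using S c by (auto simp: subsets_of_card_def)
    qed
  qed (use c in \<open>auto simp: subsets_of_card_def\<close>)
qed

text \<open>Up to groups of \<open>k + 3\<close> nearby points, a persistence pair comes from \<open>k + 2\<close> points that
  are isolated from all others, and conversely.\<close>

lemma cech_diagram_approx:
  fixes x :: "nat \<Rightarrow> 'a::euclidean_space" and \<phi> :: "real \<times> ereal \<Rightarrow> real"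
  assumes k: "k \<ge> 1" and r: "r > 0" and T: "T > 0" and x: "inj_on x {1..n}"
    and meas: "\<phi> \<in> borel_measurable (restrict_space borel Delta_L)"
    and \<phi>: "\<And>p. p \<in> Delta_L \<Longrightarrow> 0 \<le> \<phi> p \<and> \<phi> p \<le> B" "\<And>b d. (b, d) \<in> Delta_L \<Longrightarrow> b > T \<Longrightarrow> \<phi> (b, d) = 0"
  defines "\<psi> \<equiv> \<lambda>(b, d). if b < d then \<phi> (b, ereal d) else 0"
  shows "\<bar>(\<integral>p. \<phi> p \<partial>cech_diagram F k (x ` {1..n}) r)
      - (\<Sum>A\<in>subsets_of_card (k + 2) {1..n}. \<psi> (birth_time x A / r, death_time x A / r))\<bar>
    \<le> B * 2 ^ (k + 4) * card {A\<in>subsets_of_card (k + 3) {1..n}. diameter_le x (5 * T * r) A}"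
proof -
  interpret cech_points "x ` {1..n}" r T k by unfold_locales (use assms in auto)
  let ?P = "x ` {1..n}"
  have sub: "cech_pairs ?P r \<subseteq> Delta_L"
    using weight_nonneg by (auto simp: cech_pairs_def Delta_L_def)
  have "(\<integral>p. \<phi> p \<partial>cech_diagram F k ?P r) = enn2real (\<integral>\<^sup>+p. ennreal (\<phi> p) \<partial>cech_diagram F k ?P r)"
  proof (rule integral_eq_nn_integral)
    show "\<phi> \<in> borel_measurable (cech_diagram F k ?P r)" using meas by simp
    show "AE p in cech_diagram F k ?P r. 0 \<le> \<phi> p" using \<phi>(1) by (intro AE_I2) simp
  qed
  also have "(\<integral>\<^sup>+p. ennreal (\<phi> p) \<partial>cech_diagram F k ?P r) = (\<Sum>p\<in>cech_pairs ?P r. of_nat (cech_mult F k ?P r p) * ennreal (\<phi> p))"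
    by (rule nn_integral_cech_diagram) (use r meas in auto)
  also have "\<dots> = ennreal (\<Sum>p\<in>cech_pairs ?P r. real (cech_mult F k ?P r p) * \<phi> p)"
    using sub \<phi>(1) by (subst sum_ennreal[symmetric]) (auto simp: ennreal_mult ennreal_of_nat_eq_real_of_nat intro!: sum.cong)
  finally have 1: "(\<integral>p. \<phi> p \<partial>cech_diagram F k ?P r) = (\<Sum>p\<in>cech_pairs ?P r. real (cech_mult F k ?P r p) * \<phi> p)"
    using sub \<phi>(1) by (subst (asm) enn2real_ennreal) (auto intro!: sum_nonneg)
  have inj: "inj_on x A" if "A \<in> subsets_of_card q {1..n}" for A q
    using that x inj_on_subset by (auto simp: subsets_of_card_def)
  have 2: "(\<Sum>Y\<in>subsets_of_card (k + 2) ?P. \<psi> (birth_time id Y / r, death_time id Y / r)) =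
      (\<Sum>A\<in>subsets_of_card (k + 2) {1..n}. \<psi> (birth_time x A / r, death_time x A / r))"
    by (subst sum.reindex_bij_betw[OF subsets_of_card_image[OF x], symmetric])
      (intro sum.cong refl, simp add: birth_time_image inj)
  have "crowded = (`) x ` {A\<in>subsets_of_card (k + 3) {1..n}. diameter_le x (5 * T * r) A}"
    unfolding crowded_def bij_betw_imp_surj_on[OF subsets_of_card_image[OF x], symmetric]
    by (auto simp: diameter_le_def)
  moreover have "inj_on ((`) x) {A\<in>subsets_of_card (k + 3) {1..n}. diameter_le x (5 * T * r) A}"
    by (rule inj_on_subset[OF bij_betw_imp_inj_on[OF subsets_of_card_image[OF x]]]) auto
  ultimately have 3: "card crowded = card {A\<in>subsets_of_card (k + 3) {1..n}. diameter_le x (5 * T * r) A}"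
    by (simp add: card_image)
  show ?thesis
    using diagram_sum_approx[of \<phi> B F, OF \<phi>] unfolding 1 3 \<psi>_def[symmetric] 2 .
qed

section \<open>Measurability of the persistence diagram\<close>

text \<open>The function factors through the finitely many truth patterns of the predicates, so the
  preimage of any set is a finite union of measurable pieces.\<close>

lemma borel_measurable_finite_pattern:
  fixes h :: "'a \<Rightarrow> 'b::topological_space"
  assumes A: "finite A" and R: "\<And>a. a \<in> A \<Longrightarrow> {u\<in>space M. R a u} \<in> sets M"
    and h: "\<And>u u'. u \<in> space M \<Longrightarrow> u' \<in> space M \<Longrightarrow> (\<And>a. a \<in> A \<Longrightarrow> R a u \<longleftrightarrow> R a u') \<Longrightarrow> h u = h u'"
  shows "h \<in> borel_measurable M"
proof (rule measurableI)
  fix S :: "'b set"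
  define pat where "pat u = {a\<in>A. R a u}" for u
  define Q where "Q = {q \<in> Pow A. \<exists>u\<in>space M. pat u = q \<and> h u \<in> S}"
  have "h -` S \<inter> space M = (\<Union>q\<in>Q. {u\<in>space M. pat u = q})"
  proof (intro set_eqI iffI)
    fix u assume "u \<in> h -` S \<inter> space M"
    then show "u \<in> (\<Union>q\<in>Q. {u\<in>space M. pat u = q})"
      by (auto simp: Q_def pat_def)
  next
    fix u assume "u \<in> (\<Union>q\<in>Q. {u\<in>space M. pat u = q})"
    then obtain u' where "u \<in> space M" "u' \<in> space M" "pat u' = pat u" "h u' \<in> S" by (auto simp: Q_def)
    moreover have "h u = h u'" by (rule h) (use calculation in \<open>auto simp: pat_def set_eq_iff\<close>)
    ultimately show "u \<in> h -` S \<inter> space M" by simp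
  qed
  also have "\<dots> \<in> sets M"
  proof (rule sets.finite_UN)
    show "finite Q" using A by (simp add: Q_def)
    fix q assume "q \<in> Q"
    then have q: "q \<subseteq> A" by (auto simp: Q_def)
    have "{u\<in>space M. pat u = q} = {u\<in>space M. \<forall>a\<in>A. R a u \<longleftrightarrow> a \<in> q}"
      using q by (auto simp: pat_def)
    also have "\<dots> \<in> sets M"
    proof (rule sets.sets_Collect_finite_All[OF _ A])
      fix a assume "a \<in> A"
      show "{u\<in>space M. R a u \<longleftrightarrow> a \<in> q} \<in> sets M"
        using R[OF \<open>a \<in> A\<close>] by (cases "a \<in> q") (auto intro: sets.sets_Collect_neg)
    qed
    finally show "{u\<in>space M. pat u = q} \<in> sets M" .
  qed
  finally show "h -` S \<inter> space M \<in> sets M" .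
qed simp

lemma sublevel_image:
  "sublevel (x ` I) w t = (\<lambda>s. x ` s) ` {s \<in> Pow I - {{}}. ereal (w (x ` s)) \<le> t}"
  unfolding sublevel_def by (auto simp: subset_image_iff)

lemma before_sublevel_image:
  assumes "weighted_points (x ` I) w"
  shows "before (sublevel (x ` I) w) t = (\<lambda>s. x ` s) ` {s \<in> Pow I - {{}}. ereal (w (x ` s)) < t}"
  unfolding weighted_points.before_sublevel[OF assms] by (auto simp: subset_image_iff)

text \<open>The multiplicity at the weights of two given index sets depends on the sample only
  through the order of the weights of index sets. Equal patterns give a bijection between the two
  point sets that carries one filtration to the other, and persistent Betti numbers are invariant
  under it.\<close>

lemma cech_mult_order_pattern:
  fixes x y :: "'i \<Rightarrow> 'a::euclidean_space"
  assumes I: "finite I" and \<rho>: "\<rho> > 0"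
    and eq: "\<And>s v. s \<in> Pow I - {{}} \<Longrightarrow> v \<in> Pow I - {{}} \<Longrightarrow>
      cech_weight \<rho> (x ` s) \<le> cech_weight \<rho> (x ` v) \<longleftrightarrow> cech_weight \<rho> (y ` s) \<le> cech_weight \<rho> (y ` v)"
    and s: "s \<in> Pow I - {{}}" and v: "v \<in> Pow I - {{}}"
  shows "cech_mult F k (x ` I) \<rho> (cech_weight \<rho> (x ` s), ereal (cech_weight \<rho> (x ` v))) =
    cech_mult F k (y ` I) \<rho> (cech_weight \<rho> (y ` s), ereal (cech_weight \<rho> (y ` v)))"
proof -
  \<comment> \<open>Sample points may coincide, but the pattern shows this too: a singleton has
    weight 0, a pair of distinct points a positive weight.\<close>
  have coinc: "z i = z j \<longleftrightarrow> cech_weight \<rho> (z ` {i, j}) \<le> cech_weight \<rho> (z ` {i})" for z :: "'i \<Rightarrow> 'a" and i j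
  proof
    assume "cech_weight \<rho> (z ` {i, j}) \<le> cech_weight \<rho> (z ` {i})"
    then have "enclosing_radius (z ` {i, j}) \<le> 0"
      using \<rho> by (simp add: cech_weight_def enclosing_radius_singleton divide_le_0_iff)
    moreover have "dist (z i) (z j) \<le> 2 * enclosing_radius (z ` {i, j})"
      by (rule dist_le_enclosing_radius) auto
    ultimately have "dist (z i) (z j) \<le> 0" by linarith
    then show "z i = z j" by simp
  qed simp
  have xy: "x i = x j \<longleftrightarrow> y i = y j" if "i \<in> I" "j \<in> I" for i j
    unfolding coinc by (rule eq) (use that in auto)
  define f where "f = y \<circ> inv_into I x"
  have fx: "f (x i) = y i" if "i \<in> I" for i
  proof -
    have "x (inv_into I x (x i)) = x i" "inv_into I x (x i) \<in> I"
      using that by (auto simp: f_inv_into_f inv_into_into)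
    then show ?thesis using xy that by (simp add: f_def)
  qed
  have inj: "inj_on f (x ` I)" by (rule inj_onI) (use fx xy in auto)
  have im: "(`) f ` (\<lambda>s. x ` s) ` S = (\<lambda>s. y ` s) ` S" if "S \<subseteq> Pow I" for S
  proof -
    have "f ` x ` s = y ` s" if "s \<in> S" for s
      using fx \<open>S \<subseteq> Pow I\<close> that by (force simp: image_image)
    then show ?thesis by (simp add: image_image cong: image_cong)
  qed
  have lt: "cech_weight \<rho> (x ` s) < cech_weight \<rho> (x ` v) \<longleftrightarrow> cech_weight \<rho> (y ` s) < cech_weight \<rho> (y ` v)"
    if "s \<in> Pow I - {{}}" "v \<in> Pow I - {{}}" for s v
    using eq[OF that(2,1)] by (simp add: not_le[symmetric])
  have wx: "weighted_points (x ` I) (cech_weight \<rho>)" and wy: "weighted_points (y ` I) (cech_weight \<rho>)"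
    using I \<rho> by (auto intro: weighted_points_cech)
  let ?S = "\<lambda>z v. sublevel (z ` I) (cech_weight \<rho>) (ereal (cech_weight \<rho> (z ` v)))"
  let ?B = "\<lambda>z v. before (sublevel (z ` I) (cech_weight \<rho>)) (ereal (cech_weight \<rho> (z ` v)))"
  have S: "?S y v = (`) f ` ?S x v" if "v \<in> Pow I - {{}}" for v
    unfolding sublevel_image using eq[OF _ that]
    by (subst im) (auto intro!: arg_cong[where f = "image _"])
  have B: "?B y v = (`) f ` ?B x v" if "v \<in> Pow I - {{}}" for v
    unfolding before_sublevel_image[OF wx] before_sublevel_image[OF wy] using lt[OF _ that]
    by (subst im) (auto intro!: arg_cong[where f = "image _"])
  have sub: "?S x v \<subseteq> Pow (x ` I)" "?B x v \<subseteq> Pow (x ` I)" for v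
    unfolding sublevel_image before_sublevel_image[OF wx] by auto
  show ?thesis
    unfolding pair_multiplicity_def
    by (simp add: S[OF s] S[OF v] B[OF s] B[OF v] persistent_betti_image[OF _ inj] sub I)
qed

lemma Delta_L_borel: "Delta_L \<in> sets borel"
proof -
  have "closed {p :: real \<times> ereal. 0 \<le> fst p}" "open {p :: real \<times> ereal. ereal (fst p) < snd p}"
    by (intro closed_Collect_le open_Collect_less continuous_intros)+
  moreover have "Delta_L = {p. 0 \<le> fst p} \<inter> {p. ereal (fst p) < snd p}"
    by (auto simp: Delta_L_def)
  ultimately show ?thesis by (metis borel_closed borel_open sets.Int)
qed

text \<open>The birth-death pairs move with the sample, so the sum is taken over pairs of index
  sets, a fixed finite set. A summand is a function of the order pattern times the indicator that a
  measurable random point lies in \<open>B\<close>.\<close>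

lemma emeasure_cech_diagram_measurable:
  fixes X :: "'i \<Rightarrow> 'w \<Rightarrow> 'a::euclidean_space"
  assumes I: "finite I" and \<rho>: "\<rho> > 0" and X: "\<And>i. i \<in> I \<Longrightarrow> X i \<in> borel_measurable M"
    and B: "B \<in> sets (restrict_space borel Delta_L)"
  shows "(\<lambda>u. emeasure (cech_diagram F k ((\<lambda>i. X i u) ` I) \<rho>) B) \<in> borel_measurable M"
proof -
  let ?J = "Pow I - {{}}"
  define w where "w u s = cech_weight \<rho> ((\<lambda>i. X i u) ` s)" for u s
  define pr where "pr u = (\<lambda>(s, v). (w u s, ereal (w u v)))" for u
  define J where "J u = {p \<in> ?J \<times> ?J. w u (fst p) < w u (snd p)}" for u
  \<comment> \<open>Several pairs of index sets may yield the same point of the diagram; its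
    multiplicity is shared equally among them.\<close>
  define h where "h p u = (if p \<in> J u then real (cech_mult F k ((\<lambda>i. X i u) ` I) \<rho> (pr u p)) / real (card {p'\<in>J u. pr u p' = pr u p}) else 0)" for p u
  have finJ: "finite (J u)" for u using I by (simp add: J_def)
  have w_meas: "(\<lambda>u. w u s) \<in> borel_measurable M" if "s \<in> ?J" for s
    unfolding w_def cech_weight_def using that I X finite_subset[of s I]
    by (intro borel_measurable_divide borel_measurable_times borel_measurable_const enclosing_radius_image_measurable) auto
  have "emeasure (cech_diagram F k ((\<lambda>i. X i u) ` I) \<rho>) B =
      ennreal (\<Sum>p\<in>?J \<times> ?J. h p u * indicator B (pr u p))" for u
  proof -
    let ?P = "(\<lambda>i. X i u) ` I"
    have P: "finite ?P" using I by simp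
    have im: "cech_weight \<rho> ` (Pow ?P - {{}}) = w u ` ?J"
      unfolding w_def by (force simp: subset_image_iff)
    have pairs: "cech_pairs ?P \<rho> = pr u ` J u"
      unfolding cech_pairs_def im pr_def J_def by force
    have "real (\<Sum>p\<in>cech_pairs ?P \<rho> \<inter> B. cech_mult F k ?P \<rho> p) =
        (\<Sum>q\<in>pr u ` J u. real (cech_mult F k ?P \<rho> q) * indicator B q)"
      unfolding pairs using finJ
      by (simp add: indicator_def if_distrib sum.inter_restrict cong: if_cong)
    also have "\<dots> = (\<Sum>q\<in>pr u ` J u. \<Sum>p\<in>{p\<in>J u. pr u p = q}. h p u * indicator B (pr u p))"
    proof (rule sum.cong[OF refl])
      fix q assume q: "q \<in> pr u ` J u"
      let ?C = "{p\<in>J u. pr u p = q}"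
      have "card ?C \<noteq> 0" using q finJ by auto
      moreover have "(\<Sum>p\<in>?C. h p u * indicator B (pr u p)) =
          (\<Sum>p\<in>?C. real (cech_mult F k ?P \<rho> q) / real (card ?C) * indicator B q)"
        by (intro sum.cong refl) (simp add: h_def)
      ultimately show "real (cech_mult F k ?P \<rho> q) * indicator B q = (\<Sum>p\<in>?C. h p u * indicator B (pr u p))"
        by simp
    qed
    also have "\<dots> = (\<Sum>p\<in>J u. h p u * indicator B (pr u p))"
      by (rule sum.image_gen[OF finJ, symmetric])
    also have "\<dots> = (\<Sum>p\<in>?J \<times> ?J. h p u * indicator B (pr u p))"
      by (rule sum.mono_neutral_left) (use I in \<open>auto simp: J_def h_def\<close>)
    finally show ?thesis
      unfolding emeasure_cech_diagram[OF P \<rho> B] by (simp only: ennreal_of_nat_eq_real_of_nat)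
  qed
  moreover have "(\<lambda>u. h p u * indicator B (pr u p)) \<in> borel_measurable M" if p: "p \<in> ?J \<times> ?J" for p
  proof -
    have "h p \<in> borel_measurable M"
    proof (rule borel_measurable_finite_pattern[where A = "?J \<times> ?J" and R = "\<lambda>a u. w u (fst a) \<le> w u (snd a)"])
      show "finite (?J \<times> ?J)" using I by simp
      show "{u\<in>space M. w u (fst a) \<le> w u (snd a)} \<in> sets M" if "a \<in> ?J \<times> ?J" for a
        using that by (intro borel_measurable_le w_meas) auto
      fix u u' assume "\<And>a. a \<in> ?J \<times> ?J \<Longrightarrow> (w u (fst a) \<le> w u (snd a)) = (w u' (fst a) \<le> w u' (snd a))"
      then have le: "w u s \<le> w u v \<longleftrightarrow> w u' s \<le> w u' v" if "s \<in> ?J" "v \<in> ?J" for s v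
        using that by (metis SigmaI fst_conv snd_conv)
      have e: "w u s = w u v \<longleftrightarrow> w u' s = w u' v" if "s \<in> ?J" "v \<in> ?J" for s v
        using le[OF that] le[OF that(2,1)] by (simp add: eq_iff)
      have J: "J u = J u'"
      proof -
        have "w u s < w u v \<longleftrightarrow> w u' s < w u' v" if "s \<in> ?J" "v \<in> ?J" for s v
          using le[OF that(2,1)] by (simp add: not_le[symmetric])
        then show ?thesis unfolding J_def by (intro Collect_cong) (auto simp: mem_Times_iff)
      qed
      have C: "{p'\<in>J u. pr u p' = pr u p} = {p'\<in>J u'. pr u' p' = pr u' p}"
      proof -
        have "pr u p' = pr u p \<longleftrightarrow> pr u' p' = pr u' p" if "p' \<in> ?J \<times> ?J" for p'
          using e[of "fst p'" "fst p"] e[of "snd p'" "snd p"] p that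
          by (simp add: pr_def case_prod_beta mem_Times_iff)
        then show ?thesis unfolding J by (intro Collect_cong conj_cong refl) (simp add: J_def)
      qed
      obtain s v where st: "p = (s, v)" "s \<in> ?J" "v \<in> ?J" using p by auto
      have "cech_mult F k ((\<lambda>i. X i u) ` I) \<rho> (pr u p) = cech_mult F k ((\<lambda>i. X i u') ` I) \<rho> (pr u' p)"
        unfolding pr_def st(1) prod.case w_def
        by (rule cech_mult_order_pattern[OF I \<rho> _ st(2,3)]) (use le w_def in auto)
      then show "h p u = h p u'" unfolding h_def J using C[unfolded J] by simp
    qed
    moreover have "(\<lambda>u. indicator B (pr u p) :: real) \<in> borel_measurable M"
    proof -
      note Delta_L_borel
      then have B': "B \<in> sets borel" using B by (auto simp: sets_restrict_space)
      have "pr u p = (w u (fst p), ereal (w u (snd p)))" for u by (simp add: pr_def case_prod_beta)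
      moreover have "(\<lambda>u. (w u (fst p), ereal (w u (snd p)))) \<in> M \<rightarrow>\<^sub>M borel \<Otimes>\<^sub>M borel"
        using p by (intro measurable_Pair borel_measurable_ereal w_meas) auto
      ultimately have "(\<lambda>u. pr u p) \<in> borel_measurable M" by (simp add: borel_prod)
      then show ?thesis using B' by measurable
    qed
    ultimately show ?thesis by simp
  qed
  ultimately show ?thesis by (simp add: borel_measurable_sum)
qed

section \<open>Central moments of sums over subsets of a sample\<close>

definition depends_on :: "'i set \<Rightarrow> (('i \<Rightarrow> 'a) \<Rightarrow> 'b) \<Rightarrow> bool" where
  "depends_on W F \<longleftrightarrow> (\<forall>x y. (\<forall>i\<in>W. x i = y i) \<longrightarrow> F x = F y)"

lemma depends_on_mono: "depends_on W F \<Longrightarrow> W \<subseteq> V \<Longrightarrow> depends_on V F"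
  unfolding depends_on_def by blast

text \<open>Either a maximal family of pairwise unrelated elements or its complement will do.\<close>

lemma small_dominating_set:
  assumes V: "finite V" and sym: "\<And>u v. R u v \<Longrightarrow> R v u"
    and nbr: "\<And>v. v \<in> V \<Longrightarrow> \<exists>u\<in>V. u \<noteq> v \<and> R v u"
  shows "\<exists>L\<subseteq>V. 2 * card L \<le> card V \<and> (\<forall>v\<in>V - L. \<exists>u\<in>L. R v u)"
proof -
  define \<J> where "\<J> = {J. J \<subseteq> V \<and> (\<forall>u\<in>J. \<forall>v\<in>J. u \<noteq> v \<longrightarrow> \<not> R u v)}"
  have "finite \<J>" by (rule finite_subset[of _ "Pow V"]) (use V in \<open>auto simp: \<J>_def\<close>)
  moreover have "{} \<in> \<J>" by (simp add: \<J>_def)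
  ultimately obtain J where J: "J \<in> \<J>" "\<forall>J'\<in>\<J>. J \<subseteq> J' \<longrightarrow> J = J'"
    using finite_has_maximal[of \<J>] by blast
  have dom1: "\<exists>u\<in>J. R v u" if v: "v \<in> V - J" for v
  proof (rule ccontr)
    assume n: "\<not> ?thesis"
    then have "\<not> R v u \<and> \<not> R u v" if "u \<in> J" for u using that sym by blast
    then have "insert v J \<in> \<J>" using J(1) v by (auto simp: \<J>_def)
    then have "J = insert v J" using J(2) by blast
    then show False using v by blast
  qed
  have dom2: "\<exists>u\<in>V - J. R v u" if v: "v \<in> V - (V - J)" for v
  proof -
    have vJ: "v \<in> J" "v \<in> V" using v by auto
    obtain u where u: "u \<in> V" "u \<noteq> v" "R v u" using nbr[OF vJ(2)] by blast
    then have "u \<notin> J" using J(1) vJ(1) by (auto simp: \<J>_def)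
    then show ?thesis using u by blast
  qed
  have "card J + card (V - J) = card V"
    using V J(1) card_mono[of V J] card_Diff_subset[of J V] finite_subset[of J V] by (simp add: \<J>_def)
  then consider "2 * card J \<le> card V" | "2 * card (V - J) \<le> card V" by linarith
  then show ?thesis
  proof cases
    case 1
    then show ?thesis using dom1 J(1) by (intro exI[of _ J]) (auto simp: \<J>_def)
  next
    case 2
    then show ?thesis using dom2 by (intro exI[of _ "V - J"]) auto
  qed
qed

lemma sum_PiE_insert:
  assumes "l \<notin> L"
  shows "(\<Sum>P\<in>PiE (insert l L) (\<lambda>_. Y). f P) = (\<Sum>P\<in>PiE L (\<lambda>_. Y). \<Sum>A\<in>Y. f (P(l := A)))"
proof -
  have "(\<Sum>P\<in>PiE (insert l L) (\<lambda>_. Y). f P) = (\<Sum>(A, P)\<in>Y \<times> PiE L (\<lambda>_. Y). f (P(l := A)))"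
    unfolding PiE_insert_eq
    by (subst sum.reindex[OF inj_combinator[OF assms]]) (simp add: case_prod_beta o_def)
  then show ?thesis by (simp add: sum.cartesian_product[symmetric] sum.swap[of _ Y])
qed

locale iid_product =
  fixes D :: "'a::euclidean_space measure" and I :: "nat set"
  assumes D: "prob_space D" and sets_D [measurable_cong]: "sets D = sets borel" and finI: "finite I"
begin

abbreviation "\<P> \<equiv> PiM I (\<lambda>_. D)"

sublocale D: prob_space D by (rule D)
sublocale PD: product_prob_space "\<lambda>_. D" UNIV by unfold_locales
sublocale prob_space \<P> by (rule prob_space_PiM) (rule D)

text \<open>Bound and dependence are stated for all functions and not only for the extensional ones
  in the product space, so that coordinates can be overwritten freely.\<close>

definition bdd_kernel :: "nat set \<Rightarrow> ((nat \<Rightarrow> 'a) \<Rightarrow> real) \<Rightarrow> bool" where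
  "bdd_kernel W F \<longleftrightarrow> W \<subseteq> I \<and> F \<in> borel_measurable \<P> \<and> (\<exists>B. \<forall>x. \<bar>F x\<bar> \<le> B) \<and> depends_on W F"

lemma bdd_kernel_integrable: "bdd_kernel W F \<Longrightarrow> integrable \<P> F"
proof -
  assume F: "bdd_kernel W F"
  then obtain B where "\<And>x. \<bar>F x\<bar> \<le> B" by (auto simp: bdd_kernel_def)
  then show ?thesis using F by (intro integrable_const_bound[where B = B]) (auto simp: bdd_kernel_def)
qed

lemma bdd_kernel_mult:
  assumes "bdd_kernel V F" "bdd_kernel W G"
  shows "bdd_kernel (V \<union> W) (\<lambda>x. F x * G x)"
proof -
  obtain B C where BC: "\<And>x. \<bar>F x\<bar> \<le> B" "\<And>x. \<bar>G x\<bar> \<le> C" using assms by (auto simp: bdd_kernel_def)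
  have "\<bar>F x * G x\<bar> \<le> B * C" for x
    unfolding abs_mult using BC[of x] by (intro mult_mono) auto
  moreover have "depends_on (V \<union> W) (\<lambda>x. F x * G x)"
    using assms unfolding bdd_kernel_def depends_on_def by (metis UnI1 UnI2)
  ultimately show ?thesis using assms unfolding bdd_kernel_def by auto
qed

lemma bdd_kernel_add_const: "bdd_kernel W F \<Longrightarrow> bdd_kernel W (\<lambda>x. F x + c)"
proof -
  assume F: "bdd_kernel W F"
  then obtain B where B: "\<And>x. \<bar>F x\<bar> \<le> B" by (auto simp: bdd_kernel_def)
  have "\<bar>F x + c\<bar> \<le> B + \<bar>c\<bar>" for x using B[of x] by linarith
  moreover have "depends_on W (\<lambda>x. F x + c)" using F unfolding bdd_kernel_def depends_on_def by metis
  ultimately show ?thesis using F unfolding bdd_kernel_def by auto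
qed

lemma bdd_kernel_mono: "bdd_kernel W F \<Longrightarrow> W \<subseteq> V \<Longrightarrow> V \<subseteq> I \<Longrightarrow> bdd_kernel V F"
  using depends_on_mono unfolding bdd_kernel_def by blast

lemma bdd_kernel_const: "bdd_kernel {} (\<lambda>_. c)"
  by (auto simp: bdd_kernel_def depends_on_def)

lemma bdd_kernel_prod:
  assumes "finite L" "\<And>l. l \<in> L \<Longrightarrow> bdd_kernel (P l) (F l)"
  shows "bdd_kernel (\<Union>(P ` L)) (\<lambda>x. \<Prod>l\<in>L. F l x)"
  using assms
proof (induction L rule: finite_induct)
  case empty
  then show ?case using bdd_kernel_const[of 1] by simp
next
  case (insert l L)
  then show ?case using bdd_kernel_mult[of "P l" "F l" "\<Union>(P ` L)"] by simp
qed

lemma expectation_indep: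
  assumes F: "bdd_kernel W F" and G: "bdd_kernel A G" and disj: "W \<inter> A = {}"
  shows "expectation (\<lambda>x. F x * G x) = expectation F * expectation G"
proof -
  define J where "J = I - W"
  have WJ: "W \<inter> J = {}" "W \<union> J = I" "finite W" "finite J" "A \<subseteq> J"
    using F G finI disj finite_subset by (auto simp: J_def bdd_kernel_def)
  interpret W: prob_space "PiM W (\<lambda>_. D)" by (rule prob_space_PiM) (rule D)
  interpret J: prob_space "PiM J (\<lambda>_. D)" by (rule prob_space_PiM) (rule D)
  have FG: "bdd_kernel (W \<union> A) (\<lambda>x. F x * G x)" by (rule bdd_kernel_mult[OF F G])
  have fold: "expectation H = (\<integral>x. (\<integral>y. H (merge W J (x, y)) \<partial>PiM J (\<lambda>_. D)) \<partial>PiM W (\<lambda>_. D))"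
    if "bdd_kernel V H" for V H
    using PD.product_integral_fold[OF WJ(1,3,4), of H] bdd_kernel_integrable[OF that] WJ(2) by simp
  \<comment> \<open>An arbitrary filler for the coordinates on which a factor does not depend; it
    separates the variables in the iterated integral.\<close>
  define x0 where "x0 = (undefined :: nat \<Rightarrow> 'a)"
  have Fm: "F (merge W J (x, y)) = F (merge W J (x, x0))" for x y
  proof -
    have "\<forall>i\<in>W. merge W J (x, y) i = merge W J (x, x0) i" by (simp add: merge_def)
    then show ?thesis using F unfolding bdd_kernel_def depends_on_def by blast
  qed
  have Gm: "G (merge W J (x, y)) = G (merge W J (x0, y))" for x y
  proof -
    have "\<forall>i\<in>A. merge W J (x, y) i = merge W J (x0, y) i" using WJ by (auto simp: merge_def)
    then show ?thesis using G unfolding bdd_kernel_def depends_on_def by blast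
  qed
  have "expectation (\<lambda>x. F x * G x) =
      (\<integral>x. (\<integral>y. F (merge W J (x, x0)) * G (merge W J (x0, y)) \<partial>PiM J (\<lambda>_. D)) \<partial>PiM W (\<lambda>_. D))"
    unfolding fold[OF FG] by (intro Bochner_Integration.integral_cong refl arg_cong2[where f = "(*)"] Fm Gm)
  also have "\<dots> = (\<integral>x. F (merge W J (x, x0)) \<partial>PiM W (\<lambda>_. D)) * (\<integral>y. G (merge W J (x0, y)) \<partial>PiM J (\<lambda>_. D))"
    by simp
  also have "(\<integral>x. F (merge W J (x, x0)) \<partial>PiM W (\<lambda>_. D)) = expectation F"
  proof -
    have "expectation F = (\<integral>x. (\<integral>y. F (merge W J (x, x0)) \<partial>PiM J (\<lambda>_. D)) \<partial>PiM W (\<lambda>_. D))"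
      unfolding fold[OF F] by (intro Bochner_Integration.integral_cong refl Fm)
    then show ?thesis by (simp add: J.prob_space)
  qed
  also have "(\<integral>y. G (merge W J (x0, y)) \<partial>PiM J (\<lambda>_. D)) = expectation G"
  proof -
    have "expectation G = (\<integral>x. (\<integral>y. G (merge W J (x0, y)) \<partial>PiM J (\<lambda>_. D)) \<partial>PiM W (\<lambda>_. D))"
      unfolding fold[OF G] by (intro Bochner_Integration.integral_cong refl Gm)
    then show ?thesis by (simp add: W.prob_space)
  qed
  finally show ?thesis .
qed

text \<open>The coordinates in \<open>B\<close> are integrated out one at a time. \<open>F\<close>
  ignores them, and each is confined to a ball around \<open>x w0\<close> of probability at most
  \<open>k\<close>.\<close>

lemma nn_integral_near_le:
  fixes W :: "nat set"
  assumes k: "\<And>z. emeasure D (cball z R) \<le> ennreal k" "0 \<le> k"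
    and B: "finite B" "B \<subseteq> J" "finite J" "W \<subseteq> J" "B \<inter> W = {}" "w0 \<in> W"
    and F: "F \<in> borel_measurable (PiM J (\<lambda>_. D))" "depends_on W F"
  shows "(\<integral>\<^sup>+x. F x * indicator {x. \<forall>b\<in>B. dist (x w0) (x b) \<le> R} x \<partial>PiM J (\<lambda>_. D)) \<le> ennreal (k ^ card B) * (\<integral>\<^sup>+x. F x \<partial>PiM J (\<lambda>_. D))"
  using B F
proof (induction B arbitrary: J rule: finite_induct)
  case empty
  then show ?case by simp
next
  case (insert b B)
  define K where "K = J - {b}"
  have J: "J = insert b K" "b \<notin> K" "finite K" "B \<subseteq> K" "W \<subseteq> K" "w0 \<in> K" "w0 \<noteq> b" "b \<notin> W"
    using insert.prems insert.hyps by (auto simp: K_def)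
  define x0 where "x0 = (\<lambda>_ :: nat. undefined :: 'a)"
  have ind_meas: "(\<lambda>x. indicator {x. \<forall>b\<in>S. dist (x w0) (x b) \<le> R} x :: ennreal) \<in> borel_measurable (PiM V (\<lambda>_. D))"
    if S: "finite S" "S \<subseteq> V" "w0 \<in> V" for S V
  proof -
    have e: "(\<lambda>x. indicator {x. \<forall>b\<in>S. dist (x w0) (x b) \<le> R} x :: ennreal) = (\<lambda>x. \<Prod>b\<in>S. indicator {x. dist (x w0) (x b) \<le> R} x)"
      using S(1) by (auto simp: fun_eq_iff indicator_def prod.neutral prod_zero_iff)
    have c: "(\<lambda>x. x i) \<in> borel_measurable (PiM V (\<lambda>_. D))" if "i \<in> V" for i
      using measurable_component_singleton[OF that, of "\<lambda>_. D"] by (simp add: measurable_cong_sets[OF refl sets_D])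
    have "(\<lambda>x. indicator {x. dist (x w0) (x b) \<le> R} x :: ennreal) \<in> borel_measurable (PiM V (\<lambda>_. D))" if "b \<in> S" for b
    proof -
      have "{x \<in> space (PiM V (\<lambda>_. D)). dist (x w0) (x b) \<le> R} \<in> sets (PiM V (\<lambda>_. D))"
        using c[of w0] c[of b] S that by (intro borel_measurable_le borel_measurable_dist) auto
      then show ?thesis
        by (subst measurable_cong[where g = "indicator {x \<in> space (PiM V (\<lambda>_. D)). dist (x w0) (x b) \<le> R}"])
          (auto simp: indicator_def)
    qed
    then show ?thesis unfolding e by (intro borel_measurable_prod_ennreal)
  qed
  have Fb: "F (x(b := y)) = F x" for x y
  proof -
    have "\<forall>i\<in>W. (x(b := y)) i = x i" using J(8) by auto
    then show ?thesis using insert.prems(7) unfolding depends_on_def by blast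
  qed
  have FJ: "F \<in> borel_measurable (PiM K (\<lambda>_. D))"
  proof -
    have "(\<lambda>x. F (x(b := x0 b))) \<in> borel_measurable (PiM K (\<lambda>_. D))"
    proof (rule measurable_compose[OF _ insert.prems(6)])
      show "(\<lambda>x. x(b := x0 b)) \<in> PiM K (\<lambda>_. D) \<rightarrow>\<^sub>M PiM J (\<lambda>_. D)"
        unfolding J(1) using sets_eq_imp_space_eq[OF sets_D]
        by (intro measurable_fun_upd[where J = K]) auto
    qed
    then show ?thesis by (simp add: Fb)
  qed
  let ?i = "\<lambda>B. indicator {x. \<forall>b\<in>B. dist (x w0) (x b) \<le> R} :: (nat \<Rightarrow> 'a) \<Rightarrow> ennreal"
  have upd: "?i (insert b B) (x(b := y)) = ?i B x * indicator (cball (x w0) R) y" for x y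
    using J(7) insert.hyps by (auto simp: indicator_def)
  have "(\<integral>\<^sup>+x. F x * ?i (insert b B) x \<partial>PiM J (\<lambda>_. D)) =
      (\<integral>\<^sup>+x. (\<integral>\<^sup>+y. F x * (?i B x * indicator (cball (x w0) R) y) \<partial>D) \<partial>PiM K (\<lambda>_. D))"
  proof -
    have "?i (insert b B) \<in> borel_measurable (PiM J (\<lambda>_. D))"
      by (rule ind_meas) (use insert.prems insert.hyps J in auto)
    then have "(\<lambda>x. F x * ?i (insert b B) x) \<in> borel_measurable (PiM (insert b K) (\<lambda>_. D))"
      using insert.prems(6) unfolding J(1) by (intro borel_measurable_times_ennreal)
    from PD.product_nn_integral_insert[OF J(3,2) this] show ?thesis
      unfolding J(1) Fb upd .
  qed
  also have "\<dots> = (\<integral>\<^sup>+x. (F x * ?i B x) * emeasure D (cball (x w0) R) \<partial>PiM K (\<lambda>_. D))"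
    by (intro nn_integral_cong) (simp only: mult.assoc[symmetric], subst nn_integral_cmult, rule borel_measurable_indicator, simp_all add: sets_D)
  also have "\<dots> \<le> (\<integral>\<^sup>+x. (F x * ?i B x) * ennreal k \<partial>PiM K (\<lambda>_. D))"
    by (intro nn_integral_mono mult_left_mono k) auto
  also have "\<dots> = (\<integral>\<^sup>+x. F x * ?i B x \<partial>PiM K (\<lambda>_. D)) * ennreal k"
    by (rule nn_integral_multc) (use FJ ind_meas[of B K] J insert.hyps in auto)
  also have "\<dots> \<le> (ennreal (k ^ card B) * (\<integral>\<^sup>+x. F x \<partial>PiM K (\<lambda>_. D))) * ennreal k"
    by (intro mult_right_mono insert.IH) (use J insert.prems FJ in auto)
  also have "(\<integral>\<^sup>+x. F x \<partial>PiM K (\<lambda>_. D)) = (\<integral>\<^sup>+x. F x \<partial>PiM J (\<lambda>_. D))"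
    unfolding J(1) by (subst PD.product_nn_integral_insert[OF J(3,2)])
      (use insert.prems(6) J in \<open>simp_all add: Fb D.emeasure_space_1\<close>)
  finally show ?case
    using insert.hyps k(2) by (simp add: ennreal_mult mult_ac)
qed

end

text \<open>\<open>k\<close> bounds the probability of a ball of radius \<open>R\<close>, and
  \<open>card I * k\<close> the expected number of points in it. The sparse regime keeps the latter
  below the constant \<open>K\<close> while \<open>I\<close> grows, so constants may depend on
  \<open>K\<close> but not on \<open>card I\<close>.\<close>

locale local_kernel = iid_product D I for D :: "'a::euclidean_space measure" and I +
  fixes g :: "(nat \<Rightarrow> 'a) \<Rightarrow> nat set \<Rightarrow> real" and q :: nat and R k K m :: real
  assumes q: "q \<ge> 1"
    and g_range: "\<And>x A. 0 \<le> g x A \<and> g x A \<le> 1"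
    and g_meas: "\<And>A. A \<in> subsets_of_card q I \<Longrightarrow> (\<lambda>x. g x A) \<in> borel_measurable \<P>"
    and g_dep: "\<And>A. depends_on A (\<lambda>x. g x A)"
    and g_local: "\<And>x A. A \<in> subsets_of_card q I \<Longrightarrow> g x A \<noteq> 0 \<Longrightarrow> diameter_le x R A"
    and g_mean: "\<And>A. A \<in> subsets_of_card q I \<Longrightarrow> expectation (\<lambda>x. g x A) = m"
    and k: "\<And>z. emeasure D (cball z R) \<le> ennreal k" "0 \<le> k"
    and K: "real (card I) * k \<le> K" "K \<ge> 1"
begin

abbreviation "\<Y> \<equiv> subsets_of_card q I"

lemma fin\<Y>: "finite \<Y>" by (rule finite_subsets_of_card[OF finI])

lemma \<Y>D: "A \<in> \<Y> \<Longrightarrow> A \<subseteq> I \<and> card A = q \<and> finite A \<and> A \<noteq> {}"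
  using finI finite_subset q by (auto simp: subsets_of_card_def)

lemma g_bdd: "A \<in> \<Y> \<Longrightarrow> bdd_kernel A (\<lambda>x. g x A)"
  unfolding bdd_kernel_def using g_range g_meas g_dep \<Y>D by (auto intro!: exI[of _ 1])

text \<open>Where \<open>g x A\<close> does not vanish, all points of \<open>A\<close> lie within
  \<open>R\<close> of the common point \<open>w0\<close>; those outside \<open>W\<close> do not
  enter \<open>F\<close> and cost a factor \<open>k\<close> each.\<close>

lemma near_le:
  assumes F: "bdd_kernel W F" "\<And>x. 0 \<le> F x" and A: "A \<in> \<Y>" "w0 \<in> A" "w0 \<in> W"
  shows "expectation (\<lambda>x. F x * g x A) \<le> k ^ card (A - W) * expectation F"
proof -
  let ?B = "A - W"
  have W: "W \<subseteq> I" "F \<in> borel_measurable \<P>" "depends_on W F" using F by (auto simp: bdd_kernel_def)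
  have intFg: "integrable \<P> (\<lambda>x. F x * g x A)"
    by (rule bdd_kernel_integrable[OF bdd_kernel_mult[OF F(1) g_bdd[OF A(1)]]])
  have "ennreal (expectation (\<lambda>x. F x * g x A)) = (\<integral>\<^sup>+x. ennreal (F x * g x A) \<partial>\<P>)"
    by (rule nn_integral_eq_integral[OF intFg, symmetric]) (use F g_range in auto)
  also have "\<dots> \<le> (\<integral>\<^sup>+x. ennreal (F x) * indicator {x. \<forall>b\<in>?B. dist (x w0) (x b) \<le> R} x \<partial>\<P>)"
  proof (rule nn_integral_mono)
    fix x
    show "ennreal (F x * g x A) \<le> ennreal (F x) * indicator {x. \<forall>b\<in>?B. dist (x w0) (x b) \<le> R} x"
    proof (cases "g x A = 0")
      case False
      then have "diameter_le x R A" using g_local A by blast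
      then have "\<forall>b\<in>?B. dist (x w0) (x b) \<le> R" using A by (auto simp: diameter_le_def)
      moreover have "F x * g x A \<le> F x * 1" using F(2) g_range by (intro mult_left_mono) auto
      ultimately show ?thesis by (auto intro: ennreal_leI)
    qed simp
  qed
  also have "\<dots> \<le> ennreal (k ^ card ?B) * (\<integral>\<^sup>+x. ennreal (F x) \<partial>\<P>)"
  proof (rule nn_integral_near_le[OF k])
    show "depends_on W (\<lambda>x. ennreal (F x))" using W(3) unfolding depends_on_def by metis
  qed (use A W \<Y>D[OF A(1)] finI in auto)
  also have "(\<integral>\<^sup>+x. ennreal (F x) \<partial>\<P>) = ennreal (expectation F)"
    by (rule nn_integral_eq_integral[OF bdd_kernel_integrable[OF F(1)]]) (use F in auto)
  also have "ennreal (k ^ card ?B) * ennreal (expectation F) = ennreal (k ^ card ?B * expectation F)"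
    using k(2) F(2) by (intro ennreal_mult[symmetric]) (auto intro!: Bochner_Integration.integral_nonneg)
  finally show ?thesis
    using k(2) F(2) by (subst (asm) ennreal_le_iff) (auto intro!: mult_nonneg_nonneg Bochner_Integration.integral_nonneg)
qed

lemma mean_nonneg: "0 \<le> m" if "\<Y> \<noteq> {}"
  using that g_mean g_range by (metis Bochner_Integration.integral_nonneg ex_in_conv)

lemma mean_le: "m \<le> k ^ (q - 1)" if "\<Y> \<noteq> {}"
proof -
  obtain A where A: "A \<in> \<Y>" using \<open>\<Y> \<noteq> {}\<close> by blast
  then obtain w where w: "w \<in> A" using \<Y>D by blast
  have "bdd_kernel {w} (\<lambda>_. 1)" using bdd_kernel_mono[OF bdd_kernel_const] w \<Y>D[OF A] by blast
  from near_le[OF this _ A w] have "expectation (\<lambda>x. 1 * g x A) \<le> k ^ card (A - {w}) * expectation (\<lambda>_. 1)"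
    by simp
  then show ?thesis using g_mean[OF A] \<Y>D[OF A] w by (simp add: prob_space)
qed

lemma card_subsets_le: "real (card (subsets_of_card j I)) \<le> real (card I) ^ j"
proof -
  have "card (subsets_of_card j I) = card I choose j"
    unfolding subsets_of_card_def by (rule n_subsets[OF finI])
  also have "\<dots> \<le> card I ^ j"
    by (cases "j \<le> card I") (auto simp: binomial_le_pow binomial_eq_0)
  finally show ?thesis by (simp flip: of_nat_power)
qed

lemma card_mean_le: "real (card \<Y>) * m \<le> real (card I) ^ q * k ^ (q - 1)"
proof (cases "\<Y> = {}")
  case False
  then show ?thesis
    using card_subsets_le[of q] mean_le mean_nonneg by (intro mult_mono) auto
qed (use k in simp)

text \<open>In the first summand \<open>2 ^ N\<close> counts the possible traces of \<open>A\<close>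
  on \<open>W\<close>, \<open>q\<close> the possible sizes of the remainder, and
  \<open>K ^ q\<close> bounds the choices of the remainder times the probability that it is close.
  The second summand treats the mean \<open>m\<close>: one of \<open>N\<close> points, then
  \<open>q - 1\<close> further ones.\<close>

definition attach_const :: "nat \<Rightarrow> real" where
  "attach_const N = 2 ^ N * real q * K ^ q + real N * K ^ q"

lemma attach_const_nonneg: "0 \<le> attach_const N"
  using K by (auto simp: attach_const_def)

text \<open>A set that meets \<open>W\<close> is anchored there: each of its remaining points has
  \<open>card I\<close> choices but only probability \<open>k\<close> of being close, so all such
  sets together cost a constant factor.\<close>

lemma near_sum_le:
  assumes F: "bdd_kernel W F" "\<And>x. 0 \<le> F x" and W: "card W \<le> N"
  shows "(\<Sum>A\<in>{A\<in>\<Y>. A \<inter> W \<noteq> {}}. expectation (\<lambda>x. F x * (g x A + m))) \<le> attach_const N * expectation F"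
proof -
  let ?Z = "{A\<in>\<Y>. A \<inter> W \<noteq> {}}"
  have WI: "W \<subseteq> I" "finite W" using F finI finite_subset by (auto simp: bdd_kernel_def)
  have EF: "0 \<le> expectation F" using F by (intro Bochner_Integration.integral_nonneg) auto
  have fZ: "finite ?Z" using fin\<Y> by simp
  have cK: "real (card (subsets_of_card j I)) * k ^ j \<le> K ^ q" if "j \<le> q" for j
  proof -
    have "real (card (subsets_of_card j I)) * k ^ j \<le> real (card I) ^ j * k ^ j"
      using card_subsets_le k by (intro mult_right_mono) auto
    also have "\<dots> = (real (card I) * k) ^ j" by (simp add: power_mult_distrib)
    also have "\<dots> \<le> K ^ j" using K k by (intro power_mono) auto
    also have "\<dots> \<le> K ^ q" using K that by (intro power_increasing) auto
    finally show ?thesis .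
  qed
  have step: "expectation (\<lambda>x. F x * (g x A + m)) \<le> (k ^ card (A - W) + m) * expectation F" if "A \<in> ?Z" for A
  proof -
    obtain w0 where w0: "w0 \<in> A" "w0 \<in> W" using \<open>A \<in> ?Z\<close> by blast
    have A: "A \<in> \<Y>" using that by simp
    have "expectation (\<lambda>x. F x * (g x A + m)) = expectation (\<lambda>x. F x * g x A) + expectation (\<lambda>x. F x * m)"
      unfolding distrib_left
      by (rule Bochner_Integration.integral_add)
        (use bdd_kernel_integrable[OF bdd_kernel_mult[OF F(1) g_bdd[OF A]]] bdd_kernel_integrable[OF F(1)] in auto)
    also have "\<dots> \<le> k ^ card (A - W) * expectation F + m * expectation F"
      using near_le[OF F A w0] by simp
    finally show ?thesis by (simp add: algebra_simps)
  qed
  have "(\<Sum>A\<in>?Z. k ^ card (A - W)) \<le> 2 ^ N * real q * K ^ q"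
  proof -
    \<comment> \<open>The sum is taken over the two pieces of \<open>A\<close>, inside and outside
      \<open>W\<close>; the outer piece has fewer than \<open>q\<close> elements because
      \<open>A\<close> meets \<open>W\<close>.\<close>
    have "(\<Sum>A\<in>?Z. k ^ card (A - W)) \<le> (\<Sum>(U, B)\<in>Pow W \<times> (\<Union>j<q. subsets_of_card j I). k ^ card B)"
    proof (rule sum_le_included[where i = "\<lambda>(U, B). U \<union> B"])
      show "finite (Pow W \<times> (\<Union>j<q. subsets_of_card j I))"
        using WI finite_subsets_of_card[OF finI] by auto
      show "\<forall>A\<in>?Z. \<exists>y\<in>Pow W \<times> (\<Union>j<q. subsets_of_card j I).
          (case y of (U, B) \<Rightarrow> U \<union> B) = A \<and> k ^ card (A - W) \<le> (case y of (U, B) \<Rightarrow> k ^ card B)"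
      proof
        fix A assume A: "A \<in> ?Z"
        then have "finite A" "A \<subseteq> I" "card A = q" using \<Y>D by auto
        moreover have "A - W \<subset> A" using A by blast
        ultimately have "card (A - W) < q" using psubset_card_mono by metis
        then have "A - W \<in> (\<Union>j<q. subsets_of_card j I)" using \<open>A \<subseteq> I\<close> by (auto simp: subsets_of_card_def)
        then show "\<exists>y\<in>Pow W \<times> (\<Union>j<q. subsets_of_card j I).
            (case y of (U, B) \<Rightarrow> U \<union> B) = A \<and> k ^ card (A - W) \<le> (case y of (U, B) \<Rightarrow> k ^ card B)"
          by (intro bexI[of _ "(A \<inter> W, A - W)"]) auto
      qed
    qed (use fZ k in auto)
    also have "\<dots> = 2 ^ card W * (\<Sum>B\<in>(\<Union>j<q. subsets_of_card j I). k ^ card B)"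
      using WI by (simp add: sum.cartesian_product[symmetric] card_Pow)
    also have "(\<Sum>B\<in>(\<Union>j<q. subsets_of_card j I). k ^ card B) = (\<Sum>j<q. \<Sum>B\<in>subsets_of_card j I. k ^ card B)"
      by (rule sum.UNION_disjoint) (use finite_subsets_of_card[OF finI] in \<open>auto simp: subsets_of_card_def\<close>)
    also have "\<dots> = (\<Sum>j<q. real (card (subsets_of_card j I)) * k ^ j)"
      by (intro sum.cong refl) (simp add: subsets_of_card_def)
    also have "2 ^ card W * \<dots> \<le> 2 ^ N * (\<Sum>j<q. K ^ q)"
      using W k by (intro mult_mono sum_mono cK sum_nonneg power_increasing) auto
    finally show ?thesis by simp
  qed
  moreover have "real (card ?Z) * m \<le> real N * K ^ q"
  proof (cases "\<Y> = {}")
    case False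
    \<comment> \<open>Fixing one element of \<open>A\<close> in \<open>W\<close> saves a factor
      \<open>card I\<close>, just enough for \<open>m \<le> k ^ (q - 1)\<close> to turn the count
      into a power of \<open>card I * k\<close>.\<close>
    have "?Z \<subseteq> (\<Union>w\<in>W. insert w ` subsets_of_card (q - 1) I)"
    proof
      fix A assume A: "A \<in> ?Z"
      then obtain w where w: "w \<in> A" "w \<in> W" by blast
      then have "A - {w} \<in> subsets_of_card (q - 1) I"
      proof -
        have "A \<subseteq> I" "card A = q" using A \<Y>D[of A] by auto
        then show ?thesis using w(1) by (auto simp: subsets_of_card_def card_Diff_singleton)
      qed
      then have "insert w (A - {w}) \<in> insert w ` subsets_of_card (q - 1) I" by blast
      moreover have "insert w (A - {w}) = A" using w by blast
      ultimately show "A \<in> (\<Union>w\<in>W. insert w ` subsets_of_card (q - 1) I)" using w by auto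
    qed
    then have "card ?Z \<le> card (\<Union>w\<in>W. insert w ` subsets_of_card (q - 1) I)"
      using WI finite_subsets_of_card[OF finI] by (intro card_mono) auto
    also have "\<dots> \<le> (\<Sum>w\<in>W. card (insert w ` subsets_of_card (q - 1) I))"
      by (rule card_UN_le[OF WI(2)])
    also have "\<dots> \<le> (\<Sum>w\<in>W. card (subsets_of_card (q - 1) I))"
      by (intro sum_mono card_image_le finite_subsets_of_card finI)
    finally have "real (card ?Z) \<le> real (card W * card (subsets_of_card (q - 1) I))"
      by (simp only: of_nat_le_iff sum_constant of_nat_id)
    then have "real (card ?Z) * m \<le> real (card W) * real (card (subsets_of_card (q - 1) I)) * k ^ (q - 1)"
      using mean_le[OF False] mean_nonneg[OF False] k by (intro mult_mono) auto
    also have "\<dots> \<le> real N * K ^ q"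
      unfolding mult.assoc using W k by (intro mult_mono cK) auto
    finally show ?thesis .
  qed (use K in simp)
  ultimately have "(\<Sum>A\<in>?Z. k ^ card (A - W) + m) \<le> attach_const N"
    by (simp add: sum.distrib attach_const_def)
  moreover have "(\<Sum>A\<in>?Z. expectation (\<lambda>x. F x * (g x A + m))) \<le> (\<Sum>A\<in>?Z. (k ^ card (A - W) + m) * expectation F)"
    by (rule sum_mono) (rule step)
  ultimately show ?thesis
    using EF mult_right_mono unfolding sum_distrib_right[symmetric] by (meson order_trans)
qed

text \<open>The mean of the whole sum is at most \<open>card I ^ q * k ^ (q - 1)\<close>. A set
  without constraint is either attached, at cost \<open>attach_const N\<close>, or disjoint from the
  earlier ones and then independent with mean \<open>2 * m\<close>; the product form bounds the sum
  of both costs.\<close>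

definition free_const :: "nat \<Rightarrow> real" where
  "free_const N = (attach_const N + 2) * (1 + real (card I) ^ q * k ^ (q - 1))"

lemma free_sum_le:
  assumes F: "bdd_kernel W F" "\<And>x. 0 \<le> F x" and W: "card W \<le> N"
  shows "(\<Sum>A\<in>\<Y>. expectation (\<lambda>x. F x * (g x A + m))) \<le> free_const N * expectation F"
proof -
  have EF: "0 \<le> expectation F" using F by (intro Bochner_Integration.integral_nonneg) auto
  have far: "expectation (\<lambda>x. F x * (g x A + m)) = 2 * m * expectation F" if "A \<in> \<Y>" "A \<inter> W = {}" for A
  proof -
    have "expectation (\<lambda>x. F x * (g x A + m)) = expectation F * expectation (\<lambda>x. g x A + m)"
      by (rule expectation_indep[OF F(1) bdd_kernel_add_const[OF g_bdd[OF that(1)]]]) (use that in blast)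
    also have "expectation (\<lambda>x. g x A + m) = 2 * m"
      using g_mean[OF that(1)] bdd_kernel_integrable[OF g_bdd[OF that(1)]] by (simp add: prob_space)
    finally show ?thesis by simp
  qed
  have "(\<Sum>A\<in>\<Y>. expectation (\<lambda>x. F x * (g x A + m))) =
      (\<Sum>A\<in>{A\<in>\<Y>. A \<inter> W \<noteq> {}}. expectation (\<lambda>x. F x * (g x A + m))) +
      (\<Sum>A\<in>{A\<in>\<Y>. A \<inter> W = {}}. expectation (\<lambda>x. F x * (g x A + m)))"
    using fin\<Y> by (subst sum.union_disjoint[symmetric]) (auto intro: sum.cong)
  also have "(\<Sum>A\<in>{A\<in>\<Y>. A \<inter> W = {}}. expectation (\<lambda>x. F x * (g x A + m))) =
      real (card {A\<in>\<Y>. A \<inter> W = {}}) * m * (2 * expectation F)"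
    using far by simp
  also have "\<dots> \<le> real (card I) ^ q * k ^ (q - 1) * (2 * expectation F)"
  proof (cases "\<Y> = {}")
    case False
    have "card {A\<in>\<Y>. A \<inter> W = {}} \<le> card \<Y>" using fin\<Y> by (intro card_mono) auto
    then have "real (card {A\<in>\<Y>. A \<inter> W = {}}) * m \<le> real (card \<Y>) * m"
      using mean_nonneg[OF False] by (intro mult_right_mono) auto
    then show ?thesis using card_mean_le EF by (intro mult_right_mono) auto
  qed (use k EF in auto)
  also have "(\<Sum>A\<in>{A\<in>\<Y>. A \<inter> W \<noteq> {}}. expectation (\<lambda>x. F x * (g x A + m))) \<le> attach_const N * expectation F"
    by (rule near_sum_le[OF F W])
  also have "attach_const N * expectation F + real (card I) ^ q * k ^ (q - 1) * (2 * expectation F) =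
      (attach_const N + 2 * (real (card I) ^ q * k ^ (q - 1))) * expectation F"
    by (simp add: algebra_simps)
  also have "\<dots> \<le> free_const N * expectation F"
  proof (rule mult_right_mono[OF _ EF])
    have "0 \<le> attach_const N * (real (card I) ^ q * k ^ (q - 1))"
      using attach_const_nonneg k by (intro mult_nonneg_nonneg) auto
    then show "attach_const N + 2 * (real (card I) ^ q * k ^ (q - 1)) \<le> free_const N"
      unfolding free_const_def by (simp add: algebra_simps)
  qed
  finally show ?thesis by simp
qed

section \<open>Families of index sets\<close>

abbreviation fam :: "nat set \<Rightarrow> (nat \<Rightarrow> nat set) set" where
  "fam L \<equiv> PiE L (\<lambda>_. \<Y>)"

text \<open>The factors are nonnegative and majorize the absolute deviations of \<open>g\<close>
  from \<open>m\<close>; unlike these they can be summed over more families than needed.\<close>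

abbreviation weight :: "nat set \<Rightarrow> (nat \<Rightarrow> nat set) \<Rightarrow> (nat \<Rightarrow> 'a) \<Rightarrow> real" where
  "weight L P x \<equiv> (\<Prod>l\<in>L. g x (P l) + m)"

lemma weight_bdd:
  assumes "finite L" "P \<in> fam L"
  shows "bdd_kernel (\<Union>(P ` L)) (weight L P)" "0 \<le> weight L P x" "card (\<Union>(P ` L)) \<le> q * card L"
proof -
  have mem: "P l \<in> \<Y>" if "l \<in> L" for l using assms(2) that by (auto simp: PiE_def Pi_def)
  show "bdd_kernel (\<Union>(P ` L)) (weight L P)"
    by (rule bdd_kernel_prod[OF assms(1)]) (use mem g_bdd bdd_kernel_add_const in blast)
  show "0 \<le> weight L P x"
    by (rule prod_nonneg) (use mem g_range mean_nonneg in \<open>fastforce intro: add_nonneg_nonneg\<close>)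
  have "card (\<Union>(P ` L)) \<le> (\<Sum>l\<in>L. card (P l))" by (rule card_UN_le[OF assms(1)])
  also have "\<dots> = q * card L" using mem \<Y>D by simp
  finally show "card (\<Union>(P ` L)) \<le> q * card L" .
qed

lemma weight_insert:
  assumes "finite L" "l \<notin> L"
  shows "weight (insert l L) (P(l := A)) x = weight L P x * (g x A + m)"
proof -
  have "(\<Prod>j\<in>L. g x ((P(l := A)) j) + m) = weight L P x"
    by (rule prod.cong) (use assms in auto)
  then show ?thesis using assms by (simp add: mult.commute)
qed

lemma sum_weight_le:
  assumes "finite L" "q * card L \<le> N"
  shows "(\<Sum>P\<in>fam L. expectation (weight L P)) \<le> free_const N ^ card L"
  using assms
proof (induction L rule: finite_induct)
  case empty
  then show ?case by (simp add: prob_space)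
next
  case (insert l L)
  have N: "q * card L \<le> N" using insert by simp
  have fc: "0 \<le> free_const N"
    unfolding free_const_def using attach_const_nonneg[of N] k by (intro mult_nonneg_nonneg add_nonneg_nonneg) auto
  have "(\<Sum>P\<in>fam (insert l L). expectation (weight (insert l L) P)) =
      (\<Sum>P\<in>fam L. \<Sum>A\<in>\<Y>. expectation (\<lambda>x. weight L P x * (g x A + m)))"
    unfolding sum_PiE_insert[OF insert.hyps(2)] weight_insert[OF insert.hyps] ..
  also have "\<dots> \<le> (\<Sum>P\<in>fam L. free_const N * expectation (weight L P))"
  proof (rule sum_mono)
    fix P assume P: "P \<in> fam L"
    note wb = weight_bdd[OF insert.hyps(1) P]
    show "(\<Sum>A\<in>\<Y>. expectation (\<lambda>x. weight L P x * (g x A + m))) \<le> free_const N * expectation (weight L P)"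
      by (rule free_sum_le[OF wb(1,2) order_trans[OF wb(3) N]])
  qed
  also have "\<dots> = free_const N * (\<Sum>P\<in>fam L. expectation (weight L P))"
    by (simp add: sum_distrib_left)
  also have "\<dots> \<le> free_const N * free_const N ^ card L"
    using insert.IH[OF N] fc by (rule mult_left_mono)
  finally show ?case using insert.hyps by simp
qed

text \<open>Members with index in \<open>L\<close> are chosen freely, the others have to meet one of
  these. Adding the members one by one therefore costs \<open>free_const\<close> only
  \<open>card L\<close> times and a constant otherwise.\<close>

lemma sum_dominated_weight_le:
  assumes L: "finite L" and L': "finite L'" "L \<inter> L' = {}" "q * (card L + card L') \<le> N"
  shows "(\<Sum>P\<in>{P\<in>fam (L \<union> L'). \<forall>l\<in>L'. P l \<inter> \<Union>(P ` L) \<noteq> {}}. expectation (weight (L \<union> L') P))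
    \<le> free_const N ^ card L * attach_const N ^ card L'"
  using L'
proof (induction L' rule: finite_induct)
  case empty
  then show ?case using sum_weight_le[OF L] by simp
next
  case (insert l L')
  let ?D = "\<lambda>P. \<forall>l\<in>L'. P l \<inter> \<Union>(P ` L) \<noteq> {}"
  let ?M = "L \<union> L'"
  have M: "finite ?M" "l \<notin> ?M" "L \<union> insert l L' = insert l ?M" "card ?M \<le> card L + card L'"
    using insert.hyps insert.prems L card_Un_le[of L L'] by auto
  have N: "q * (card L + card L') \<le> N" "L \<inter> L' = {}" using insert by auto
  have fc: "0 \<le> free_const N"
    unfolding free_const_def using attach_const_nonneg[of N] k by (intro mult_nonneg_nonneg add_nonneg_nonneg) auto
  have img: "(P(l := A)) ` L = P ` L" for P and A :: "nat set" using M(2) by auto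
  have Dupd: "?D (P(l := A)) \<longleftrightarrow> ?D P" for P :: "nat \<Rightarrow> nat set" and A
  proof -
    have upd: "(P(l := A)) j = P j" if "j \<in> L'" for j using that insert.hyps(2) by auto
    show ?thesis
    proof (intro ball_cong refl)
      fix j assume "j \<in> L'"
      then show "((P(l := A)) j \<inter> \<Union>((P(l := A)) ` L) \<noteq> {}) = (P j \<inter> \<Union>(P ` L) \<noteq> {})"
        using upd[of j] img[of P A] by simp
    qed
  qed
  have finfam: "finite (fam S)" if "finite S" for S using that fin\<Y> by (intro finite_PiE) auto
  have "(\<Sum>P\<in>{P\<in>fam (insert l ?M). \<forall>j\<in>insert l L'. P j \<inter> \<Union>(P ` L) \<noteq> {}}. expectation (weight (insert l ?M) P)) =
      (\<Sum>P\<in>fam (insert l ?M). if \<forall>j\<in>insert l L'. P j \<inter> \<Union>(P ` L) \<noteq> {} then expectation (weight (insert l ?M) P) else 0)"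
    by (rule sum.inter_filter[OF finfam]) (simp only: finite_insert M(1))
  also have "\<dots> = (\<Sum>P\<in>fam ?M. \<Sum>A\<in>\<Y>. if ?D P \<and> A \<inter> \<Union>(P ` L) \<noteq> {} then expectation (\<lambda>x. weight ?M P x * (g x A + m)) else 0)"
  proof -
    have e: "(\<forall>j\<in>insert l L'. (P(l := A)) j \<inter> \<Union>((P(l := A)) ` L) \<noteq> {}) \<longleftrightarrow> ?D P \<and> A \<inter> \<Union>(P ` L) \<noteq> {}" for P :: "nat \<Rightarrow> nat set" and A
      using Dupd[of P A] unfolding img by (auto simp del: fun_upd_apply simp: fun_upd_same)
    show ?thesis unfolding sum_PiE_insert[OF M(2)] weight_insert[OF M(1,2)] e ..
  qed
  also have "\<dots> \<le> (\<Sum>P\<in>fam ?M. if ?D P then attach_const N * expectation (weight ?M P) else 0)"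
  proof (rule sum_mono)
    fix P assume P: "P \<in> fam ?M"
    note wb = weight_bdd[OF M(1) P]
    have nn: "0 \<le> expectation (\<lambda>x. weight ?M P x * (g x A + m))" if "A \<in> \<Y>" for A
      using wb(2) g_range mean_nonneg that
      by (intro Bochner_Integration.integral_nonneg mult_nonneg_nonneg add_nonneg_nonneg) auto
    show "(\<Sum>A\<in>\<Y>. if ?D P \<and> A \<inter> \<Union>(P ` L) \<noteq> {} then expectation (\<lambda>x. weight ?M P x * (g x A + m)) else 0)
        \<le> (if ?D P then attach_const N * expectation (weight ?M P) else 0)"
    proof (cases "?D P")
      case True
      have "(\<Sum>A\<in>\<Y>. if ?D P \<and> A \<inter> \<Union>(P ` L) \<noteq> {} then expectation (\<lambda>x. weight ?M P x * (g x A + m)) else 0) \<le>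
          (\<Sum>A\<in>\<Y>. if A \<inter> \<Union>(P ` ?M) \<noteq> {} then expectation (\<lambda>x. weight ?M P x * (g x A + m)) else 0)"
        by (rule sum_mono) (use nn in auto)
      also have "\<dots> = (\<Sum>A\<in>{A\<in>\<Y>. A \<inter> \<Union>(P ` ?M) \<noteq> {}}. expectation (\<lambda>x. weight ?M P x * (g x A + m)))"
        by (rule sum.inter_filter[OF fin\<Y>, symmetric])
      also have "\<dots> \<le> attach_const N * expectation (weight ?M P)"
      proof (rule near_sum_le[OF wb(1,2)])
        have "q * card ?M \<le> q * (card L + card L')" using M(4) by (rule mult_le_mono2)
        then show "card (\<Union>(P ` ?M)) \<le> N" using wb(3) N(1) by linarith
      qed
      finally show ?thesis using True by simp
    next
      case False
      then show ?thesis by (simp only: False simp_thms if_False sum.neutral_const order_refl)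
    qed
  qed
  also have "\<dots> = attach_const N * (\<Sum>P\<in>{P\<in>fam ?M. ?D P}. expectation (weight ?M P))"
    unfolding sum_distrib_left by (rule sum.inter_filter[OF finfam[OF M(1)], symmetric])
  also have "\<dots> \<le> attach_const N * (free_const N ^ card L * attach_const N ^ card L')"
    by (rule mult_left_mono[OF insert.IH attach_const_nonneg]) (use N in auto)
  finally show ?case using insert.hyps unfolding M(3) by (simp add: algebra_simps)
qed

text \<open>Only families of sets in which every member meets another one contribute to the expansion of
  the central moment; half of the members then dominate the family, and each of the others costs
  only a constant factor.\<close>

theorem central_moment_le:
  fixes p :: nat
  defines "N \<equiv> q * (2 * p)"
  shows "expectation (\<lambda>x. ((\<Sum>A\<in>\<Y>. g x A) - real (card \<Y>) * m) ^ (2 * p))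
    \<le> 4 ^ p * (attach_const N + 2) ^ (2 * p) * (1 + real (card I) ^ q * k ^ (q - 1)) ^ p"
proof -
  let ?V = "{..<2 * p}"
  let ?c = "attach_const N + 2"
  let ?a = "1 + real (card I) ^ q * k ^ (q - 1)"
  let ?dev = "\<lambda>P x. \<Prod>l\<in>?V. (g x (P l) - m)"
  define dom where "dom L = {P\<in>fam ?V. \<forall>l\<in>?V - L. P l \<inter> \<Union>(P ` L) \<noteq> {}}" for L
  define \<L> where "\<L> = {L. L \<subseteq> ?V \<and> card L \<le> p}"
  have finfam: "finite (fam ?V)" using fin\<Y> by (intro finite_PiE) auto
  have mem: "P l \<in> \<Y>" if "P \<in> fam ?V" "l \<in> ?V" for P l using that by (auto simp: PiE_def Pi_def)
  have devb: "bdd_kernel (\<Union>(P ` S)) (\<lambda>x. \<Prod>l\<in>S. (g x (P l) - m))" if "P \<in> fam ?V" "S \<subseteq> ?V" for P S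
  proof (rule bdd_kernel_prod)
    show "bdd_kernel (P l) (\<lambda>x. g x (P l) - m)" if "l \<in> S" for l
      using bdd_kernel_add_const[OF g_bdd, of "P l" "-m"] mem[OF \<open>P \<in> fam ?V\<close>, of l] that \<open>S \<subseteq> ?V\<close> by auto
  qed (rule finite_subset[OF that(2)], simp)
  have ne: "\<Y> \<noteq> {}" if "P \<in> fam ?V" "p > 0" for P using mem[OF that(1), of 0] that(2) by auto
  have small: "expectation (?dev P) \<le> (\<Sum>L\<in>\<L>. if P \<in> dom L then expectation (weight ?V P) else 0)"
    if P: "P \<in> fam ?V" for P
  proof -
    have Ew: "0 \<le> expectation (weight ?V P)"
      using weight_bdd(2)[OF _ P] by (intro Bochner_Integration.integral_nonneg) auto
    have fL: "finite \<L>" by (rule finite_subset[of _ "Pow ?V"]) (auto simp: \<L>_def)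
    show ?thesis
    proof (cases "\<forall>l\<in>?V. \<exists>l'\<in>?V. l' \<noteq> l \<and> P l \<inter> P l' \<noteq> {}")
      case False
      then obtain l where l: "l \<in> ?V" "\<And>l'. l' \<in> ?V \<Longrightarrow> l' \<noteq> l \<Longrightarrow> P l \<inter> P l' = {}" by blast
      let ?S = "?V - {l}"
      \<comment> \<open>A member that meets no other depends on separate coordinates and its factor
        is centred, so the whole term vanishes.\<close>
      have "expectation (?dev P) = expectation (\<lambda>x. (\<Prod>j\<in>?S. (g x (P j) - m)) * (g x (P l) - m))"
        by (intro Bochner_Integration.integral_cong refl)
          (subst prod.remove[OF finite_lessThan l(1)], rule mult.commute)
      also have "\<dots> = expectation (\<lambda>x. \<Prod>j\<in>?S. (g x (P j) - m)) * expectation (\<lambda>x. g x (P l) - m)"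
      proof (rule expectation_indep)
        show "bdd_kernel (\<Union>(P ` ?S)) (\<lambda>x. \<Prod>j\<in>?S. (g x (P j) - m))" by (rule devb[OF P]) auto
        show "bdd_kernel (P l) (\<lambda>x. g x (P l) - m)"
          using bdd_kernel_add_const[OF g_bdd[OF mem[OF P l(1)]], of "-m"] by simp
        show "\<Union>(P ` ?S) \<inter> P l = {}" using l(2) by blast
      qed
      also have "expectation (\<lambda>x. g x (P l) - m) = 0"
        using g_mean[OF mem[OF P l(1)]] bdd_kernel_integrable[OF g_bdd[OF mem[OF P l(1)]]] by (simp add: prob_space)
      finally show ?thesis using Ew by (simp add: sum_nonneg)
    next
      case True
      \<comment> \<open>Since \<open>card ?V = 2 * p\<close>, at most \<open>p\<close> members are
        free. This is why the moment of order \<open>2 * p\<close> is bounded by the power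
        \<open>p\<close> of the mean.\<close>
      obtain L where L: "L \<subseteq> ?V" "2 * card L \<le> card ?V" "\<forall>v\<in>?V - L. \<exists>u\<in>L. P v \<inter> P u \<noteq> {}"
        using small_dominating_set[of ?V "\<lambda>u v. P u \<inter> P v \<noteq> {}"] True by blast
      have LL: "L \<in> \<L>" "P \<in> dom L" using L P by (auto simp: \<L>_def dom_def) blast
      have "expectation (?dev P) \<le> expectation (weight ?V P)"
      proof (rule integral_mono)
        show "integrable \<P> (?dev P)" by (rule bdd_kernel_integrable[OF devb[OF P order_refl]])
        show "integrable \<P> (weight ?V P)" by (rule bdd_kernel_integrable[OF weight_bdd(1)[OF _ P]]) simp
        fix x
        have "?dev P x \<le> \<bar>?dev P x\<bar>" by simp
        also have "\<dots> = (\<Prod>l\<in>?V. \<bar>g x (P l) - m\<bar>)" by (rule abs_prod)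
        also have "\<dots> \<le> weight ?V P x"
        proof (rule prod_mono)
          fix l assume "l \<in> ?V"
          then have "0 \<le> m" using mem[OF P] mean_nonneg by blast
          then show "0 \<le> \<bar>g x (P l) - m\<bar> \<and> \<bar>g x (P l) - m\<bar> \<le> g x (P l) + m"
            using g_range[of x "P l"] by auto
        qed
        finally show "?dev P x \<le> weight ?V P x" .
      qed
      also have "\<dots> = (if P \<in> dom L then expectation (weight ?V P) else 0)" using LL by simp
      also have "\<dots> \<le> (\<Sum>L\<in>\<L>. if P \<in> dom L then expectation (weight ?V P) else 0)"
        by (rule member_le_sum[OF LL(1)]) (use Ew fL in auto)
      finally show ?thesis .
    qed
  qed
  have c: "0 \<le> attach_const N" "1 \<le> ?c" "1 \<le> ?a" "free_const N = ?c * ?a"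
    using attach_const_nonneg[of N] k by (auto simp: free_const_def)
  have "expectation (\<lambda>x. ((\<Sum>A\<in>\<Y>. g x A) - real (card \<Y>) * m) ^ (2 * p)) = expectation (\<lambda>x. \<Sum>P\<in>fam ?V. ?dev P x)"
  proof (rule Bochner_Integration.integral_cong[OF refl])
    fix x
    have "((\<Sum>A\<in>\<Y>. g x A) - real (card \<Y>) * m) ^ (2 * p) = (\<Prod>l\<in>?V. \<Sum>A\<in>\<Y>. g x A - m)"
      by (simp add: sum_subtractf)
    also have "\<dots> = (\<Sum>P\<in>fam ?V. ?dev P x)" by (rule prod_sum_PiE) (use fin\<Y> in auto)
    finally show "((\<Sum>A\<in>\<Y>. g x A) - real (card \<Y>) * m) ^ (2 * p) = (\<Sum>P\<in>fam ?V. ?dev P x)" .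
  qed
  also have "\<dots> = (\<Sum>P\<in>fam ?V. expectation (?dev P))"
    by (rule Bochner_Integration.integral_sum) (use bdd_kernel_integrable[OF devb] in auto)
  also have "\<dots> \<le> (\<Sum>P\<in>fam ?V. \<Sum>L\<in>\<L>. if P \<in> dom L then expectation (weight ?V P) else 0)"
    by (rule sum_mono) (rule small)
  also have "\<dots> = (\<Sum>L\<in>\<L>. \<Sum>P\<in>dom L. expectation (weight ?V P))"
  proof -
    have "(\<Sum>P\<in>fam ?V. if P \<in> dom L then expectation (weight ?V P) else 0) = (\<Sum>P\<in>dom L. expectation (weight ?V P))" for L
      by (subst sum.inter_filter[symmetric, OF finfam]) (auto simp: dom_def intro!: sum.cong)
    then show ?thesis by (subst sum.swap) simp
  qed
  also have "\<dots> \<le> (\<Sum>L\<in>\<L>. ?c ^ (2 * p) * ?a ^ p)"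
  proof (rule sum_mono)
    fix L assume "L \<in> \<L>"
    then have L: "L \<subseteq> ?V" "card L \<le> p" "finite L" using finite_subset by (auto simp: \<L>_def)
    have cc: "card L + card (?V - L) = 2 * p" using L card_mono[of ?V L] by (simp add: card_Diff_subset)
    have V: "L \<union> (?V - L) = ?V" using L by blast
    have "(\<Sum>P\<in>dom L. expectation (weight ?V P)) \<le> free_const N ^ card L * attach_const N ^ card (?V - L)"
      using sum_dominated_weight_le[of L "?V - L" N] L cc unfolding V dom_def N_def by simp
    also have "\<dots> \<le> (?c * ?a) ^ card L * ?c ^ card (?V - L)"
      unfolding c(4) using c by (intro mult_left_mono power_mono) auto
    also have "\<dots> = ?c ^ (2 * p) * ?a ^ card L"
    proof -
      have "?c ^ (card L + card (?V - L)) = ?c ^ card L * ?c ^ card (?V - L)" by (rule power_add)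
      then have "?c ^ (2 * p) = ?c ^ card L * ?c ^ card (?V - L)" unfolding cc .
      then show ?thesis by (simp only: power_mult_distrib mult_ac)
    qed
    also have "\<dots> \<le> ?c ^ (2 * p) * ?a ^ p"
      using c L by (intro mult_left_mono power_increasing) auto
    finally show "(\<Sum>P\<in>dom L. expectation (weight ?V P)) \<le> ?c ^ (2 * p) * ?a ^ p" .
  qed
  also have "\<dots> \<le> 4 ^ p * (?c ^ (2 * p) * ?a ^ p)"
  proof -
    \<comment> \<open>At most \<open>2 ^ (2 * p)\<close> dominating sets are possible.\<close>
    have "card \<L> \<le> card (Pow ?V)" by (rule card_mono) (auto simp: \<L>_def)
    also have "\<dots> = 4 ^ p" by (simp add: card_Pow power_mult)
    finally have "real (card \<L>) \<le> 4 ^ p" by (metis of_nat_le_iff of_nat_numeral of_nat_power)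
    then show ?thesis using c by (simp add: mult_right_mono)
  qed
  finally show ?thesis by (simp add: mult.assoc)
qed

end

section \<open>Asymptotics of the mean\<close>

text \<open>Each coordinate contributes the Jacobian \<open>c ^ DIM('a)\<close>; equality of
  measures on boxes suffices, as these determine the product measure.\<close>

lemma nn_integral_PiM_affine:
  fixes a :: "'a::euclidean_space" and I :: "'i set"
  assumes I: "finite I" and c: "c > 0" and F: "F \<in> borel_measurable (PiM I (\<lambda>_. lborel :: 'a measure))"
  shows "(\<integral>\<^sup>+y. F y \<partial>PiM I (\<lambda>_. lborel)) =
    ennreal (c ^ (DIM('a) * card I)) * (\<integral>\<^sup>+z. F (\<lambda>i\<in>I. a + c *\<^sub>R z i) \<partial>PiM I (\<lambda>_. lborel))"
proof -
  interpret product_sigma_finite "\<lambda>_ :: 'i. lborel :: 'a measure" by unfold_locales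
  let ?L = "PiM I (\<lambda>_. lborel :: 'a measure)"
  let ?T = "\<lambda>z. \<lambda>i\<in>I. a + c *\<^sub>R z i"
  have T: "?T \<in> ?L \<rightarrow>\<^sub>M ?L" by measurable
  have sc: "emeasure lborel A = ennreal (c ^ DIM('a)) * emeasure lborel ((\<lambda>z. a + c *\<^sub>R z) -` A)"
    if A: "A \<in> sets borel" for A :: "'a set"
  proof -
    have "emeasure lborel A = emeasure (density (distr lborel borel (\<lambda>z. a + c *\<^sub>R z)) (\<lambda>_. \<bar>c\<bar> ^ DIM('a))) A"
      using lborel_affine[of c a] c by simp
    also have "\<dots> = ennreal (\<bar>c\<bar> ^ DIM('a)) * emeasure (distr lborel borel (\<lambda>z. a + c *\<^sub>R z)) A"
      using A by (subst emeasure_density) (auto simp: nn_integral_cmult)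
    also have "emeasure (distr lborel borel (\<lambda>z. a + c *\<^sub>R z)) A = emeasure lborel ((\<lambda>z. a + c *\<^sub>R z) -` A)"
      using A by (subst emeasure_distr) auto
    finally show ?thesis using c by simp
  qed
  have eq: "scale_measure (ennreal (c ^ (DIM('a) * card I))) (distr ?L ?L ?T) = ?L"
  proof (rule PiM_eqI[OF I])
    fix A assume A: "\<And>i. i \<in> I \<Longrightarrow> A i \<in> sets (lborel :: 'a measure)"
    have "?T -` (PiE I A) \<inter> space ?L = PiE I (\<lambda>i. (\<lambda>z. a + c *\<^sub>R z) -` A i)"
      by (auto simp: space_PiM PiE_def Pi_def extensional_def)
    moreover have "PiE I A \<in> sets ?L" using I A by (intro sets_PiM_I_finite) auto
    moreover have "(\<lambda>z. a + c *\<^sub>R z) -` A i \<in> sets (lborel :: 'a measure)" if "i \<in> I" for i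
      using A[OF that] measurable_sets[of "\<lambda>z. a + c *\<^sub>R z" borel borel "A i"] by simp
    ultimately have "emeasure (distr ?L ?L ?T) (PiE I A) = (\<Prod>i\<in>I. emeasure lborel ((\<lambda>z. a + c *\<^sub>R z) -` A i))"
      using T I by (simp add: emeasure_distr emeasure_PiM)
    moreover have "ennreal (c ^ (DIM('a) * card I)) = (\<Prod>i\<in>I. ennreal (c ^ DIM('a)))"
      using c by (simp add: ennreal_power power_mult)
    moreover have "(\<Prod>i\<in>I. emeasure lborel (A i)) =
        (\<Prod>i\<in>I. ennreal (c ^ DIM('a)) * emeasure lborel ((\<lambda>z. a + c *\<^sub>R z) -` A i))"
      by (intro prod.cong refl sc) (use A in simp)
    ultimately show "emeasure (scale_measure (ennreal (c ^ (DIM('a) * card I))) (distr ?L ?L ?T)) (PiE I A) =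
        (\<Prod>i\<in>I. emeasure lborel (A i))"
      by (simp add: prod.distrib)
  qed simp
  have "(\<integral>\<^sup>+y. F y \<partial>?L) = (\<integral>\<^sup>+y. F y \<partial>scale_measure (ennreal (c ^ (DIM('a) * card I))) (distr ?L ?L ?T))"
    unfolding eq ..
  also have "\<dots> = ennreal (c ^ (DIM('a) * card I)) * (\<integral>\<^sup>+y. F y \<partial>distr ?L ?L ?T)"
    by (rule nn_integral_scale_measure) (use F in simp)
  also have "(\<integral>\<^sup>+y. F y \<partial>distr ?L ?L ?T) = (\<integral>\<^sup>+z. F (?T z) \<partial>?L)"
    by (rule nn_integral_distr[OF T]) (use F in simp)
  finally show ?thesis .
qed

lemma PiM_density:
  fixes f :: "'a \<Rightarrow> ennreal" and I :: "'i set"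
  assumes I: "finite I" and L: "sigma_finite_measure L" and D: "sigma_finite_measure (density L f)"
    and f: "f \<in> borel_measurable L"
  shows "PiM I (\<lambda>_. density L f) = density (PiM I (\<lambda>_. L)) (\<lambda>y. \<Prod>i\<in>I. f (y i))"
proof -
  interpret L: product_sigma_finite "\<lambda>_ :: 'i. L" using L by (simp add: product_sigma_finite_def)
  interpret D: product_sigma_finite "\<lambda>_ :: 'i. density L f" using D by (simp add: product_sigma_finite_def)
  have fm: "(\<lambda>y. \<Prod>i\<in>I. f (y i)) \<in> borel_measurable (PiM I (\<lambda>_. L))"
    using f by (intro borel_measurable_prod_ennreal) (auto intro: measurable_compose[OF measurable_component_singleton])
  show ?thesis
  proof (rule D.PiM_eqI[OF I, symmetric])
    show "sets (density (PiM I (\<lambda>_. L)) (\<lambda>y. \<Prod>i\<in>I. f (y i))) = sets (PiM I (\<lambda>_. density L f))"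
      by (simp cong: sets_PiM_cong)
    fix A assume "\<And>i. i \<in> I \<Longrightarrow> A i \<in> sets (density L f)"
    then have A: "\<And>i. i \<in> I \<Longrightarrow> A i \<in> sets L" by simp
    have P: "PiE I A \<in> sets (PiM I (\<lambda>_. L))" using I A by (intro sets_PiM_I_finite) auto
    have "emeasure (density (PiM I (\<lambda>_. L)) (\<lambda>y. \<Prod>i\<in>I. f (y i))) (PiE I A) =
        (\<integral>\<^sup>+y. (\<Prod>i\<in>I. f (y i)) * indicator (PiE I A) y \<partial>PiM I (\<lambda>_. L))"
      by (rule emeasure_density[OF fm P])
    also have "\<dots> = (\<integral>\<^sup>+y. (\<Prod>i\<in>I. f (y i) * indicator (A i) (y i)) \<partial>PiM I (\<lambda>_. L))"
    proof (rule nn_integral_cong)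
      fix y assume y: "y \<in> space (PiM I (\<lambda>_. L))"
      have "indicator (PiE I A) y = (\<Prod>i\<in>I. indicator (A i) (y i) :: ennreal)"
      proof (cases "\<forall>i\<in>I. y i \<in> A i")
        case True
        then show ?thesis using y by (auto simp: space_PiM PiE_def)
      next
        case False
        then obtain i where "i \<in> I" "y i \<notin> A i" by blast
        then have "(\<Prod>i\<in>I. indicator (A i) (y i) :: ennreal) = 0" using I by (intro prod_zero bexI[of _ i]) auto
        then show ?thesis using False by (auto simp: indicator_def)
      qed
      then show "(\<Prod>i\<in>I. f (y i)) * indicator (PiE I A) y = (\<Prod>i\<in>I. f (y i) * indicator (A i) (y i))"
        by (simp add: prod.distrib)
    qed
    also have "\<dots> = (\<Prod>i\<in>I. \<integral>\<^sup>+y. f y * indicator (A i) y \<partial>L)"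
      by (rule L.product_nn_integral_prod[OF I]) (use f A in auto)
    also have "\<dots> = (\<Prod>i\<in>I. emeasure (density L f) (A i))"
      using f A by (intro prod.cong refl) (simp add: emeasure_density)
    finally show "emeasure (density (PiM I (\<lambda>_. L)) (\<lambda>y. \<Prod>i\<in>I. f (y i))) (PiE I A) = (\<Prod>i\<in>I. emeasure (density L f) (A i))" .
  qed
qed

lemma birth_death_time_affine:
  fixes y :: "'i \<Rightarrow> 'a::euclidean_space"
  assumes "finite A" "card A \<ge> 2" "c > 0" "\<And>i. i \<in> A \<Longrightarrow> x i = a + c *\<^sub>R y i"
  shows "birth_time x A = c * birth_time y A" "death_time x A = c * death_time y A"
proof -
  have er: "enclosing_radius (x ` B) = c * enclosing_radius (y ` B)" if "B \<subseteq> A" "B \<noteq> {}" for B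
  proof -
    have "x ` B = (\<lambda>v. a + c *\<^sub>R v) ` (y ` B)" using assms(4) that by (force simp: image_image)
    then show ?thesis
      using enclosing_radius_affine[of "y ` B" c a] that assms(3) finite_subset[OF that(1) assms(1)] by auto
  qed
  have ne: "A - {i} \<noteq> {}" for i
  proof
    assume "A - {i} = {}"
    then have "card A \<le> card {i}" by (intro card_mono) auto
    then show False using assms(2) by simp
  qed
  have "birth_time x A = Max ((\<lambda>i. c * (2 * enclosing_radius (y ` (A - {i})))) ` A)"
    unfolding birth_time_def using er[OF _ ne] by (intro arg_cong[where f = Max] image_cong refl) auto
  also have "\<dots> = Max ((*) c ` (\<lambda>i. 2 * enclosing_radius (y ` (A - {i}))) ` A)"
    by (simp add: image_image)
  also have "\<dots> = c * birth_time y A"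
    unfolding birth_time_def
    by (rule mono_Max_commute[symmetric]) (use assms ne in \<open>auto simp: mono_def mult_left_mono\<close>)
  finally show "birth_time x A = c * birth_time y A" .
  have "A \<noteq> {}" using assms(2) by auto
  then show "death_time x A = c * death_time y A" unfolding death_time_def using er[of A] by simp
qed

lemma birth_time_cong:
  assumes "\<And>i. i \<in> A \<Longrightarrow> x i = y i"
  shows "birth_time x A = birth_time y A" "death_time x A = death_time y A"
proof -
  have im: "x ` B = y ` B" if "B \<subseteq> A" for B using assms that by (force intro: image_cong)
  have "x ` (A - {i}) = y ` (A - {i})" for i by (rule im) auto
  then show "birth_time x A = birth_time y A" by (simp add: birth_time_def)
  show "death_time x A = death_time y A" using im[of A] by (simp add: death_time_def)
qed

lemma birth_time_reindex:
  assumes "inj_on e B"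
  shows "birth_time (\<lambda>j. x (e j)) B = birth_time x (e ` B)" "death_time (\<lambda>j. x (e j)) B = death_time x (e ` B)"
proof -
  have "e ` B - {e j} = e ` (B - {j})" if "j \<in> B" for j
    using inj_on_image_set_diff[OF assms, of B "{j}"] that by auto
  then have "(\<lambda>i. 2 * enclosing_radius (x ` (e ` B - {i}))) ` (e ` B) =
      (\<lambda>j. 2 * enclosing_radius ((\<lambda>j. x (e j)) ` (B - {j}))) ` B"
    by (force simp: image_image image_iff)
  then show "birth_time (\<lambda>j. x (e j)) B = birth_time x (e ` B)" by (simp add: birth_time_def)
qed (simp add: death_time_def image_image)

lemma birth_time_measurable:
  fixes X :: "'i \<Rightarrow> 'w \<Rightarrow> 'a::euclidean_space"
  assumes "finite A" "card A \<ge> 2" "\<And>i. i \<in> A \<Longrightarrow> X i \<in> borel_measurable M"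
  shows "(\<lambda>\<omega>. birth_time (\<lambda>i. X i \<omega>) A) \<in> borel_measurable M"
    "(\<lambda>\<omega>. death_time (\<lambda>i. X i \<omega>) A) \<in> borel_measurable M"
proof -
  have ne: "A - {i} \<noteq> {}" for i
  proof
    assume "A - {i} = {}"
    then have "card A \<le> card {i}" by (intro card_mono) auto
    then show False using assms(2) by simp
  qed
  have A: "A \<noteq> {}" using ne by blast
  show "(\<lambda>\<omega>. birth_time (\<lambda>i. X i \<omega>) A) \<in> borel_measurable M"
    unfolding birth_time_def using assms ne A
    by (intro borel_measurable_Max borel_measurable_times borel_measurable_const enclosing_radius_image_measurable) auto
  show "(\<lambda>\<omega>. death_time (\<lambda>i. X i \<omega>) A) \<in> borel_measurable M"
    unfolding death_time_def using assms A
    by (intro borel_measurable_times borel_measurable_const enclosing_radius_image_measurable) auto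
qed

text \<open>Translation invariance allows one vertex, the one with index 0, to be pinned at the
  origin.\<close>

abbreviation origin_times :: "nat \<Rightarrow> (nat \<Rightarrow> 'a::euclidean_space) \<Rightarrow> real \<times> real" where
  "origin_times q y \<equiv> (birth_time (y(0 := 0)) {0..q}, death_time (y(0 := 0)) {0..q})"

definition time_integral :: "'a::euclidean_space itself \<Rightarrow> nat \<Rightarrow> (real \<times> real \<Rightarrow> real) \<Rightarrow> ennreal" where
  "time_integral _ q g = (\<integral>\<^sup>+y. ennreal (g (origin_times q y))
     \<partial>(PiM {1..q} (\<lambda>_. lborel :: 'a measure)))"

locale bounded_density =
  fixes f :: "'a::euclidean_space \<Rightarrow> real" and Bf :: real
  assumes f_nonneg: "\<And>x. 0 \<le> f x" and f_le: "\<And>x. f x \<le> Bf"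
    and f_meas [measurable]: "f \<in> borel_measurable borel"
    and f_cont: "AE x in lborel. isCont f x"
    and f_prob: "(\<integral>\<^sup>+x. ennreal (f x) \<partial>lborel) = 1"
begin

definition D :: "'a measure" where "D = density lborel (\<lambda>x. ennreal (f x))"

lemma prob_D: "prob_space D"
  by (rule prob_spaceI) (simp add: D_def emeasure_density f_prob)

lemma sets_D [simp, measurable_cong]: "sets D = sets borel"
  by (simp add: D_def)

lemma Bf_nonneg: "0 \<le> Bf"
  using f_nonneg f_le order_trans by blast

definition near_prob :: "real \<Rightarrow> real" where
  "near_prob R = Bf * unit_ball_vol (real DIM('a)) * R ^ DIM('a)"

lemma near_prob_nonneg: "0 \<le> R \<Longrightarrow> 0 \<le> near_prob R"
  using Bf_nonneg by (simp add: near_prob_def)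

lemma emeasure_D_cball_le:
  assumes "0 \<le> R"
  shows "emeasure D (cball z R) \<le> ennreal (near_prob R)"
proof -
  have "emeasure D (cball z R) = (\<integral>\<^sup>+x. ennreal (f x) * indicator (cball z R) x \<partial>lborel)"
    unfolding D_def by (rule emeasure_density) auto
  also have "\<dots> \<le> (\<integral>\<^sup>+x. ennreal Bf * indicator (cball z R) x \<partial>lborel)"
    by (intro nn_integral_mono mult_right_mono ennreal_leI f_le) auto
  also have "\<dots> = ennreal Bf * emeasure lborel (cball z R)"
    by (subst nn_integral_cmult) (auto intro!: borel_measurable_indicator borel_closed)
  also have "\<dots> = ennreal (near_prob R)"
    using assms Bf_nonneg by (simp add: emeasure_cball near_prob_def ennreal_mult mult.assoc)
  finally show ?thesis .
qed

lemma f_power_integral: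
  "(\<integral>\<^sup>+x. ennreal (f x) * ennreal (f x ^ q) \<partial>lborel) = ennreal (\<integral>x. f x ^ Suc q \<partial>lborel)"
proof -
  have "(\<integral>\<^sup>+x. ennreal (f x ^ Suc q) \<partial>lborel) \<le> (\<integral>\<^sup>+x. ennreal (Bf ^ q) * ennreal (f x) \<partial>lborel)"
    by (intro nn_integral_mono, subst ennreal_mult[symmetric])
      (auto intro!: ennreal_leI mult_right_mono power_mono f_nonneg f_le simp: f_nonneg Bf_nonneg mult.commute[of "f _"])
  also have "\<dots> = ennreal (Bf ^ q)" by (subst nn_integral_cmult) (auto simp: f_prob)
  finally have fin: "(\<integral>\<^sup>+x. ennreal (f x ^ Suc q) \<partial>lborel) < \<infinity>" by (simp add: le_less_trans)
  then have "integrable lborel (\<lambda>x. f x ^ Suc q)"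
    using f_nonneg by (intro integrableI_nonneg) auto
  then have "(\<integral>\<^sup>+x. ennreal (f x ^ Suc q) \<partial>lborel) = ennreal (\<integral>x. f x ^ Suc q \<partial>lborel)"
    by (rule nn_integral_eq_integral) (simp add: f_nonneg)
  then show ?thesis using f_nonneg by (simp add: ennreal_mult)
qed

lemma time_kernel_measurable:
  assumes g: "g \<in> borel_measurable borel" and q: "q \<ge> 1" and A: "A \<subseteq> I" "finite A" "card A = Suc q"
  shows "(\<lambda>x. g (birth_time x A / c, death_time x A / c)) \<in> borel_measurable (PiM I (\<lambda>_. borel :: 'a measure))"
proof -
  have "(\<lambda>x. x i) \<in> borel_measurable (PiM I (\<lambda>_. borel :: 'a measure))" if "i \<in> A" for i
    using measurable_component_singleton[of i I "\<lambda>_. borel"] A that by auto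
  from birth_time_measurable[of A "\<lambda>i x. x i", OF A(2) _ this] q A(3)
  have "(\<lambda>x. birth_time x A) \<in> borel_measurable (PiM I (\<lambda>_. borel :: 'a measure))"
    "(\<lambda>x. death_time x A) \<in> borel_measurable (PiM I (\<lambda>_. borel :: 'a measure))" by auto
  then have "(\<lambda>x. (birth_time x A / c, death_time x A / c)) \<in> PiM I (\<lambda>_. borel :: 'a measure) \<rightarrow>\<^sub>M borel \<Otimes>\<^sub>M borel"
    by (intro measurable_Pair borel_measurable_divide) auto
  then show ?thesis using measurable_compose[OF _ g] by (simp add: borel_prod)
qed

definition mean_kernel :: "nat \<Rightarrow> (real \<times> real \<Rightarrow> real) \<Rightarrow> real \<Rightarrow> real" where
  "mean_kernel q g c = (\<integral>x. g (birth_time x {0..q} / c, death_time x {0..q} / c) \<partial>PiM {0..q} (\<lambda>_. D))"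

text \<open>A birth time of at most \<open>T\<close> forces all points into the ball of radius
  \<open>T\<close> around the pinned point, and a product of balls has finite measure.\<close>

lemma time_integral_finite:
  assumes q: "q \<ge> 2" and g: "\<And>p. 0 \<le> g p \<and> g p \<le> 1" "\<And>b d. g (b, d) \<noteq> 0 \<Longrightarrow> b \<le> T"
  shows "time_integral TYPE('a) q g < \<infinity>"
proof -
  interpret product_sigma_finite "\<lambda>_ :: nat. lborel :: 'a measure" by unfold_locales
  have "time_integral TYPE('a) q g \<le> (\<integral>\<^sup>+y. (\<Prod>i\<in>{1..q}. indicator (cball 0 T) (y i)) \<partial>PiM {1..q} (\<lambda>_. lborel :: 'a measure))"
    unfolding time_integral_def
  proof (rule nn_integral_mono)
    fix y :: "nat \<Rightarrow> 'a"
    let ?y = "y(0 := 0)"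
    show "ennreal (g (birth_time ?y {0..q}, death_time ?y {0..q})) \<le> (\<Prod>i\<in>{1..q}. indicator (cball 0 T) (y i))"
    proof (cases "g (birth_time ?y {0..q}, death_time ?y {0..q}) = 0")
      case False
      then have "birth_time ?y {0..q} \<le> T" using g(2) by blast
      moreover have d: "diameter_le ?y (birth_time ?y {0..q}) {0..q}"
        by (rule diameter_le_birth_time) (use q in auto)
      have "dist (?y 0) (?y i) \<le> birth_time ?y {0..q}" if "i \<in> {1..q}" for i
        by (rule d[unfolded diameter_le_def, rule_format]) (use that in auto)
      ultimately have "y i \<in> cball 0 T" if "i \<in> {1..q}" for i
        using that by (fastforce simp: dist_norm)
      then have "(\<Prod>i\<in>{1..q}. indicator (cball 0 T) (y i) :: ennreal) = 1"
        by (intro prod.neutral) auto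
      then show ?thesis using g(1) by (simp add: ennreal_le_1)
    qed simp
  qed
  also have "\<dots> = (\<Prod>i\<in>{1..q}. \<integral>\<^sup>+y. indicator (cball (0::'a) T) y \<partial>lborel)"
    by (rule product_nn_integral_prod) (auto intro!: borel_measurable_indicator borel_closed)
  also have "\<dots> < \<infinity>"
  proof -
    have "(\<integral>\<^sup>+y. indicator (cball (0::'a) T) y \<partial>lborel) = emeasure lborel (cball (0::'a) T)"
      by (rule nn_integral_indicator) simp
    also have "\<dots> = ennreal (measure lborel (cball (0::'a) T))"
      by (rule emeasure_eq_ennreal_measure) (use emeasure_bounded_finite[OF bounded_cball, of "0::'a" T] in simp)
    finally show ?thesis by (simp add: ennreal_power)
  qed
  finally show ?thesis .
qed

text \<open>The first point \<open>x\<close> is split off and the others are written as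
  \<open>x + c *\<^sub>R z i\<close>. Both times are translation invariant and homogeneous, so after
  division by \<open>c\<close> they depend on \<open>z\<close> alone.\<close>

lemma mean_kernel_eq:
  assumes c: "c > 0" and q: "q \<ge> 1"
    and g: "g \<in> borel_measurable borel" "\<And>p. 0 \<le> g p \<and> g p \<le> 1"
  shows "ennreal (mean_kernel q g c) = ennreal (c ^ (DIM('a) * q)) *
    (\<integral>\<^sup>+x. ennreal (f x) * (\<integral>\<^sup>+z. (\<Prod>i\<in>{1..q}. ennreal (f (x + c *\<^sub>R z i))) *
        ennreal (g (origin_times q z)) \<partial>PiM {1..q} (\<lambda>_. lborel)) \<partial>lborel)"
proof -
  interpret D: prob_space D by (rule prob_D)
  interpret PD: product_sigma_finite "\<lambda>_ :: nat. D" by unfold_locales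
  interpret P0: prob_space "PiM {0..q} (\<lambda>_. D)" by (rule prob_space_PiM) (rule prob_D)
  let ?h = "\<lambda>x. g (birth_time x {0..q} / c, death_time x {0..q} / c)"
  have ins: "{0..q} = insert 0 {1..q}" by auto
  have setsP: "sets (PiM J (\<lambda>_. D)) = sets (PiM J (\<lambda>_. borel :: 'a measure))"
    "sets (PiM J (\<lambda>_. lborel :: 'a measure)) = sets (PiM J (\<lambda>_. borel :: 'a measure))" for J :: "nat set"
    by (simp_all cong: sets_PiM_cong)
  have h0: "?h \<in> borel_measurable (PiM {0..q} (\<lambda>_. borel :: 'a measure))"
    by (rule time_kernel_measurable) (use g q in auto)
  have h: "?h \<in> borel_measurable (PiM {0..q} (\<lambda>_. D))"
    using h0 by (simp add: measurable_cong_sets[OF setsP(1) refl])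
  have hx: "(\<lambda>y. ?h (y(0 := x))) \<in> borel_measurable (PiM {1..q} (\<lambda>_. lborel))" for x :: 'a
  proof -
    have "(\<lambda>y. y(0 := x)) \<in> PiM {1..q} (\<lambda>_. lborel) \<rightarrow>\<^sub>M PiM {0..q} (\<lambda>_. borel :: 'a measure)"
      unfolding ins by (intro measurable_fun_upd[where J = "{1..q}"]) (auto simp: measurable_cong_sets[OF setsP(2) refl])
    from measurable_compose[OF this h0] show ?thesis .
  qed
  have fm: "(\<lambda>y. \<Prod>i\<in>{1..q}. ennreal (f (y i))) \<in> borel_measurable (PiM {1..q} (\<lambda>_. lborel))"
    by (intro borel_measurable_prod_ennreal) measurable
  have inner: "(\<integral>\<^sup>+y. ennreal (?h (y(0 := x))) \<partial>PiM {1..q} (\<lambda>_. D)) =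
      ennreal (c ^ (DIM('a) * q)) * (\<integral>\<^sup>+z. (\<Prod>i\<in>{1..q}. ennreal (f (x + c *\<^sub>R z i))) *
        ennreal (g (origin_times q z)) \<partial>PiM {1..q} (\<lambda>_. lborel))" for x
  proof -
    have "PiM {1..q} (\<lambda>_. D) = density (PiM {1..q} (\<lambda>_. lborel)) (\<lambda>y. \<Prod>i\<in>{1..q}. ennreal (f (y i)))"
      unfolding D_def by (rule PiM_density) (use D.sigma_finite_measure_axioms in \<open>auto simp: D_def[symmetric] lborel.sigma_finite_measure_axioms\<close>)
    then have "(\<integral>\<^sup>+y. ennreal (?h (y(0 := x))) \<partial>PiM {1..q} (\<lambda>_. D)) =
        (\<integral>\<^sup>+y. (\<Prod>i\<in>{1..q}. ennreal (f (y i))) * ennreal (?h (y(0 := x))) \<partial>PiM {1..q} (\<lambda>_. lborel))"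
      using fm hx by (simp add: nn_integral_density)
    also have "\<dots> = ennreal (c ^ (DIM('a) * q)) *
        (\<integral>\<^sup>+z. (\<Prod>i\<in>{1..q}. ennreal (f ((\<lambda>i\<in>{1..q}. x + c *\<^sub>R z i) i))) *
          ennreal (?h ((\<lambda>i\<in>{1..q}. x + c *\<^sub>R z i)(0 := x))) \<partial>PiM {1..q} (\<lambda>_. lborel))"
      by (subst nn_integral_PiM_affine[of "{1..q}" c _ x]) (use fm hx c in auto)
    also have "(\<integral>\<^sup>+z. (\<Prod>i\<in>{1..q}. ennreal (f ((\<lambda>i\<in>{1..q}. x + c *\<^sub>R z i) i))) *
          ennreal (?h ((\<lambda>i\<in>{1..q}. x + c *\<^sub>R z i)(0 := x))) \<partial>PiM {1..q} (\<lambda>_. lborel)) =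
        (\<integral>\<^sup>+z. (\<Prod>i\<in>{1..q}. ennreal (f (x + c *\<^sub>R z i))) *
        ennreal (g (origin_times q z)) \<partial>PiM {1..q} (\<lambda>_. lborel))"
    proof (rule nn_integral_cong)
      fix z :: "nat \<Rightarrow> 'a"
      let ?w = "(\<lambda>i\<in>{1..q}. x + c *\<^sub>R z i)(0 := x)"
      have "?w i = x + c *\<^sub>R (z(0 := 0)) i" if "i \<in> {0..q}" for i using that by (cases i) auto
      from birth_death_time_affine[of "{0..q}" c ?w x "z(0 := 0)", OF _ _ c this]
      have bd: "birth_time ?w {0..q} = c * birth_time (z(0 := 0)) {0..q}" "death_time ?w {0..q} = c * death_time (z(0 := 0)) {0..q}"
        using q by auto
      have "?h ?w = g (origin_times q z)"
        unfolding bd using c by simp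
      moreover have "(\<Prod>i\<in>{1..q}. ennreal (f ((\<lambda>i\<in>{1..q}. x + c *\<^sub>R z i) i))) = (\<Prod>i\<in>{1..q}. ennreal (f (x + c *\<^sub>R z i)))"
        by (intro prod.cong) auto
      ultimately show "(\<Prod>i\<in>{1..q}. ennreal (f ((\<lambda>i\<in>{1..q}. x + c *\<^sub>R z i) i))) * ennreal (?h ?w) =
          (\<Prod>i\<in>{1..q}. ennreal (f (x + c *\<^sub>R z i))) *
          ennreal (g (origin_times q z))" by (simp only:)
    qed
    finally show ?thesis .
  qed
  have jm: "(\<lambda>x. \<integral>\<^sup>+z. (\<Prod>i\<in>{1..q}. ennreal (f (x + c *\<^sub>R z i))) *
        ennreal (g (origin_times q z)) \<partial>PiM {1..q} (\<lambda>_. lborel)) \<in> borel_measurable lborel"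
  proof -
    interpret PL: product_sigma_finite "\<lambda>_ :: nat. lborel :: 'a measure" by unfold_locales
    interpret L: sigma_finite_measure "PiM {1..q} (\<lambda>_. lborel :: 'a measure)" by (rule PL.sigma_finite) simp
    have s: "(\<lambda>z. g (origin_times q z)) \<in> borel_measurable (PiM {1..q} (\<lambda>_. lborel :: 'a measure))"
    proof -
      have "(\<lambda>y. y(0 := 0)) \<in> PiM {1..q} (\<lambda>_. lborel) \<rightarrow>\<^sub>M PiM {0..q} (\<lambda>_. borel :: 'a measure)"
        unfolding ins by (intro measurable_fun_upd[where J = "{1..q}"]) (auto simp: measurable_cong_sets[OF setsP(2) refl])
      from measurable_compose[OF this time_kernel_measurable[OF g(1) q, of "{0..q}" "{0..q}" 1]] show ?thesis by simp
    qed
    have s': "(\<lambda>z. ennreal (g (origin_times q z))) \<in> borel_measurable (PiM {1..q} (\<lambda>_. lborel :: 'a measure))"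
      using s by (rule measurable_compose[OF _ measurable_ennreal])
    have "(\<lambda>(x, z). (\<Prod>i\<in>{1..q}. ennreal (f (x + c *\<^sub>R z i))) *
        ennreal (g (origin_times q z))) \<in> borel_measurable (lborel \<Otimes>\<^sub>M PiM {1..q} (\<lambda>_. lborel))"
      unfolding split_beta'
    proof (rule borel_measurable_times_ennreal)
      show "(\<lambda>p. \<Prod>i\<in>{1..q}. ennreal (f (fst p + c *\<^sub>R snd p i))) \<in> borel_measurable (lborel \<Otimes>\<^sub>M PiM {1..q} (\<lambda>_. lborel))"
        by (intro borel_measurable_prod_ennreal) measurable
      show "(\<lambda>p. ennreal (g (birth_time ((snd p)(0 := 0)) {0..q}, death_time ((snd p)(0 := 0)) {0..q})))
          \<in> borel_measurable ((lborel :: 'a measure) \<Otimes>\<^sub>M PiM {1..q} (\<lambda>_. lborel :: 'a measure))"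
        by (rule measurable_compose[OF measurable_snd s'])
    qed
    then show ?thesis by (rule L.borel_measurable_nn_integral)
  qed
  have "ennreal (mean_kernel q g c) = (\<integral>\<^sup>+x. ennreal (?h x) \<partial>PiM {0..q} (\<lambda>_. D))"
    unfolding mean_kernel_def
    by (rule nn_integral_eq_integral[symmetric])
      (use h g(2) in \<open>auto intro!: P0.integrable_const_bound[where B = 1]\<close>)
  also have "\<dots> = (\<integral>\<^sup>+x. (\<integral>\<^sup>+y. ennreal (?h (y(0 := x))) \<partial>PiM {1..q} (\<lambda>_. D)) \<partial>D)"
  proof -
    have "0 \<notin> {1..q}" by simp
    moreover have "(\<lambda>x. ennreal (?h x)) \<in> borel_measurable (PiM {0..q} (\<lambda>_. D))" using h by simp
    ultimately show ?thesis by (rule PD.product_nn_integral_insert_rev[of "{1..q}" 0, folded ins, OF finite_atLeastAtMost])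
  qed
  also have "\<dots> = (\<integral>\<^sup>+x. ennreal (f x) * (ennreal (c ^ (DIM('a) * q)) * (\<integral>\<^sup>+z. (\<Prod>i\<in>{1..q}. ennreal (f (x + c *\<^sub>R z i))) *
        ennreal (g (origin_times q z)) \<partial>PiM {1..q} (\<lambda>_. lborel))) \<partial>lborel)"
    unfolding inner unfolding D_def
    by (rule nn_integral_density, measurable) (use jm in simp)
  also have "\<dots> = ennreal (c ^ (DIM('a) * q)) * (\<integral>\<^sup>+x. ennreal (f x) * (\<integral>\<^sup>+z. (\<Prod>i\<in>{1..q}. ennreal (f (x + c *\<^sub>R z i))) *
        ennreal (g (origin_times q z)) \<partial>PiM {1..q} (\<lambda>_. lborel)) \<partial>lborel)"
    unfolding mult.left_commute[of "ennreal (f _)"] by (rule nn_integral_cmult) (intro borel_measurable_times_ennreal jm, measurable)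
  finally show ?thesis .
qed

text \<open>As \<open>c n\<close> tends to 0, the density at all the points approaches its value at
  \<open>x\<close>, and the product of densities becomes \<open>f x ^ q\<close>. Two dominated
  convergences, over the relative positions and then over \<open>x\<close>, justify this with
  dominating constant \<open>Bf ^ q\<close>.\<close>

theorem mean_kernel_asymp:
  assumes c: "\<And>n. c n > 0" "c \<longlonglongrightarrow> 0" and q: "q \<ge> 2"
    and g: "g \<in> borel_measurable borel" "\<And>p. 0 \<le> g p \<and> g p \<le> 1" "\<And>b d. g (b, d) \<noteq> 0 \<Longrightarrow> b \<le> T"
  shows "(\<lambda>n. mean_kernel q g (c n) / c n ^ (DIM('a) * q))
    \<longlonglongrightarrow> (\<integral>x. f x ^ Suc q \<partial>lborel) * enn2real (time_integral TYPE('a) q g)"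
proof -
  let ?L = "PiM {1..q} (\<lambda>_. lborel :: 'a measure)"
  let ?p = "\<lambda>z. ennreal (g (origin_times q z))"
  define J where "J = (\<lambda>r x. \<integral>\<^sup>+z. (\<Prod>i\<in>{1..q}. ennreal (f (x + r *\<^sub>R z i))) * ?p z \<partial>?L)"
  let ?I = "time_integral TYPE('a) q g"
  have Ifin: "?I < \<infinity>" by (rule time_integral_finite[OF q g(2,3)])
  have setsP: "sets (PiM K (\<lambda>_. lborel :: 'a measure)) = sets (PiM K (\<lambda>_. borel :: 'a measure))" for K :: "nat set"
    by (simp cong: sets_PiM_cong)
  have pm: "?p \<in> borel_measurable ?L"
  proof -
    have ins: "{0..q} = insert 0 {1..q}" by auto
    have "(\<lambda>y. y(0 := 0)) \<in> ?L \<rightarrow>\<^sub>M PiM {0..q} (\<lambda>_. borel :: 'a measure)"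
      unfolding ins by (intro measurable_fun_upd[where J = "{1..q}"]) (auto simp: measurable_cong_sets[OF setsP refl])
    from measurable_compose[OF this time_kernel_measurable[OF g(1), of q "{0..q}" "{0..q}" 1]] q show ?thesis by simp
  qed
  have fm: "(\<lambda>z. \<Prod>i\<in>{1..q}. ennreal (f (x + r *\<^sub>R z i))) \<in> borel_measurable ?L" for x r
    by (intro borel_measurable_prod_ennreal) measurable
  have Jm: "J r \<in> borel_measurable lborel" for r
  proof -
    interpret PL: product_sigma_finite "\<lambda>_ :: nat. lborel :: 'a measure" by unfold_locales
    interpret L: sigma_finite_measure ?L by (rule PL.sigma_finite) simp
    have "(\<lambda>(x, z). (\<Prod>i\<in>{1..q}. ennreal (f (x + r *\<^sub>R z i))) * ?p z) \<in> borel_measurable (lborel \<Otimes>\<^sub>M ?L)"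
      unfolding split_beta'
    proof (rule borel_measurable_times_ennreal)
      show "(\<lambda>p. \<Prod>i\<in>{1..q}. ennreal (f (fst p + r *\<^sub>R snd p i))) \<in> borel_measurable (lborel \<Otimes>\<^sub>M ?L)"
        by (intro borel_measurable_prod_ennreal) measurable
      show "(\<lambda>p. ?p (snd p)) \<in> borel_measurable (lborel \<Otimes>\<^sub>M ?L)"
        by (rule measurable_compose[OF measurable_snd pm])
    qed
    then show ?thesis unfolding J_def by (rule L.borel_measurable_nn_integral)
  qed
  have prod_le: "(\<Prod>i\<in>{1..q}. ennreal (f (x + r *\<^sub>R z i))) \<le> ennreal (Bf ^ q)" for x r and z :: "nat \<Rightarrow> 'a"
  proof -
    have "(\<Prod>i\<in>{1..q}. f (x + r *\<^sub>R z i)) \<le> (\<Prod>i\<in>{1..q}. Bf)"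
      by (intro prod_mono) (auto intro: f_le f_nonneg)
    then show ?thesis using f_nonneg by (simp add: prod_ennreal ennreal_leI)
  qed
  have J_le: "J r x \<le> ennreal (Bf ^ q) * ?I" for r x
  proof -
    have "J r x \<le> (\<integral>\<^sup>+z. ennreal (Bf ^ q) * ?p z \<partial>?L)"
      unfolding J_def by (intro nn_integral_mono mult_right_mono prod_le) auto
    also have "\<dots> = ennreal (Bf ^ q) * ?I"
      unfolding time_integral_def by (rule nn_integral_cmult[OF pm])
    finally show ?thesis .
  qed
  \<comment> \<open>Continuity at the single point \<open>x\<close> is enough, which is why almost
    everywhere continuity of \<open>f\<close> suffices for the outer limit.\<close>
  have J_lim: "(\<lambda>n. J (c n) x) \<longlonglongrightarrow> ennreal (f x ^ q) * ?I" if cont: "isCont f x" for x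
  proof -
    have "(\<lambda>n. \<integral>\<^sup>+z. (\<Prod>i\<in>{1..q}. ennreal (f (x + c n *\<^sub>R z i))) * ?p z \<partial>?L) \<longlonglongrightarrow> (\<integral>\<^sup>+z. ennreal (f x ^ q) * ?p z \<partial>?L)"
    proof (rule nn_integral_dominated_convergence[where w = "\<lambda>z. ennreal (Bf ^ q) * ?p z"])
      show "(\<integral>\<^sup>+z. ennreal (Bf ^ q) * ?p z \<partial>?L) < \<infinity>"
        using Ifin by (subst nn_integral_cmult[OF pm]) (simp add: time_integral_def ennreal_mult_less_top)
      show "AE z in ?L. (\<Prod>i\<in>{1..q}. ennreal (f (x + c n *\<^sub>R z i))) * ?p z \<le> ennreal (Bf ^ q) * ?p z" for n
        by (intro AE_I2 mult_right_mono prod_le) auto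
      show "AE z in ?L. (\<lambda>n. (\<Prod>i\<in>{1..q}. ennreal (f (x + c n *\<^sub>R z i))) * ?p z) \<longlonglongrightarrow> ennreal (f x ^ q) * ?p z"
      proof (rule AE_I2)
        fix z :: "nat \<Rightarrow> 'a"
        have "(\<lambda>n. f (x + c n *\<^sub>R z i)) \<longlonglongrightarrow> f x" for i
        proof (rule isCont_tendsto_compose[OF cont])
          have "(\<lambda>n. x + c n *\<^sub>R z i) \<longlonglongrightarrow> x + 0 *\<^sub>R z i" by (intro tendsto_intros c)
          then show "(\<lambda>n. x + c n *\<^sub>R z i) \<longlonglongrightarrow> x" by simp
        qed
        then have "(\<lambda>n. \<Prod>i\<in>{1..q}. f (x + c n *\<^sub>R z i)) \<longlonglongrightarrow> (\<Prod>i\<in>{1..q}. f x)"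
          by (intro tendsto_prod)
        then have "(\<lambda>n. ennreal ((\<Prod>i\<in>{1..q}. f (x + c n *\<^sub>R z i)) * g (origin_times q z)))
            \<longlonglongrightarrow> ennreal (f x ^ q * g (origin_times q z))"
          by (intro tendsto_intros) simp
        then show "(\<lambda>n. (\<Prod>i\<in>{1..q}. ennreal (f (x + c n *\<^sub>R z i))) * ?p z) \<longlonglongrightarrow> ennreal (f x ^ q) * ?p z"
          using f_nonneg g(2) by (simp add: prod_ennreal ennreal_mult prod_nonneg)
      qed
    qed (use fm pm in auto)
    then show ?thesis unfolding J_def time_integral_def using nn_integral_cmult[OF pm] by simp
  qed
  have "(\<lambda>n. \<integral>\<^sup>+x. ennreal (f x) * J (c n) x \<partial>lborel) \<longlonglongrightarrow> (\<integral>\<^sup>+x. ennreal (f x) * (ennreal (f x ^ q) * ?I) \<partial>lborel)"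
  proof (rule nn_integral_dominated_convergence[where w = "\<lambda>x. ennreal (f x) * (ennreal (Bf ^ q) * ?I)"])
    show "(\<integral>\<^sup>+x. ennreal (f x) * (ennreal (Bf ^ q) * ?I) \<partial>lborel) < \<infinity>"
      using Ifin by (subst nn_integral_multc) (auto simp: f_prob ennreal_mult_less_top)
    show "AE x in lborel. ennreal (f x) * J (c n) x \<le> ennreal (f x) * (ennreal (Bf ^ q) * ?I)" for n
      by (intro AE_I2 mult_left_mono J_le) auto
    show "AE x in lborel. (\<lambda>n. ennreal (f x) * J (c n) x) \<longlonglongrightarrow> ennreal (f x) * (ennreal (f x ^ q) * ?I)"
      using f_cont by eventually_elim (intro ennreal_tendsto_cmult J_lim, auto)
  qed (use Jm in auto)
  also have "(\<integral>\<^sup>+x. ennreal (f x) * (ennreal (f x ^ q) * ?I) \<partial>lborel) = ennreal (\<integral>x. f x ^ Suc q \<partial>lborel) * ?I"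
    unfolding mult.assoc[symmetric] by (subst nn_integral_multc) (auto simp: f_power_integral)
  also have "\<dots> = ennreal ((\<integral>x. f x ^ Suc q \<partial>lborel) * enn2real ?I)"
    using Ifin f_nonneg by (subst ennreal_mult) (auto intro!: integral_nonneg_AE)
  finally have lim: "(\<lambda>n. \<integral>\<^sup>+x. ennreal (f x) * J (c n) x \<partial>lborel) \<longlonglongrightarrow> ennreal ((\<integral>x. f x ^ Suc q \<partial>lborel) * enn2real ?I)" .
  have "(\<integral>\<^sup>+x. ennreal (f x) * J (c n) x \<partial>lborel) = ennreal (mean_kernel q g (c n) / c n ^ (DIM('a) * q))" for n
  proof -
    have e: "ennreal (mean_kernel q g (c n)) = ennreal (c n ^ (DIM('a) * q)) * (\<integral>\<^sup>+x. ennreal (f x) * J (c n) x \<partial>lborel)"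
      unfolding J_def by (rule mean_kernel_eq) (use c q g in auto)
    have pos: "0 < c n ^ (DIM('a) * q)" using c(1) by simp
    have "(\<integral>\<^sup>+x. ennreal (f x) * J (c n) x \<partial>lborel) =
        ennreal (1 / c n ^ (DIM('a) * q)) * (ennreal (c n ^ (DIM('a) * q)) * (\<integral>\<^sup>+x. ennreal (f x) * J (c n) x \<partial>lborel))"
      using pos c(1)[of n] by (simp add: mult.assoc[symmetric] ennreal_mult[symmetric])
    also have "\<dots> = ennreal (1 / c n ^ (DIM('a) * q) * mean_kernel q g (c n))"
      unfolding e[symmetric] using pos
      by (intro ennreal_mult[symmetric]) (auto simp: mean_kernel_def g(2) intro!: Bochner_Integration.integral_nonneg)
    finally show ?thesis by simp
  qed
  from lim[unfolded this] show ?thesis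
    using f_nonneg c(1) by (subst (asm) tendsto_ennreal_iff)
      (auto simp: mean_kernel_def g(2) less_imp_le intro!: always_eventually divide_nonneg_nonneg mult_nonneg_nonneg Bochner_Integration.integral_nonneg)
qed

end

section \<open>The indicator of a hollow simplex\<close>

text \<open>If two points coincide, leaving one of them out does not change the set of
  points.\<close>

lemma birth_ge_death_time:
  assumes "finite A" "i \<in> A" "j \<in> A" "i \<noteq> j" "x i = x j"
  shows "death_time x A \<le> birth_time x A"
proof -
  have "A = insert i (A - {i})" "j \<in> A - {i}" using assms by auto
  then have "x ` A = x ` (A - {i})" using assms(5) by (metis image_insert imageI insert_absorb)
  then show ?thesis using birth_time_ge[OF assms(1,2), of x] by (simp add: death_time_def)
qed

text \<open>If points coincide there are at most \<open>k + 1\<close> vertices, too few for a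
  nonzero \<open>k\<close>-cycle, and death does not come after birth. Otherwise a nonzero cycle
  needs all facets, the cycle space is then the line of the hollow simplex, and this line bounds
  exactly when the full simplex is present.\<close>

lemma h_ind_eq:
  fixes x :: "nat \<Rightarrow> 'a::euclidean_space" and F :: "'f::field itself"
  assumes k: "k \<ge> 1" and r: "0 \<le> r"
  shows "h_ind F k r x = (if ereal (birth_time x {0..k+1}) \<le> r \<and> r < ereal (death_time x {0..k+1}) then 1 else 0)"
proof -
  define Y where "Y = x ` {0..k+1}"
  define K where "K = cech Y r"
  let ?Z = "cycles k K :: ('a set \<Rightarrow> 'f) set" and ?B = "boundaries k K :: ('a set \<Rightarrow> 'f) set"
  have finY: "finite Y" by (simp add: Y_def)
  have K: "K = sublevel Y (cech_weight 1) r"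
    using cech_eq_sublevel[OF finY zero_less_one r] by (simp add: K_def one_ereal_def[symmetric])
  interpret weighted_points Y "cech_weight 1" by (rule weighted_points_cech[OF finY]) simp
  have finK: "finite K" unfolding K by (rule finite_sublevel)
  have KY: "w \<subseteq> Y" if "w \<in> K" for w using that by (auto simp: K sublevel_def)
  have supp: "w \<in> K \<and> card w = Suc k" if "c \<in> ?Z" "c w \<noteq> 0" for c w
    using that by (auto simp: cycles_def simplicial_chains_def)
  have betti: "betti F k K = chain_space.dim ?Z - chain_space.dim (?Z \<inter> ?B)"
    by (simp add: betti_def persistent_betti_def)
  have h: "h_ind F k r x = (if betti F k K = 1 then 1 else 0)"
    by (simp add: h_ind_def K_def Y_def)
  have dim0: "chain_space.dim V = 0" if "V \<subseteq> {0}" for V :: "('a set \<Rightarrow> 'f) set"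
  proof -
    have "V \<subseteq> chain_space.span {}" using that by simp
    then have "chain_space.dim V \<le> card ({} :: ('a set \<Rightarrow> 'f) set)" by (rule chain_space.dim_le_card) simp
    then show ?thesis by simp
  qed
  have zero: "betti F k K = 0" if "?Z \<subseteq> {0}"
    using dim0[OF that] by (simp add: betti)
  have faceE: "\<exists>u. u \<in> Y \<and> u \<notin> w" if c: "c \<in> ?Z" "c w \<noteq> 0" for c w
  proof -
    have "w \<noteq> {}" using supp[OF c] by auto
    then obtain v where "v \<in> w" by blast
    then obtain u where u: "u \<notin> w" "c (insert u (w - {v})) \<noteq> 0" using cycle_adjacent[OF c(1) k c(2)] by blast
    then have "insert u (w - {v}) \<subseteq> Y" using supp[OF c(1)] KY by blast
    then show ?thesis using u by blast
  qed
  show ?thesis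
  proof (cases "inj_on x {0..k+1}")
    case False
    then obtain i j where ij: "i \<in> {0..k+1}" "j \<in> {0..k+1}" "i \<noteq> j" "x i = x j" by (auto simp: inj_on_def)
    have "card Y \<noteq> card {0..k+1}" unfolding Y_def using False eq_card_imp_inj_on[of "{0..k+1}" x] by blast
    moreover have "card Y \<le> card {0..k+1}" unfolding Y_def by (rule card_image_le) simp
    ultimately have cY: "card Y \<le> k + 1" by simp
    have "c = 0" if c: "c \<in> ?Z" for c
    proof (rule ccontr)
      assume "c \<noteq> 0"
      then obtain w where s: "c w \<noteq> 0" by (auto simp: fun_eq_iff)
      obtain u where "u \<in> Y" "u \<notin> w" using faceE[OF c s] by blast
      then have "w \<subset> Y" using KY supp[OF c s] by blast
      then have "card w < card Y" by (rule psubset_card_mono[OF finY])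
      then show False using supp[OF c s] cY by simp
    qed
    then have Z: "?Z \<subseteq> {0}" by blast
    have "death_time x {0..k+1} \<le> birth_time x {0..k+1}"
      by (rule birth_ge_death_time[OF _ ij]) simp
    then have "\<not> (ereal (birth_time x {0..k+1}) \<le> r \<and> r < ereal (death_time x {0..k+1}))"
      by (metis ereal_less_eq(3) leD order_trans)
    then show ?thesis using zero[OF Z] h by simp
  next
    case True
    have cY: "card Y = k + 2" using card_image[OF True] by (simp add: Y_def)
    have bt: "birth_time x {0..k+1} = birth_time id Y" "death_time x {0..k+1} = death_time id Y"
      using birth_time_image[OF True] by (simp_all add: Y_def)
    have Yne: "Y - {v} \<noteq> {}" for v
    proof
      assume "Y - {v} = {}"
      then have "card Y \<le> card {v}" by (intro card_mono) auto
      with cY show False by simp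
    qed
    have Yne0: "Y \<noteq> {}" using Yne by blast
    have birth_iff: "ereal (birth_time id Y) \<le> r \<longleftrightarrow> (\<forall>v\<in>Y. Y - {v} \<in> K)"
    proof -
      have "ereal (birth_time id Y) \<le> r \<longleftrightarrow> (\<forall>v\<in>Y. ereal (2 * enclosing_radius (Y - {v})) \<le> r)"
      proof (cases r)
        case (real s)
        then show ?thesis unfolding birth_time_def using finY Yne0 by (simp add: Max_le_iff)
      qed (use r in auto)
      then show ?thesis using Yne by (simp add: K sublevel_def cech_weight_def)
    qed
    have Y_iff: "Y \<in> K \<longleftrightarrow> \<not> r < ereal (death_time id Y)"
      using Yne0 by (simp add: K sublevel_def cech_weight_def death_time_def not_less)
    have faces: "c (Y - {v}) \<noteq> 0" if c: "c \<in> ?Z" "c w \<noteq> 0" "v \<in> Y" for c w v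
    proof -
      obtain u where u: "u \<in> Y" "u \<notin> w" using faceE[OF c(1,2)] by blast
      have s: "w \<subseteq> Y - {u}" "card w = Suc k" using u KY supp[OF c(1,2)] by auto
      have "card (Y - {u}) = Suc k" using cY u finY by simp
      then have "w = Y - {u}" using s finY card_subset_eq[of "Y - {u}" w] by simp
      then show ?thesis using cycle_isolated_faces[OF c(1) k finY cY _ u(1) _ c(3)] KY c(2) by blast
    qed
    show ?thesis
    proof (cases "ereal (birth_time id Y) \<le> r")
      case False
      have "c = 0" if c: "c \<in> ?Z" for c
      proof (rule ccontr)
        assume "c \<noteq> 0"
        then obtain w where s: "c w \<noteq> 0" by (auto simp: fun_eq_iff)
        have "Y - {v} \<in> K" if "v \<in> Y" for v using supp[OF c faces[OF c s that]] by simp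
        then show False using False birth_iff by blast
      qed
      then have "?Z \<subseteq> {0}" by blast
      then show ?thesis using False zero h bt by simp
    next
      case b: True
      let ?z = "incidence Y :: 'a set \<Rightarrow> 'f"
      have Y0: "x 0 \<in> Y" by (simp add: Y_def)
      have z: "?z \<in> ?Z" using incidence_in_cycles[OF finY, of k K] cY b birth_iff by simp
      have zn: "?z (Y - {x 0}) \<noteq> 0" by (rule incidence_nonzero[OF finY Y0 Yne])
      then have "?z \<noteq> 0" by auto
      then have "chain_space.independent {?z}" by (simp add: chain_space.dependent_single)
      then have dz: "chain_space.dim {?z} = 1" by (simp add: chain_space.dim_eq_card_independent)
      \<comment> \<open>A cycle that vanishes on one facet of \<open>Y\<close> vanishes on all of
        them, so a single coordinate determines it.\<close>
      have "chain_space.dim ?Z \<le> card {Y - {x 0}}"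
      proof (rule dim_le_card_coordinates[OF subspace_cycles order_refl finK])
        fix c :: "'a set \<Rightarrow> 'f" assume c: "c \<in> ?Z" "\<And>w. w \<in> {Y - {x 0}} \<Longrightarrow> c w = 0"
        have "c w = 0" for w using faces[OF c(1) _ Y0, of w] c(2) by blast
        then show "c = 0" by (simp add: fun_eq_iff)
      qed simp
      moreover have "1 \<le> chain_space.dim ?Z" using dim_cycles_mono[OF finK, of "{?z}" ?Z k] z dz by simp
      ultimately have dZ: "chain_space.dim ?Z = 1" by simp
      show ?thesis
      proof (cases "Y \<in> K")
        case True
        have "?z \<in> ?B" by (rule incidence_in_boundaries[OF True]) (use cY in simp)
        then have "1 \<le> chain_space.dim (?Z \<inter> ?B)"
          using dim_cycles_mono[OF finK, of "{?z}" "?Z \<inter> ?B" k] z dz by simp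
        then have "betti F k K = 0" using betti dZ by simp
        then show ?thesis using h bt True Y_iff by simp
      next
        case False
        have "c \<tau> = 0" if "c \<in> ?B" for c \<tau>
        proof (rule boundaries_vanish[OF that])
          fix w assume "w \<in> K" "card w = Suc (Suc k)"
          then have "w = Y" using card_subset_eq[OF finY KY] cY by simp
          then show False using \<open>w \<in> K\<close> False by simp
        qed
        then have "?Z \<inter> ?B \<subseteq> {0}" by (auto simp: fun_eq_iff)
        then have "betti F k K = 1" using betti dZ dim0 by simp
        then show ?thesis using h bt False Y_iff b by simp
      qed
    qed
  qed
qed

text \<open>For \<open>t \<le> u\<close> the product of the indicators at \<open>t\<close> and
  \<open>u\<close> says that birth is at most \<open>t\<close> and death exceeds \<open>u\<close>.
  The four terms thus factor into a difference in the birth times a difference in the death.\<close>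

lemma H_ind_eq:
  fixes x :: "nat \<Rightarrow> 'a::euclidean_space"
  assumes k: "k \<ge> 1" and st: "0 \<le> s" "s \<le> t" "ereal t \<le> u" "u \<le> v"
  shows "H_ind F k (ereal s) (ereal t) u v x =
    (if s < birth_time x {0..k+1} \<and> birth_time x {0..k+1} \<le> t \<and> u < ereal (death_time x {0..k+1}) \<and> ereal (death_time x {0..k+1}) \<le> v then 1 else 0)"
proof -
  define b d where "b = ereal (birth_time x {0..k+1})" and "d = ereal (death_time x {0..k+1})"
  have s: "0 \<le> ereal s" "ereal s \<le> ereal t" using st by auto
  then have nn: "0 \<le> ereal t" "0 \<le> u" "0 \<le> v" using st order_trans by blast+
  have h: "h_ind F k r x = (if b \<le> r \<and> r < d then 1 else 0)" if "0 \<le> r" for r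
    unfolding b_def d_def by (rule h_ind_eq[OF k that])
  have b: "s < birth_time x {0..k+1} \<longleftrightarrow> \<not> b \<le> ereal s" "birth_time x {0..k+1} \<le> t \<longleftrightarrow> b \<le> ereal t"
    by (auto simp: b_def)
  have st': "b \<le> ereal s \<Longrightarrow> b \<le> ereal t" "b \<le> ereal t \<Longrightarrow> b \<le> u" "b \<le> u \<Longrightarrow> b \<le> v"
    "v < d \<Longrightarrow> u < d" "u < d \<Longrightarrow> ereal t < d" "ereal t < d \<Longrightarrow> ereal s < d"
    using s(2) st(3,4) by (meson order_trans le_less_trans)+
  show ?thesis
    unfolding H_ind_def h[OF s(1)] h[OF nn(1)] h[OF nn(2)] h[OF nn(3)] b d_def[symmetric] not_less[symmetric, of v d]
    using st' by (cases "b \<le> ereal s"; cases "b \<le> ereal t"; cases "v < d"; cases "u < d"; simp)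
qed

section \<open>The limit measure\<close>

definition origin_birth :: "nat \<Rightarrow> (nat \<Rightarrow> 'a::euclidean_space) \<Rightarrow> real" where
  "origin_birth k y = birth_time (y(0 := 0)) {0..k+1}"

definition origin_death :: "nat \<Rightarrow> (nat \<Rightarrow> 'a::euclidean_space) \<Rightarrow> real" where
  "origin_death k y = death_time (y(0 := 0)) {0..k+1}"

abbreviation tuple_space :: "'a::euclidean_space itself \<Rightarrow> nat \<Rightarrow> (nat \<Rightarrow> 'a) measure" where
  "tuple_space _ k \<equiv> PiM {1..k+1} (\<lambda>_. lborel)"

text \<open>Only tuples with birth before death are mapped into \<open>Delta_L\<close>. The others
  need not be negligible: in dimension at least 2 and for \<open>k = 1\<close>, an obtuse triangle
  is filled as soon as its longest edge appears.\<close>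

definition limit_measure :: "'a::euclidean_space itself \<Rightarrow> nat \<Rightarrow> real \<Rightarrow> (real \<times> ereal) measure" where
  "limit_measure _ k C = scale_measure (ennreal C)
    (distr (restrict_space (tuple_space TYPE('a) k) {y. origin_birth k y < origin_death k (y :: nat \<Rightarrow> 'a)})
      (restrict_space borel Delta_L) (\<lambda>y. (origin_birth k y, ereal (origin_death k y))))"

lemma origin_birth_nonneg: "k \<ge> 1 \<Longrightarrow> 0 \<le> origin_birth k y"
  unfolding origin_birth_def by (rule birth_time_nonneg) auto

lemma origin_measurable:
  shows "origin_birth k \<in> borel_measurable (tuple_space TYPE('a::euclidean_space) k)"
    and "origin_death k \<in> borel_measurable (tuple_space TYPE('a) k)"
proof -
  have m: "(\<lambda>y. (y(0 := 0)) i) \<in> borel_measurable (tuple_space TYPE('a) k)" if "i \<in> {0..k+1}" for i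
  proof (cases "i = 0")
    case False
    then have "i \<in> {1..k+1}" using that by auto
    from measurable_component_singleton[OF this, of "\<lambda>_. lborel :: 'a measure"] show ?thesis using False by simp
  qed simp
  from birth_time_measurable[of "{0..k+1}" "\<lambda>i y. (y(0 := 0)) i", OF _ _ m]
  show "origin_birth k \<in> borel_measurable (tuple_space TYPE('a::euclidean_space) k)"
    "origin_death k \<in> borel_measurable (tuple_space TYPE('a) k)"
    unfolding origin_birth_def[abs_def] origin_death_def[abs_def] by (simp_all add: fun_upd_def)
qed

lemma limit_measure_sets [simp, measurable_cong]:
  "sets (limit_measure TY k C) = sets (restrict_space borel Delta_L)"
  by (simp add: limit_measure_def)

lemma space_limit_measure [simp]: "space (limit_measure TY k C) = Delta_L"
  using sets_eq_imp_space_eq[OF limit_measure_sets] by (simp add: space_restrict_space)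

lemma nn_integral_limit_measure:
  assumes k: "k \<ge> 1" and \<phi>: "\<phi> \<in> borel_measurable (restrict_space borel Delta_L)"
  shows "(\<integral>\<^sup>+p. \<phi> p \<partial>limit_measure TYPE('a::euclidean_space) k C) =
    ennreal C * (\<integral>\<^sup>+y. (if origin_birth k y < origin_death k y then \<phi> (origin_birth k y, ereal (origin_death k y)) else 0) \<partial>tuple_space TYPE('a) k)"
proof -
  let ?N = "tuple_space TYPE('a) k"
  let ?S = "{y :: nat \<Rightarrow> 'a. origin_birth k y < origin_death k y}"
  let ?g = "\<lambda>y :: nat \<Rightarrow> 'a. (origin_birth k y, ereal (origin_death k y))"
  note [measurable] = origin_measurable[where 'a = 'a, of k]
  have S: "?S \<inter> space ?N \<in> sets ?N"
  proof -
    have "?S \<inter> space ?N = {y \<in> space ?N. origin_birth k y < origin_death k y}" by auto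
    also have "\<dots> \<in> sets ?N" by measurable
    finally show ?thesis .
  qed
  have g: "?g \<in> restrict_space ?N ?S \<rightarrow>\<^sub>M restrict_space borel Delta_L"
  proof (rule measurable_restrict_space2)
    show "?g \<in> space (restrict_space ?N ?S) \<rightarrow> Delta_L"
      using origin_birth_nonneg[OF k] by (auto simp: space_restrict_space Delta_L_def)
    have "?g \<in> ?N \<rightarrow>\<^sub>M borel \<Otimes>\<^sub>M borel"
      by (intro measurable_Pair borel_measurable_ereal origin_measurable)
    then show "?g \<in> borel_measurable (restrict_space ?N ?S)"
      by (intro measurable_restrict_space1) (simp add: borel_prod)
  qed
  have "(\<integral>\<^sup>+p. \<phi> p \<partial>limit_measure TYPE('a) k C) =
      ennreal C * (\<integral>\<^sup>+p. \<phi> p \<partial>distr (restrict_space ?N ?S) (restrict_space borel Delta_L) ?g)"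
    unfolding limit_measure_def by (rule nn_integral_scale_measure) (use \<phi> in simp)
  also have "(\<integral>\<^sup>+p. \<phi> p \<partial>distr (restrict_space ?N ?S) (restrict_space borel Delta_L) ?g) =
      (\<integral>\<^sup>+y. \<phi> (?g y) \<partial>restrict_space ?N ?S)"
    by (rule nn_integral_distr[OF g]) (use \<phi> in simp)
  also have "\<dots> = (\<integral>\<^sup>+y. \<phi> (?g y) * indicator ?S y \<partial>?N)"
    by (rule nn_integral_restrict_space[OF S])
  also have "\<dots> = (\<integral>\<^sup>+y. (if origin_birth k y < origin_death k y then \<phi> (?g y) else 0) \<partial>?N)"
    by (intro nn_integral_cong) (auto simp: indicator_def)
  finally show ?thesis .
qed

lemma nn_integral_limit_measure_time_integral:
  fixes \<phi> :: "real \<times> ereal \<Rightarrow> real"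
  assumes k: "k \<ge> 1" and \<phi>: "\<phi> \<in> borel_measurable (restrict_space borel Delta_L)"
  shows "(\<integral>\<^sup>+p. ennreal (\<phi> p) \<partial>limit_measure TYPE('a::euclidean_space) k C) =
    ennreal C * time_integral TYPE('a) (k + 1) (\<lambda>(b, d). if b < d then \<phi> (b, ereal d) else 0)"
proof -
  have "(\<lambda>p. ennreal (\<phi> p)) \<in> borel_measurable (restrict_space borel Delta_L)" using \<phi> by simp
  note eq = nn_integral_limit_measure[OF k this, where 'a = 'a, of C]
  show ?thesis
    unfolding eq time_integral_def origin_birth_def[symmetric] origin_death_def[symmetric]
    by (intro arg_cong2[where f = "(*)"] refl nn_integral_cong) simp
qed

text \<open>Only births are bounded on compact sets; deaths may reach \<open>\<infinity>\<close>,
  which belongs to \<open>Delta_L\<close>.\<close>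

lemma compact_Delta_L_bounded:
  assumes "compact K" "K \<subseteq> Delta_L"
  obtains T where "T > 0" "\<And>b d. (b, d) \<in> K \<Longrightarrow> b \<le> T"
proof -
  have "compact (fst ` K)" by (rule compact_continuous_image[OF _ assms(1)]) (intro continuous_intros)
  then have "bounded (fst ` K)" by (rule compact_imp_bounded)
  then obtain T where T: "\<And>x. x \<in> fst ` K \<Longrightarrow> norm x \<le> T" by (auto simp: bounded_iff)
  have "b \<le> max 1 T" if "(b, d) \<in> K" for b d
  proof -
    have "b \<in> fst ` K" using that by (rule rev_image_eqI) simp
    then show ?thesis using T[of b] by simp
  qed
  then show ?thesis using that[of "max 1 T"] by auto
qed

lemma compact_sets_Delta_L:
  assumes "compact K" "K \<subseteq> Delta_L"
  shows "K \<in> sets (restrict_space borel Delta_L)"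
  using assms by (auto simp: sets_restrict_space_iff Delta_L_borel borel_compact)

lemma radon_limit_measure:
  assumes k: "k \<ge> 1"
    and fin: "\<And>T. time_integral TYPE('a::euclidean_space) (k + 1) (\<lambda>(b, d). if b \<le> T then 1 else 0) < \<infinity>"
  shows "radon_measure_on Delta_L (limit_measure TYPE('a) k C)"
  unfolding radon_measure_on_def
proof (intro conjI allI impI)
  fix K :: "(real \<times> ereal) set" assume K: "compact K \<and> K \<subseteq> Delta_L"
  then obtain T where T: "T > 0" "\<And>b d. (b, d) \<in> K \<Longrightarrow> b \<le> T" using compact_Delta_L_bounded by metis
  have Ks: "K \<in> sets (restrict_space borel Delta_L)" using K compact_sets_Delta_L by blast
  have "emeasure (limit_measure TYPE('a) k C) K = (\<integral>\<^sup>+p. indicator K p \<partial>limit_measure TYPE('a) k C)"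
    using Ks by simp
  also have "\<dots> = ennreal C * (\<integral>\<^sup>+y. (if origin_birth k y < origin_death k y then indicator K (origin_birth k y, ereal (origin_death k y)) else 0) \<partial>tuple_space TYPE('a) k)"
    by (rule nn_integral_limit_measure[OF k]) (use Ks in simp)
  also have "\<dots> \<le> ennreal C * time_integral TYPE('a) (k + 1) (\<lambda>(b, d). if b \<le> T then 1 else 0)"
    unfolding time_integral_def origin_birth_def[symmetric] origin_death_def[symmetric]
    by (intro mult_left_mono nn_integral_mono) (use T in \<open>auto simp: indicator_def\<close>)
  also have "\<dots> < \<infinity>" using fin[of T] by (simp add: ennreal_mult_less_top)
  finally show "emeasure (limit_measure TYPE('a) k C) K < \<infinity>" .
qed simp

text \<open>\<open>H_ind\<close> is the indicator that the two times lie in the half-open rectangle.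
  The closed alternative for \<open>s = 0\<close> adds only births at time 0, which force two points
  to coincide; so the formula holds for all rectangles.\<close>

lemma limit_measure_rectangle:
  assumes k: "k \<ge> 1" and R: "is_rectangle s t u v R" and C: "0 \<le> C"
    and fin: "time_integral TYPE('a::euclidean_space) (k + 1) (\<lambda>(b, d). if b \<le> t then 1 else 0) < \<infinity>"
  shows "emeasure (limit_measure TYPE('a) k C) R =
    ennreal (C * (\<integral>y. H_ind F k (ereal s) (ereal t) u v (y(0 := 0)) \<partial>(\<Pi>\<^sub>M i\<in>{1..k+1}. (lborel :: 'a measure))))"
proof -
  let ?N = "tuple_space TYPE('a) k"
  have st: "0 \<le> s" "s \<le> t" "ereal t \<le> u" "u \<le> v" using R by (auto simp: is_rectangle_def)
  have R': "R = {s<..t} \<times> {u<..v} \<or> s = 0 \<and> R = {0..t} \<times> {u<..v}" using R by (simp add: is_rectangle_def)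
  have RD: "R \<subseteq> Delta_L"
  proof
    fix p assume p: "p \<in> R"
    obtain x y where xy: "p = (x, y)" by (cases p)
    have "0 \<le> x" "x \<le> t" "u < y" using p xy R' st by auto
    then have "ereal x \<le> ereal t" "u < y" "0 \<le> x" by auto
    then have "ereal x < y" using st(3) by (meson le_less_trans order_trans)
    then show "p \<in> Delta_L" using \<open>0 \<le> x\<close> xy by (simp add: Delta_L_def)
  qed
  have "{s<..t} \<times> {u<..v} \<in> sets (borel \<Otimes>\<^sub>M borel)" "{0..t} \<times> {u<..v} \<in> sets (borel \<Otimes>\<^sub>M borel)"
    by (intro pair_measureI; simp)+
  then have "{s<..t} \<times> {u<..v} \<in> sets borel" "{0..t} \<times> {u<..v} \<in> sets borel"
    unfolding borel_prod by simp_all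
  then have Rb: "R \<in> sets borel" using R' by blast
  have Rs: "R \<in> sets (restrict_space borel Delta_L)"
    using RD Rb Delta_L_borel by (simp add: sets_restrict_space_iff)
  interpret PL: product_sigma_finite "\<lambda>_ :: nat. lborel :: 'a measure" by unfold_locales
  \<comment> \<open>The point with index 1 differs from the pinned origin almost everywhere, and the
    birth time is at least their distance.\<close>
  have ae: "AE y in ?N. y 1 \<noteq> 0"
  proof (rule AE_I')
    have "(\<integral>\<^sup>+y. (\<Prod>i\<in>{1..k+1}. if i = 1 then indicator {0} (y i) else 1) \<partial>?N) =
        (\<Prod>i\<in>{1..k+1}. \<integral>\<^sup>+y. (if i = 1 then indicator {0::'a} y else 1) \<partial>lborel)"
      by (rule PL.product_nn_integral_prod) auto
    also have "\<dots> = 0" by (rule prod_zero) (auto intro!: bexI[of _ 1])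
    finally have 0: "(\<integral>\<^sup>+y. (\<Prod>i\<in>{1..k+1}. if i = 1 then indicator {0} (y i) else 1) \<partial>?N) = 0" .
    have m1: "(\<lambda>y. y 1) \<in> ?N \<rightarrow>\<^sub>M (lborel :: 'a measure)" by (rule measurable_component_singleton) simp
    have "(\<lambda>y. y 1) -` {0} \<inter> space ?N \<in> sets ?N" by (rule measurable_sets[OF m1]) simp
    moreover have "(\<lambda>y. y 1) -` {0} \<inter> space ?N = {y \<in> space ?N. y 1 = 0}" by auto
    ultimately have S: "{y \<in> space ?N. y 1 = 0} \<in> sets ?N" by (simp only:)
    have "emeasure ?N {y \<in> space ?N. y 1 = 0} = (\<integral>\<^sup>+y. indicator {y \<in> space ?N. y 1 = 0} y \<partial>?N)"
      by (rule nn_integral_indicator[OF S, symmetric])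
    also have "\<dots> \<le> (\<integral>\<^sup>+y. (\<Prod>i\<in>{1..k+1}. if i = 1 then indicator {0} (y i) else 1) \<partial>?N)"
    proof (rule nn_integral_mono)
      fix y :: "nat \<Rightarrow> 'a"
      show "indicator {y \<in> space ?N. y 1 = 0} y \<le> (\<Prod>i\<in>{1..k+1}. if i = 1 then indicator {0} (y i) else (1 :: ennreal))"
      proof (cases "y 1 = 0")
        case True
        then have "(\<Prod>i\<in>{1..k+1}. if i = 1 then indicator {0} (y i) else (1 :: ennreal)) = 1" by (intro prod.neutral) auto
        then show ?thesis by (simp add: indicator_def)
      qed (simp add: indicator_def)
    qed
    finally show "{y \<in> space ?N. y 1 = 0} \<in> null_sets ?N" using S 0 by (simp add: null_sets_def)
  qed auto
  have bpos: "0 < origin_birth k y" if "y 1 \<noteq> 0" for y :: "nat \<Rightarrow> 'a"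
  proof -
    have "diameter_le (y(0 := 0)) (origin_birth k y) {0..k+1}"
      unfolding origin_birth_def by (rule diameter_le_birth_time) (use k in auto)
    from this[unfolded diameter_le_def, rule_format, of 0 1] have "norm (y 1) \<le> origin_birth k y"
      by (simp add: dist_norm)
    moreover have "0 < norm (y 1)" using that by simp
    ultimately show ?thesis by linarith
  qed
  have H: "H_ind F k (ereal s) (ereal t) u v (y(0 := 0)) =
      (if s < origin_birth k y \<and> origin_birth k y \<le> t \<and> u < ereal (origin_death k y) \<and> ereal (origin_death k y) \<le> v then 1 else 0)" for y :: "nat \<Rightarrow> 'a"
    unfolding origin_birth_def origin_death_def by (rule H_ind_eq[OF k st])
  \<comment> \<open>The restriction of the limit measure to birth before death is automatic in a
    rectangle, because \<open>t \<le> u\<close>.\<close>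
  have lt: "b < d" if "b \<le> t" "u < ereal d" for b d
  proof -
    have "ereal b < ereal d" using that st(3) by (meson ereal_less_eq(3) le_less_trans order_trans)
    then show ?thesis by simp
  qed
  note [measurable] = origin_measurable[where 'a = 'a, of k]
  have Hm: "(\<lambda>y. H_ind F k (ereal s) (ereal t) u v (y(0 := 0))) \<in> borel_measurable ?N"
    unfolding H by measurable
  have "emeasure (limit_measure TYPE('a) k C) R = (\<integral>\<^sup>+p. indicator R p \<partial>limit_measure TYPE('a) k C)"
    using Rs by simp
  also have "\<dots> = ennreal C * (\<integral>\<^sup>+y. (if origin_birth k y < origin_death k y then indicator R (origin_birth k y, ereal (origin_death k y)) else 0) \<partial>?N)"
    by (rule nn_integral_limit_measure[OF k]) (use Rs in simp)
  also have "(\<integral>\<^sup>+y. (if origin_birth k y < origin_death k y then indicator R (origin_birth k y, ereal (origin_death k y)) else 0) \<partial>?N)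
      = (\<integral>\<^sup>+y. ennreal (H_ind F k (ereal s) (ereal t) u v (y(0 := 0))) \<partial>?N)"
  proof (rule nn_integral_cong_AE, use ae in eventually_elim)
    fix y :: "nat \<Rightarrow> 'a" assume "y 1 \<noteq> 0"
    then have b: "0 < origin_birth k y" by (rule bpos)
    have "(origin_birth k y, ereal (origin_death k y)) \<in> R \<longleftrightarrow>
        s < origin_birth k y \<and> origin_birth k y \<le> t \<and> u < ereal (origin_death k y) \<and> ereal (origin_death k y) \<le> v"
      using R' b by auto
    then show "(if origin_birth k y < origin_death k y then indicator R (origin_birth k y, ereal (origin_death k y)) else 0) =
        ennreal (H_ind F k (ereal s) (ereal t) u v (y(0 := 0)))"
      unfolding H indicator_def using lt[of "origin_birth k y" "origin_death k y"] by auto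
  qed
  also have "\<dots> = ennreal (\<integral>y. H_ind F k (ereal s) (ereal t) u v (y(0 := 0)) \<partial>?N)"
  proof (rule nn_integral_eq_integral)
    have "(\<integral>\<^sup>+y. ennreal (H_ind F k (ereal s) (ereal t) u v (y(0 := 0))) \<partial>?N) \<le>
        time_integral TYPE('a) (k + 1) (\<lambda>(b, d). if b \<le> t then 1 else 0)"
      unfolding time_integral_def H origin_birth_def[symmetric] origin_death_def[symmetric]
      by (intro nn_integral_mono) auto
    then have "(\<integral>\<^sup>+y. ennreal (H_ind F k (ereal s) (ereal t) u v (y(0 := 0))) \<partial>?N) < \<infinity>"
      using fin by (rule le_less_trans)
    then show "integrable ?N (\<lambda>y. H_ind F k (ereal s) (ereal t) u v (y(0 := 0)))"
      using Hm by (intro integrableI_nonneg) (auto simp: H)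
  qed (simp add: H)
  also have "ennreal C * \<dots> = ennreal (C * (\<integral>y. H_ind F k (ereal s) (ereal t) u v (y(0 := 0)) \<partial>?N))"
    by (rule ennreal_mult[symmetric]) (auto simp: C H intro!: Bochner_Integration.integral_nonneg)
  finally show ?thesis .
qed

section \<open>A Radon measure is determined by its integrals\<close>

text \<open>For \<open>t < u\<close> these sets are compact subsets of \<open>Delta_L\<close> that
  include infinite deaths. They are closed under intersection, and the rational ones cover
  \<open>Delta_L\<close>, so a Radon measure is determined by its finite values on them.\<close>

definition corner :: "real \<Rightarrow> real \<Rightarrow> (real \<times> ereal) set" where
  "corner t u = {0..t} \<times> {ereal u..\<infinity>}"

definition corners :: "(real \<times> ereal) set set" where
  "corners = {corner t u | t u. t < u}"

lemma compact_corner: "compact (corner t u)"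
  unfolding corner_def by (intro compact_Times compact_Icc) (simp add: compact_eq_closed)

lemma mem_corner: "p \<in> corner t u \<longleftrightarrow> 0 \<le> fst p \<and> fst p \<le> t \<and> ereal u \<le> snd p"
  by (cases p) (auto simp: corner_def)

lemma mem_Delta_L: "p \<in> Delta_L \<longleftrightarrow> 0 \<le> fst p \<and> ereal (fst p) < snd p"
  by (cases p) (simp add: Delta_L_def)

lemma corner_subset:
  assumes "t < u"
  shows "corner t u \<subseteq> Delta_L"
proof
  fix p assume "p \<in> corner t u"
  then have p: "0 \<le> fst p" "fst p \<le> t" "ereal u \<le> snd p" by (auto simp: mem_corner)
  then have "ereal (fst p) < ereal u" using assms by simp
  then have "ereal (fst p) < snd p" using p(3) by (rule less_le_trans)
  then show "p \<in> Delta_L" using p by (simp add: mem_Delta_L)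
qed

lemma ereal_max_le_iff: "ereal (max a b) \<le> y \<longleftrightarrow> ereal a \<le> y \<and> ereal b \<le> y"
proof (cases "a \<le> b")
  case True
  then have "ereal a \<le> ereal b" by simp
  from order_trans[OF this, of y] show ?thesis using True by (auto simp: max_def)
next
  case False
  then have "ereal b \<le> ereal a" by simp
  from order_trans[OF this, of y] show ?thesis using False by (auto simp: max_def)
qed

lemma corners_Int_stable: "Int_stable corners"
proof (rule Int_stableI)
  fix A B assume "A \<in> corners" "B \<in> corners"
  then obtain t u t' u' where *: "A = corner t u" "t < u" "B = corner t' u'" "t' < u'" by (auto simp: corners_def)
  have "A \<inter> B = corner (min t t') (max u u')"
    unfolding * by (intro set_eqI) (auto simp: mem_corner ereal_max_le_iff simp del: ereal_max)
  moreover have "min t t' < max u u'" using * by linarith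
  ultimately show "A \<inter> B \<in> corners" unfolding corners_def by blast
qed

abbreviation rational_pairs :: "(real \<times> real) set" where
  "rational_pairs \<equiv> {(t, u). t \<in> \<rat> \<and> u \<in> \<rat> \<and> t < u}"

lemma countable_rational_pairs: "countable rational_pairs"
  by (rule countable_subset[of _ "\<rat> \<times> \<rat>"]) (auto simp: countable_rat)

lemma rational_corner:
  assumes "p \<in> Delta_L"
  obtains t u where "(t, u) \<in> rational_pairs" "p \<in> corner t u"
proof -
  have p: "0 \<le> fst p" "ereal (fst p) < snd p" using assms by (auto simp: mem_Delta_L)
  obtain z where z: "ereal (fst p) < ereal z" "ereal z < snd p" using p(2) ereal_dense2 by blast
  obtain t where t: "t \<in> \<rat>" "fst p < t" "t < z" using Rats_dense_in_real[of "fst p" z] z by auto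
  obtain u where u: "u \<in> \<rat>" "t < u" "u < z" using Rats_dense_in_real[of t z] t by auto
  have "ereal u \<le> ereal z" using u by simp
  then have "ereal u \<le> snd p" using z(2) by (meson less_imp_le order_trans)
  then have "p \<in> corner t u" using p t by (simp add: mem_corner)
  then show ?thesis using that t u by blast
qed

text \<open>Each half-space condition on a coordinate is a countable union of pieces cut out of
  rational corners; hence both coordinates are measurable for the generated sigma-algebra, and so is
  the identity.\<close>

lemma sets_Delta_L_corners: "sets (restrict_space borel Delta_L) = sigma_sets Delta_L corners"
proof
  have corners_sub: "corners \<subseteq> Pow Delta_L" using corner_subset by (auto simp: corners_def)
  let ?S = "sigma Delta_L corners"
  have sp: "space ?S = Delta_L" "sets ?S = sigma_sets Delta_L corners"
    using corners_sub by (simp_all add: space_measure_of sets_measure_of)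
  have mem: "corner t u \<in> sets ?S" if "t < u" for t u
    unfolding sp(2) using that by (intro sigma_sets.Basic) (auto simp: corners_def)
  have fst_meas: "fst \<in> borel_measurable ?S"
    unfolding borel_measurable_iff_le
  proof
    fix a :: real
    have "{p \<in> space ?S. fst p \<le> a} = (\<Union>tu\<in>rational_pairs. corner (min (fst tu) a) (snd tu))"
    proof (intro set_eqI iffI)
      fix p assume p: "p \<in> {p \<in> space ?S. fst p \<le> a}"
      then have "p \<in> Delta_L" using sp by simp
      then obtain t u where tu: "(t, u) \<in> rational_pairs" "p \<in> corner t u" by (rule rational_corner)
      then have "p \<in> corner (min t a) u" using p by (auto simp: mem_corner)
      with tu(1) show "p \<in> (\<Union>tu\<in>rational_pairs. corner (min (fst tu) a) (snd tu))"
        by (intro UN_I[of "(t, u)"]) auto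
    next
      fix p assume "p \<in> (\<Union>tu\<in>rational_pairs. corner (min (fst tu) a) (snd tu))"
      then obtain t u where tu: "t < u" "p \<in> corner (min t a) u" by auto
      then have "p \<in> Delta_L" using corner_subset[of "min t a" u] by (simp add: min.strict_coboundedI1) blast
      then show "p \<in> {p \<in> space ?S. fst p \<le> a}" using sp tu by (simp add: mem_corner)
    qed
    also have "\<dots> \<in> sets ?S"
    proof (rule sets.countable_UN'[OF countable_rational_pairs])
      have "corner (min (fst tu) a) (snd tu) \<in> sets ?S" if "tu \<in> rational_pairs" for tu
        by (rule mem) (use that in auto)
      then show "(\<lambda>tu. corner (min (fst tu) a) (snd tu)) ` rational_pairs \<subseteq> sets ?S" by blast
    qed
    finally show "{p \<in> space ?S. fst p \<le> a} \<in> sets ?S" .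
  qed
  have snd_meas: "snd \<in> borel_measurable ?S"
  proof (rule borel_measurableI_ge)
    fix a :: ereal
    have "{p \<in> space ?S. a \<le> snd p} = (\<Union>tu\<in>rational_pairs. corner (fst tu) (snd tu) \<inter> {p \<in> space ?S. a \<le> snd p})"
    proof (intro set_eqI iffI)
      fix p assume p: "p \<in> {p \<in> space ?S. a \<le> snd p}"
      then have "p \<in> Delta_L" using sp by simp
      then obtain t u where tu: "(t, u) \<in> rational_pairs" "p \<in> corner t u" by (rule rational_corner)
      with p show "p \<in> (\<Union>tu\<in>rational_pairs. corner (fst tu) (snd tu) \<inter> {p \<in> space ?S. a \<le> snd p})"
        by (intro UN_I[of "(t, u)"]) auto
    qed blast
    also have "\<dots> \<in> sets ?S"
    proof (rule sets.countable_UN'[OF countable_rational_pairs])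
      \<comment> \<open>The slice of infinite deaths is not a corner itself but the intersection of
        the corners with lower bounds \<open>n\<close>.\<close>
      have inf: "corner t u \<inter> {p \<in> space ?S. \<infinity> \<le> snd p} \<in> sets ?S" if "t < u" for t u
      proof -
        have "corner t u \<inter> {p \<in> space ?S. \<infinity> \<le> snd p} = (\<Inter>n :: nat. corner t (max u (real n)))"
        proof (intro set_eqI iffI)
          fix p assume "p \<in> (\<Inter>n :: nat. corner t (max u (real n)))"
          then have "p \<in> corner t (max u (real n))" for n :: nat by blast
          then have p: "ereal u \<le> snd p" "ereal (real n) \<le> snd p" "p \<in> corner t u" for n :: nat
            unfolding mem_corner ereal_max_le_iff by blast+
          have "snd p = \<infinity>"
          proof (cases "snd p")
            case (real r)
            then show ?thesis using p(2) reals_Archimedean2[of r] by (metis ereal_less_eq(3) not_less)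
          qed (use p(1) in auto)
          then show "p \<in> corner t u \<inter> {p \<in> space ?S. \<infinity> \<le> snd p}"
            using p(3) corner_subset[OF that] sp by auto
        next
          fix p assume "p \<in> corner t u \<inter> {p \<in> space ?S. \<infinity> \<le> snd p}"
          then show "p \<in> (\<Inter>n :: nat. corner t (max u (real n)))" by (auto simp: mem_corner)
        qed
        also have "\<dots> \<in> sets ?S"
        proof (rule sets.countable_INT)
          have "corner t (max u (real n)) \<in> sets ?S" for n :: nat by (rule mem) (use that in auto)
          then show "(\<lambda>n :: nat. corner t (max u (real n))) ` UNIV \<subseteq> sets ?S" by blast
        qed simp
        finally show ?thesis .
      qed
      have "corner (fst tu) (snd tu) \<inter> {p \<in> space ?S. a \<le> snd p} \<in> sets ?S" if tu: "tu \<in> rational_pairs" for tu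
      proof -
        have lt: "fst tu < snd tu" using tu by auto
        have sub: "p \<in> space ?S" if "p \<in> corner (fst tu) (snd tu)" for p
          using that corner_subset[OF lt] sp by auto
        show ?thesis
        proof (cases a)
          case (real r)
          have "corner (fst tu) (snd tu) \<inter> {p \<in> space ?S. a \<le> snd p} = corner (fst tu) (max (snd tu) r)"
            using sub real by (auto simp: mem_corner ereal_max_le_iff simp del: ereal_max)
          then show ?thesis using mem[of "fst tu" "max (snd tu) r"] lt by simp
        next
          case PInf
          then show ?thesis using inf[OF lt] by simp
        next
          case MInf
          then have "corner (fst tu) (snd tu) \<inter> {p \<in> space ?S. a \<le> snd p} = corner (fst tu) (snd tu)" using sub by auto
          then show ?thesis using mem[OF lt] by simp
        qed
      qed
      then show "(\<lambda>tu. corner (fst tu) (snd tu) \<inter> {p \<in> space ?S. a \<le> snd p}) ` rational_pairs \<subseteq> sets ?S" by blast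
    qed
    finally show "{p \<in> space ?S. a \<le> snd p} \<in> sets ?S" .
  qed
  have "(\<lambda>p. (fst p, snd p)) \<in> ?S \<rightarrow>\<^sub>M borel \<Otimes>\<^sub>M borel"
    using fst_meas snd_meas by (rule measurable_Pair)
  then have id_meas: "(\<lambda>p. p) \<in> borel_measurable ?S" by (simp add: borel_prod)
  show "sets (restrict_space borel Delta_L) \<subseteq> sigma_sets Delta_L corners"
  proof
    fix A :: "(real \<times> ereal) set" assume "A \<in> sets (restrict_space borel Delta_L)"
    then obtain B where B: "B \<in> sets borel" "A = Delta_L \<inter> B" by (auto simp: sets_restrict_space)
    have "(\<lambda>p. p) -` B \<inter> space ?S \<in> sets ?S" by (rule measurable_sets[OF id_meas B(1)])
    then show "A \<in> sigma_sets Delta_L corners" using B(2) sp by (simp add: Int_commute)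
  qed
  show "sigma_sets Delta_L corners \<subseteq> sets (restrict_space borel Delta_L)"
  proof -
    have "corners \<subseteq> sets (restrict_space borel Delta_L)"
      using compact_sets_Delta_L compact_corner corner_subset by (auto simp: corners_def)
    then show ?thesis
      using sets.sigma_sets_subset[of corners "restrict_space borel Delta_L"] by (simp add: space_restrict_space)
  qed
qed

text \<open>Continuous cut-offs around the corner. Widening it by a third of the gap on either side
  keeps it inside \<open>Delta_L\<close>, so the supports lie in one common compact set.\<close>

lemma corner_bump:
  assumes tu: "t < u"
  shows "\<exists>\<phi> :: nat \<Rightarrow> real \<times> ereal \<Rightarrow> real. (\<forall>n. continuous_on Delta_L (\<phi> n)) \<and>
    (\<forall>n. \<forall>p\<in>Delta_L. 0 \<le> \<phi> n p \<and> \<phi> n p \<le> 1) \<and>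
    (\<forall>n. \<forall>p\<in>Delta_L - corner (t + (u - t) / 3) (u - (u - t) / 3). \<phi> n p = 0) \<and>
    (\<forall>p\<in>Delta_L. (\<lambda>n. \<phi> n p) \<longlonglongrightarrow> indicator (corner t u) p)"
proof -
  \<comment> \<open>Slopes of at least \<open>3 / (u - t)\<close> make both ramps reach 0 within a
    third of the gap.\<close>
  define c where "c n = (real n + 3) / (u - t)" for n :: nat
  have c: "0 < c n" "3 \<le> c n * (u - t)" for n using tu by (simp_all add: c_def)
  \<comment> \<open>Deaths are truncated at \<open>u\<close>, beyond which the bump is constant in
    the death; this gives a real-valued continuous function also at infinite deaths.\<close>
  define m where "m p = real_of_ereal (min (snd p) (ereal u))" for p :: "real \<times> ereal"
  define \<phi> where "\<phi> n p = max 0 (1 - c n * max 0 (fst p - t)) * max 0 (1 - c n * (u - m p))" for n p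
  have fin: "\<bar>min (snd p) (ereal u)\<bar> \<noteq> \<infinity>" if "p \<in> Delta_L" for p
    using that by (cases "snd p") (auto simp: mem_Delta_L min_def)
  have m_real: "ereal (m p) = min (snd p) (ereal u)" if "p \<in> Delta_L" for p
    unfolding m_def using fin[OF that] by (simp add: ereal_real)
  have mu: "m p \<le> u" if "p \<in> Delta_L" for p
  proof -
    have "ereal (m p) \<le> ereal u" unfolding m_real[OF that] by simp
    then show ?thesis by simp
  qed
  have m_ge: "a \<le> m p \<Longrightarrow> ereal a \<le> snd p" if "p \<in> Delta_L" for p a
  proof -
    assume "a \<le> m p"
    then have "ereal a \<le> min (snd p) (ereal u)" unfolding m_real[OF that, symmetric] by simp
    then show ?thesis by simp
  qed
  have m_eq: "m p = u \<longleftrightarrow> ereal u \<le> snd p" if "p \<in> Delta_L" for p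
  proof
    assume "ereal u \<le> snd p"
    then have "ereal (m p) = ereal u" unfolding m_real[OF that] by simp
    then show "m p = u" by simp
  qed (use m_ge[OF that, of u] in simp)
  have "continuous_on Delta_L m"
    unfolding m_def
  proof (rule continuous_on_compose2[OF continuous_on_real])
    show "continuous_on Delta_L (\<lambda>p. min (snd p) (ereal u))" by (intro continuous_intros)
    show "(\<lambda>p. min (snd p) (ereal u)) ` Delta_L \<subseteq> UNIV - {\<infinity>, -\<infinity>}"
    proof
      fix y assume "y \<in> (\<lambda>p. min (snd p) (ereal u)) ` Delta_L"
      then obtain p where "y = min (snd p) (ereal u)" "p \<in> Delta_L" by blast
      then have "\<bar>y\<bar> \<noteq> \<infinity>" using fin[of p] by simp
      then show "y \<in> UNIV - {\<infinity>, -\<infinity>}" by auto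
    qed
  qed
  then have cont: "continuous_on Delta_L (\<phi> n)" for n unfolding \<phi>_def by (intro continuous_intros)
  have bd: "0 \<le> \<phi> n p \<and> \<phi> n p \<le> 1" if "p \<in> Delta_L" for n p
  proof -
    have "0 \<le> c n * (u - m p)" "0 \<le> c n * max 0 (fst p - t)"
      using c(1)[of n] mu[OF that] by (auto intro!: mult_nonneg_nonneg)
    then show ?thesis unfolding \<phi>_def by (auto intro!: mult_le_one)
  qed
  have supp: "\<phi> n p = 0" if p: "p \<in> Delta_L - corner (t + (u - t) / 3) (u - (u - t) / 3)" for n p
  proof (rule ccontr)
    assume "\<phi> n p \<noteq> 0"
    then have 1: "c n * max 0 (fst p - t) < 1" "c n * (u - m p) < 1"
      unfolding \<phi>_def by (auto simp: max_def split: if_splits)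
    have *: "y \<le> (u - t) / 3" if "c n * y < 1" for y
    proof (rule ccontr)
      assume "\<not> ?thesis"
      then have "c n * ((u - t) / 3) < c n * y" using c(1)[of n] by simp
      then show False using that c(2)[of n] by simp
    qed
    have "fst p \<le> t + (u - t) / 3" using *[OF 1(1)] by linarith
    moreover have "u - (u - t) / 3 \<le> m p" using *[OF 1(2)] by linarith
    then have "ereal (u - (u - t) / 3) \<le> snd p" using m_ge p by blast
    moreover have "0 \<le> fst p" using p by (simp add: mem_Delta_L)
    ultimately show False using p by (simp add: mem_corner)
  qed
  have lim: "(\<lambda>n. \<phi> n p) \<longlonglongrightarrow> indicator (corner t u) p" if p: "p \<in> Delta_L" for p
  proof (cases "p \<in> corner t u")
    case True
    then have "fst p \<le> t" "m p = u" using m_eq[OF p] by (auto simp: mem_corner)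
    then have "\<phi> n p = 1" for n unfolding \<phi>_def by simp
    then show ?thesis using True by simp
  next
    case False
    then have "fst p > t \<or> \<not> ereal u \<le> snd p" using p by (auto simp: mem_corner mem_Delta_L)
    then have *: "fst p - t > 0 \<or> u - m p > 0" using m_eq[OF p] mu[OF p] by auto
    have ev: "eventually (\<lambda>n. 1 \<le> c n * y) sequentially" if y: "y > 0" for y
    proof -
      obtain N :: nat where N: "(u - t) / y < real N" using reals_Archimedean2 by blast
      have "1 \<le> c n * y" if "n \<ge> N" for n
      proof -
        have "(u - t) / y < real n + 3" using N that by simp
        then show ?thesis using y tu by (simp add: c_def field_simps)
      qed
      then show ?thesis unfolding eventually_sequentially by blast
    qed
    from * have "eventually (\<lambda>n. \<phi> n p = 0) sequentially"
    proof
      assume "fst p - t > 0"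
      from ev[OF this] show ?thesis
        by (rule eventually_mono) (use \<open>fst p - t > 0\<close> in \<open>simp add: \<phi>_def max_def\<close>)
    next
      assume "u - m p > 0"
      from ev[OF this] show ?thesis by (rule eventually_mono) (simp add: \<phi>_def max_def)
    qed
    then have "(\<lambda>n. \<phi> n p) \<longlonglongrightarrow> 0" by (rule tendsto_eventually)
    then show ?thesis using False by simp
  qed
  show ?thesis using cont bd supp lim by (intro exI[of _ \<phi>] conjI allI ballI) auto
qed

text \<open>Dominated convergence along the bumps recovers the measure of every corner, and corners
  form an intersection-stable generator with a countable cover of finite measure.\<close>

theorem radon_measure_eqI:
  assumes \<mu>: "radon_measure_on Delta_L \<mu>" and \<nu>: "radon_measure_on Delta_L \<nu>"
    and eq: "\<And>\<phi> :: real \<times> ereal \<Rightarrow> real. continuous_on Delta_L \<phi> \<Longrightarrow> (\<forall>p\<in>Delta_L. 0 \<le> \<phi> p) \<Longrightarrow>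
      (\<exists>K. compact K \<and> K \<subseteq> Delta_L \<and> (\<forall>p\<in>Delta_L - K. \<phi> p = 0)) \<Longrightarrow> (\<integral>p. \<phi> p \<partial>\<mu>) = (\<integral>p. \<phi> p \<partial>\<nu>)"
  shows "\<mu> = \<nu>"
proof (rule measure_eqI_generator_eq_countable[of corners Delta_L \<mu> \<nu>])
  let ?Q = "(\<lambda>tu. corner (fst tu) (snd tu)) ` rational_pairs"
  have sets: "sets \<mu> = sets (restrict_space borel Delta_L)" "sets \<nu> = sets (restrict_space borel Delta_L)"
    using \<mu> \<nu> by (auto simp: radon_measure_on_def)
  then show "sets \<mu> = sigma_sets Delta_L corners" "sets \<nu> = sigma_sets Delta_L corners"
    by (simp_all add: sets_Delta_L_corners)
  show "Int_stable corners" by (rule corners_Int_stable)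
  show "corners \<subseteq> Pow Delta_L" using corner_subset by (auto simp: corners_def)
  show "?Q \<subseteq> corners" unfolding corners_def by fastforce
  show "countable ?Q" by (rule countable_image[OF countable_rational_pairs])
  show "\<Union>?Q = Delta_L"
  proof
    show "\<Union>?Q \<subseteq> Delta_L"
    proof
      fix p assume "p \<in> \<Union>?Q"
      then obtain tu where "tu \<in> rational_pairs" "p \<in> corner (fst tu) (snd tu)" by blast
      then show "p \<in> Delta_L" using corner_subset[of "fst tu" "snd tu"] by auto
    qed
    show "Delta_L \<subseteq> \<Union>?Q"
    proof
      fix p assume "p \<in> Delta_L"
      then obtain t u where "(t, u) \<in> rational_pairs" "p \<in> corner t u" by (rule rational_corner)
      then show "p \<in> \<Union>?Q" by (intro UnionI[of "corner t u"] image_eqI[of _ _ "(t, u)"]) auto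
    qed
  qed
  have finc: "emeasure \<mu> (corner t u) < \<infinity>" "emeasure \<nu> (corner t u) < \<infinity>" if "t < u" for t u
    using \<mu> \<nu> compact_corner corner_subset[OF that] by (auto simp: radon_measure_on_def)
  show "emeasure \<mu> A \<noteq> \<infinity>" if A: "A \<in> ?Q" for A
  proof -
    obtain tu where "tu \<in> rational_pairs" "A = corner (fst tu) (snd tu)" using A by blast
    then show ?thesis using finc(1)[of "fst tu" "snd tu"] by auto
  qed
  fix A assume "A \<in> corners"
  then obtain t u where A: "A = corner t u" "t < u" by (auto simp: corners_def)
  let ?L = "corner (t + (u - t) / 3) (u - (u - t) / 3)"
  obtain \<phi> :: "nat \<Rightarrow> real \<times> ereal \<Rightarrow> real" where b: "\<And>n. continuous_on Delta_L (\<phi> n)"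
    "\<And>n p. p \<in> Delta_L \<Longrightarrow> 0 \<le> \<phi> n p \<and> \<phi> n p \<le> 1"
    "\<And>n p. p \<in> Delta_L - ?L \<Longrightarrow> \<phi> n p = 0"
    "\<And>p. p \<in> Delta_L \<Longrightarrow> (\<lambda>n. \<phi> n p) \<longlonglongrightarrow> indicator (corner t u) p"
    using corner_bump[OF A(2)] by blast
  have L: "t + (u - t) / 3 < u - (u - t) / 3" using A(2) by (simp add: field_simps)
  have lim: "(\<lambda>n. \<integral>p. \<phi> n p \<partial>m) \<longlonglongrightarrow> measure m (corner t u)"
    if m: "radon_measure_on Delta_L m" for m
  proof -
    have sm: "sets m = sets (restrict_space borel Delta_L)" using m by (simp add: radon_measure_on_def)
    have spm: "space m = Delta_L" using sets_eq_imp_space_eq[OF sm] by (simp add: space_restrict_space)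
    have C: "corner t' u' \<in> sets m" if "t' < u'" for t' u'
      unfolding sm by (rule compact_sets_Delta_L[OF compact_corner corner_subset[OF that]])
    have finm: "emeasure m ?L < \<infinity>"
      using m compact_corner corner_subset[OF L] by (auto simp: radon_measure_on_def)
    have "(\<lambda>n. \<integral>p. \<phi> n p \<partial>m) \<longlonglongrightarrow> (\<integral>p. indicator (corner t u) p \<partial>m)"
    proof (rule integral_dominated_convergence[where w = "indicator ?L"])
      show "(\<lambda>p. indicator (corner t u) p :: real) \<in> borel_measurable m" using C[OF A(2)] by simp
      show "\<phi> n \<in> borel_measurable m" for n
        using borel_measurable_continuous_on_restrict[OF b(1)] by (simp add: measurable_cong_sets[OF sm refl])
      show "integrable m (indicator ?L :: _ \<Rightarrow> real)"
        using C[OF L] finm by (intro integrable_real_indicator)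
      show "AE p in m. (\<lambda>n. \<phi> n p) \<longlonglongrightarrow> indicator (corner t u) p"
        using b(4) by (intro AE_I2) (simp add: spm)
      show "AE p in m. norm (\<phi> n p) \<le> indicator ?L p" for n
      proof (rule AE_I2)
        fix p assume "p \<in> space m"
        then show "norm (\<phi> n p) \<le> indicator ?L p"
          using b(2)[of p n] b(3)[of p n] by (cases "p \<in> ?L") (auto simp: spm)
      qed
    qed
    then show ?thesis using C[OF A(2)] by simp
  qed
  have "(\<integral>p. \<phi> n p \<partial>\<mu>) = (\<integral>p. \<phi> n p \<partial>\<nu>)" for n
  proof (rule eq[OF b(1)])
    show "\<forall>p\<in>Delta_L. 0 \<le> \<phi> n p" using b(2) by blast
    show "\<exists>K. compact K \<and> K \<subseteq> Delta_L \<and> (\<forall>p\<in>Delta_L - K. \<phi> n p = 0)"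
      using b(3) compact_corner corner_subset[OF L] by (intro exI[of _ ?L]) auto
  qed
  then have "(\<lambda>n. \<integral>p. \<phi> n p \<partial>\<mu>) \<longlonglongrightarrow> measure \<nu> (corner t u)" using lim[OF \<nu>] by simp
  then have "measure \<mu> (corner t u) = measure \<nu> (corner t u)" by (rule LIMSEQ_unique[OF lim[OF \<mu>]])
  then show "emeasure \<mu> A = emeasure \<nu> A"
    using finc[OF A(2)] unfolding A(1) by (simp add: emeasure_eq_ennreal_measure less_top)
qed

section \<open>Mean measures\<close>

lemma (in prob_space)
  fixes S :: "'s::topological_space set"
  assumes \<xi>: "random_measure_on M S \<xi>"
  shows sets_mean_measure: "sets (mean_measure M S \<xi>) = sets (restrict_space borel S)"
    and emeasure_mean_measure: "B \<in> sets (restrict_space borel S) \<Longrightarrow> emeasure (mean_measure M S \<xi>) B = (\<integral>\<^sup>+x. emeasure (\<xi> x) B \<partial>M)"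
    and nn_integral_random_measure_measurable: "g \<in> borel_measurable (restrict_space borel S) \<Longrightarrow>
      (\<lambda>x. \<integral>\<^sup>+p. g p \<partial>\<xi> x) \<in> borel_measurable M"
    and nn_integral_mean_measure: "g \<in> borel_measurable (restrict_space borel S) \<Longrightarrow>
      (\<integral>\<^sup>+p. g p \<partial>mean_measure M S \<xi>) = (\<integral>\<^sup>+x. (\<integral>\<^sup>+p. g p \<partial>\<xi> x) \<partial>M)"
proof -
  let ?R = "restrict_space borel S :: 's measure"
  let ?m = "mean_measure M S \<xi>"
  have sp: "space ?R = S" by (simp add: space_restrict_space)
  have sa: "sigma_algebra S (sets ?R)" using sets.sigma_algebra_axioms[of ?R] by (simp add: sp)
  have s\<xi>: "sets (\<xi> x) = sets ?R" if "x \<in> space M" for x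
    using \<xi> that by (simp add: random_measure_on_def radon_measure_on_def)
  have me: "(\<lambda>x. emeasure (\<xi> x) B) \<in> borel_measurable M" if "B \<in> sets ?R" for B
    using \<xi> that by (simp add: random_measure_on_def)
  show sm: "sets ?m = sets ?R"
    unfolding mean_measure_def by (rule sigma_algebra.sets_measure_of_eq[OF sa])
  show em: "emeasure ?m B = (\<integral>\<^sup>+x. emeasure (\<xi> x) B \<partial>M)" if B: "B \<in> sets ?R" for B
    unfolding mean_measure_def
  proof (rule emeasure_measure_of_sigma[OF sa _ _ B])
    show "positive (sets ?R) (\<lambda>B. \<integral>\<^sup>+x. emeasure (\<xi> x) B \<partial>M)" by (simp add: positive_def)
    show "countably_additive (sets ?R) (\<lambda>B. \<integral>\<^sup>+x. emeasure (\<xi> x) B \<partial>M)"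
    proof (rule countably_additiveI)
      fix A :: "nat \<Rightarrow> 's set" assume A: "range A \<subseteq> sets ?R" "disjoint_family A" "\<Union>(range A) \<in> sets ?R"
      have "(\<Sum>i. \<integral>\<^sup>+x. emeasure (\<xi> x) (A i) \<partial>M) = (\<integral>\<^sup>+x. (\<Sum>i. emeasure (\<xi> x) (A i)) \<partial>M)"
        by (rule nn_integral_suminf[symmetric]) (use me A in auto)
      also have "\<dots> = (\<integral>\<^sup>+x. emeasure (\<xi> x) (\<Union>(range A)) \<partial>M)"
        by (intro nn_integral_cong suminf_emeasure) (use A s\<xi> in auto)
      finally show "(\<Sum>i. \<integral>\<^sup>+x. emeasure (\<xi> x) (A i) \<partial>M) = (\<integral>\<^sup>+x. emeasure (\<xi> x) (\<Union>(range A)) \<partial>M)" .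
    qed
  qed
  \<comment> \<open>Measurability and the exchange of integrals are proved in one induction, because
    the sum and the limit in the second claim rely on the first.\<close>
  have *: "(\<lambda>x. \<integral>\<^sup>+p. g p \<partial>\<xi> x) \<in> borel_measurable M \<and> (\<integral>\<^sup>+p. g p \<partial>?m) = (\<integral>\<^sup>+x. (\<integral>\<^sup>+p. g p \<partial>\<xi> x) \<partial>M)"
    if "g \<in> borel_measurable ?R" for g
    using that
  proof (induction rule: borel_measurable_induct)
    case (cong f g)
    have e: "(\<integral>\<^sup>+p. f p \<partial>\<xi> x) = (\<integral>\<^sup>+p. g p \<partial>\<xi> x)" if "x \<in> space M" for x
      using cong(3) sets_eq_imp_space_eq[OF s\<xi>[OF that]] by (intro nn_integral_cong) auto
    have "(\<integral>\<^sup>+p. f p \<partial>?m) = (\<integral>\<^sup>+p. g p \<partial>?m)"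
      using cong(3) sets_eq_imp_space_eq[OF sm] by (intro nn_integral_cong) auto
    moreover have "(\<integral>\<^sup>+x. (\<integral>\<^sup>+p. f p \<partial>\<xi> x) \<partial>M) = (\<integral>\<^sup>+x. (\<integral>\<^sup>+p. g p \<partial>\<xi> x) \<partial>M)"
      by (intro nn_integral_cong e)
    moreover have "(\<lambda>x. \<integral>\<^sup>+p. f p \<partial>\<xi> x) \<in> borel_measurable M \<longleftrightarrow> (\<lambda>x. \<integral>\<^sup>+p. g p \<partial>\<xi> x) \<in> borel_measurable M"
      by (intro measurable_cong e)
    ultimately show ?case using cong(4) by simp
  next
    case (set A)
    have e: "(\<integral>\<^sup>+p. indicator A p \<partial>\<xi> x) = emeasure (\<xi> x) A" if "x \<in> space M" for x
      using set s\<xi>[OF that] by simp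
    have "(\<integral>\<^sup>+p. indicator A p \<partial>?m) = emeasure ?m A" using set sm by simp
    moreover have "(\<integral>\<^sup>+x. (\<integral>\<^sup>+p. indicator A p \<partial>\<xi> x) \<partial>M) = (\<integral>\<^sup>+x. emeasure (\<xi> x) A \<partial>M)"
      by (intro nn_integral_cong e)
    moreover have "(\<lambda>x. \<integral>\<^sup>+p. indicator A p \<partial>\<xi> x) \<in> borel_measurable M \<longleftrightarrow> (\<lambda>x. emeasure (\<xi> x) A) \<in> borel_measurable M"
      by (intro measurable_cong e)
    ultimately show ?case using me[OF set] em[OF set] by simp
  next
    case (mult u c)
    have e: "(\<integral>\<^sup>+p. c * u p \<partial>\<xi> x) = c * (\<integral>\<^sup>+p. u p \<partial>\<xi> x)" if "x \<in> space M" for x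
      using mult(2) by (intro nn_integral_cmult) (simp add: measurable_cong_sets[OF s\<xi>[OF that] refl])
    have "(\<integral>\<^sup>+p. c * u p \<partial>?m) = c * (\<integral>\<^sup>+p. u p \<partial>?m)"
      using mult(2) by (intro nn_integral_cmult) (simp add: measurable_cong_sets[OF sm refl])
    moreover have "(\<integral>\<^sup>+x. (\<integral>\<^sup>+p. c * u p \<partial>\<xi> x) \<partial>M) = (\<integral>\<^sup>+x. c * (\<integral>\<^sup>+p. u p \<partial>\<xi> x) \<partial>M)"
      by (intro nn_integral_cong e)
    moreover have "(\<lambda>x. \<integral>\<^sup>+p. c * u p \<partial>\<xi> x) \<in> borel_measurable M \<longleftrightarrow> (\<lambda>x. c * (\<integral>\<^sup>+p. u p \<partial>\<xi> x)) \<in> borel_measurable M"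
      by (intro measurable_cong e)
    moreover have "(\<lambda>x. c * (\<integral>\<^sup>+p. u p \<partial>\<xi> x)) \<in> borel_measurable M"
      using mult by (intro borel_measurable_times_ennreal) auto
    ultimately show ?case using mult by (simp add: nn_integral_cmult)
  next
    case (add u v)
    have e: "(\<integral>\<^sup>+p. v p + u p \<partial>\<xi> x) = (\<integral>\<^sup>+p. v p \<partial>\<xi> x) + (\<integral>\<^sup>+p. u p \<partial>\<xi> x)" if "x \<in> space M" for x
      using add by (intro nn_integral_add) (simp_all add: measurable_cong_sets[OF s\<xi>[OF that] refl])
    have "(\<integral>\<^sup>+p. v p + u p \<partial>?m) = (\<integral>\<^sup>+p. v p \<partial>?m) + (\<integral>\<^sup>+p. u p \<partial>?m)"
      using add by (intro nn_integral_add) (simp_all add: measurable_cong_sets[OF sm refl])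
    moreover have "(\<integral>\<^sup>+x. (\<integral>\<^sup>+p. v p + u p \<partial>\<xi> x) \<partial>M) = (\<integral>\<^sup>+x. (\<integral>\<^sup>+p. v p \<partial>\<xi> x) + (\<integral>\<^sup>+p. u p \<partial>\<xi> x) \<partial>M)"
      by (intro nn_integral_cong e)
    moreover have "(\<lambda>x. \<integral>\<^sup>+p. v p + u p \<partial>\<xi> x) \<in> borel_measurable M \<longleftrightarrow> (\<lambda>x. (\<integral>\<^sup>+p. v p \<partial>\<xi> x) + (\<integral>\<^sup>+p. u p \<partial>\<xi> x)) \<in> borel_measurable M"
      by (intro measurable_cong e)
    moreover have "(\<lambda>x. (\<integral>\<^sup>+p. v p \<partial>\<xi> x) + (\<integral>\<^sup>+p. u p \<partial>\<xi> x)) \<in> borel_measurable M"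
      using add by (intro borel_measurable_add) auto
    ultimately show ?case using add by (simp add: nn_integral_add)
  next
    case (seq U)
    have e: "(\<integral>\<^sup>+p. (SUP i. U i) p \<partial>\<xi> x) = (SUP i. \<integral>\<^sup>+p. U i p \<partial>\<xi> x)" if "x \<in> space M" for x
      unfolding SUP_apply using seq
      by (intro nn_integral_monotone_convergence_SUP) (simp_all add: measurable_cong_sets[OF s\<xi>[OF that] refl])
    have "(\<integral>\<^sup>+p. (SUP i. U i) p \<partial>?m) = (SUP i. \<integral>\<^sup>+p. U i p \<partial>?m)"
      unfolding SUP_apply using seq
      by (intro nn_integral_monotone_convergence_SUP) (simp_all add: measurable_cong_sets[OF sm refl])
    moreover have "(\<integral>\<^sup>+x. (\<integral>\<^sup>+p. (SUP i. U i) p \<partial>\<xi> x) \<partial>M) = (\<integral>\<^sup>+x. (SUP i. \<integral>\<^sup>+p. U i p \<partial>\<xi> x) \<partial>M)"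
      by (intro nn_integral_cong e)
    moreover have "(\<integral>\<^sup>+x. (SUP i. \<integral>\<^sup>+p. U i p \<partial>\<xi> x) \<partial>M) = (SUP i. \<integral>\<^sup>+x. (\<integral>\<^sup>+p. U i p \<partial>\<xi> x) \<partial>M)"
    proof (rule nn_integral_monotone_convergence_SUP)
      show "incseq (\<lambda>i x. \<integral>\<^sup>+p. U i p \<partial>\<xi> x)"
        using seq(3) by (auto intro!: nn_integral_mono simp: incseq_def le_fun_def)
    qed (use seq in blast)
    moreover have "(\<lambda>x. \<integral>\<^sup>+p. (SUP i. U i) p \<partial>\<xi> x) \<in> borel_measurable M \<longleftrightarrow> (\<lambda>x. SUP i. \<integral>\<^sup>+p. U i p \<partial>\<xi> x) \<in> borel_measurable M"
      by (intro measurable_cong e)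
    moreover have "(\<lambda>x. SUP i. \<integral>\<^sup>+p. U i p \<partial>\<xi> x) \<in> borel_measurable M"
      using seq by (intro borel_measurable_SUP) auto
    ultimately show ?case using seq by simp
  qed
  show "(\<lambda>x. \<integral>\<^sup>+p. g p \<partial>\<xi> x) \<in> borel_measurable M" if "g \<in> borel_measurable ?R" for g
    using *[OF that] by blast
  show "(\<integral>\<^sup>+p. g p \<partial>?m) = (\<integral>\<^sup>+x. (\<integral>\<^sup>+p. g p \<partial>\<xi> x) \<partial>M)" if "g \<in> borel_measurable ?R" for g
    using *[OF that] by blast
qed

section \<open>Uniform convergence for regularly varying sequences\<close>

text \<open>The set of factors for which the convergence is already uniform has nearly full measure, so it
  meets its dilation by \<open>m / n\<close>; this compares \<open>r m\<close> and \<open>r n\<close> through a common third index.\<close>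

lemma regularly_varying_uniform:
  fixes r :: "nat \<Rightarrow> real"
  assumes pos: "\<And>n. n \<ge> 1 \<Longrightarrow> 0 < r n"
    and rv: "\<And>c. c > 0 \<Longrightarrow> (\<lambda>n. r (nat \<lfloor>c * real n\<rfloor>) / r n) \<longlonglongrightarrow> c powr \<rho>"
    and \<epsilon>: "\<epsilon> > 0"
  shows "\<exists>N\<ge>1. \<forall>n\<ge>N. \<forall>m. n \<le> m \<longrightarrow> real m \<le> 6 / 5 * real n \<longrightarrow> \<bar>ln (r m) - ln (r n) - \<rho> * ln (real m / real n)\<bar> \<le> \<epsilon>"
proof -
  define P where "P n a \<longleftrightarrow> \<bar>ln (r (nat \<lfloor>a * real n\<rfloor>)) - ln (r n) - \<rho> * ln a\<bar> \<le> \<epsilon> / 2" for n a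
  \<comment> \<open>Factors for which the convergence is within \<open>\<epsilon> / 2\<close> from
    index \<open>Suc N\<close> on; these sets increase to \<open>{1..2}\<close>.\<close>
  define E where "E N = {a\<in>{1..2}. \<forall>n\<ge>Suc N. P n a}" for N :: nat
  have P_meas: "{a \<in> space lborel. P n a} \<in> sets lborel" for n
  proof -
    have "(\<lambda>a :: real. nat \<lfloor>a * real n\<rfloor>) \<in> borel \<rightarrow>\<^sub>M count_space UNIV" by measurable
    then have "(\<lambda>a :: real. ln (r (nat \<lfloor>a * real n\<rfloor>))) \<in> borel_measurable borel"
      by (rule measurable_compose) simp
    then show ?thesis unfolding P_def by measurable
  qed
  have E_meas: "E N \<in> sets lborel" for N
  proof -
    have "E N = {1..2} \<inter> (\<Inter>n\<in>{Suc N..}. {a \<in> space lborel. P n a})" by (auto simp: E_def)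
    also have "\<dots> \<in> sets lborel"
    proof (rule sets.Int)
      show "(\<Inter>n\<in>{Suc N..}. {a \<in> space lborel. P n a}) \<in> sets lborel"
        by (rule sets.countable_INT'') (use P_meas in auto)
    qed simp
    finally show ?thesis .
  qed
  have E_sub: "E N \<subseteq> {1..2}" for N by (auto simp: E_def)
  have union: "(\<Union>N. E N) = {1..2}"
  proof
    show "(\<Union>N. E N) \<subseteq> {1..2}" using E_sub by blast
    show "{1..2} \<subseteq> (\<Union>N. E N)"
    proof
      fix a :: real assume a: "a \<in> {1..2}"
      then have a1: "1 \<le> a" "0 < a" by auto
      have "(\<lambda>n. ln (r (nat \<lfloor>a * real n\<rfloor>) / r n)) \<longlonglongrightarrow> ln (a powr \<rho>)"
        by (rule tendsto_ln[OF rv]) (use a1 in auto)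
      then have "eventually (\<lambda>n. dist (ln (r (nat \<lfloor>a * real n\<rfloor>) / r n)) (ln (a powr \<rho>)) < \<epsilon> / 2) sequentially"
        using \<epsilon> by (intro tendstoD) auto
      then obtain N where N: "\<And>n. n \<ge> N \<Longrightarrow> dist (ln (r (nat \<lfloor>a * real n\<rfloor>) / r n)) (ln (a powr \<rho>)) < \<epsilon> / 2"
        by (auto simp: eventually_sequentially)
      have "P n a" if n: "n \<ge> Suc N" for n
      proof -
        have "1 * 1 \<le> a * real n" using a1 n by (intro mult_mono) auto
        then have "nat \<lfloor>a * real n\<rfloor> \<ge> 1" by linarith
        then have "ln (r (nat \<lfloor>a * real n\<rfloor>) / r n) = ln (r (nat \<lfloor>a * real n\<rfloor>)) - ln (r n)"
          using pos[of "nat \<lfloor>a * real n\<rfloor>"] pos[of n] n by (simp add: ln_div)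
        moreover have "ln (a powr \<rho>) = \<rho> * ln a" using a1 by (simp add: ln_powr)
        ultimately show ?thesis using N[of n] n by (simp add: P_def dist_real_def)
      qed
      then show "a \<in> (\<Union>N. E N)" using a by (auto simp: E_def)
    qed
  qed
  have E_mono: "E N \<subseteq> E N'" if "N \<le> N'" for N N'
    using that by (intro subsetI) (simp add: E_def)
  have "(\<lambda>N. emeasure lborel (E N)) \<longlonglongrightarrow> emeasure lborel (\<Union>N. E N)"
    by (rule Lim_emeasure_incseq) (use E_meas in \<open>auto simp: incseq_def E_mono\<close>)
  then have "(\<lambda>N. emeasure lborel (E N)) \<longlonglongrightarrow> 1" unfolding union by simp
  then have "eventually (\<lambda>N. ennreal (9 / 10) < emeasure lborel (E N)) sequentially"
    by (rule order_tendstoD) (simp add: ennreal_less_one_iff)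
  then obtain N where N: "ennreal (9 / 10) < emeasure lborel (E N)"
    by (auto simp: eventually_sequentially)
  have "\<bar>ln (r m) - ln (r n) - \<rho> * ln (real m / real n)\<bar> \<le> \<epsilon>"
    if nm: "n \<ge> Suc N" "n \<le> m" "real m \<le> 6 / 5 * real n" for n m
  proof -
    define s where "s = real m / real n"
    have n0: "0 < real n" using nm by simp
    have s: "1 \<le> s" "s \<le> 6 / 5" using nm n0 by (auto simp: s_def field_simps)
    let ?F = "{x. x / s \<in> E N}"
    have Fm: "?F \<in> sets lborel"
      using measurable_sets[of "\<lambda>x. x / s" borel borel "E N"] E_meas[of N] by (simp add: vimage_def)
    have "emeasure lborel ?F = (\<integral>\<^sup>+x. indicator ?F x \<partial>lborel)" using Fm by simp
    also have "\<dots> = ennreal \<bar>s\<bar> * (\<integral>\<^sup>+x. indicator ?F (0 + s * x) \<partial>lborel)"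
      by (rule nn_integral_real_affine) (use Fm s in auto)
    also have "(\<integral>\<^sup>+x. indicator ?F (0 + s * x) \<partial>lborel) = (\<integral>\<^sup>+x. indicator (E N) x \<partial>lborel)"
      using s by (intro nn_integral_cong) (auto simp: indicator_def)
    also have "\<dots> = emeasure lborel (E N)" using E_meas by simp
    finally have F: "emeasure lborel ?F = ennreal s * emeasure lborel (E N)" using s by simp
    \<comment> \<open>If the two sets were disjoint, their union would have measure at least
      \<open>9 / 10 + 9 / 10\<close>, but it lies in an interval of length \<open>7 / 5\<close>,
      because the dilation factor is at most \<open>6 / 5\<close>.\<close>
    have "E N \<inter> ?F \<noteq> {}"
    proof
      assume "E N \<inter> ?F = {}"
      then have u0: "emeasure lborel (E N \<union> ?F) = emeasure lborel (E N) + ennreal s * emeasure lborel (E N)"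
        using E_meas Fm F by (simp add: plus_emeasure[symmetric])
      have "E N \<union> ?F \<subseteq> {1..12 / 5}"
      proof
        fix x assume "x \<in> E N \<union> ?F"
        then consider "1 \<le> x" "x \<le> 2" | "1 \<le> x / s" "x / s \<le> 2" by (auto simp: E_def)
        then show "x \<in> {1..12 / 5}"
        proof cases
          case 2
          then have "s \<le> x" "x \<le> 2 * s" using s by (auto simp: field_simps)
          then show ?thesis using s by auto
        qed auto
      qed
      then have u1: "emeasure lborel (E N \<union> ?F) \<le> emeasure lborel {1..12 / 5 :: real}"
        by (intro emeasure_mono) auto
      have u2: "emeasure lborel {1..12 / 5 :: real} = ennreal (7 / 5)" by simp
      have u3: "emeasure lborel (E N) + emeasure lborel (E N) \<le> emeasure lborel (E N) + ennreal s * emeasure lborel (E N)"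
      proof -
        have "1 * emeasure lborel (E N) \<le> ennreal s * emeasure lborel (E N)"
          using s by (intro mult_right_mono) (auto simp: ennreal_1[symmetric] simp del: ennreal_1 intro: ennreal_leI)
        then show ?thesis by (simp add: add_left_mono)
      qed
      have u4: "ennreal (9 / 10) + ennreal (9 / 10) \<le> emeasure lborel (E N) + emeasure lborel (E N)"
        using N by (intro add_mono) auto
      note u4 also note u3 also note u0[symmetric] also note u1 also note u2
      finally have "ennreal (9 / 10) + ennreal (9 / 10) \<le> ennreal (7 / 5)" .
      then show False by (simp add: ennreal_plus[symmetric] del: ennreal_plus)
    qed
    then obtain x where x: "x \<in> E N" "x / s \<in> E N" by auto
    \<comment> \<open>Now \<open>x * n = y * m\<close>, so the good factor \<open>x\<close> at
      \<open>n\<close> and the good factor \<open>y\<close> at \<open>m\<close> lead to the same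
      third index.\<close>
    define y where "y = x / s"
    have xy: "x = s * y" "1 \<le> y" "P n x" "P m y" using x s nm by (auto simp: y_def E_def)
    have "x * real n = y * real m" using n0 xy(1) by (simp add: s_def)
    then have "\<bar>ln (r (nat \<lfloor>y * real m\<rfloor>)) - ln (r n) - \<rho> * ln x\<bar> \<le> \<epsilon> / 2"
      using xy(3) by (simp add: P_def)
    moreover have "\<bar>ln (r (nat \<lfloor>y * real m\<rfloor>)) - ln (r m) - \<rho> * ln y\<bar> \<le> \<epsilon> / 2"
      using xy(4) by (simp add: P_def)
    moreover have "\<rho> * ln x = \<rho> * ln s + \<rho> * ln y" using xy s by (simp add: ln_mult distrib_left)
    ultimately have "\<bar>ln (r m) - ln (r n) - \<rho> * ln s\<bar> \<le> \<epsilon>" unfolding abs_le_iff by linarith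
    then show ?thesis by (simp add: s_def)
  qed
  then show ?thesis by (intro exI[of _ "Suc N"]) auto
qed

text \<open>The tolerance is taken to be \<open>ln l\<close>; the factor \<open>m / n\<close>
  contributes another \<open>\<bar>\<rho>\<bar> * ln l\<close>, which together give the exponent
  \<open>\<bar>\<rho>\<bar> + 1\<close>.\<close>

lemma regularly_varying_ratio_le:
  fixes r :: "nat \<Rightarrow> real"
  assumes pos: "\<And>n. n \<ge> 1 \<Longrightarrow> 0 < r n"
    and rv: "\<And>c. c > 0 \<Longrightarrow> (\<lambda>n. r (nat \<lfloor>c * real n\<rfloor>) / r n) \<longlonglongrightarrow> c powr \<rho>"
    and l: "1 < l" "l \<le> 6 / 5"
  shows "\<exists>N\<ge>1. \<forall>n\<ge>N. \<forall>m. n \<le> m \<longrightarrow> real m \<le> l * real n \<longrightarrow>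
    r m \<le> l powr (\<bar>\<rho>\<bar> + 1) * r n \<and> r n \<le> l powr (\<bar>\<rho>\<bar> + 1) * r m"
proof -
  have "0 < ln l" using l by simp
  from regularly_varying_uniform[OF pos rv this]
  obtain N where N: "N \<ge> 1" "\<And>n m. n \<ge> N \<Longrightarrow> n \<le> m \<Longrightarrow> real m \<le> 6 / 5 * real n \<Longrightarrow>
      \<bar>ln (r m) - ln (r n) - \<rho> * ln (real m / real n)\<bar> \<le> ln l" by blast
  have "r m \<le> l powr (\<bar>\<rho>\<bar> + 1) * r n \<and> r n \<le> l powr (\<bar>\<rho>\<bar> + 1) * r m"
    if nm: "n \<ge> N" "n \<le> m" "real m \<le> l * real n" for n m
  proof -
    have p: "0 < r n" "0 < r m" "0 < real n" using pos nm N(1) by auto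
    have "l * real n \<le> 6 / 5 * real n" using l by (intro mult_right_mono) auto
    then have a: "\<bar>ln (r m) - ln (r n) - \<rho> * ln (real m / real n)\<bar> \<le> ln l"
      using N(2)[OF nm(1,2)] nm(3) by simp
    have q: "1 \<le> real m / real n" "real m / real n \<le> l" using nm p by (auto simp: field_simps)
    then have "0 \<le> ln (real m / real n)" "ln (real m / real n) \<le> ln l" using l by (auto simp: ln_mono)
    then have "\<bar>\<rho> * ln (real m / real n)\<bar> \<le> \<bar>\<rho>\<bar> * ln l" by (auto simp: abs_mult intro: mult_left_mono)
    then have b: "\<bar>ln (r m) - ln (r n)\<bar> \<le> (\<bar>\<rho>\<bar> + 1) * ln l" using a by (simp add: algebra_simps)
    have e: "exp ((\<bar>\<rho>\<bar> + 1) * ln l) = l powr (\<bar>\<rho>\<bar> + 1)" using l by (simp add: powr_def)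
    have "r m = exp (ln (r m) - ln (r n)) * r n" using p by (simp add: exp_diff)
    also have "\<dots> \<le> exp ((\<bar>\<rho>\<bar> + 1) * ln l) * r n" using b p by (intro mult_right_mono) auto
    finally have 1: "r m \<le> l powr (\<bar>\<rho>\<bar> + 1) * r n" by (simp only: e)
    have "r n = exp (ln (r n) - ln (r m)) * r m" using p by (simp add: exp_diff)
    also have "\<dots> \<le> exp ((\<bar>\<rho>\<bar> + 1) * ln l) * r m" using b p by (intro mult_right_mono) auto
    finally have 2: "r n \<le> l powr (\<bar>\<rho>\<bar> + 1) * r m" by (simp only: e)
    show ?thesis using 1 2 by simp
  qed
  then show ?thesis using N(1) by (intro exI[of _ N] conjI) auto
qed

section \<open>A strong law along sparse sequences\<close>

text \<open>The sum of all \<open>Z n\<close> has finite expectation, hence is finite almost surely,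
  and its terms tend to 0.\<close>

lemma (in prob_space) AE_tendsto_zero_of_summable:
  assumes int: "\<And>n. integrable M (Z n)" and nn: "\<And>n \<omega>. 0 \<le> Z n \<omega>" and sum: "summable (\<lambda>n. expectation (Z n))"
  shows "AE \<omega> in M. (\<lambda>n. Z n \<omega>) \<longlonglongrightarrow> (0 :: real)"
proof -
  have m: "(\<lambda>\<omega>. \<Sum>n. ennreal (Z n \<omega>)) \<in> borel_measurable M" using int by measurable
  have "(\<integral>\<^sup>+\<omega>. (\<Sum>n. ennreal (Z n \<omega>)) \<partial>M) = (\<Sum>n. \<integral>\<^sup>+\<omega>. ennreal (Z n \<omega>) \<partial>M)"
    by (rule nn_integral_suminf) (use int in measurable)
  also have "\<dots> = (\<Sum>n. ennreal (expectation (Z n)))"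
    using int nn by (simp add: nn_integral_eq_integral)
  also have "\<dots> \<noteq> \<infinity>"
    using sum nn by (subst suminf_ennreal2) (auto intro: Bochner_Integration.integral_nonneg)
  finally have "AE \<omega> in M. (\<Sum>n. ennreal (Z n \<omega>)) \<noteq> \<infinity>" by (rule nn_integral_PInf_AE[OF m])
  then show ?thesis
  proof eventually_elim
    case (elim \<omega>)
    then have "summable (\<lambda>n. Z n \<omega>)" using nn by (intro summable_suminf_not_top) (auto simp: infinity_ennreal_def)
    then show ?case by (rule summable_LIMSEQ_zero)
  qed
qed

lemma choose_over_power_tendsto:
  "(\<lambda>n. real (n choose q) / real n ^ q) \<longlonglongrightarrow> 1 / fact q"
proof -
  have e: "real (n choose q) / real n ^ q = (\<Prod>i\<in>{0..<q}. 1 - real i / real n) / fact q" if "n > 0" for n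
  proof -
    have "real (n choose q) = (\<Prod>i\<in>{0..<q}. real n - real i) / fact q"
      by (simp add: binomial_gbinomial gbinomial_prod_rev)
    moreover have "(\<Prod>i\<in>{0..<q}. real n - real i) = (\<Prod>i\<in>{0..<q}. real n * (1 - real i / real n))"
      using that by (intro prod.cong refl) (simp add: field_simps)
    ultimately show ?thesis using that by (simp add: prod.distrib)
  qed
  have "(\<lambda>n. (\<Prod>i\<in>{0..<q}. 1 - real i / real n) / fact q) \<longlonglongrightarrow> (\<Prod>i\<in>{0..<q}. 1 - 0) / fact q"
    by (intro tendsto_intros lim_const_over_n) auto
  then have "(\<lambda>n. (\<Prod>i\<in>{0..<q}. 1 - real i / real n) / fact q) \<longlonglongrightarrow> 1 / fact q" by simp
  then show ?thesis
    by (rule Lim_transform_eventually)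
      (use e in \<open>auto simp: eventually_sequentially intro!: exI[of _ 1]\<close>)
qed

lemma card_subsets_of_card: "card (subsets_of_card q {1..n}) = n choose q"
  unfolding subsets_of_card_def using n_subsets[of "{1..n}" q] by simp

text \<open>One setting for the counts of \<open>k + 2\<close> points with given times and of
  \<open>k + 3\<close> crowded points. Dependence on the own coordinates together with invariance
  under relabelling gives all index sets the same mean.\<close>

locale scale_kernel = bounded_density f Bf for f :: "'a::euclidean_space \<Rightarrow> real" and Bf +
  fixes G :: "real \<Rightarrow> (nat \<Rightarrow> 'a) \<Rightarrow> nat set \<Rightarrow> real" and q :: nat and T :: real
  assumes q: "q \<ge> 1" and T: "T > 0"
    and G_range: "\<And>r x A. 0 \<le> G r x A \<and> G r x A \<le> 1"
    and G_meas: "\<And>r I A. r > 0 \<Longrightarrow> finite I \<Longrightarrow> A \<in> subsets_of_card q I \<Longrightarrow> (\<lambda>x. G r x A) \<in> borel_measurable (PiM I (\<lambda>_. borel))"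
    and G_dep: "\<And>r A. depends_on A (\<lambda>x. G r x A)"
    and G_local: "\<And>r x A. r > 0 \<Longrightarrow> finite A \<Longrightarrow> card A = q \<Longrightarrow> G r x A \<noteq> 0 \<Longrightarrow> diameter_le x (T * r) A"
    and G_reindex: "\<And>r x e B. inj_on e B \<Longrightarrow> G r (\<lambda>j. x (e j)) B = G r x (e ` B)"
begin

definition kernel_mean :: "real \<Rightarrow> real" where
  "kernel_mean r = (\<integral>x. G r x {0..<q} \<partial>PiM {0..<q} (\<lambda>_. D))"

lemma sets_PiM_D: "sets (PiM I (\<lambda>_. D)) = sets (PiM I (\<lambda>_. borel :: 'a measure))" for I :: "nat set"
  by (simp cong: sets_PiM_cong)

lemma kernel_mean_eq:
  assumes r: "r > 0" and I: "finite I" and A: "A \<in> subsets_of_card q I"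
  shows "(\<integral>x. G r x A \<partial>PiM I (\<lambda>_. D)) = kernel_mean r"
proof -
  have A': "A \<subseteq> I" "card A = q" "finite A" using A I finite_subset by (auto simp: subsets_of_card_def)
  obtain e where e: "bij_betw e {0..<q} A" using ex_bij_betw_nat_finite[OF A'(3)] A'(2) by blast
  have inj: "inj_on e {0..<q}" "e ` {0..<q} = A" using e by (auto simp: bij_betw_def)
  then have eI: "e \<in> {0..<q} \<rightarrow> I" using A'(1) by blast
  let ?t = "\<lambda>x. \<lambda>j\<in>{0..<q}. x (e j)"
  have d: "distr (PiM I (\<lambda>_. D)) (PiM {0..<q} (\<lambda>_. D)) ?t = PiM {0..<q} (\<lambda>_. D)"
    by (rule distr_PiM_reindex[OF prob_D inj(1) eI])
  have t: "?t \<in> PiM I (\<lambda>_. D) \<rightarrow>\<^sub>M PiM {0..<q} (\<lambda>_. D)"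
    by (rule measurable_restrict) (use eI in \<open>auto intro: measurable_component_singleton\<close>)
  have m: "(\<lambda>x. G r x {0..<q}) \<in> borel_measurable (PiM {0..<q} (\<lambda>_. D))"
    using G_meas[OF r, of "{0..<q}" "{0..<q}"] by (simp add: subsets_of_card_def measurable_cong_sets[OF sets_PiM_D refl])
  have "kernel_mean r = (\<integral>x. G r x {0..<q} \<partial>distr (PiM I (\<lambda>_. D)) (PiM {0..<q} (\<lambda>_. D)) ?t)"
    unfolding d kernel_mean_def ..
  also have "\<dots> = (\<integral>x. G r (?t x) {0..<q} \<partial>PiM I (\<lambda>_. D))"
    by (rule integral_distr[OF t m])
  also have "\<dots> = (\<integral>x. G r x A \<partial>PiM I (\<lambda>_. D))"
  proof (rule Bochner_Integration.integral_cong[OF refl])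
    fix x
    have "G r (?t x) {0..<q} = G r (\<lambda>j. x (e j)) {0..<q}"
      by (rule G_dep[unfolded depends_on_def, rule_format]) simp
    then show "G r (?t x) {0..<q} = G r x A" using G_reindex[OF inj(1)] inj(2) by simp
  qed
  finally show ?thesis ..
qed

lemma local_kernel_G:
  assumes r: "r > 0" and I: "finite I" and K: "real (card I) * near_prob (T * r) \<le> K" "K \<ge> 1"
  shows "local_kernel D I (G r) q (T * r) (near_prob (T * r)) K (kernel_mean r)"
proof (intro local_kernel.intro iid_product.intro local_kernel_axioms.intro)
  show "prob_space D" by (rule prob_D)
  show "0 \<le> near_prob (T * r)" using T r by (intro near_prob_nonneg) simp
  show "emeasure D (cball z (T * r)) \<le> ennreal (near_prob (T * r))" for z
    using T r by (intro emeasure_D_cball_le) simp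
  fix A assume A: "A \<in> subsets_of_card q I"
  then have A': "finite A" "card A = q" using I finite_subset by (auto simp: subsets_of_card_def)
  show "(\<lambda>x. G r x A) \<in> borel_measurable (PiM I (\<lambda>_. D))"
    using G_meas[OF r I A] by (simp add: measurable_cong_sets[OF sets_PiM_D refl])
  show "(\<integral>x. G r x A \<partial>PiM I (\<lambda>_. D)) = kernel_mean r" by (rule kernel_mean_eq[OF r I A])
  show "diameter_le x (T * r) A" if "G r x A \<noteq> 0" for x
    by (rule G_local[OF r A' that])
qed (use q G_range G_dep I K in auto)

lemma kernel_total_mean_le:
  assumes r: "r > 0"
  shows "0 \<le> kernel_mean r" "real (n choose q) * kernel_mean r \<le> real n ^ q * near_prob (T * r) ^ (q - 1)"
proof -
  have "0 \<le> near_prob (T * r)" using T r by (intro near_prob_nonneg) simp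
  show "0 \<le> kernel_mean r" unfolding kernel_mean_def using G_range by (intro Bochner_Integration.integral_nonneg) auto
  interpret local_kernel D "{1..n}" "G r" q "T * r" "near_prob (T * r)" "max 1 (real (card {1..n}) * near_prob (T * r))" "kernel_mean r"
    by (rule local_kernel_G[OF r]) auto
  show "real (n choose q) * kernel_mean r \<le> real n ^ q * near_prob (T * r) ^ (q - 1)"
    using card_mean_le unfolding card_subsets_of_card by simp
qed

end

section \<open>Sums over subsets of an iid sample\<close>

locale iid_sample = bounded_density f Bf + prob_space M
  for f :: "'a::euclidean_space \<Rightarrow> real" and Bf and M :: "'w measure" +
  fixes X :: "nat \<Rightarrow> 'w \<Rightarrow> 'a"
  assumes indep: "indep_vars (\<lambda>_. borel) X {1..}"
    and dist_X: "\<And>i. i \<ge> 1 \<Longrightarrow> distributed M lborel (X i) (\<lambda>x. ennreal (f x))"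
begin

lemma X_meas: "i \<ge> 1 \<Longrightarrow> X i \<in> borel_measurable M"
  using dist_X[of i] by (simp add: distributed_def)

lemma distr_X: "i \<ge> 1 \<Longrightarrow> distr M borel (X i) = D"
proof -
  assume i: "i \<ge> 1"
  have "distr M borel (X i) = distr M lborel (X i)" by (rule distr_cong) auto
  then show ?thesis using dist_X[OF i] by (simp add: distributed_def D_def)
qed

definition sample :: "nat \<Rightarrow> 'w \<Rightarrow> nat \<Rightarrow> 'a" where
  "sample n w = (\<lambda>i\<in>{1..n}. X i w)"

lemma sample_measurable: "sample n \<in> M \<rightarrow>\<^sub>M PiM {1..n} (\<lambda>_. borel)"
  unfolding sample_def[abs_def] by (rule measurable_restrict) (use X_meas in auto)

lemma distr_sample:
  assumes "n \<ge> 1"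
  shows "distr M (PiM {1..n} (\<lambda>_. borel)) (sample n) = PiM {1..n} (\<lambda>_. D)"
proof -
  have "indep_vars (\<lambda>_. borel) X {1..n}" by (rule indep_vars_subset[OF indep]) auto
  then have "distr M (PiM {1..n} (\<lambda>_. borel)) (sample n) = PiM {1..n} (\<lambda>i. distr M borel (X i))"
    unfolding sample_def[abs_def]
    by (subst (asm) indep_vars_iff_distr_eq_PiM') (use assms X_meas in auto)
  also have "\<dots> = PiM {1..n} (\<lambda>_. D)" by (rule PiM_cong) (use distr_X in auto)
  finally show ?thesis .
qed

lemma expectation_sample:
  assumes "n \<ge> 1" "H \<in> borel_measurable (PiM {1..n} (\<lambda>_. borel))"
  shows "expectation (\<lambda>w. H (sample n w)) = (\<integral>x. H x \<partial>PiM {1..n} (\<lambda>_. D) :: real)"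
  unfolding distr_sample[OF assms(1), symmetric] by (rule integral_distr[OF sample_measurable assms(2), symmetric])

end

locale sample_kernel = iid_sample f Bf M X + scale_kernel f Bf G q T
  for f :: "'a::euclidean_space \<Rightarrow> real" and Bf and M :: "'w measure" and X and G q T
begin

definition kernel_sum :: "nat \<Rightarrow> real \<Rightarrow> 'w \<Rightarrow> real" where
  "kernel_sum n r w = (\<Sum>A\<in>subsets_of_card q {1..n}. G r (\<lambda>i. X i w) A)"

lemma kernel_sum_sample: "kernel_sum n r w = (\<Sum>A\<in>subsets_of_card q {1..n}. G r (sample n w) A)"
  unfolding kernel_sum_def
proof (rule sum.cong[OF refl])
  fix A assume "A \<in> subsets_of_card q {1..n}"
  then show "G r (\<lambda>i. X i w) A = G r (sample n w) A"
    by (intro G_dep[unfolded depends_on_def, rule_format]) (auto simp: sample_def subsets_of_card_def)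
qed

lemma G_sum_meas:
  assumes "r > 0"
  shows "(\<lambda>x. \<Sum>A\<in>subsets_of_card q {1..n}. G r x A) \<in> borel_measurable (PiM {1..n} (\<lambda>_. borel))"
  by (intro borel_measurable_sum G_meas assms) auto

lemma kernel_sum_bounds: "0 \<le> kernel_sum n r w" "kernel_sum n r w \<le> real (n choose q)"
proof -
  show "0 \<le> kernel_sum n r w" unfolding kernel_sum_def using G_range by (intro sum_nonneg) auto
  have "kernel_sum n r w \<le> (\<Sum>A\<in>subsets_of_card q {1..n}. 1)"
    unfolding kernel_sum_def using G_range by (intro sum_mono) auto
  then show "kernel_sum n r w \<le> real (n choose q)" by (simp only: sum_constant card_subsets_of_card mult_1_right)
qed

lemma kernel_sum_measurable:
  assumes "r > 0"
  shows "kernel_sum n r \<in> borel_measurable M"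
  unfolding kernel_sum_sample[abs_def] by (rule measurable_compose[OF sample_measurable G_sum_meas[OF assms]])

lemma expectation_kernel_sum:
  assumes r: "r > 0" and n: "n \<ge> 1"
  shows "expectation (kernel_sum n r) = real (n choose q) * kernel_mean r"
proof -
  interpret P: prob_space "PiM {1..n} (\<lambda>_. D)" by (rule prob_space_PiM) (rule prob_D)
  have "expectation (kernel_sum n r) = (\<integral>x. (\<Sum>A\<in>subsets_of_card q {1..n}. G r x A) \<partial>PiM {1..n} (\<lambda>_. D))"
    unfolding kernel_sum_sample[abs_def] by (rule expectation_sample[OF n G_sum_meas[OF r]])
  also have "\<dots> = (\<Sum>A\<in>subsets_of_card q {1..n}. \<integral>x. G r x A \<partial>PiM {1..n} (\<lambda>_. D))"
  proof (rule Bochner_Integration.integral_sum)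
    fix A assume "A \<in> subsets_of_card q {1..n}"
    from G_meas[OF r _ this] show "integrable (PiM {1..n} (\<lambda>_. D)) (\<lambda>x. G r x A)"
      using G_range by (intro P.integrable_const_bound[where B = 1]) (auto simp: measurable_cong_sets[OF sets_PiM_D refl])
  qed
  also have "\<dots> = (\<Sum>A\<in>subsets_of_card q {1..n}. kernel_mean r)"
    by (intro sum.cong refl kernel_mean_eq r) auto
  finally show ?thesis by (simp only: sum_constant card_subsets_of_card)
qed

lemma kernel_sum_moment_le:
  assumes r: "r > 0" and n: "n \<ge> 1" and K: "real n * near_prob (T * r) \<le> K" "K \<ge> 1"
  shows "expectation (\<lambda>w. (kernel_sum n r w - real (n choose q) * kernel_mean r) ^ (2 * p))
    \<le> 4 ^ p * (local_kernel.attach_const q K (q * (2 * p)) + 2) ^ (2 * p) * (1 + real n ^ q * near_prob (T * r) ^ (q - 1)) ^ p"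
proof -
  interpret L: local_kernel D "{1..n}" "G r" q "T * r" "near_prob (T * r)" K "kernel_mean r"
    by (rule local_kernel_G[OF r]) (use K in auto)
  have "expectation (\<lambda>w. (kernel_sum n r w - real (n choose q) * kernel_mean r) ^ (2 * p)) =
      (\<integral>x. ((\<Sum>A\<in>subsets_of_card q {1..n}. G r x A) - real (n choose q) * kernel_mean r) ^ (2 * p) \<partial>PiM {1..n} (\<lambda>_. D))"
    unfolding kernel_sum_sample
    by (rule expectation_sample[OF n]) (intro borel_measurable_power borel_measurable_diff G_sum_meas[OF r] borel_measurable_const)
  also have "\<dots> \<le> 4 ^ p * (L.attach_const (q * (2 * p)) + 2) ^ (2 * p) * (1 + real (card {1..n}) ^ q * near_prob (T * r) ^ (q - 1)) ^ p"
    using L.central_moment_le[of p] by (simp only: card_subsets_of_card)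
  finally show ?thesis by simp
qed

text \<open>The central moment of order \<open>2 * p\<close> is of order \<open>a m ^ p\<close>, so
  after normalization a bound of order \<open>1 / a m ^ p\<close> remains. The exponent
  \<open>p\<close> is free and is chosen to make this summable, however small \<open>\<eta>\<close>
  is.\<close>

theorem kernel_strong_law:
  fixes N :: "nat \<Rightarrow> nat" and r a :: "nat \<Rightarrow> real"
  assumes N: "\<And>m. N m \<ge> 1" and r: "\<And>m. r m > 0"
    and K: "\<And>m. real (N m) * near_prob (T * r m) \<le> K" "K \<ge> 1"
    and B: "\<And>m. real (N m) ^ q * near_prob (T * r m) ^ (q - 1) \<le> B * a m"
    and a: "\<And>m. c * (real m + 1) powr \<eta> \<le> a m" "c > 0" "\<eta> > 0"
  shows "AE w in M. (\<lambda>m. (kernel_sum (N m) (r m) w - real (N m choose q) * kernel_mean (r m)) / a m) \<longlonglongrightarrow> 0"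
proof -
  \<comment> \<open>\<open>\<eta> * p > 2\<close> turns the bound into a multiple of
    \<open>1 / (m + 1) ^ 2\<close>.\<close>
  obtain p0 :: nat where p0: "2 / \<eta> < real p0" using reals_Archimedean2 by blast
  define p where "p = Suc p0"
  have "2 / \<eta> < real p" using p0 by (simp add: p_def)
  then have p: "2 < \<eta> * real p" "p \<ge> 1" using a(3) by (simp_all add: field_simps p_def)
  define Y where "Y m w = (kernel_sum (N m) (r m) w - real (N m choose q) * kernel_mean (r m)) / a m" for m w
  define Z where "Z m w = Y m w ^ (2 * p)" for m w
  define C where "C = 4 ^ p * (local_kernel.attach_const q K (q * (2 * p)) + 2) ^ (2 * p)"
  have C0: "0 \<le> C" unfolding C_def by simp
  have powr1: "1 \<le> (real m + 1) powr \<eta>" for m :: nat using a(3) by (simp add: ge_one_powr_ge_zero)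
  have a_ge: "c \<le> a m" for m
  proof -
    have "c * 1 \<le> c * (real m + 1) powr \<eta>" using powr1 a(2) by (intro mult_left_mono) auto
    then show ?thesis using a(1)[of m] by simp
  qed
  have a_pos: "0 < a m" for m using a_ge[of m] a(2) by linarith
  \<comment> \<open>The moment bound involves 1 plus the bound on the mean;
    \<open>a m \<ge> c\<close> absorbs the 1 into \<open>a m / c\<close>.\<close>
  define B' where "B' = 1 / c + \<bar>B\<bar>"
  have B'0: "0 \<le> B'" using a(2) by (simp add: B'_def)
  have step: "expectation (Z m) \<le> C * B' ^ p / c ^ p * (1 / (real m + 1) ^ 2)" for m
  proof -
    have "expectation (Z m) = expectation (\<lambda>w. (kernel_sum (N m) (r m) w - real (N m choose q) * kernel_mean (r m)) ^ (2 * p)) / a m ^ (2 * p)"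
      by (simp add: Z_def[abs_def] Y_def power_divide)
    also have "\<dots> \<le> C * (1 + real (N m) ^ q * near_prob (T * r m) ^ (q - 1)) ^ p / a m ^ (2 * p)"
      unfolding C_def using a_pos[of m] by (intro divide_right_mono kernel_sum_moment_le r N K) auto
    also have "\<dots> \<le> C * (B' * a m) ^ p / a m ^ (2 * p)"
    proof -
      have "0 \<le> near_prob (T * r m)" using T r[of m] by (intro near_prob_nonneg) simp
      moreover have "1 + real (N m) ^ q * near_prob (T * r m) ^ (q - 1) \<le> B' * a m"
      proof -
        have "1 \<le> 1 / c * a m" using a_ge[of m] a(2) by (simp add: field_simps)
        moreover have "real (N m) ^ q * near_prob (T * r m) ^ (q - 1) \<le> \<bar>B\<bar> * a m"
          using B[of m] a_pos[of m] by (meson abs_ge_self mult_right_mono less_imp_le order_trans)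
        ultimately show ?thesis by (simp add: B'_def algebra_simps)
      qed
      ultimately show ?thesis
        using C0 a_pos[of m] by (intro divide_right_mono mult_left_mono power_mono) auto
    qed
    also have "\<dots> = C * B' ^ p / a m ^ p"
      using a_pos[of m] by (simp add: power_mult_distrib mult_2 power_add)
    also have "\<dots> \<le> C * B' ^ p / (c * (real m + 1) powr \<eta>) ^ p"
      using a(1)[of m] a(2) C0 B'0 a_pos[of m]
      by (intro divide_left_mono power_mono mult_nonneg_nonneg mult_pos_pos zero_less_power) auto
    also have "\<dots> = C * B' ^ p / c ^ p * (1 / ((real m + 1) powr \<eta>) ^ p)"
      by (simp add: power_mult_distrib)
    also have "\<dots> \<le> C * B' ^ p / c ^ p * (1 / (real m + 1) ^ 2)"
    proof -
      have "(real m + 1) ^ 2 = (real m + 1) powr 2" by (simp add: powr_numeral)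
      also have "\<dots> \<le> (real m + 1) powr (\<eta> * real p)" using p(1) by (intro powr_mono) auto
      also have "\<dots> = ((real m + 1) powr \<eta>) ^ p" by (simp add: powr_powr[symmetric] powr_realpow)
      finally have "(real m + 1) ^ 2 \<le> ((real m + 1) powr \<eta>) ^ p" .
      then show ?thesis using C0 B'0 a(2) by (intro mult_left_mono divide_left_mono) auto
    qed
    finally show ?thesis .
  qed
  have meas: "Z m \<in> borel_measurable M" for m
    unfolding Z_def[abs_def] Y_def using kernel_sum_measurable[OF r]
    by (intro borel_measurable_power borel_measurable_divide borel_measurable_diff) auto
  have int: "integrable M (Z m)" for m
  proof (rule integrable_const_bound[OF _ meas])
    have "\<bar>Y m w\<bar> \<le> (real (N m choose q) + real (N m choose q) * \<bar>kernel_mean (r m)\<bar>) / a m" for w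
    proof -
      have "\<bar>kernel_sum (N m) (r m) w - real (N m choose q) * kernel_mean (r m)\<bar> \<le>
          \<bar>kernel_sum (N m) (r m) w\<bar> + \<bar>real (N m choose q) * kernel_mean (r m)\<bar>" by (rule abs_triangle_ineq4)
      also have "\<dots> \<le> real (N m choose q) + real (N m choose q) * \<bar>kernel_mean (r m)\<bar>"
        using kernel_sum_bounds[of "N m" "r m" w] by (simp add: abs_mult)
      finally show ?thesis unfolding Y_def using a_pos[of m] by (simp add: abs_divide divide_right_mono)
    qed
    then have "norm (Z m w) \<le> ((real (N m choose q) + real (N m choose q) * \<bar>kernel_mean (r m)\<bar>) / a m) ^ (2 * p)" for w
      unfolding Z_def by (simp add: power_abs power_mono)
    then show "AE w in M. norm (Z m w) \<le> ((real (N m choose q) + real (N m choose q) * \<bar>kernel_mean (r m)\<bar>) / a m) ^ (2 * p)"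
      by simp
  qed
  have nn: "0 \<le> Z m w" for m w unfolding Z_def by simp
  have "summable (\<lambda>m. 1 / (real (Suc m)) ^ 2)"
    using inverse_power_summable[of 2, where 'a = real] summable_Suc_iff[of "\<lambda>n. inverse (real n ^ 2)"]
    by (simp add: inverse_eq_divide)
  then have "summable (\<lambda>m. C * B' ^ p / c ^ p * (1 / (real m + 1) ^ 2))"
    by (intro summable_mult) (simp add: add.commute)
  then have "summable (\<lambda>m. expectation (Z m))"
    by (rule summable_comparison_test'[where N = 0])
      (use step nn in \<open>auto simp: Bochner_Integration.integral_nonneg\<close>)
  then have "AE w in M. (\<lambda>m. Z m w) \<longlonglongrightarrow> 0"
    using AE_tendsto_zero_of_summable[of Z, OF int nn] by blast
  then show ?thesis
  proof (rule AE_mp, intro AE_I2 impI)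
    fix w assume "(\<lambda>m. Z m w) \<longlonglongrightarrow> 0"
    then have "(\<lambda>m. root (2 * p) (Z m w)) \<longlonglongrightarrow> root (2 * p) 0" by (intro tendsto_real_root)
    moreover have "root (2 * p) (Z m w) = \<bar>Y m w\<bar>" for m
    proof -
      have "Z m w = \<bar>Y m w\<bar> ^ (2 * p)" unfolding Z_def by (simp add: power_even_abs)
      then show ?thesis using p(2) by (simp add: real_root_power_cancel)
    qed
    ultimately have "(\<lambda>m. \<bar>Y m w\<bar>) \<longlonglongrightarrow> 0" using p(2) by simp
    then have "(\<lambda>m. Y m w) \<longlonglongrightarrow> 0" by (rule tendsto_rabs_zero_cancel)
    then show "(\<lambda>m. (kernel_sum (N m) (r m) w - real (N m choose q) * kernel_mean (r m)) / a m) \<longlonglongrightarrow> 0"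
      by (simp only: Y_def)
  qed
qed

end

section \<open>Interpolation between sparse indices\<close>

definition scaling :: "nat \<Rightarrow> nat \<Rightarrow> nat \<Rightarrow> real \<Rightarrow> real" where
  "scaling d k n \<rho> = real n ^ (k + 2) * \<rho> ^ (d * (k + 1))"

lemma scaling_pos: "n \<ge> 1 \<Longrightarrow> \<rho> > 0 \<Longrightarrow> 0 < scaling d k n \<rho>"
  by (simp add: scaling_def)

lemma scaling_mono: "n \<le> n' \<Longrightarrow> 0 < \<rho> \<Longrightarrow> \<rho> \<le> \<rho>' \<Longrightarrow> scaling d k n \<rho> \<le> scaling d k n' \<rho>'"
  unfolding scaling_def by (intro mult_mono power_mono) auto

lemma scaling_mult: "scaling d k n (c * \<rho>) = c ^ (d * (k + 1)) * scaling d k n \<rho>"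
  by (simp add: scaling_def power_mult_distrib)

lemma (in bounded_density) near_prob_scale: "near_prob (T * \<rho>) = near_prob T * \<rho> ^ DIM('a)"
  by (simp add: near_prob_def power_mult_distrib)

lemma power_at_top:
  fixes b :: real
  assumes "1 < b"
  shows "filterlim (\<lambda>m. b ^ m) at_top sequentially"
  using filterlim_at_infinity_imp_norm_at_top[OF filterlim_realpow_sequentially_gt1[of b]] assms
  by (simp add: abs_of_pos)

lemma geometric_interval:
  fixes b :: real
  assumes "b > 1" "n \<ge> 1"
  obtains m where "b ^ m \<le> real n" "real n < b ^ Suc m"
proof -
  have ex: "\<exists>m. real n < b ^ Suc m"
  proof -
    obtain m where "real n < b ^ m" using real_arch_pow[OF assms(1)] by blast
    moreover have "b ^ m \<le> b ^ Suc m" using assms(1) by (intro power_increasing) auto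
    ultimately have "real n < b ^ Suc m" by linarith
    then show ?thesis by blast
  qed
  define m where "m = (LEAST m. real n < b ^ Suc m)"
  have 1: "real n < b ^ Suc m" unfolding m_def by (rule LeastI_ex[OF ex])
  have "b ^ m \<le> real n"
  proof (cases m)
    case 0
    then show ?thesis using assms(2) by simp
  next
    case (Suc m')
    then have "m' < (LEAST m. real n < b ^ Suc m)" by (simp add: m_def)
    then have "\<not> real n < b ^ Suc m'" by (rule not_less_Least)
    then show ?thesis using Suc by simp
  qed
  then show ?thesis using 1 that by blast
qed

context sample_kernel
begin

lemma kernel_sum_mono:
  assumes G_mono: "\<And>\<rho> \<rho>' x A. 0 < \<rho> \<Longrightarrow> \<rho> \<le> \<rho>' \<Longrightarrow> G \<rho> x A \<le> G \<rho>' x A"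
    and "n \<le> n'" "0 < \<rho>" "\<rho> \<le> \<rho>'"
  shows "kernel_sum n \<rho> w \<le> kernel_sum n' \<rho>' w"
proof -
  have "kernel_sum n \<rho> w \<le> (\<Sum>A\<in>subsets_of_card q {1..n}. G \<rho>' (\<lambda>i. X i w) A)"
    unfolding kernel_sum_def by (intro sum_mono G_mono assms)
  also have "\<dots> \<le> kernel_sum n' \<rho>' w"
    unfolding kernel_sum_def
  proof (rule sum_mono2)
    show "finite (subsets_of_card q {1..n'})" by (rule finite_subsets_of_card) simp
    show "subsets_of_card q {1..n} \<subseteq> subsets_of_card q {1..n'}"
      using assms(2) unfolding subsets_of_card_def by fastforce
  qed (use G_range in auto)
  finally show ?thesis .
qed

text \<open>The hypotheses hold only from some index on, so the strong law is applied to the shifted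
  sequence; adding the convergence of the means replaces the centring by the limit
  \<open>c0\<close>.\<close>

lemma sparse_strong_law:
  fixes N :: "nat \<Rightarrow> nat" and \<rho> :: "nat \<Rightarrow> real"
  assumes bound: "\<And>n \<rho>. n \<ge> 1 \<Longrightarrow> \<rho> > 0 \<Longrightarrow> real n * \<rho> ^ DIM('a) \<le> 1 \<Longrightarrow>
      real n ^ q * near_prob (T * \<rho>) ^ (q - 1) \<le> B * scaling DIM('a) k n \<rho>"
    and mean: "(\<lambda>m. real (N m choose q) * kernel_mean (\<rho> m) / scaling DIM('a) k (N m) (\<rho> m)) \<longlonglongrightarrow> c0"
    and N: "\<And>m. N m \<ge> 1" and \<rho>: "\<And>m. \<rho> m > 0"
    and small: "(\<lambda>m. real (N m) * \<rho> m ^ DIM('a)) \<longlonglongrightarrow> 0"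
    and large: "eventually (\<lambda>m. c * (real m + 1) powr \<eta> \<le> scaling DIM('a) k (N m) (\<rho> m)) sequentially" "c > 0" "\<eta> > 0"
  shows "AE w in M. (\<lambda>m. kernel_sum (N m) (\<rho> m) w / scaling DIM('a) k (N m) (\<rho> m)) \<longlonglongrightarrow> c0"
proof -
  have "eventually (\<lambda>m. real (N m) * \<rho> m ^ DIM('a) < 1) sequentially"
    using small by (rule order_tendstoD) simp
  with large(1) have "eventually (\<lambda>m. c * (real m + 1) powr \<eta> \<le> scaling DIM('a) k (N m) (\<rho> m) \<and>
      real (N m) * \<rho> m ^ DIM('a) < 1) sequentially"
    by (rule eventually_conj)
  then obtain m0 where m0: "\<And>m. m \<ge> m0 \<Longrightarrow> c * (real m + 1) powr \<eta> \<le> scaling DIM('a) k (N m) (\<rho> m)"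
      "\<And>m. m \<ge> m0 \<Longrightarrow> real (N m) * \<rho> m ^ DIM('a) < 1"
    by (auto simp: eventually_sequentially)
  have nT: "0 \<le> near_prob T" using T by (intro near_prob_nonneg) simp
  have "AE w in M. (\<lambda>m. (kernel_sum (N (m + m0)) (\<rho> (m + m0)) w - real (N (m + m0) choose q) * kernel_mean (\<rho> (m + m0)))
      / scaling DIM('a) k (N (m + m0)) (\<rho> (m + m0))) \<longlonglongrightarrow> 0"
  proof (rule kernel_strong_law[where K = "max 1 (near_prob T)" and B = B and c = c and \<eta> = \<eta>])
    fix m
    have s: "real (N (m + m0)) * \<rho> (m + m0) ^ DIM('a) \<le> 1" using m0(2)[of "m + m0"] by simp
    have "real (N (m + m0)) * near_prob (T * \<rho> (m + m0)) = near_prob T * (real (N (m + m0)) * \<rho> (m + m0) ^ DIM('a))"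
      by (simp add: near_prob_scale)
    also have "\<dots> \<le> near_prob T * 1" using s nT by (intro mult_left_mono)
    finally show "real (N (m + m0)) * near_prob (T * \<rho> (m + m0)) \<le> max 1 (near_prob T)" by simp
    show "real (N (m + m0)) ^ q * near_prob (T * \<rho> (m + m0)) ^ (q - 1) \<le> B * scaling DIM('a) k (N (m + m0)) (\<rho> (m + m0))"
      by (rule bound[OF N \<rho> s])
    have "c * (real m + 1) powr \<eta> \<le> c * (real (m + m0) + 1) powr \<eta>"
      using large(2,3) by (intro mult_left_mono powr_mono2) auto
    also have "\<dots> \<le> scaling DIM('a) k (N (m + m0)) (\<rho> (m + m0))" by (rule m0(1)) simp
    finally show "c * (real m + 1) powr \<eta> \<le> scaling DIM('a) k (N (m + m0)) (\<rho> (m + m0))" .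
  qed (use N \<rho> large in auto)
  then show ?thesis
  proof (rule AE_mp, intro AE_I2 impI)
    fix w
    assume "(\<lambda>m. (kernel_sum (N (m + m0)) (\<rho> (m + m0)) w - real (N (m + m0) choose q) * kernel_mean (\<rho> (m + m0)))
      / scaling DIM('a) k (N (m + m0)) (\<rho> (m + m0))) \<longlonglongrightarrow> 0"
    then have "(\<lambda>m. (kernel_sum (N m) (\<rho> m) w - real (N m choose q) * kernel_mean (\<rho> m))
      / scaling DIM('a) k (N m) (\<rho> m)) \<longlonglongrightarrow> 0" by (rule LIMSEQ_offset)
    from tendsto_add[OF this mean]
    show "(\<lambda>m. kernel_sum (N m) (\<rho> m) w / scaling DIM('a) k (N m) (\<rho> m)) \<longlonglongrightarrow> c0"
      by (simp add: diff_divide_distrib)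
  qed
qed

text \<open>The limit of the means is required along arbitrary sparse sequences of sizes and scales,
  because interpolation evaluates the sums at distorted scales. The case \<open>c0 = 0\<close>
  serves for crowded sets.\<close>

context
  fixes k :: nat and r :: "nat \<Rightarrow> real" and \<alpha> \<eta> B c0 C :: real
  assumes G_mono: "\<And>\<rho> \<rho>' x A. 0 < \<rho> \<Longrightarrow> \<rho> \<le> \<rho>' \<Longrightarrow> G \<rho> x A \<le> G \<rho>' x A"
    and bound: "\<And>n \<rho>. n \<ge> 1 \<Longrightarrow> \<rho> > 0 \<Longrightarrow> real n * \<rho> ^ DIM('a) \<le> 1 \<Longrightarrow>
      real n ^ q * near_prob (T * \<rho>) ^ (q - 1) \<le> B * scaling DIM('a) k n \<rho>"
    and mean: "\<And>N \<rho>. filterlim N at_top sequentially \<Longrightarrow> (\<And>m. N m \<ge> 1) \<Longrightarrow> (\<And>m. \<rho> m > 0) \<Longrightarrow>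
      (\<lambda>m. real (N m) * \<rho> m ^ DIM('a)) \<longlonglongrightarrow> 0 \<Longrightarrow>
      (\<lambda>m. real (N m choose q) * kernel_mean (\<rho> m) / scaling DIM('a) k (N m) (\<rho> m)) \<longlonglongrightarrow> c0"
    and c0: "c0 \<ge> 0"
    and pos: "\<And>n. n \<ge> 1 \<Longrightarrow> 0 < r n"
    and sparse: "(\<lambda>n. real n * r n ^ DIM('a)) \<longlonglongrightarrow> 0"
    and rv: "\<And>c. c > 0 \<Longrightarrow> (\<lambda>n. r (nat \<lfloor>c * real n\<rfloor>) / r n) \<longlonglongrightarrow> c powr \<alpha>"
    and growth: "\<eta> > 0" "C > 0" "\<And>n. n \<ge> 1 \<Longrightarrow> C * ln (real n) powr \<eta> \<le> scaling DIM('a) k n (r n)"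
begin

text \<open>Between two sparse indices the sum is enclosed by one with fewer points at a smaller
  scale and one with more points at a larger scale. Both obey the sparse law, and \<open>L\<close>
  bounds the quotient of their normalizations: \<open>k + 2\<close> powers of the quotient of sizes
  and the distortion of the scale once in each direction.\<close>

lemma interpolation_bounds:
  assumes \<mu>: "1 < \<mu>" "\<mu> ^ 4 \<le> 6 / 5"
  defines "L \<equiv> (\<mu> ^ 4) ^ (k + 2) * (((\<mu> ^ 4) powr (\<bar>\<alpha>\<bar> + 1)) ^ (DIM('a) * (k + 1)))\<^sup>2"
  shows "AE w in M. \<forall>\<epsilon>>0. eventually (\<lambda>n. (c0 - \<epsilon>) / L \<le> kernel_sum n (r n) w / scaling DIM('a) k n (r n) \<and>
    kernel_sum n (r n) w / scaling DIM('a) k n (r n) \<le> L * (c0 + \<epsilon>)) sequentially"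
proof -
  let ?s = "scaling DIM('a) k"
  define l where "l = \<mu> ^ 4"
  define \<kappa> where "\<kappa> = l powr (\<bar>\<alpha>\<bar> + 1)"
  define e where "e = DIM('a) * (k + 1)"
  have l: "1 < l" "l \<le> 6 / 5" using \<mu> unfolding l_def by (auto intro: one_less_power)
  have \<kappa>: "1 \<le> \<kappa>" unfolding \<kappa>_def using l by (simp add: ge_one_powr_ge_zero)
  have L_eq: "L = l ^ (k + 2) * (\<kappa> ^ e)\<^sup>2" by (simp add: L_def l_def \<kappa>_def e_def)
  have L1: "1 \<le> L"
  proof -
    have "1 * 1 \<le> l ^ (k + 2) * (\<kappa> ^ e)\<^sup>2" using l \<kappa> by (intro mult_mono one_le_power) auto
    then show ?thesis by (simp add: L_eq)
  qed
  obtain n0 where n0: "n0 \<ge> 1" "\<And>n m. n \<ge> n0 \<Longrightarrow> n \<le> m \<Longrightarrow> real m \<le> l * real n \<Longrightarrow>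
      r m \<le> \<kappa> * r n \<and> r n \<le> \<kappa> * r m"
    using regularly_varying_ratio_le[OF pos rv l] unfolding \<kappa>_def by blast
  \<comment> \<open>Steps by \<open>\<mu>\<^sup>2\<close> leave a further factor
    \<open>\<mu>\<^sup>2\<close> for rounding, so that the quotient of consecutive sizes is
    eventually at most \<open>l = \<mu> ^ 4\<close>.\<close>
  define N where "N m = nat \<lfloor>(\<mu>\<^sup>2) ^ m\<rfloor>" for m
  have \<mu>2: "1 < \<mu>\<^sup>2" using \<mu> by (simp add: one_less_power)
  have p1: "1 \<le> (\<mu>\<^sup>2) ^ m" for m using \<mu>2 by simp
  have N_le: "real (N m) \<le> (\<mu>\<^sup>2) ^ m" for m unfolding N_def using p1[of m] by linarith
  have N_ge: "(\<mu>\<^sup>2) ^ m - 1 \<le> real (N m)" for m unfolding N_def using p1[of m] by linarith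
  have N1: "1 \<le> N m" for m unfolding N_def using p1[of m] by linarith
  have le_N: "n \<le> N m" if "real n \<le> (\<mu>\<^sup>2) ^ m" for n m unfolding N_def using that by (simp add: le_nat_floor)
  have N_mono: "N m \<le> N (Suc m)" for m
    by (rule le_N) (use N_le[of m] power_increasing[of m "Suc m" "\<mu>\<^sup>2"] \<mu>2 in linarith)
  have pow_top: "filterlim (\<lambda>m. \<mu> ^ m) at_top sequentially"
    by (rule power_at_top) (use \<mu> in simp)
  have pow2_top: "filterlim (\<lambda>m. (\<mu>\<^sup>2) ^ m) at_top sequentially"
    by (rule power_at_top) (use \<mu>2 in simp)
  have N_top: "filterlim N at_top sequentially"
    unfolding filterlim_at_top
  proof
    fix Z
    have "eventually (\<lambda>m. real Z \<le> (\<mu>\<^sup>2) ^ m) sequentially"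
      using pow2_top unfolding filterlim_at_top by blast
    then show "eventually (\<lambda>m. Z \<le> N m) sequentially" by eventually_elim (rule le_N)
  qed
  have N_step: "eventually (\<lambda>m. real (N (Suc m)) \<le> l * real (N m)) sequentially"
  proof -
    have "eventually (\<lambda>m. \<mu>\<^sup>2 / (\<mu>\<^sup>2 - 1) \<le> (\<mu>\<^sup>2) ^ m) sequentially"
      using pow2_top unfolding filterlim_at_top by blast
    then show ?thesis
    proof eventually_elim
      case (elim m)
      then have "\<mu>\<^sup>2 \<le> (\<mu>\<^sup>2) ^ m * (\<mu>\<^sup>2 - 1)" using \<mu>2 by (simp add: field_simps)
      then have "\<mu>\<^sup>2 * \<mu>\<^sup>2 \<le> \<mu>\<^sup>2 * ((\<mu>\<^sup>2) ^ m * (\<mu>\<^sup>2 - 1))" using \<mu>2 by (intro mult_left_mono) auto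
      then have "\<mu>\<^sup>2 * (\<mu>\<^sup>2) ^ m \<le> \<mu>\<^sup>2 * \<mu>\<^sup>2 * ((\<mu>\<^sup>2) ^ m - 1)" by (simp add: algebra_simps)
      also have "\<dots> \<le> \<mu>\<^sup>2 * \<mu>\<^sup>2 * real (N m)" using N_ge[of m] by (intro mult_left_mono) auto
      also have "\<mu>\<^sup>2 * \<mu>\<^sup>2 = l" by (simp add: l_def power_add[symmetric])
      finally show ?case using N_le[of "Suc m"] by simp
    qed
  qed
  \<comment> \<open>Again rounding is absorbed: eventually \<open>N m\<close> is at least
    \<open>\<mu> ^ Suc m\<close>. Thus a power of \<open>ln\<close> at \<open>N m\<close> is at
    least a constant times the same power of \<open>m + 1\<close>, as the sparse law
    requires.\<close>
  have ln_N: "eventually (\<lambda>m. ln \<mu> * (real m + 1) \<le> ln (real (N m))) sequentially"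
  proof -
    have "eventually (\<lambda>m. \<mu> + 1 \<le> \<mu> ^ m) sequentially"
      using pow_top unfolding filterlim_at_top by blast
    then show ?thesis
    proof eventually_elim
      case (elim m)
      have "1 * 1 \<le> \<mu> ^ m * (\<mu> ^ m - \<mu>)" using elim \<mu> by (intro mult_mono) auto
      then have "\<mu> ^ Suc m \<le> (\<mu>\<^sup>2) ^ m - 1" by (simp add: algebra_simps power_mult_distrib power2_eq_square)
      also have "\<dots> \<le> real (N m)" by (rule N_ge)
      finally have "ln (\<mu> ^ Suc m) \<le> ln (real (N m))" using \<mu> by (intro ln_mono) auto
      moreover have "ln (\<mu> ^ Suc m) = ln \<mu> * (real m + 1)" using \<mu> by (simp add: ln_mult ln_realpow algebra_simps)
      ultimately show ?case by simp
    qed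
  qed
  have scale_N: "eventually (\<lambda>m. (C * ln \<mu> powr \<eta>) * (real m + 1) powr \<eta> \<le> ?s (N m) (r (N m))) sequentially"
    using ln_N
  proof eventually_elim
    case (elim m)
    have "(C * ln \<mu> powr \<eta>) * (real m + 1) powr \<eta> = C * (ln \<mu> * (real m + 1)) powr \<eta>"
      using \<mu> by (simp add: powr_mult)
    also have "\<dots> \<le> C * ln (real (N m)) powr \<eta>" using elim growth \<mu> by (intro mult_left_mono powr_mono2) auto
    also have "\<dots> \<le> ?s (N m) (r (N m))" by (rule growth(3)[OF N1])
    finally show ?case .
  qed
  have rN: "0 < r (N m)" for m by (rule pos[OF N1])
  have small_N: "(\<lambda>m. real (N m) * r (N m) ^ DIM('a)) \<longlonglongrightarrow> 0"
    using filterlim_compose[OF sparse N_top] .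
  have c_pos: "0 < C * ln \<mu> powr \<eta>" using growth \<mu> by simp
  \<comment> \<open>The scale shrunk by \<open>\<kappa>\<close> stays below \<open>r n\<close> for
    every \<open>n\<close> up to the next sparse index.\<close>
  have lower: "AE w in M. (\<lambda>m. kernel_sum (N m) (1 / \<kappa> * r (N m)) w / ?s (N m) (1 / \<kappa> * r (N m))) \<longlonglongrightarrow> c0"
  proof (rule sparse_strong_law[OF bound mean])
    show "eventually (\<lambda>m. (1 / \<kappa>) ^ e * (C * ln \<mu> powr \<eta>) * (real m + 1) powr \<eta> \<le> ?s (N m) (1 / \<kappa> * r (N m))) sequentially"
      using scale_N
    proof eventually_elim
      case (elim m)
      then have "(1 / \<kappa>) ^ e * ((C * ln \<mu> powr \<eta>) * (real m + 1) powr \<eta>) \<le> (1 / \<kappa>) ^ e * ?s (N m) (r (N m))"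
        using \<kappa> by (intro mult_left_mono) auto
      then show ?case by (simp only: scaling_mult e_def mult.assoc)
    qed
    have "(\<lambda>m. (1 / \<kappa>) ^ DIM('a) * (real (N m) * r (N m) ^ DIM('a))) \<longlonglongrightarrow> (1 / \<kappa>) ^ DIM('a) * 0"
      by (intro tendsto_mult tendsto_const small_N)
    then show "(\<lambda>m. real (N m) * (1 / \<kappa> * r (N m)) ^ DIM('a)) \<longlonglongrightarrow> 0"
      by (simp add: power_mult_distrib power_divide mult_ac)
    then show "(\<lambda>m. real (N m) * (1 / \<kappa> * r (N m)) ^ DIM('a)) \<longlonglongrightarrow> 0" .
    show "0 < (1 / \<kappa>) ^ e * (C * ln \<mu> powr \<eta>)" using c_pos \<kappa> by simp
  qed (use N_top N1 rN \<kappa> growth in auto)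
  \<comment> \<open>The next sample size is paired with the enlarged scale of the current index, so
    that one and the same \<open>r (N m)\<close> enters both bounds.\<close>
  have upper: "AE w in M. (\<lambda>m. kernel_sum (N (Suc m)) (\<kappa> * r (N m)) w / ?s (N (Suc m)) (\<kappa> * r (N m))) \<longlonglongrightarrow> c0"
  proof (rule sparse_strong_law[OF bound mean])
    show "eventually (\<lambda>m. (C * ln \<mu> powr \<eta>) * (real m + 1) powr \<eta> \<le> ?s (N (Suc m)) (\<kappa> * r (N m))) sequentially"
      using scale_N
    proof eventually_elim
      case (elim m)
      have "r (N m) \<le> \<kappa> * r (N m)" using \<kappa> rN[of m] by simp
      then have "?s (N m) (r (N m)) \<le> ?s (N (Suc m)) (\<kappa> * r (N m))" by (intro scaling_mono N_mono rN)
      with elim show ?case by linarith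
    qed
    show "filterlim (\<lambda>m. N (Suc m)) at_top sequentially"
      using filterlim_compose[OF N_top filterlim_Suc] .
    have lim: "(\<lambda>m. l * \<kappa> ^ DIM('a) * (real (N m) * r (N m) ^ DIM('a))) \<longlonglongrightarrow> l * \<kappa> ^ DIM('a) * 0"
      by (intro tendsto_mult tendsto_const small_N)
    have "eventually (\<lambda>m. real (N (Suc m)) * (\<kappa> * r (N m)) ^ DIM('a) \<le> l * \<kappa> ^ DIM('a) * (real (N m) * r (N m) ^ DIM('a))) sequentially"
      using N_step
    proof eventually_elim
      case (elim m)
      then have "real (N (Suc m)) * (\<kappa> * r (N m)) ^ DIM('a) \<le> l * real (N m) * (\<kappa> * r (N m)) ^ DIM('a)"
        using \<kappa> rN[of m] by (intro mult_right_mono) auto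
      then show ?case by (simp add: power_mult_distrib mult_ac)
    qed
    then show sm: "(\<lambda>m. real (N (Suc m)) * (\<kappa> * r (N m)) ^ DIM('a)) \<longlonglongrightarrow> 0"
    proof (rule real_tendsto_sandwich[rotated])
      show "eventually (\<lambda>m. 0 \<le> real (N (Suc m)) * (\<kappa> * r (N m)) ^ DIM('a)) sequentially"
        using \<kappa> less_imp_le[OF rN] by (intro always_eventually allI mult_nonneg_nonneg zero_le_power) auto
      show "(\<lambda>m. l * \<kappa> ^ DIM('a) * (real (N m) * r (N m) ^ DIM('a))) \<longlonglongrightarrow> 0" using lim by simp
    qed simp
    show "(\<lambda>m. real (N (Suc m)) * (\<kappa> * r (N m)) ^ DIM('a)) \<longlonglongrightarrow> 0" by (rule sm)
  qed (use N1 rN \<kappa> growth c_pos in auto)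
  show ?thesis
    using lower upper
  proof (eventually_elim, intro allI impI)
    fix w and \<epsilon> :: real
    assume lim: "(\<lambda>m. kernel_sum (N m) (1 / \<kappa> * r (N m)) w / ?s (N m) (1 / \<kappa> * r (N m))) \<longlonglongrightarrow> c0"
      "(\<lambda>m. kernel_sum (N (Suc m)) (\<kappa> * r (N m)) w / ?s (N (Suc m)) (\<kappa> * r (N m))) \<longlonglongrightarrow> c0"
      and \<epsilon>: "\<epsilon> > 0"
    have "eventually (\<lambda>m. c0 - \<epsilon> < kernel_sum (N m) (1 / \<kappa> * r (N m)) w / ?s (N m) (1 / \<kappa> * r (N m)) \<and>
        kernel_sum (N (Suc m)) (\<kappa> * r (N m)) w / ?s (N (Suc m)) (\<kappa> * r (N m)) < c0 + \<epsilon> \<and>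
        real (N (Suc m)) \<le> l * real (N m) \<and> n0 \<le> N m) sequentially"
      using \<epsilon> N_top
      by (intro eventually_conj N_step order_tendstoD(1)[OF lim(1)] order_tendstoD(2)[OF lim(2)])
        (auto simp: filterlim_at_top)
    then obtain m1 where m1: "\<And>m. m \<ge> m1 \<Longrightarrow> c0 - \<epsilon> < kernel_sum (N m) (1 / \<kappa> * r (N m)) w / ?s (N m) (1 / \<kappa> * r (N m))"
        "\<And>m. m \<ge> m1 \<Longrightarrow> kernel_sum (N (Suc m)) (\<kappa> * r (N m)) w / ?s (N (Suc m)) (\<kappa> * r (N m)) < c0 + \<epsilon>"
        "\<And>m. m \<ge> m1 \<Longrightarrow> real (N (Suc m)) \<le> l * real (N m)" "\<And>m. m \<ge> m1 \<Longrightarrow> n0 \<le> N m"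
      unfolding eventually_sequentially by blast
    have "(c0 - \<epsilon>) / L \<le> kernel_sum n (r n) w / ?s n (r n) \<and> kernel_sum n (r n) w / ?s n (r n) \<le> L * (c0 + \<epsilon>)"
      if n: "n \<ge> Suc (N m1)" for n
    proof -
      have n1: "n \<ge> 1" using n by simp
      obtain m where m: "(\<mu>\<^sup>2) ^ m \<le> real n" "real n < (\<mu>\<^sup>2) ^ Suc m" by (rule geometric_interval[OF \<mu>2 n1])
      have "m \<ge> m1"
      proof (rule ccontr)
        assume "\<not> m \<ge> m1"
        then have "(\<mu>\<^sup>2) ^ Suc m \<le> (\<mu>\<^sup>2) ^ m1" using \<mu>2 by (intro power_increasing) auto
        then have "n \<le> N m1" using m(2) by (intro le_N) simp
        then show False using n by simp
      qed
      note b = m1[OF this]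
      have Nn: "N m \<le> n" "n \<le> N (Suc m)"
        using N_le[of m] m le_N[of n "Suc m"] by linarith+
      have "real n \<le> l * real (N m)" using Nn(2) b(3) by linarith
      from n0(2)[OF b(4) Nn(1) this] have rr: "r n \<le> \<kappa> * r (N m)" "1 / \<kappa> * r (N m) \<le> r n"
        using \<kappa> by (auto simp: field_simps)
      have ps: "0 < 1 / \<kappa> * r (N m)" "0 < r n" "0 < \<kappa> * r (N m)" using rN[of m] \<kappa> pos[OF n1] by auto
      define u where "u = ?s (N m) (1 / \<kappa> * r (N m))"
      define v where "v = ?s (N (Suc m)) (\<kappa> * r (N m))"
      have uv: "0 < u" "u \<le> ?s n (r n)" "?s n (r n) \<le> v"
        unfolding u_def v_def using ps rr Nn N1 by (auto intro!: scaling_mono scaling_pos)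
      \<comment> \<open>The upper normalization carries \<open>\<kappa> ^ e\<close>, the lower one
        its inverse; their quotient explains the square in \<open>L\<close>.\<close>
      have "v \<le> L * u"
      proof -
        have "v = real (N (Suc m)) ^ (k + 2) * (\<kappa> ^ e * r (N m) ^ e)"
          by (simp only: v_def scaling_def e_def power_mult_distrib)
        also have "\<dots> \<le> (l * real (N m)) ^ (k + 2) * (\<kappa> ^ e * r (N m) ^ e)"
          using b(3) \<kappa> less_imp_le[OF rN[of m]] by (intro mult_right_mono power_mono) auto
        also have "\<dots> = L * u"
        proof -
          have "u = (1 / \<kappa>) ^ e * (real (N m) ^ (k + 2) * r (N m) ^ e)"
            unfolding u_def scaling_mult by (simp only: scaling_def e_def)
          moreover have "\<kappa> ^ e * (1 / \<kappa>) ^ e = 1" using \<kappa> by (simp add: power_mult_distrib[symmetric])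
          ultimately have "L * u = l ^ (k + 2) * \<kappa> ^ e * (real (N m) ^ (k + 2) * r (N m) ^ e)"
            unfolding L_eq power2_eq_square by (simp add: mult_ac)
          then show ?thesis unfolding power_mult_distrib by (simp add: mult_ac)
        qed
        finally show ?thesis .
      qed
      have S: "kernel_sum (N m) (1 / \<kappa> * r (N m)) w \<le> kernel_sum n (r n) w"
        "kernel_sum n (r n) w \<le> kernel_sum (N (Suc m)) (\<kappa> * r (N m)) w"
        by (intro kernel_sum_mono G_mono Nn rr ps; assumption)+
      have s0: "0 < ?s n (r n)" using uv by linarith
      have 1: "kernel_sum n (r n) w / ?s n (r n) \<le> L * (c0 + \<epsilon>)"
      proof -
        have "kernel_sum (N (Suc m)) (\<kappa> * r (N m)) w \<le> (c0 + \<epsilon>) * v"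
          using b(2) uv unfolding v_def[symmetric] by (simp add: field_simps)
        also have "\<dots> \<le> (c0 + \<epsilon>) * (L * u)" using \<open>v \<le> L * u\<close> c0 \<epsilon> by (intro mult_left_mono) auto
        also have "\<dots> \<le> (c0 + \<epsilon>) * (L * ?s n (r n))" using uv L1 c0 \<epsilon> by (intro mult_left_mono) auto
        finally have "kernel_sum n (r n) w \<le> L * (c0 + \<epsilon>) * ?s n (r n)" using S(2) by (simp add: mult_ac)
        then show ?thesis using s0 by (simp add: divide_le_eq)
      qed
      have 2: "(c0 - \<epsilon>) / L \<le> kernel_sum n (r n) w / ?s n (r n)"
      proof (cases "c0 - \<epsilon> \<le> 0")
        case True
        then have "(c0 - \<epsilon>) / L \<le> 0" using L1 by (simp add: divide_le_0_iff)
        also have "0 \<le> kernel_sum n (r n) w / ?s n (r n)" using s0 kernel_sum_bounds(1) by simp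
        finally show ?thesis .
      next
        case False
        have "?s n (r n) \<le> L * u" using uv \<open>v \<le> L * u\<close> by linarith
        then have "(c0 - \<epsilon>) * ?s n (r n) \<le> (c0 - \<epsilon>) * (L * u)" using False by (intro mult_left_mono) auto
        also have "\<dots> = L * ((c0 - \<epsilon>) * u)" by simp
        also have "\<dots> \<le> L * kernel_sum (N m) (1 / \<kappa> * r (N m)) w"
          using b(1) uv(1) L1 unfolding u_def[symmetric] by (intro mult_left_mono) (auto simp: field_simps)
        also have "\<dots> \<le> L * kernel_sum n (r n) w" using S(1) L1 by (intro mult_left_mono) auto
        finally have "(c0 - \<epsilon>) * ?s n (r n) \<le> L * kernel_sum n (r n) w" .
        then show ?thesis using s0 L1 by (simp add: field_simps)
      qed
      show ?thesis using 1 2 by simp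
    qed
    then show "eventually (\<lambda>n. (c0 - \<epsilon>) / L \<le> kernel_sum n (r n) w / ?s n (r n) \<and>
        kernel_sum n (r n) w / ?s n (r n) \<le> L * (c0 + \<epsilon>)) sequentially"
      unfolding eventually_sequentially by blast
  qed
qed

theorem interpolated_strong_law:
  "AE w in M. (\<lambda>n. kernel_sum n (r n) w / scaling DIM('a) k n (r n)) \<longlonglongrightarrow> c0"
proof -
  let ?x = "\<lambda>w n. kernel_sum n (r n) w / scaling DIM('a) k n (r n)"
  \<comment> \<open>Countably many ratios decreasing to 1 share one null set. Starting at
    \<open>26 / 25\<close> ensures \<open>\<mu> j ^ 4 \<le> 6 / 5\<close>, the range of the uniform
    estimate.\<close>
  define \<mu> where "\<mu> j = 1 + 1 / (real j + 25)" for j :: nat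
  define L where "L j = (\<mu> j ^ 4) ^ (k + 2) * (((\<mu> j ^ 4) powr (\<bar>\<alpha>\<bar> + 1)) ^ (DIM('a) * (k + 1)))\<^sup>2" for j
  have \<mu>: "1 < \<mu> j" "\<mu> j ^ 4 \<le> 6 / 5" for j
  proof -
    show "1 < \<mu> j" by (simp add: \<mu>_def)
    have "\<mu> j \<le> 26 / 25" by (simp add: \<mu>_def field_simps)
    then have "\<mu> j ^ 4 \<le> (26 / 25) ^ 4" using \<open>1 < \<mu> j\<close> by (intro power_mono) auto
    also have "\<dots> \<le> 6 / (5 :: real)" by (simp add: power_divide)
    finally show "\<mu> j ^ 4 \<le> 6 / 5" .
  qed
  have "filterlim (\<lambda>j. 25 + real j) at_top sequentially"
    by (rule filterlim_tendsto_add_at_top[OF tendsto_const filterlim_real_sequentially])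
  then have "(\<lambda>j. 1 / (25 + real j)) \<longlonglongrightarrow> 0" by (rule tendsto_divide_0[OF tendsto_const filterlim_at_top_imp_at_infinity])
  then have "(\<lambda>j. 1 + 1 / (25 + real j)) \<longlonglongrightarrow> 1 + 0" by (intro tendsto_add tendsto_const)
  then have "\<mu> \<longlonglongrightarrow> 1" by (simp add: \<mu>_def[abs_def] add.commute)
  then have "L \<longlonglongrightarrow> (1 ^ 4) ^ (k + 2) * (((1 ^ 4) powr (\<bar>\<alpha>\<bar> + 1)) ^ (DIM('a) * (k + 1)))\<^sup>2"
    unfolding L_def[abs_def] by (intro tendsto_mult tendsto_power tendsto_powr tendsto_const) auto
  then have L: "L \<longlonglongrightarrow> 1" by simp
  have L_pos: "0 < L j" for j using \<mu>(1)[of j] by (simp add: L_def)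
  have "AE w in M. \<forall>j. \<forall>\<epsilon>>0. eventually (\<lambda>n. (c0 - \<epsilon>) / L j \<le> ?x w n \<and>
    ?x w n \<le> L j * (c0 + \<epsilon>)) sequentially"
    unfolding AE_all_countable L_def using interpolation_bounds[OF \<mu>] by blast
  then show ?thesis
  proof (rule AE_mp, intro AE_I2 impI)
    fix w
    assume *: "\<forall>j. \<forall>\<epsilon>>0. eventually (\<lambda>n. (c0 - \<epsilon>) / L j \<le> ?x w n \<and>
      ?x w n \<le> L j * (c0 + \<epsilon>)) sequentially"
    show "(\<lambda>n. ?x w n) \<longlonglongrightarrow> c0"
    proof (rule order_tendstoI)
      fix y assume y: "y < c0"
      define \<epsilon> where "\<epsilon> = (c0 - y) / 2"
      have "(\<lambda>j. (c0 - \<epsilon>) / L j) \<longlonglongrightarrow> (c0 - \<epsilon>) / 1" by (intro tendsto_divide tendsto_const L) simp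
      then have "eventually (\<lambda>j. y < (c0 - \<epsilon>) / L j) sequentially"
        by (rule order_tendstoD) (use y in \<open>simp add: \<epsilon>_def field_simps\<close>)
      then obtain j where j: "y < (c0 - \<epsilon>) / L j" using eventually_happens'[OF sequentially_bot] by blast
      have "\<epsilon> > 0" using y by (simp add: \<epsilon>_def)
      with * have "eventually (\<lambda>n. (c0 - \<epsilon>) / L j \<le> ?x w n \<and>
        ?x w n \<le> L j * (c0 + \<epsilon>)) sequentially" by blast
      then show "eventually (\<lambda>n. y < ?x w n) sequentially"
        by eventually_elim (use j in linarith)
    next
      fix y assume y: "c0 < y"
      define \<epsilon> where "\<epsilon> = (y - c0) / 2"
      have "(\<lambda>j. L j * (c0 + \<epsilon>)) \<longlonglongrightarrow> 1 * (c0 + \<epsilon>)" by (intro tendsto_mult tendsto_const L)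
      then have "eventually (\<lambda>j. L j * (c0 + \<epsilon>) < y) sequentially"
        by (rule order_tendstoD) (use y in \<open>simp add: \<epsilon>_def field_simps\<close>)
      then obtain j where j: "L j * (c0 + \<epsilon>) < y" using eventually_happens'[OF sequentially_bot] by blast
      have "\<epsilon> > 0" using y by (simp add: \<epsilon>_def)
      with * have "eventually (\<lambda>n. (c0 - \<epsilon>) / L j \<le> ?x w n \<and>
        ?x w n \<le> L j * (c0 + \<epsilon>)) sequentially" by blast
      then show "eventually (\<lambda>n. ?x w n < y) sequentially"
        by eventually_elim (use j in linarith)
    qed
  qed
qed

end

end

section \<open>Counting simplices born and filled before given times\<close>

text \<open>The guard gives the kernel the value 0 on index sets of the wrong size, so that locality
  and reindexing need no case of degenerate sets.\<close>

definition time_kernel :: "nat \<Rightarrow> (real \<times> real \<Rightarrow> real) \<Rightarrow> real \<Rightarrow> (nat \<Rightarrow> 'a::euclidean_space) \<Rightarrow> nat set \<Rightarrow> real" where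
  "time_kernel q \<psi> \<rho> x A =
     (if finite A \<and> card A = q then \<psi> (birth_time x A / \<rho>, death_time x A / \<rho>) else 0)"

definition crowd_kernel :: "real \<Rightarrow> real \<Rightarrow> (nat \<Rightarrow> 'a::euclidean_space) \<Rightarrow> nat set \<Rightarrow> real" where
  "crowd_kernel T \<rho> x A = (if diameter_le x (T * \<rho>) A then 1 else 0)"

text \<open>Unlike a rectangle this set is closed under lowering both times: enlarging the scale can
  only switch the indicator on, which is the monotonicity needed for interpolation.\<close>

definition quadrant :: "real \<Rightarrow> real \<Rightarrow> real \<times> real \<Rightarrow> real" where
  "quadrant s u p = (if fst p \<le> s \<and> snd p \<le> u then 1 else 0)"

lemma quadrant_measurable: "quadrant s u \<in> borel_measurable borel"
proof -
  have "{p :: real \<times> real. fst p \<le> s \<and> snd p \<le> u} = {..s} \<times> {..u}" by auto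
  moreover have "closed ({..s} \<times> {..u})" by (intro closed_Times) auto
  ultimately have "{p :: real \<times> real. fst p \<le> s \<and> snd p \<le> u} \<in> sets borel" by simp
  then show ?thesis unfolding quadrant_def[abs_def] by (intro measurable_If) auto
qed

lemma subsets_of_cardD: "finite I \<Longrightarrow> A \<in> subsets_of_card q I \<Longrightarrow> A \<subseteq> I \<and> card A = q \<and> finite A"
  by (auto simp: subsets_of_card_def finite_subset)

context bounded_density
begin

lemma scale_kernel_time:
  assumes k: "k \<ge> 1" and T: "T > 0"
    and \<psi>: "\<psi> \<in> borel_measurable borel" "\<And>p. 0 \<le> \<psi> p \<and> \<psi> p \<le> 1" "\<And>b d. \<psi> (b, d) \<noteq> 0 \<Longrightarrow> b \<le> T"
  shows "scale_kernel f Bf (time_kernel (k + 2) \<psi>) (k + 2) T"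
proof (intro scale_kernel.intro scale_kernel_axioms.intro bounded_density_axioms)
  fix \<rho> :: real and I A :: "nat set"
  assume "\<rho> > 0" and I: "finite I" and A: "A \<in> subsets_of_card (k + 2) I"
  note A' = subsets_of_cardD[OF I A]
  show "(\<lambda>x. time_kernel (k + 2) \<psi> \<rho> x A) \<in> borel_measurable (PiM I (\<lambda>_. borel :: 'a measure))"
    using time_kernel_measurable[OF \<psi>(1), of "k + 1" A I \<rho>] A' by (simp add: time_kernel_def)
next
  fix \<rho> :: real and A :: "nat set"
  show "depends_on A (\<lambda>x :: nat \<Rightarrow> 'a. time_kernel (k + 2) \<psi> \<rho> x A)"
    unfolding depends_on_def
  proof (intro allI impI)
    fix x y :: "nat \<Rightarrow> 'a" assume "\<forall>i\<in>A. x i = y i"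
    then show "time_kernel (k + 2) \<psi> \<rho> x A = time_kernel (k + 2) \<psi> \<rho> y A"
      using birth_time_cong[of A x y] by (simp add: time_kernel_def)
  qed
next
  fix \<rho> :: real and x :: "nat \<Rightarrow> 'a" and A :: "nat set"
  assume *: "\<rho> > 0" "finite A" "card A = k + 2" "time_kernel (k + 2) \<psi> \<rho> x A \<noteq> 0"
  then have "birth_time x A / \<rho> \<le> T" using \<psi>(3) by (simp add: time_kernel_def)
  then have "birth_time x A \<le> T * \<rho>" using *(1) by (simp add: field_simps)
  moreover have "diameter_le x (birth_time x A) A" using * k by (intro diameter_le_birth_time) auto
  ultimately show "diameter_le x (T * \<rho>) A" unfolding diameter_le_def by force
next
  fix \<rho> :: real and x :: "nat \<Rightarrow> 'a" and e :: "nat \<Rightarrow> nat" and B :: "nat set"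
  assume "inj_on e B"
  then show "time_kernel (k + 2) \<psi> \<rho> (\<lambda>j. x (e j)) B = time_kernel (k + 2) \<psi> \<rho> x (e ` B)"
    using birth_time_reindex[of e B x] by (simp add: time_kernel_def finite_image_iff card_image)
qed (use k T \<psi>(2) in \<open>auto simp: time_kernel_def\<close>)

lemma scale_kernel_crowd:
  assumes "T > 0" "q \<ge> 1"
  shows "scale_kernel f Bf (crowd_kernel T) q T"
proof (intro scale_kernel.intro scale_kernel_axioms.intro bounded_density_axioms)
  fix \<rho> :: real and I A :: "nat set"
  assume "\<rho> > 0" and I: "finite I" and A: "A \<in> subsets_of_card q I"
  note A' = subsets_of_cardD[OF I A]
  have c: "(\<lambda>x. x i) \<in> borel_measurable (PiM I (\<lambda>_. borel :: 'a measure))" if "i \<in> A" for i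
    using measurable_component_singleton[of i I "\<lambda>_. borel"] A' that by auto
  have "{x \<in> space (PiM I (\<lambda>_. borel :: 'a measure)). \<forall>i\<in>A. \<forall>j\<in>A. dist (x i) (x j) \<le> T * \<rho>} \<in> sets (PiM I (\<lambda>_. borel))"
  proof (intro sets.sets_Collect_finite_All')
    fix i j assume ij: "i \<in> A" "j \<in> A"
    have "(\<lambda>x. dist (x i) (x j)) \<in> borel_measurable (PiM I (\<lambda>_. borel :: 'a measure))"
      by (intro borel_measurable_dist c ij)
    then show "{x \<in> space (PiM I (\<lambda>_. borel :: 'a measure)). dist (x i) (x j) \<le> T * \<rho>} \<in> sets (PiM I (\<lambda>_. borel))"
      by measurable
  qed (use A' assms in auto)
  then show "(\<lambda>x. crowd_kernel T \<rho> x A) \<in> borel_measurable (PiM I (\<lambda>_. borel :: 'a measure))"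
    unfolding crowd_kernel_def diameter_le_def by (intro measurable_If) auto
qed (use assms in \<open>auto simp: crowd_kernel_def depends_on_def diameter_le_def split: if_splits\<close>)

lemma kernel_mean_time:
  assumes "scale_kernel f Bf (time_kernel (k + 2) \<psi>) (k + 2) T"
  shows "scale_kernel.kernel_mean f (time_kernel (k + 2) \<psi>) (k + 2) \<rho> = mean_kernel (k + 1) \<psi> \<rho>"
proof -
  interpret scale_kernel f Bf "time_kernel (k + 2) \<psi>" "k + 2" T by (rule assms)
  have e: "{0..<k + 2} = {0..k + 1}" by auto
  show ?thesis unfolding kernel_mean_def mean_kernel_def e by (simp add: time_kernel_def)
qed

lemma sparse_scale_tendsto_zero:
  fixes N :: "nat \<Rightarrow> nat" and \<rho> :: "nat \<Rightarrow> real"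
  assumes "\<And>m. N m \<ge> 1" "\<And>m. \<rho> m > 0" "(\<lambda>m. real (N m) * \<rho> m ^ DIM('a)) \<longlonglongrightarrow> 0"
  shows "\<rho> \<longlonglongrightarrow> 0"
proof -
  have "(\<lambda>m. \<rho> m ^ DIM('a)) \<longlonglongrightarrow> 0"
  proof (rule real_tendsto_sandwich[rotated])
    show "eventually (\<lambda>m. 0 \<le> \<rho> m ^ DIM('a)) sequentially"
      using assms(2) by (intro always_eventually allI zero_le_power) (simp add: less_imp_le)
    have "1 * \<rho> m ^ DIM('a) \<le> real (N m) * \<rho> m ^ DIM('a)" for m
      using assms(1)[of m] less_imp_le[OF assms(2)[of m]] by (intro mult_right_mono) auto
    then show "eventually (\<lambda>m. \<rho> m ^ DIM('a) \<le> real (N m) * \<rho> m ^ DIM('a)) sequentially" by simp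
  qed (use assms in auto)
  then have "(\<lambda>m. root DIM('a) (\<rho> m ^ DIM('a))) \<longlonglongrightarrow> root DIM('a) 0" by (rule tendsto_real_root)
  then show ?thesis using assms(2) by (simp add: real_root_power_cancel less_imp_le)
qed

text \<open>The factorial in \<open>C_const\<close> is the limit of the binomial coefficient over
  \<open>N m ^ (k + 2)\<close>; the integral of the power of \<open>f\<close> comes from the
  rescaled kernel.\<close>

lemma time_mean_limit:
  fixes N :: "nat \<Rightarrow> nat" and \<rho> :: "nat \<Rightarrow> real"
  assumes k: "k \<ge> 1"
    and \<psi>: "\<psi> \<in> borel_measurable borel" "\<And>p. 0 \<le> \<psi> p \<and> \<psi> p \<le> 1" "\<And>b d. \<psi> (b, d) \<noteq> 0 \<Longrightarrow> b \<le> T"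
    and N: "filterlim N at_top sequentially" "\<And>m. N m \<ge> 1" and \<rho>: "\<And>m. \<rho> m > 0"
    and small: "(\<lambda>m. real (N m) * \<rho> m ^ DIM('a)) \<longlonglongrightarrow> 0"
  shows "(\<lambda>m. real (N m choose (k + 2)) * mean_kernel (k + 1) \<psi> (\<rho> m) / scaling DIM('a) k (N m) (\<rho> m))
    \<longlonglongrightarrow> C_const f k * enn2real (time_integral TYPE('a) (k + 1) \<psi>)"
proof -
  have "(\<lambda>m. real (N m choose (k + 2)) / real (N m) ^ (k + 2)) \<longlonglongrightarrow> 1 / fact (k + 2)"
    by (rule filterlim_compose[OF choose_over_power_tendsto N(1)])
  moreover have "(\<lambda>m. mean_kernel (k + 1) \<psi> (\<rho> m) / \<rho> m ^ (DIM('a) * (k + 1)))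
    \<longlonglongrightarrow> (\<integral>x. f x ^ Suc (k + 1) \<partial>lborel) * enn2real (time_integral TYPE('a) (k + 1) \<psi>)"
    by (rule mean_kernel_asymp[OF \<rho> sparse_scale_tendsto_zero[OF N(2) \<rho> small] _ \<psi>]) (use k in auto)
  ultimately have "(\<lambda>m. real (N m choose (k + 2)) / real (N m) ^ (k + 2) * (mean_kernel (k + 1) \<psi> (\<rho> m) / \<rho> m ^ (DIM('a) * (k + 1))))
    \<longlonglongrightarrow> 1 / fact (k + 2) * ((\<integral>x. f x ^ Suc (k + 1) \<partial>lborel) * enn2real (time_integral TYPE('a) (k + 1) \<psi>))"
    by (rule tendsto_mult)
  moreover have "1 / fact (k + 2) * ((\<integral>x. f x ^ Suc (k + 1) \<partial>lborel) * enn2real (time_integral TYPE('a) (k + 1) \<psi>)) =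
      C_const f k * enn2real (time_integral TYPE('a) (k + 1) \<psi>)"
    by (simp add: C_const_def)
  ultimately show ?thesis by (simp only: scaling_def times_divide_times_eq)
qed

lemma C_const_nonneg: "0 \<le> C_const f k"
  unfolding C_const_def using f_nonneg by (intro mult_nonneg_nonneg Bochner_Integration.integral_nonneg) auto

text \<open>One more nearby point multiplies the bound by a constant times
  \<open>n * \<rho> ^ DIM('a)\<close>, which is exactly what tends to 0 in the sparse
  regime.\<close>

lemma near_prob_bound:
  fixes \<rho> :: real
  assumes "T > 0" "\<rho> > 0"
  shows "real n ^ (k + 2) * near_prob (T * \<rho>) ^ (k + 2 - 1) \<le> near_prob T ^ (k + 1) * scaling DIM('a) k n \<rho>"
    and "real n ^ (k + 3) * near_prob (T * \<rho>) ^ (k + 3 - 1)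
      = near_prob T ^ (k + 2) * (real n * \<rho> ^ DIM('a)) * scaling DIM('a) k n \<rho>"
proof -
  have e: "near_prob (T * \<rho>) ^ j = near_prob T ^ j * \<rho> ^ (DIM('a) * j)" for j
    by (simp only: near_prob_scale power_mult_distrib power_mult)
  have "k + 2 - 1 = k + 1" "k + 3 - 1 = k + 2" by auto
  note e' = this e
  show "real n ^ (k + 2) * near_prob (T * \<rho>) ^ (k + 2 - 1) \<le> near_prob T ^ (k + 1) * scaling DIM('a) k n \<rho>"
    unfolding e' scaling_def by (simp only: mult_ac order_refl)
  have "\<rho> ^ (DIM('a) * (k + 2)) = \<rho> ^ DIM('a) * \<rho> ^ (DIM('a) * (k + 1))"
    by (simp add: power_add[symmetric])
  moreover have "real n ^ (k + 3) = real n * real n ^ (k + 2)" by (simp add: numeral_3_eq_3)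
  ultimately show "real n ^ (k + 3) * near_prob (T * \<rho>) ^ (k + 3 - 1)
      = near_prob T ^ (k + 2) * (real n * \<rho> ^ DIM('a)) * scaling DIM('a) k n \<rho>"
    unfolding e' scaling_def by (simp only: mult_ac)
qed

lemma crowd_mean_limit:
  fixes N :: "nat \<Rightarrow> nat" and \<rho> :: "nat \<Rightarrow> real"
  assumes T: "T > 0" and N: "\<And>m. N m \<ge> 1" and \<rho>: "\<And>m. \<rho> m > 0"
    and small: "(\<lambda>m. real (N m) * \<rho> m ^ DIM('a)) \<longlonglongrightarrow> 0"
  shows "(\<lambda>m. real (N m choose (k + 3)) * scale_kernel.kernel_mean f (crowd_kernel T) (k + 3) (\<rho> m) / scaling DIM('a) k (N m) (\<rho> m)) \<longlonglongrightarrow> 0"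
proof -
  interpret scale_kernel f Bf "crowd_kernel T" "k + 3" T by (rule scale_kernel_crowd) (use T in auto)
  have s: "0 < scaling DIM('a) k (N m) (\<rho> m)" for m by (rule scaling_pos[OF N \<rho>])
  show ?thesis
  proof (rule real_tendsto_sandwich[rotated])
    show "eventually (\<lambda>m. 0 \<le> real (N m choose (k + 3)) * kernel_mean (\<rho> m) / scaling DIM('a) k (N m) (\<rho> m)) sequentially"
      using kernel_total_mean_le(1)[OF \<rho>] less_imp_le[OF s]
      by (intro always_eventually allI divide_nonneg_nonneg mult_nonneg_nonneg) auto
    have "real (N m choose (k + 3)) * kernel_mean (\<rho> m) / scaling DIM('a) k (N m) (\<rho> m) \<le> near_prob T ^ (k + 2) * (real (N m) * \<rho> m ^ DIM('a))" for m
      using kernel_total_mean_le(2)[OF \<rho>, of "N m" m] s[of m]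
      unfolding near_prob_bound(2)[OF T \<rho>] by (simp add: divide_le_eq)
    then show "eventually (\<lambda>m. real (N m choose (k + 3)) * kernel_mean (\<rho> m) / scaling DIM('a) k (N m) (\<rho> m)
      \<le> near_prob T ^ (k + 2) * (real (N m) * \<rho> m ^ DIM('a))) sequentially" by simp
    have "(\<lambda>m. near_prob T ^ (k + 2) * (real (N m) * \<rho> m ^ DIM('a))) \<longlonglongrightarrow> near_prob T ^ (k + 2) * 0"
      by (intro tendsto_mult tendsto_const small)
    then show "(\<lambda>m. near_prob T ^ (k + 2) * (real (N m) * \<rho> m ^ DIM('a))) \<longlonglongrightarrow> 0" by simp
  qed simp
qed

end

locale sparse_sample = iid_sample f Bf M X
  for f :: "'a::euclidean_space \<Rightarrow> real" and Bf and M :: "'w measure" and X +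
  fixes k :: nat and r :: "nat \<Rightarrow> real" and \<alpha> \<eta> C :: real
  assumes k: "k \<ge> 1"
    and r_pos: "\<And>n. n \<ge> 1 \<Longrightarrow> 0 < r n"
    and sparse: "(\<lambda>n. real n * r n ^ DIM('a)) \<longlonglongrightarrow> 0"
    and rv: "\<And>c. c > 0 \<Longrightarrow> (\<lambda>n. r (nat \<lfloor>c * real n\<rfloor>) / r n) \<longlonglongrightarrow> c powr \<alpha>"
    and growth: "\<eta> > 0" "C > 0" "\<And>n. n \<ge> 1 \<Longrightarrow> C * ln (real n) powr \<eta> \<le> scaling DIM('a) k n (r n)"
begin

definition time_sum :: "(real \<times> real \<Rightarrow> real) \<Rightarrow> nat \<Rightarrow> 'w \<Rightarrow> real" where
  "time_sum \<psi> n w = (\<Sum>A\<in>subsets_of_card (k + 2) {1..n}.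
     \<psi> (birth_time (\<lambda>i. X i w) A / r n, death_time (\<lambda>i. X i w) A / r n))"

definition crowd_count :: "real \<Rightarrow> nat \<Rightarrow> 'w \<Rightarrow> real" where
  "crowd_count T n w = card {A\<in>subsets_of_card (k + 3) {1..n}. diameter_le (\<lambda>i. X i w) (T * r n) A}"

lemma time_sum_eq:
  assumes "sample_kernel f Bf M X (time_kernel (k + 2) \<psi>) (k + 2) T"
  shows "sample_kernel.kernel_sum X (time_kernel (k + 2) \<psi>) (k + 2) n (r n) w = time_sum \<psi> n w"
proof -
  interpret sample_kernel f Bf M X "time_kernel (k + 2) \<psi>" "k + 2" T by (rule assms)
  show ?thesis unfolding kernel_sum_def time_sum_def
    by (intro sum.cong refl) (auto simp: time_kernel_def dest: subsets_of_cardD[OF finite_atLeastAtMost])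
qed

lemma crowd_count_eq:
  assumes "sample_kernel f Bf M X (crowd_kernel T) (k + 3) T"
  shows "sample_kernel.kernel_sum X (crowd_kernel T) (k + 3) n (r n) w = crowd_count T n w"
proof -
  interpret sample_kernel f Bf M X "crowd_kernel T" "k + 3" T by (rule assms)
  have "finite (subsets_of_card (k + 3) {1..n})" by (rule finite_subsets_of_card) simp
  then show ?thesis unfolding kernel_sum_def crowd_count_def crowd_kernel_def
    by (simp add: sum.If_cases Int_def)
qed

lemma sample_kernel_time:
  assumes "T > 0"
    and "\<psi> \<in> borel_measurable borel" "\<And>p. 0 \<le> \<psi> p \<and> \<psi> p \<le> 1" "\<And>b d. \<psi> (b, d) \<noteq> 0 \<Longrightarrow> b \<le> T"
  shows "sample_kernel f Bf M X (time_kernel (k + 2) \<psi>) (k + 2) T"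
  by (intro sample_kernel.intro iid_sample_axioms scale_kernel_time k assms)

lemma sample_kernel_crowd: "T > 0 \<Longrightarrow> sample_kernel f Bf M X (crowd_kernel T) (k + 3) T"
  by (intro sample_kernel.intro iid_sample_axioms scale_kernel_crowd) auto

theorem quadrant_strong_law:
  assumes su: "s \<ge> 0" "u \<ge> 0"
  shows "AE w in M. (\<lambda>n. time_sum (quadrant s u) n w / scaling DIM('a) k n (r n))
    \<longlonglongrightarrow> C_const f k * enn2real (time_integral TYPE('a) (k + 1) (quadrant s u))"
proof -
  \<comment> \<open>A birth bound that stays positive also for \<open>s = 0\<close>.\<close>
  define T where "T = s + 1"
  have T: "T > 0" using su by (simp add: T_def)
  have \<psi>: "quadrant s u \<in> borel_measurable borel" "\<And>p. 0 \<le> quadrant s u p \<and> quadrant s u p \<le> 1"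
    "\<And>b d. quadrant s u (b, d) \<noteq> 0 \<Longrightarrow> b \<le> T"
    by (auto simp: quadrant_measurable) (auto simp: quadrant_def T_def split: if_splits)
  have sk: "sample_kernel f Bf M X (time_kernel (k + 2) (quadrant s u)) (k + 2) T"
    by (rule sample_kernel_time[OF T \<psi>])
  interpret K: sample_kernel f Bf M X "time_kernel (k + 2) (quadrant s u)" "k + 2" T by (rule sk)
  have km: "K.kernel_mean \<rho> = mean_kernel (k + 1) (quadrant s u) \<rho>" for \<rho>
    by (rule kernel_mean_time[OF sample_kernel.axioms(2)[OF sk]])
  show ?thesis
    unfolding time_sum_eq[OF sk, symmetric]
  proof (rule K.interpolated_strong_law[OF _ _ _ _ r_pos sparse rv growth])
    fix \<rho> \<rho>' :: real and x :: "nat \<Rightarrow> 'a" and A :: "nat set"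
    assume *: "0 < \<rho>" "\<rho> \<le> \<rho>'"
    have "b / \<rho>' \<le> c" if "b / \<rho> \<le> c" "c \<ge> 0" for b c
    proof -
      have "b \<le> c * \<rho>" using that * by (simp add: field_simps)
      also have "\<dots> \<le> c * \<rho>'" using * that by (intro mult_left_mono)
      finally show ?thesis using * by (simp add: field_simps)
    qed
    then show "time_kernel (k + 2) (quadrant s u) \<rho> x A \<le> time_kernel (k + 2) (quadrant s u) \<rho>' x A"
      using su by (auto simp: time_kernel_def quadrant_def)
  next
    fix n :: nat and \<rho> :: real
    assume "\<rho> > 0"
    then show "real n ^ (k + 2) * near_prob (T * \<rho>) ^ (k + 2 - 1) \<le> near_prob T ^ (k + 1) * scaling DIM('a) k n \<rho>"
      by (rule near_prob_bound(1)[OF T])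
  next
    fix N :: "nat \<Rightarrow> nat" and \<rho> :: "nat \<Rightarrow> real"
    assume N: "filterlim N at_top sequentially" "\<And>m. N m \<ge> 1" "\<And>m. \<rho> m > 0" "(\<lambda>m. real (N m) * \<rho> m ^ DIM('a)) \<longlonglongrightarrow> 0"
    show "(\<lambda>m. real (N m choose (k + 2)) * K.kernel_mean (\<rho> m) / scaling DIM('a) k (N m) (\<rho> m))
      \<longlonglongrightarrow> C_const f k * enn2real (time_integral TYPE('a) (k + 1) (quadrant s u))"
      unfolding km by (rule time_mean_limit[OF k \<psi> N])
  qed (simp add: C_const_nonneg)
qed

text \<open>The same interpolation with \<open>k + 3\<close> points but the normalization for
  \<open>k + 2\<close>: the moment bound only uses \<open>n * \<rho> ^ DIM('a) \<le> 1\<close>,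
  while convergence of this quantity to 0 makes the limit 0.\<close>

theorem crowd_strong_law:
  assumes T: "T > 0"
  shows "AE w in M. (\<lambda>n. crowd_count T n w / scaling DIM('a) k n (r n)) \<longlonglongrightarrow> 0"
proof -
  note sk = sample_kernel_crowd[OF T]
  interpret K: sample_kernel f Bf M X "crowd_kernel T" "k + 3" T by (rule sk)
  show ?thesis
    unfolding crowd_count_eq[OF sk, symmetric]
  proof (rule K.interpolated_strong_law[OF _ _ _ _ r_pos sparse rv growth])
    fix \<rho> \<rho>' :: real and x :: "nat \<Rightarrow> 'a" and A :: "nat set"
    assume *: "0 < \<rho>" "\<rho> \<le> \<rho>'"
    then have "T * \<rho> \<le> T * \<rho>'" using T by (intro mult_left_mono) auto
    then show "crowd_kernel T \<rho> x A \<le> crowd_kernel T \<rho>' x A"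
      by (force simp: crowd_kernel_def diameter_le_def)
  next
    fix n :: nat and \<rho> :: real
    assume *: "n \<ge> 1" "\<rho> > 0" "real n * \<rho> ^ DIM('a) \<le> 1"
    have "0 \<le> near_prob T" using T by (intro near_prob_nonneg) simp
    then have "near_prob T ^ (k + 2) * (real n * \<rho> ^ DIM('a)) * scaling DIM('a) k n \<rho> \<le> near_prob T ^ (k + 2) * 1 * scaling DIM('a) k n \<rho>"
      using * scaling_pos[OF *(1,2), of "DIM('a)" k] by (intro mult_right_mono mult_left_mono) auto
    then show "real n ^ (k + 3) * near_prob (T * \<rho>) ^ (k + 3 - 1) \<le> near_prob T ^ (k + 2) * scaling DIM('a) k n \<rho>"
      unfolding near_prob_bound(2)[OF T *(2)] by simp
  next
    fix N :: "nat \<Rightarrow> nat" and \<rho> :: "nat \<Rightarrow> real"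
    assume "\<And>m. N m \<ge> 1" "\<And>m. \<rho> m > 0" "(\<lambda>m. real (N m) * \<rho> m ^ DIM('a)) \<longlonglongrightarrow> 0"
    then show "(\<lambda>m. real (N m choose (k + 3)) * K.kernel_mean (\<rho> m) / scaling DIM('a) k (N m) (\<rho> m)) \<longlonglongrightarrow> 0"
      by (rule crowd_mean_limit[OF T])
  qed simp
qed

text \<open>The index is shifted because positivity of the scale is known from index 1 on
  only.\<close>

lemma shift_limits:
  "filterlim Suc at_top sequentially" "\<And>m. 1 \<le> Suc m" "\<And>m. 0 < r (Suc m)"
  "(\<lambda>m. real (Suc m) * r (Suc m) ^ DIM('a)) \<longlonglongrightarrow> 0"
  using filterlim_Suc r_pos sparse LIMSEQ_Suc[OF sparse] by auto

lemma time_sum_mean: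
  assumes T: "T > 0"
    and \<psi>: "\<psi> \<in> borel_measurable borel" "\<And>p. 0 \<le> \<psi> p \<and> \<psi> p \<le> 1" "\<And>b d. \<psi> (b, d) \<noteq> 0 \<Longrightarrow> b \<le> T"
  shows "(\<lambda>n. expectation (time_sum \<psi> n) / scaling DIM('a) k n (r n))
      \<longlonglongrightarrow> C_const f k * enn2real (time_integral TYPE('a) (k + 1) \<psi>)"
    and "n \<ge> 1 \<Longrightarrow> integrable M (time_sum \<psi> n)"
proof -
  have sk: "sample_kernel f Bf M X (time_kernel (k + 2) \<psi>) (k + 2) T"
    by (rule sample_kernel_time[OF T \<psi>])
  interpret K: sample_kernel f Bf M X "time_kernel (k + 2) \<psi>" "k + 2" T by (rule sk)
  have km: "K.kernel_mean \<rho> = mean_kernel (k + 1) \<psi> \<rho>" for \<rho>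
    by (rule kernel_mean_time[OF sample_kernel.axioms(2)[OF sk]])
  have "(\<lambda>m. real (Suc m choose (k + 2)) * K.kernel_mean (r (Suc m)) / scaling DIM('a) k (Suc m) (r (Suc m)))
      \<longlonglongrightarrow> C_const f k * enn2real (time_integral TYPE('a) (k + 1) \<psi>)"
    unfolding km by (rule time_mean_limit[OF k \<psi> shift_limits])
  moreover have "expectation (time_sum \<psi> n) = real (n choose (k + 2)) * K.kernel_mean (r n)" if "n \<ge> 1" for n
    using K.expectation_kernel_sum[OF r_pos[OF that] that] unfolding time_sum_eq[OF sk, abs_def] by simp
  ultimately show "(\<lambda>n. expectation (time_sum \<psi> n) / scaling DIM('a) k n (r n))
      \<longlonglongrightarrow> C_const f k * enn2real (time_integral TYPE('a) (k + 1) \<psi>)"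
    by (subst filterlim_sequentially_Suc[symmetric]) simp
  show "integrable M (time_sum \<psi> n)" if "n \<ge> 1"
  proof (rule integrable_const_bound)
    show "AE w in M. norm (time_sum \<psi> n w) \<le> real (n choose (k + 2))"
      using K.kernel_sum_bounds[of n "r n"] unfolding time_sum_eq[OF sk] by simp
    show "time_sum \<psi> n \<in> borel_measurable M"
      using K.kernel_sum_measurable[OF r_pos[OF that], of n] unfolding time_sum_eq[OF sk, abs_def] by simp
  qed
qed

lemma crowd_count_mean:
  assumes T: "T > 0"
  shows "(\<lambda>n. expectation (crowd_count T n) / scaling DIM('a) k n (r n)) \<longlonglongrightarrow> 0"
    and "n \<ge> 1 \<Longrightarrow> integrable M (crowd_count T n)"
proof -
  note sk = sample_kernel_crowd[OF T]
  interpret K: sample_kernel f Bf M X "crowd_kernel T" "k + 3" T by (rule sk)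
  have "(\<lambda>m. real (Suc m choose (k + 3)) * K.kernel_mean (r (Suc m)) / scaling DIM('a) k (Suc m) (r (Suc m))) \<longlonglongrightarrow> 0"
    by (rule crowd_mean_limit[OF T shift_limits(2-4)])
  moreover have "expectation (crowd_count T n) = real (n choose (k + 3)) * K.kernel_mean (r n)" if "n \<ge> 1" for n
    using K.expectation_kernel_sum[OF r_pos[OF that] that] unfolding crowd_count_eq[OF sk, abs_def] by simp
  ultimately show "(\<lambda>n. expectation (crowd_count T n) / scaling DIM('a) k n (r n)) \<longlonglongrightarrow> 0"
    by (subst filterlim_sequentially_Suc[symmetric]) simp
  show "integrable M (crowd_count T n)" if "n \<ge> 1"
  proof (rule integrable_const_bound)
    show "AE w in M. norm (crowd_count T n w) \<le> real (n choose (k + 3))"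
      using K.kernel_sum_bounds[of n "r n"] unfolding crowd_count_eq[OF sk] by simp
    show "crowd_count T n \<in> borel_measurable M"
      using K.kernel_sum_measurable[OF r_pos[OF that], of n] unfolding crowd_count_eq[OF sk, abs_def] by simp
  qed
qed

end

section \<open>Approximation by combinations of quadrants\<close>

lemma tail_sum:
  fixes g :: "nat \<Rightarrow> real"
  shows "(\<Sum>i'<m. (g i' - g (Suc i')) * of_bool (i \<le> i')) = (if i \<le> m then g i - g m else 0)"
proof (induction m)
  case (Suc m)
  show ?case
  proof (cases "i = Suc m")
    case False
    then show ?thesis using Suc by auto
  qed (use Suc in auto)
qed auto

text \<open>Summation by parts in both indices: a function that vanishes beyond \<open>m\<close> is
  the combination of indicators of lower quadrants whose coefficients are its mixed second
  differences.\<close>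

lemma double_tail_sum:
  fixes h :: "nat \<Rightarrow> nat \<Rightarrow> real"
  assumes h: "\<And>i l. i \<ge> m \<or> l \<ge> m \<Longrightarrow> h i l = 0"
  shows "(\<Sum>i'<m. \<Sum>l'<m. (h i' l' - h (Suc i') l' - h i' (Suc l') + h (Suc i') (Suc l')) * of_bool (i \<le> i' \<and> l \<le> l')) = h i l"
proof -
  have "(\<Sum>l'<m. (h i' l' - h (Suc i') l' - h i' (Suc l') + h (Suc i') (Suc l')) * of_bool (i \<le> i' \<and> l \<le> l')) =
      (h i' l - h (Suc i') l) * of_bool (i \<le> i')" for i'
  proof -
    have "(\<Sum>l'<m. (h i' l' - h (Suc i') l' - h i' (Suc l') + h (Suc i') (Suc l')) * of_bool (i \<le> i' \<and> l \<le> l')) =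
        (\<Sum>l'<m. ((h i' l' - h (Suc i') l') - (h i' (Suc l') - h (Suc i') (Suc l'))) * of_bool (l \<le> l')) * of_bool (i \<le> i')"
      unfolding sum_distrib_right by (intro sum.cong refl) (auto simp: of_bool_conj)
    also have "(\<Sum>l'<m. ((h i' l' - h (Suc i') l') - (h i' (Suc l') - h (Suc i') (Suc l'))) * of_bool (l \<le> l')) =
        (h i' l - h (Suc i') l)"
      using h[of i' m] h[of "Suc i'" m] h[of i' l] h[of "Suc i'" l]
      by (subst tail_sum[of "\<lambda>l'. h i' l' - h (Suc i') l'"]) auto
    finally show ?thesis .
  qed
  then have "(\<Sum>i'<m. \<Sum>l'<m. (h i' l' - h (Suc i') l' - h i' (Suc l') + h (Suc i') (Suc l')) * of_bool (i \<le> i' \<and> l \<le> l')) =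
      (\<Sum>i'<m. (h i' l - h (Suc i') l) * of_bool (i \<le> i'))" by simp
  also have "\<dots> = h i l" using h[of m l] h[of i l] by (subst tail_sum[of "\<lambda>i'. h i' l"]) auto
  finally show ?thesis .
qed

text \<open>\<open>\<psi>\<close> is replaced by its value at the next grid point above in both
  coordinates. Rounding upwards preserves births beyond \<open>T\<close>, where both functions
  vanish, so the error is confined to the quadrant with deaths at most \<open>2 * T\<close>.\<close>

lemma quadrant_approx:
  fixes \<psi> :: "real \<times> real \<Rightarrow> real"
  assumes cont: "continuous_on ({0..} \<times> {0..}) \<psi>" and T: "T > 0"
    and supp: "\<And>b d. \<psi> (b, d) \<noteq> 0 \<Longrightarrow> b \<le> T" and \<epsilon>: "\<epsilon> > 0"
  obtains j m :: nat and c :: "nat \<Rightarrow> nat \<Rightarrow> real" where "j > 0"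
    "\<And>p. 0 \<le> fst p \<Longrightarrow> 0 \<le> snd p \<Longrightarrow> snd p \<le> 2 * fst p \<Longrightarrow>
      \<bar>\<psi> p - (\<Sum>i<m. \<Sum>l<m. c i l * quadrant (real i / real j) (real l / real j) p)\<bar> \<le> \<epsilon> * quadrant T (2 * T) p"
proof -
  \<comment> \<open>Births up to \<open>T\<close>, deaths up to \<open>2 * T\<close>, and room for
    rounding by at most 1.\<close>
  define R where "R = 2 * T + 2"
  have "uniformly_continuous_on ({0..R} \<times> {0..R}) \<psi>"
    by (intro compact_uniformly_continuous continuous_on_subset[OF cont] compact_Times) auto
  then obtain \<delta> where \<delta>: "\<delta> > 0" "\<And>p p'. p \<in> {0..R} \<times> {0..R} \<Longrightarrow> p' \<in> {0..R} \<times> {0..R} \<Longrightarrow> dist p' p < \<delta> \<Longrightarrow> dist (\<psi> p') (\<psi> p) < \<epsilon>"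
    using \<epsilon> unfolding uniformly_continuous_on_def by blast
  obtain j0 :: nat where j0: "2 / \<delta> < real j0" using reals_Archimedean2 by blast
  define j where "j = Suc j0"
  have j: "j > 0" "2 / real j < \<delta>" "1 / real j \<le> 1"
  proof -
    have "2 / \<delta> < real j" using j0 by (simp add: j_def)
    then show "2 / real j < \<delta>" using \<delta>(1) by (simp add: field_simps j_def)
  qed (simp_all add: j_def)
  obtain m :: nat where m: "real j * R < real m" using reals_Archimedean2 by blast
  define h where "h i l = (if i < m \<and> l < m then \<psi> (real i / real j, real l / real j) else 0)" for i l :: nat
  define c where "c i l = h i l - h (Suc i) l - h i (Suc l) + h (Suc i) (Suc l)" for i l
  have "\<bar>\<psi> p - (\<Sum>i<m. \<Sum>l<m. c i l * quadrant (real i / real j) (real l / real j) p)\<bar> \<le> \<epsilon> * quadrant T (2 * T) p"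
    if p: "0 \<le> fst p" "0 \<le> snd p" "snd p \<le> 2 * fst p" for p
  proof -
    obtain b d where bd: "p = (b, d)" "0 \<le> b" "0 \<le> d" "d \<le> 2 * b" using p by (cases p) auto
    \<comment> \<open>With the index rounded up, lying in a grid quadrant becomes the comparison of
      indices in \<open>double_tail_sum\<close>.\<close>
    define I where "I = nat \<lceil>real j * b\<rceil>"
    define L where "L = nat \<lceil>real j * d\<rceil>"
    have le: "nat \<lceil>real j * z\<rceil> \<le> i \<longleftrightarrow> z \<le> real i / real j" for z and i :: nat
      using j(1) by (simp add: nat_le_iff ceiling_le_iff field_simps)
    have up: "z \<le> real (nat \<lceil>real j * z\<rceil>) / real j" for z using le[of z "nat \<lceil>real j * z\<rceil>"] by simp
    have near: "real (nat \<lceil>real j * z\<rceil>) / real j \<le> z + 1 / real j" if "0 \<le> z" for z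
    proof -
      have "0 \<le> real j * z" using that by simp
      then have "real (nat \<lceil>real j * z\<rceil>) \<le> real j * z + 1" by linarith
      then show ?thesis using j(1) by (simp add: field_simps)
    qed
    have "(\<Sum>i<m. \<Sum>l<m. c i l * quadrant (real i / real j) (real l / real j) p) = (\<Sum>i<m. \<Sum>l<m. c i l * of_bool (I \<le> i \<and> L \<le> l))"
      unfolding quadrant_def bd I_def L_def le fst_conv snd_conv of_bool_def by simp
    also have "\<dots> = h I L" unfolding c_def by (rule double_tail_sum) (auto simp: h_def)
    finally have eq: "(\<Sum>i<m. \<Sum>l<m. c i l * quadrant (real i / real j) (real l / real j) p) = h I L" .
    show ?thesis
    proof (cases "b \<le> T")
      case False
      then have "\<psi> (b, d) = 0" using supp by blast
      moreover have "\<not> real I / real j \<le> T" using up[of b] False by (simp add: I_def)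
      then have "h I L = 0" using supp by (auto simp: h_def)
      ultimately show ?thesis using eq bd \<epsilon> by (simp add: quadrant_def)
    next
      case True
      have nI: "b \<le> real I / real j" "real I / real j \<le> b + 1 / real j" unfolding I_def by (rule up) (rule near[OF bd(2)])
      have nL: "d \<le> real L / real j" "real L / real j \<le> d + 1 / real j" unfolding L_def by (rule up) (rule near[OF bd(3)])
      have "b + 1 / real j \<le> R" "d + 1 / real j \<le> R" using True bd j(3) T by (auto simp: R_def)
      then have *: "real I / real j \<le> R" "real L / real j \<le> R" "b \<le> R" "d \<le> R" using nI nL by linarith+
      then have "real I \<le> real j * R" "real L \<le> real j * R" using j(1) by (auto simp: field_simps)
      then have "I < m" "L < m" using m by linarith+
      then have h: "h I L = \<psi> (real I / real j, real L / real j)" by (simp add: h_def)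
      have "dist (real I / real j, real L / real j) (b, d) \<le> \<bar>real I / real j - b\<bar> + \<bar>real L / real j - d\<bar>"
        using sqrt_sum_squares_le_sum_abs[of "real I / real j - b" "real L / real j - d"] by (simp add: dist_prod_def dist_real_def)
      also have "\<dots> \<le> 1 / real j + 1 / real j" using nI nL by linarith
      also have "\<dots> < \<delta>" using j(2) by simp
      finally have "dist (\<psi> (real I / real j, real L / real j)) (\<psi> (b, d)) < \<epsilon>"
        using * bd by (intro \<delta>(2)) auto
      then have "\<bar>\<psi> p - h I L\<bar> \<le> \<epsilon>" unfolding h bd(1) dist_real_def by linarith
      moreover have "quadrant T (2 * T) p = 1" using True bd by (simp add: quadrant_def)
      ultimately show ?thesis using eq by simp
    qed
  qed
  then show ?thesis using that j(1) by blast
qed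

text \<open>Stated for an arbitrary measure, since it is applied to counting measure on subsets of
  the sample as well as to Lebesgue measure on tuples.\<close>

lemma quadrant_integral_approx:
  assumes le: "\<And>p. 0 \<le> fst p \<Longrightarrow> 0 \<le> snd p \<Longrightarrow> snd p \<le> 2 * fst p \<Longrightarrow>
      \<bar>\<psi> p - (\<Sum>i<m. \<Sum>l<m. c i l * quadrant (s i) (s l) p)\<bar> \<le> \<epsilon> * quadrant T (2 * T) p"
    and F: "\<And>y. y \<in> space N \<Longrightarrow> 0 \<le> fst (F y) \<and> 0 \<le> snd (F y) \<and> snd (F y) \<le> 2 * fst (F y)"
    and int: "integrable N (\<lambda>y. \<psi> (F y))" "\<And>s u. integrable N (\<lambda>y. quadrant s u (F y))"
  shows "\<bar>(\<integral>y. \<psi> (F y) \<partial>N) - (\<Sum>i<m. \<Sum>l<m. c i l * (\<integral>y. quadrant (s i) (s l) (F y) \<partial>N))\<bar>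
    \<le> \<epsilon> * (\<integral>y. quadrant T (2 * T) (F y) \<partial>N)"
proof -
  have S: "integrable N (\<lambda>y. \<Sum>i<m. \<Sum>l<m. c i l * quadrant (s i) (s l) (F y))"
    by (intro Bochner_Integration.integrable_sum integrable_mult_right int)
  have "(\<integral>y. \<psi> (F y) \<partial>N) - (\<Sum>i<m. \<Sum>l<m. c i l * (\<integral>y. quadrant (s i) (s l) (F y) \<partial>N)) =
      (\<integral>y. \<psi> (F y) - (\<Sum>i<m. \<Sum>l<m. c i l * quadrant (s i) (s l) (F y)) \<partial>N)"
    using int S by simp
  also have "\<bar>\<dots>\<bar> \<le> (\<integral>y. \<bar>\<psi> (F y) - (\<Sum>i<m. \<Sum>l<m. c i l * quadrant (s i) (s l) (F y))\<bar> \<partial>N)"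
    by (rule integral_abs_bound)
  also have "\<dots> \<le> (\<integral>y. \<epsilon> * quadrant T (2 * T) (F y) \<partial>N)"
    using int S F le by (intro integral_mono integrable_abs Bochner_Integration.integrable_diff integrable_mult_right) auto
  finally show ?thesis by simp
qed

definition plane_function :: "(real \<times> ereal \<Rightarrow> real) \<Rightarrow> real \<times> real \<Rightarrow> real" where
  "plane_function \<phi> = (\<lambda>(b, d). if 0 \<le> b \<and> b < d then \<phi> (b, ereal d) else 0)"

text \<open>All that the limits use of a continuous function with compact support, in one predicate.
  The bound on births is a natural number so that countably many null sets serve all test
  functions.\<close>

definition test_function :: "(real \<times> ereal \<Rightarrow> real) \<Rightarrow> real \<Rightarrow> nat \<Rightarrow> bool" where
  "test_function \<phi> B T \<longleftrightarrow> continuous_on Delta_L \<phi> \<and> B > 0 \<and> T > 0 \<and>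
     (\<forall>p\<in>Delta_L. 0 \<le> \<phi> p \<and> \<phi> p \<le> B) \<and>
     (\<forall>b d. (b, d) \<in> Delta_L \<longrightarrow> b > real T \<longrightarrow> \<phi> (b, d) = 0) \<and>
     plane_function \<phi> \<in> borel_measurable borel \<and>
     continuous_on ({0..} \<times> {0..}) (plane_function \<phi>) \<and>
     (\<forall>p. 0 \<le> plane_function \<phi> p \<and> plane_function \<phi> p \<le> B) \<and>
     (\<forall>b d. plane_function \<phi> (b, d) \<noteq> 0 \<longrightarrow> b \<le> real T)"

lemma compact_support_test_function:
  fixes \<phi> :: "real \<times> ereal \<Rightarrow> real"
  assumes cont: "continuous_on Delta_L \<phi>" and nonneg: "\<And>p. p \<in> Delta_L \<Longrightarrow> 0 \<le> \<phi> p"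
    and K: "compact K" "K \<subseteq> Delta_L" "\<And>p. p \<in> Delta_L - K \<Longrightarrow> \<phi> p = 0"
  obtains B T where "test_function \<phi> B T"
proof -
  have "compact (\<phi> ` K)" by (rule compact_continuous_image[OF continuous_on_subset[OF cont K(2)] K(1)])
  then have "bounded (\<phi> ` K)" by (rule compact_imp_bounded)
  then obtain B0 where B0: "\<And>p. p \<in> K \<Longrightarrow> norm (\<phi> p) \<le> B0" by (auto simp: bounded_iff)
  define B where "B = max 1 B0"
  have B: "\<phi> p \<le> B" if "p \<in> Delta_L" for p
  proof (cases "p \<in> K")
    case True
    then show ?thesis using B0[of p] by (simp add: B_def)
  qed (use K(3) that in \<open>simp add: B_def\<close>)
  obtain T0 where T0: "T0 > 0" "\<And>b d. (b, d) \<in> K \<Longrightarrow> b \<le> T0" using compact_Delta_L_bounded[OF K(1,2)] by blast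
  obtain T :: nat where T: "T0 < real T" using reals_Archimedean2 by blast
  have supp: "\<phi> (b, d) = 0" if "(b, d) \<in> Delta_L" "b > real T" for b d
    using K(3)[of "(b, d)"] T0(2)[of b d] T that by force
  have Bp: "B > 0" by (simp add: B_def)
  let ?g = "\<lambda>p :: real \<times> real. (fst p, ereal (snd p))"
  define E where "E = {p :: real \<times> real. 0 \<le> fst p \<and> fst p < snd p}"
  have g: "continuous_on A ?g" for A by (intro continuous_intros)
  have gE: "?g p \<in> Delta_L \<longleftrightarrow> p \<in> E" for p by (simp add: mem_Delta_L E_def)
  have pf: "plane_function \<phi> p = (if p \<in> E then \<phi> (?g p) else 0)" for p
    by (cases p) (simp add: plane_function_def E_def)
  have contE: "continuous_on E (\<lambda>p. \<phi> (?g p))"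
    by (rule continuous_on_compose2[OF cont g]) (use gE in auto)
  have "closed {p :: real \<times> real. 0 \<le> fst p}" by (intro closed_Collect_le continuous_intros)
  moreover have op: "open {p :: real \<times> real. fst p < snd p}" by (intro open_Collect_less continuous_intros)
  ultimately have "{p :: real \<times> real. 0 \<le> fst p} \<inter> {p. fst p < snd p} \<in> sets borel" by (intro sets.Int) auto
  also have "{p :: real \<times> real. 0 \<le> fst p} \<inter> {p. fst p < snd p} = E" by (auto simp: E_def)
  finally have Es: "E \<in> sets borel" .
  have m: "plane_function \<phi> \<in> borel_measurable borel"
    unfolding pf[abs_def] by (rule borel_measurable_continuous_on_if[OF Es contE]) (rule continuous_on_const)
  have c: "continuous_on ({0..} \<times> {0..}) (plane_function \<phi>)"
  proof -
    let ?S = "{0..} \<times> {0..} :: (real \<times> real) set"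
    \<comment> \<open>Extension by 0 is continuous across the diagonal because the support
      \<open>K\<close> is compact inside \<open>Delta_L\<close>: \<open>E\<close> and the complement
      of \<open>K\<close> form a relatively open cover of the plane quadrant, with the zero function
      on the second set.\<close>
    define V where "V = ?S - ?g -` K"
    have "closed (?g -` K)" by (rule closed_vimage[OF compact_imp_closed[OF K(1)] g])
    then have oV: "open (- (?g -` K))" by (rule open_Compl)
    have SE: "?S \<inter> {p. fst p < snd p} = E" by (auto simp: E_def)
    have un: "E \<union> V = ?S"
    proof
      show "E \<union> V \<subseteq> ?S" by (auto simp: E_def V_def)
      show "?S \<subseteq> E \<union> V" using K(2) gE by (auto simp: V_def)
    qed
    have z: "plane_function \<phi> p = 0" if "p \<in> V" for p
      using that K(3)[of "?g p"] gE[of p] by (auto simp: pf V_def)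
    have "continuous_on (E \<union> V) (plane_function \<phi>)"
    proof (rule continuous_on_Un_local_open)
      show "openin (top_of_set (E \<union> V)) E" unfolding un using openin_open_Int[OF op, of ?S] SE by simp
      have "?S \<inter> - (?g -` K) = V" by (auto simp: V_def)
      then show "openin (top_of_set (E \<union> V)) V" unfolding un using openin_open_Int[OF oV, of ?S] by simp
      show "continuous_on E (plane_function \<phi>)"
        by (rule continuous_on_eq[OF contE]) (simp add: pf)
      show "continuous_on V (plane_function \<phi>)"
        by (rule continuous_on_eq[OF continuous_on_const[of V 0]]) (simp add: z)
    qed
    then show ?thesis unfolding un .
  qed
  have r: "0 \<le> plane_function \<phi> p \<and> plane_function \<phi> p \<le> B" for p
    using nonneg[of "?g p"] B[of "?g p"] gE[of p] Bp by (simp add: pf)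
  have s: "b \<le> real T" if "plane_function \<phi> (b, d) \<noteq> 0" for b d
    using that supp[of b "ereal d"] gE[of "(b, d)"] by (force simp: pf split: if_splits)
  have Tp: "T > 0" using T T0(1) by linarith
  show ?thesis
    by (rule that[of B T]) (unfold test_function_def, use cont nonneg Bp Tp B supp m c r s in blast)
qed

lemma integral_scale_measure:
  fixes \<phi> :: "'b \<Rightarrow> real"
  assumes "\<phi> \<in> borel_measurable N" "\<And>x. x \<in> space N \<Longrightarrow> 0 \<le> \<phi> x" "0 \<le> c"
  shows "(\<integral>x. \<phi> x \<partial>scale_measure (ennreal c) N) = c * (\<integral>x. \<phi> x \<partial>N)"
proof -
  have m: "\<phi> \<in> borel_measurable (scale_measure (ennreal c) N)" using assms(1) by simp
  have "(\<integral>x. \<phi> x \<partial>scale_measure (ennreal c) N) = enn2real (\<integral>\<^sup>+x. ennreal (\<phi> x) \<partial>scale_measure (ennreal c) N)"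
    by (rule integral_eq_nn_integral[OF m]) (use assms(2) in \<open>auto simp: space_scale_measure\<close>)
  also have "\<dots> = enn2real (ennreal c * (\<integral>\<^sup>+x. ennreal (\<phi> x) \<partial>N))"
    using assms(1) by (subst nn_integral_scale_measure) auto
  also have "\<dots> = c * enn2real (\<integral>\<^sup>+x. ennreal (\<phi> x) \<partial>N)" using assms(3) by (simp add: enn2real_mult)
  also have "enn2real (\<integral>\<^sup>+x. ennreal (\<phi> x) \<partial>N) = (\<integral>x. \<phi> x \<partial>N)"
    by (rule integral_eq_nn_integral[symmetric, OF assms(1)]) (use assms(2) in auto)
  finally show ?thesis .
qed

section \<open>Almost sure and mean convergence\<close>

context bounded_density
begin

lemma time_integral_eq_integral:
  assumes k: "k \<ge> 1" and \<psi>: "\<psi> \<in> borel_measurable borel" "\<And>p. 0 \<le> \<psi> p \<and> \<psi> p \<le> B" "\<And>b d. \<psi> (b, d) \<noteq> 0 \<Longrightarrow> b \<le> T"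
  shows "enn2real (time_integral TYPE('a) (k + 1) \<psi>) = (\<integral>y. \<psi> (origin_birth k y, origin_death k y) \<partial>tuple_space TYPE('a) k)"
    and "integrable (tuple_space TYPE('a) k) (\<lambda>y. \<psi> (origin_birth k y, origin_death k y))"
    and "time_integral TYPE('a) (k + 1) \<psi> < \<infinity>"
proof -
  have "(\<lambda>y. (origin_birth k y, origin_death k y)) \<in> tuple_space TYPE('a) k \<rightarrow>\<^sub>M borel \<Otimes>\<^sub>M borel"
    using origin_measurable[where 'a = 'a] by (intro measurable_Pair) auto
  then have m: "(\<lambda>y. \<psi> (origin_birth k y, origin_death k y)) \<in> borel_measurable (tuple_space TYPE('a) k)"
    using measurable_compose[OF _ \<psi>(1)] by (simp add: borel_prod)
  have eq: "time_integral TYPE('a) (k + 1) \<psi> = (\<integral>\<^sup>+y. ennreal (\<psi> (origin_birth k y, origin_death k y)) \<partial>tuple_space TYPE('a) k)"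
    by (simp add: time_integral_def origin_birth_def origin_death_def)
  show "enn2real (time_integral TYPE('a) (k + 1) \<psi>) = (\<integral>y. \<psi> (origin_birth k y, origin_death k y) \<partial>tuple_space TYPE('a) k)"
    unfolding eq by (rule integral_eq_nn_integral[symmetric, OF m]) (use \<psi>(2) in auto)
  \<comment> \<open>Finiteness was shown for functions bounded by 1; the maximum avoids a division
    by 0.\<close>
  let ?\<psi> = "\<lambda>p. \<psi> p / (max 1 B)"
  have "time_integral TYPE('a) (k + 1) ?\<psi> < \<infinity>"
  proof (rule time_integral_finite[where T = T])
    fix p
    have "\<psi> p \<le> max 1 B" using \<psi>(2)[of p] by linarith
    then show "0 \<le> ?\<psi> p \<and> ?\<psi> p \<le> 1" using \<psi>(2)[of p] by (simp add: divide_le_eq_1 less_max_iff_disj)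
  qed (use k \<psi>(3) in auto)
  then have "ennreal (max 1 B) * time_integral TYPE('a) (k + 1) ?\<psi> < \<infinity>"
    by (simp add: ennreal_mult_less_top)
  also have "ennreal (max 1 B) * time_integral TYPE('a) (k + 1) ?\<psi> =
      (\<integral>\<^sup>+y. ennreal (max 1 B) * ennreal (?\<psi> (origin_birth k y, origin_death k y)) \<partial>tuple_space TYPE('a) k)"
    unfolding time_integral_def origin_birth_def[symmetric] origin_death_def[symmetric]
    by (rule nn_integral_cmult[symmetric]) (use m in simp)
  also have "\<dots> = time_integral TYPE('a) (k + 1) \<psi>"
    unfolding eq using \<psi>(2) by (intro nn_integral_cong) (simp add: ennreal_mult'[symmetric])
  finally show fin: "time_integral TYPE('a) (k + 1) \<psi> < \<infinity>" .
  show "integrable (tuple_space TYPE('a) k) (\<lambda>y. \<psi> (origin_birth k y, origin_death k y))"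
    using m fin \<psi>(2) unfolding eq by (intro integrableI_nonneg) auto
qed

end

context sparse_sample
begin

lemma death_time_nonneg: "finite A \<Longrightarrow> A \<noteq> {} \<Longrightarrow> 0 \<le> death_time x A"
  unfolding death_time_def by (simp add: enclosing_radius_nonneg)

lemma quadrant_props:
  "quadrant s u \<in> borel_measurable borel" "0 \<le> quadrant s u p \<and> quadrant s u p \<le> 1"
  "quadrant s u (b, d) \<noteq> 0 \<Longrightarrow> b \<le> s"
  by (rule quadrant_measurable) (auto simp: quadrant_def split: if_splits)

definition limit_integral :: "(real \<times> real \<Rightarrow> real) \<Rightarrow> real" where
  "limit_integral \<psi> = C_const f k * enn2real (time_integral TYPE('a) (k + 1) \<psi>)"

text \<open>A statement about one fixed sample point. The approximation error is
  \<open>\<epsilon>\<close> times a normalized quadrant count, which stays bounded because that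
  count converges as well.\<close>

lemma time_sum_convergence:
  fixes \<psi> :: "real \<times> real \<Rightarrow> real"
  assumes quad: "\<And>i l j :: nat. (\<lambda>n. time_sum (quadrant (real i / real j) (real l / real j)) n w / scaling DIM('a) k n (r n))
      \<longlonglongrightarrow> limit_integral (quadrant (real i / real j) (real l / real j))"
    and T: "T > 0" and \<psi>: "\<psi> \<in> borel_measurable borel" "continuous_on ({0..} \<times> {0..}) \<psi>"
      "\<And>p. 0 \<le> \<psi> p \<and> \<psi> p \<le> B" "\<And>b d. \<psi> (b, d) \<noteq> 0 \<Longrightarrow> b \<le> real T"
  shows "(\<lambda>n. time_sum \<psi> n w / scaling DIM('a) k n (r n)) \<longlonglongrightarrow> limit_integral \<psi>"
proof (rule LIMSEQ_I)
  fix e :: real assume e: "e > 0"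
  let ?s = "\<lambda>n. scaling DIM('a) k n (r n)"
  let ?Q = "quadrant (real T) (2 * real T)"
  have T': "real T > 0" using T by simp
  have limQ: "(\<lambda>n. time_sum ?Q n w / ?s n) \<longlonglongrightarrow> limit_integral ?Q" using quad[of T 1 "2 * T"] by simp
  have Q0: "0 \<le> limit_integral ?Q" unfolding limit_integral_def using C_const_nonneg by simp
  \<comment> \<open>Three errors of at most \<open>e / 4\<close> arise: for the sum, for the
    combination of quadrants and for the limit. Adding 1 covers the fluctuation of the quadrant
    count around its limit.\<close>
  define \<epsilon> where "\<epsilon> = e / (4 * (limit_integral ?Q + 1))"
  have \<epsilon>: "\<epsilon> > 0" using e Q0 by (simp add: \<epsilon>_def)
  obtain j m :: nat and c :: "nat \<Rightarrow> nat \<Rightarrow> real" where j: "j > 0" and app: "\<And>p. 0 \<le> fst p \<Longrightarrow> 0 \<le> snd p \<Longrightarrow> snd p \<le> 2 * fst p \<Longrightarrow>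
      \<bar>\<psi> p - (\<Sum>i<m. \<Sum>l<m. c i l * quadrant (real i / real j) (real l / real j) p)\<bar> \<le> \<epsilon> * ?Q p"
    by (rule quadrant_approx[OF \<psi>(2) T' _ \<epsilon>], erule \<psi>(4), rule that)
  let ?q = "\<lambda>i l. quadrant (real i / real j) (real l / real j)"
  define G where "G n = (\<Sum>i<m. \<Sum>l<m. c i l * (time_sum (?q i l) n w / ?s n))" for n
  define g where "g = (\<Sum>i<m. \<Sum>l<m. c i l * limit_integral (?q i l))"
  have "G \<longlonglongrightarrow> g" unfolding G_def[abs_def] g_def
    by (intro tendsto_sum tendsto_mult tendsto_const quad)
  then have ev1: "eventually (\<lambda>n. dist (G n) g < e / 4) sequentially" using e by (intro tendstoD) auto
  have ev2: "eventually (\<lambda>n. time_sum ?Q n w / ?s n < limit_integral ?Q + 1) sequentially"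
    using limQ by (rule order_tendstoD) simp
  have lim: "\<bar>limit_integral \<psi> - g\<bar> \<le> \<epsilon> * limit_integral ?Q"
  proof -
    let ?N = "tuple_space TYPE('a) k"
    let ?F = "\<lambda>y :: nat \<Rightarrow> 'a. (origin_birth k y, origin_death k y)"
    have k3: "3 \<le> card {0..k + 1}" using k by simp
    have F: "0 \<le> fst (?F y) \<and> 0 \<le> snd (?F y) \<and> snd (?F y) \<le> 2 * fst (?F y)" for y
      using birth_time_nonneg[OF _ k3, of "y(0 := 0)"] death_time_le[OF _ k3, of "y(0 := 0)"] death_time_nonneg[of "{0..k + 1}" "y(0 := 0)"]
      by (simp add: origin_birth_def origin_death_def)
    have Lq: "limit_integral (quadrant s u) = C_const f k * (\<integral>y. quadrant s u (?F y) \<partial>?N)" for s u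
      unfolding limit_integral_def by (subst time_integral_eq_integral(1)[OF k quadrant_props]) auto
    have L\<psi>: "limit_integral \<psi> = C_const f k * (\<integral>y. \<psi> (?F y) \<partial>?N)"
      unfolding limit_integral_def by (subst time_integral_eq_integral(1)[OF k \<psi>(1,3,4)]) auto
    have "\<bar>(\<integral>y. \<psi> (?F y) \<partial>?N) - (\<Sum>i<m. \<Sum>l<m. c i l * (\<integral>y. ?q i l (?F y) \<partial>?N))\<bar> \<le> \<epsilon> * (\<integral>y. ?Q (?F y) \<partial>?N)"
      by (rule quadrant_integral_approx[OF app F time_integral_eq_integral(2)[OF k \<psi>(1,3,4)] time_integral_eq_integral(2)[OF k quadrant_props]]) auto
    then have "C_const f k * \<bar>(\<integral>y. \<psi> (?F y) \<partial>?N) - (\<Sum>i<m. \<Sum>l<m. c i l * (\<integral>y. ?q i l (?F y) \<partial>?N))\<bar>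
        \<le> C_const f k * (\<epsilon> * (\<integral>y. ?Q (?F y) \<partial>?N))"
      by (intro mult_left_mono C_const_nonneg)
    moreover have "C_const f k * \<bar>(\<integral>y. \<psi> (?F y) \<partial>?N) - (\<Sum>i<m. \<Sum>l<m. c i l * (\<integral>y. ?q i l (?F y) \<partial>?N))\<bar> = \<bar>limit_integral \<psi> - g\<bar>"
    proof -
      have "limit_integral \<psi> - g = C_const f k * ((\<integral>y. \<psi> (?F y) \<partial>?N) - (\<Sum>i<m. \<Sum>l<m. c i l * (\<integral>y. ?q i l (?F y) \<partial>?N)))"
        unfolding g_def L\<psi> Lq right_diff_distrib sum_distrib_left by (simp add: mult_ac)
      then show ?thesis using C_const_nonneg[of k] by (simp add: abs_mult)
    qed
    ultimately show ?thesis unfolding Lq by (simp add: mult_ac)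
  qed
  have fin: "\<bar>time_sum \<psi> n w / ?s n - G n\<bar> \<le> \<epsilon> * (time_sum ?Q n w / ?s n)" if n: "n \<ge> 1" for n
  proof -
    let ?Y = "subsets_of_card (k + 2) {1..n}"
    let ?F = "\<lambda>A. (birth_time (\<lambda>i. X i w) A / r n, death_time (\<lambda>i. X i w) A / r n)"
    have Y: "finite ?Y" by (rule finite_subsets_of_card) simp
    have s: "0 < ?s n" by (rule scaling_pos[OF n r_pos[OF n]])
    \<comment> \<open>The sum is viewed as an integral against counting measure, so that the same
      approximation lemma applies.\<close>
    have sumeq: "time_sum h n w = (\<integral>A. h (?F A) \<partial>count_space ?Y)" for h
      unfolding time_sum_def by (rule lebesgue_integral_count_space_finite[OF Y, symmetric])
    have "\<bar>(\<integral>A. \<psi> (?F A) \<partial>count_space ?Y) - (\<Sum>i<m. \<Sum>l<m. c i l * (\<integral>A. ?q i l (?F A) \<partial>count_space ?Y))\<bar> \<le> \<epsilon> * (\<integral>A. ?Q (?F A) \<partial>count_space ?Y)"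
    proof (rule quadrant_integral_approx[OF app])
      fix A assume "A \<in> space (count_space ?Y)"
      then have A: "finite A" "card A \<ge> 3" "A \<noteq> {}" using subsets_of_cardD[of "{1..n}" A "k + 2"] k by auto
      show "0 \<le> fst (?F A) \<and> 0 \<le> snd (?F A) \<and> snd (?F A) \<le> 2 * fst (?F A)"
        using birth_time_nonneg[OF A(1,2), of "\<lambda>i. X i w"] death_time_le[OF A(1,2), of "\<lambda>i. X i w"] death_time_nonneg[OF A(1) A(3), of "\<lambda>i. X i w"] r_pos[OF n]
        by (auto simp: divide_le_cancel field_simps)
    qed (assumption | rule integrable_count_space[OF Y])+
    then have *: "\<bar>time_sum \<psi> n w - (\<Sum>i<m. \<Sum>l<m. c i l * time_sum (?q i l) n w)\<bar> \<le> \<epsilon> * time_sum ?Q n w"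
      unfolding sumeq .
    have "time_sum \<psi> n w / ?s n - G n = (time_sum \<psi> n w - (\<Sum>i<m. \<Sum>l<m. c i l * time_sum (?q i l) n w)) / ?s n"
      unfolding G_def diff_divide_distrib sum_divide_distrib by simp
    then have "\<bar>time_sum \<psi> n w / ?s n - G n\<bar> = \<bar>time_sum \<psi> n w - (\<Sum>i<m. \<Sum>l<m. c i l * time_sum (?q i l) n w)\<bar> / ?s n"
      using s by (simp add: abs_divide)
    also have "\<dots> \<le> \<epsilon> * time_sum ?Q n w / ?s n" using * s by (intro divide_right_mono) auto
    finally show ?thesis by simp
  qed
  have "eventually (\<lambda>n. n \<ge> (1 :: nat)) sequentially" by (rule eventually_ge_at_top)
  with ev1 ev2 have "eventually (\<lambda>n. norm (time_sum \<psi> n w / ?s n - limit_integral \<psi>) < e) sequentially"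
  proof eventually_elim
    case (elim n)
    have "\<epsilon> * (time_sum ?Q n w / ?s n) \<le> \<epsilon> * (limit_integral ?Q + 1)" using elim \<epsilon> by (intro mult_left_mono) auto
    moreover have "\<epsilon> * limit_integral ?Q \<le> \<epsilon> * (limit_integral ?Q + 1)" using \<epsilon> by (intro mult_left_mono) auto
    moreover have "\<epsilon> * (limit_integral ?Q + 1) = e / 4"
    proof -
      have "limit_integral ?Q + 1 \<noteq> 0" using Q0 by linarith
      then show ?thesis unfolding \<epsilon>_def by (simp add: divide_eq_eq)
    qed
    ultimately show ?case using fin[OF elim(3)] lim elim(1) e unfolding real_norm_def dist_real_def by linarith
  qed
  then show "\<exists>no. \<forall>n\<ge>no. norm (time_sum \<psi> n w / ?s n - limit_integral \<psi>) < e"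
    by (simp add: eventually_sequentially)
qed

text \<open>The comparison of diagram and sum needs distinct points. Coincidence of two points is
  contained in the event that they lie within \<open>\<rho>\<close>, whose probability vanishes with
  \<open>\<rho>\<close> because the density is bounded.\<close>

lemma AE_distinct: "AE w in M. \<forall>n. inj_on (\<lambda>i. X i w) {1..n}"
proof -
  have ne: "AE w in M. X i w \<noteq> X j w" if ij: "i \<ge> 1" "j \<ge> 1" "i \<noteq> j" for i j
  proof -
    define n where "n = max i j"
    define S where "S = {w \<in> space M. X i w = X j w}"
    have [measurable]: "X i \<in> borel_measurable M" "X j \<in> borel_measurable M" using X_meas ij by auto
    have S: "S \<in> sets M" unfolding S_def by measurable
    interpret K: sample_kernel f Bf M X "crowd_kernel 1" 2 1
      by (intro sample_kernel.intro iid_sample_axioms scale_kernel_crowd) auto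
    have A: "{i, j} \<in> subsets_of_card 2 {1..n}" using ij by (auto simp: subsets_of_card_def n_def)
    have n: "n \<ge> 1" using ij by (simp add: n_def)
    have le: "prob S \<le> 4 * near_prob 1 * \<rho> ^ DIM('a)" if \<rho>: "\<rho> > 0" for \<rho>
    proof -
      have m: "(\<lambda>x. crowd_kernel 1 \<rho> x {i, j}) \<in> borel_measurable (PiM {1..n} (\<lambda>_. borel :: 'a measure))"
        by (rule K.G_meas[OF \<rho> _ A]) simp
      have ms: "(\<lambda>w. crowd_kernel 1 \<rho> (sample n w) {i, j}) \<in> borel_measurable M"
        by (rule measurable_compose[OF sample_measurable m])
      have "prob S = expectation (indicator S)" using S by simp
      also have "\<dots> \<le> expectation (\<lambda>w. crowd_kernel 1 \<rho> (sample n w) {i, j})"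
      proof (rule integral_mono)
        show "integrable M (indicator S :: 'w \<Rightarrow> real)" using S by (simp add: emeasure_eq_measure)
        show "integrable M (\<lambda>w. crowd_kernel 1 \<rho> (sample n w) {i, j})"
          by (rule integrable_const_bound[where B = 1, OF _ ms]) (simp add: crowd_kernel_def)
        fix w
        show "indicator S w \<le> crowd_kernel 1 \<rho> (sample n w) {i, j}"
          using ij \<rho> by (auto simp: indicator_def S_def crowd_kernel_def diameter_le_def sample_def n_def)
      qed
      also have "\<dots> = K.kernel_mean \<rho>"
        unfolding expectation_sample[OF n m] by (rule K.kernel_mean_eq[OF \<rho> _ A]) simp
      \<comment> \<open>The factor 4 is \<open>2 ^ 2\<close>, from the general bound for pairs out
        of two points.\<close>
      also have "\<dots> \<le> 4 * near_prob (1 * \<rho>)" using K.kernel_total_mean_le(2)[OF \<rho>, of 2] by simp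
      finally show ?thesis unfolding near_prob_scale by simp
    qed
    have lim: "(\<lambda>m. 4 * near_prob 1 * (1 / real (Suc m)) ^ DIM('a)) \<longlonglongrightarrow> 4 * near_prob 1 * 0 ^ DIM('a)"
      by (intro tendsto_intros LIMSEQ_Suc[OF lim_1_over_n])
    have "prob S \<le> 4 * near_prob 1 * 0 ^ DIM('a)"
      by (rule LIMSEQ_le_const[OF lim]) (use le in auto)
    moreover have "(0 :: real) ^ DIM('a) = 0" by (simp add: zero_power)
    ultimately have "prob S = 0" by (simp add: measure_le_0_iff)
    then have "emeasure M S = 0" by (simp add: emeasure_eq_measure)
    then have "AE w in M. w \<notin> S" by (intro AE_not_in) (simp add: null_sets_def S)
    then show ?thesis by (rule AE_mp) (auto simp: S_def)
  qed
  have "AE w in M. \<forall>i j. i \<ge> 1 \<longrightarrow> j \<ge> 1 \<longrightarrow> i \<noteq> j \<longrightarrow> X i w \<noteq> X j w"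
    unfolding AE_all_countable using ne by (auto intro: AE_impI)
  then show ?thesis
  proof (rule AE_mp, intro AE_I2 impI)
    fix w assume *: "\<forall>i j. i \<ge> 1 \<longrightarrow> j \<ge> 1 \<longrightarrow> i \<noteq> j \<longrightarrow> X i w \<noteq> X j w"
    show "\<forall>n. inj_on (\<lambda>i. X i w) {1..n}"
    proof (intro allI inj_onI)
      fix n x y assume "x \<in> {1..n}" "y \<in> {1..n}" "X x w = X y w"
      then show "x = y" using * by force
    qed
  qed
qed

end

context sparse_sample
begin

section \<open>The diagram as a random measure\<close>

definition diagram :: "'f::field itself \<Rightarrow> nat \<Rightarrow> 'w \<Rightarrow> (real \<times> ereal) measure" where
  "diagram F n w = cech_diagram F k ((\<lambda>i. X i w) ` {1..n}) (r n)"

abbreviation mean_diagram :: "'f::field itself \<Rightarrow> nat \<Rightarrow> (real \<times> ereal) measure" where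
  "mean_diagram F n \<equiv> mean_measure M Delta_L (diagram F n)"

lemma sets_diagram [simp, measurable_cong]: "sets (diagram F n w) = sets (restrict_space borel Delta_L)"
  by (simp add: diagram_def)

lemma space_diagram [simp]: "space (diagram F n w) = Delta_L"
  by (simp add: diagram_def)

text \<open>The scale \<open>r 0\<close> is unconstrained, but the diagram of the empty set does not depend on it.\<close>

lemma diagram_pos_scale: "\<exists>\<rho>>0. \<forall>w. diagram F n w = cech_diagram F k ((\<lambda>i. X i w) ` {1..n}) \<rho>"
proof (cases "n = 0")
  case True
  have "cech {} a = (cech {} b :: 'a set set)" for a b :: ereal by (auto simp: cech_def)
  then have *: "(\<lambda>t. cech ({} :: 'a set) (ereal \<rho> * t)) = (\<lambda>t. cech {} (ereal 1 * t))" for \<rho> by (intro ext)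
  have "cech_diagram F k ({} :: 'a set) \<rho> = cech_diagram F k ({} :: 'a set) 1" for \<rho>
    unfolding cech_diagram_def by (rule arg_cong[OF *, where f = "persistence_diagram F k"])
  then show ?thesis using True by (intro exI[of _ 1]) (simp add: diagram_def)
next
  case False
  then show ?thesis using r_pos[of n] by (intro exI[of _ "r n"]) (simp add: diagram_def)
qed

lemma emeasure_diagram_le:
  assumes "B \<in> sets (restrict_space borel Delta_L)"
  shows "emeasure (diagram F n w) B \<le> ennreal (2 ^ n)"
proof -
  obtain \<rho> where \<rho>: "\<rho> > 0" "diagram F n w = cech_diagram F k ((\<lambda>i. X i w) ` {1..n}) \<rho>"
    using diagram_pos_scale[of F n] by blast
  have "emeasure (diagram F n w) B \<le> of_nat (2 ^ card ((\<lambda>i. X i w) ` {1..n}))"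
    unfolding \<rho>(2) by (rule emeasure_cech_diagram_le[OF _ \<rho>(1) assms k]) simp
  also have "\<dots> = ennreal (2 ^ card ((\<lambda>i. X i w) ` {1..n}))" by (simp add: ennreal_of_nat_eq_real_of_nat)
  also have "\<dots> \<le> ennreal (2 ^ n)"
    using card_image_le[of "{1..n}" "\<lambda>i. X i w"] by (intro ennreal_leI power_increasing) auto
  finally show ?thesis .
qed

lemma random_measure_diagram: "random_measure_on M Delta_L (diagram F n)"
  unfolding random_measure_on_def radon_measure_on_def
proof (intro conjI ballI allI impI)
  fix w K assume "compact K \<and> K \<subseteq> Delta_L"
  then have "emeasure (diagram F n w) K \<le> ennreal (2 ^ n)" by (intro emeasure_diagram_le compact_sets_Delta_L) auto
  also have "\<dots> < \<infinity>" by simp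
  finally show "emeasure (diagram F n w) K < \<infinity>" .
next
  fix B assume B: "B \<in> sets (restrict_space borel Delta_L)"
  obtain \<rho> where \<rho>: "\<rho> > 0" "\<And>w. diagram F n w = cech_diagram F k ((\<lambda>i. X i w) ` {1..n}) \<rho>"
    using diagram_pos_scale[of F n] by blast
  show "(\<lambda>w. emeasure (diagram F n w) B) \<in> borel_measurable M"
    unfolding \<rho>(2) by (rule emeasure_cech_diagram_measurable[OF _ \<rho>(1) _ B]) (use X_meas in auto)
qed simp

lemma radon_mean_diagram: "radon_measure_on Delta_L (mean_diagram F n)"
  unfolding radon_measure_on_def
proof (intro conjI allI impI)
  show "sets (mean_diagram F n) = sets (restrict_space borel Delta_L)"
    by (rule sets_mean_measure[OF random_measure_diagram])
  fix K assume "compact K \<and> K \<subseteq> Delta_L"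
  then have K: "K \<in> sets (restrict_space borel Delta_L)" using compact_sets_Delta_L by blast
  have "emeasure (mean_diagram F n) K = (\<integral>\<^sup>+w. emeasure (diagram F n w) K \<partial>M)"
    by (rule emeasure_mean_measure[OF random_measure_diagram K])
  also have "\<dots> \<le> (\<integral>\<^sup>+w. ennreal (2 ^ n) \<partial>M)" by (intro nn_integral_mono emeasure_diagram_le K)
  also have "\<dots> < \<infinity>" by (simp add: emeasure_space_1)
  finally show "emeasure (mean_diagram F n) K < \<infinity>" .
qed

context
  fixes \<phi> B T
  assumes test: "test_function \<phi> B T"
begin

lemma
  shows cont: "continuous_on Delta_L \<phi>" and nonneg: "\<And>p. p \<in> Delta_L \<Longrightarrow> 0 \<le> \<phi> p"
    and B: "B > 0" "\<And>p. p \<in> Delta_L \<Longrightarrow> \<phi> p \<le> B"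
    and T: "T > 0" "\<And>b d. (b, d) \<in> Delta_L \<Longrightarrow> b > real T \<Longrightarrow> \<phi> (b, d) = 0"
    and \<psi>: "plane_function \<phi> \<in> borel_measurable borel" "continuous_on ({0..} \<times> {0..}) (plane_function \<phi>)"
      "\<And>p. 0 \<le> plane_function \<phi> p \<and> plane_function \<phi> p \<le> B"
      "\<And>b d. plane_function \<phi> (b, d) \<noteq> 0 \<Longrightarrow> b \<le> real T"
  using test unfolding test_function_def by blast+

text \<open>\<open>\<phi>\<close> is arbitrary outside \<open>Delta_L\<close>; cutting it off there
  makes its planar version agree with \<open>plane_function\<close> also at negative births.\<close>

definition cut where "cut p = (if p \<in> Delta_L then \<phi> p else 0)"

lemma cut_plane: "(\<lambda>(b, d). if b < d then cut (b, ereal d) else 0) = plane_function \<phi>"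
  by (auto simp: fun_eq_iff plane_function_def cut_def mem_Delta_L)

lemma test_measurable: "\<phi> \<in> borel_measurable (restrict_space borel Delta_L)"
  by (rule borel_measurable_continuous_on_restrict[OF cont])

lemma cut_measurable: "cut \<in> borel_measurable (restrict_space borel Delta_L)"
  using test_measurable by (rule measurable_cong[THEN iffD1, rotated]) (simp add: cut_def space_restrict_space)

lemma diagram_integral_approx:
  assumes n: "n \<ge> 1" and inj: "inj_on (\<lambda>i. X i w) {1..n}"
  shows "\<bar>(\<integral>p. \<phi> p \<partial>diagram F n w) - time_sum (plane_function \<phi>) n w\<bar> \<le> B * 2 ^ (k + 4) * crowd_count (5 * real T) n w"
proof -
  have "(\<integral>p. \<phi> p \<partial>diagram F n w) = (\<integral>p. cut p \<partial>diagram F n w)"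
    by (rule Bochner_Integration.integral_cong) (auto simp: cut_def)
  moreover have "\<bar>(\<integral>p. cut p \<partial>diagram F n w) - time_sum (plane_function \<phi>) n w\<bar> \<le> B * 2 ^ (k + 4) * crowd_count (5 * real T) n w"
    unfolding diagram_def time_sum_def crowd_count_def cut_plane[symmetric]
    by (rule cech_diagram_approx[OF k r_pos[OF n] _ inj cut_measurable])
      (use T B nonneg in \<open>auto simp: cut_def\<close>)
  ultimately show ?thesis by simp
qed

lemma limit_measure_integral:
  "(\<integral>p. \<phi> p \<partial>limit_measure TYPE('a) k (C_const f k)) = limit_integral (plane_function \<phi>)"
proof -
  have "(\<integral>p. \<phi> p \<partial>limit_measure TYPE('a) k (C_const f k)) = (\<integral>p. cut p \<partial>limit_measure TYPE('a) k (C_const f k))"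
    by (rule Bochner_Integration.integral_cong) (auto simp: cut_def)
  also have "\<dots> = enn2real (\<integral>\<^sup>+p. ennreal (cut p) \<partial>limit_measure TYPE('a) k (C_const f k))"
  proof (rule integral_eq_nn_integral)
    show "cut \<in> borel_measurable (limit_measure TYPE('a) k (C_const f k))" using cut_measurable by simp
  qed (use nonneg in \<open>auto simp: cut_def\<close>)
  also have "\<dots> = limit_integral (plane_function \<phi>)"
    unfolding nn_integral_limit_measure_time_integral[OF k cut_measurable] cut_plane limit_integral_def
    using C_const_nonneg[of k] by (simp add: enn2real_mult)
  finally show ?thesis .
qed

lemma perturbed_limit:
  assumes "\<And>n. n \<ge> 1 \<Longrightarrow> \<bar>x n - y n\<bar> \<le> c * z n"
    and "(\<lambda>n. y n / scaling DIM('a) k n (r n)) \<longlonglongrightarrow> l" "(\<lambda>n. z n / scaling DIM('a) k n (r n)) \<longlonglongrightarrow> 0"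
  shows "(\<lambda>n. 1 / scaling DIM('a) k n (r n) * x n) \<longlonglongrightarrow> l"
proof -
  have "(\<lambda>n. c * (z n / scaling DIM('a) k n (r n))) \<longlonglongrightarrow> c * 0" by (intro tendsto_mult tendsto_const assms)
  then have z: "(\<lambda>n. c * (z n / scaling DIM('a) k n (r n))) \<longlonglongrightarrow> 0" by simp
  have "eventually (\<lambda>n. norm ((x n - y n) / scaling DIM('a) k n (r n)) \<le> c * (z n / scaling DIM('a) k n (r n))) sequentially"
    using eventually_ge_at_top[of 1]
  proof eventually_elim
    case (elim n)
    have s: "0 < scaling DIM('a) k n (r n)" by (rule scaling_pos[OF elim r_pos[OF elim]])
    then have "\<bar>x n - y n\<bar> / scaling DIM('a) k n (r n) \<le> c * z n / scaling DIM('a) k n (r n)" using assms(1)[OF elim] by (intro divide_right_mono) auto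
    then show ?case using s by (simp add: abs_divide)
  qed
  from tendsto_add[OF Lim_null_comparison[OF this z] assms(2)] show ?thesis
    by (simp add: add_divide_distrib[symmetric])
qed

lemma diagram_limit:
  assumes inj: "\<And>n. inj_on (\<lambda>i. X i w) {1..n}"
    and quad: "\<And>i l j :: nat. (\<lambda>n. time_sum (quadrant (real i / real j) (real l / real j)) n w / scaling DIM('a) k n (r n))
      \<longlonglongrightarrow> limit_integral (quadrant (real i / real j) (real l / real j))"
    and crowd: "(\<lambda>n. crowd_count (5 * real T) n w / scaling DIM('a) k n (r n)) \<longlonglongrightarrow> 0"
  shows "(\<lambda>n. 1 / scaling DIM('a) k n (r n) * (\<integral>p. \<phi> p \<partial>diagram F n w)) \<longlonglongrightarrow> limit_integral (plane_function \<phi>)"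
  by (rule perturbed_limit[OF diagram_integral_approx[OF _ inj] time_sum_convergence[OF quad T(1) \<psi>] crowd])

lemma mean_integral:
  shows "(\<integral>p. \<phi> p \<partial>mean_diagram F n) = expectation (\<lambda>w. \<integral>p. \<phi> p \<partial>diagram F n w)"
    and "integrable M (\<lambda>w. \<integral>p. \<phi> p \<partial>diagram F n w)"
proof -
  let ?N = "mean_diagram F n"
  note rm = random_measure_diagram[of F n]
  have em: "(\<lambda>p. ennreal (\<phi> p)) \<in> borel_measurable (restrict_space borel Delta_L)" using test_measurable by simp
  have sN: "sets ?N = sets (restrict_space borel Delta_L)" by (rule sets_mean_measure[OF rm])
  then have spN: "space ?N = Delta_L" using sets_eq_imp_space_eq[OF sN] by (simp add: space_restrict_space)
  have I: "(\<integral>p. \<phi> p \<partial>diagram F n w) = enn2real (\<integral>\<^sup>+p. ennreal (\<phi> p) \<partial>diagram F n w)" for w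
    by (rule integral_eq_nn_integral) (use test_measurable nonneg in auto)
  have le: "(\<integral>\<^sup>+p. ennreal (\<phi> p) \<partial>diagram F n w) \<le> ennreal (B * 2 ^ n)" for w
  proof -
    have "(\<integral>\<^sup>+p. ennreal (\<phi> p) \<partial>diagram F n w) \<le> (\<integral>\<^sup>+p. ennreal B \<partial>diagram F n w)"
      using B by (intro nn_integral_mono ennreal_leI) auto
    also have "\<dots> = ennreal B * emeasure (diagram F n w) Delta_L" by simp
    also have "\<dots> \<le> ennreal B * ennreal (2 ^ n)"
      using sets.top[of "restrict_space borel Delta_L"]
      by (intro mult_left_mono emeasure_diagram_le) (auto simp: space_restrict_space)
    finally show ?thesis using B by (simp add: ennreal_mult')
  qed
  have fin: "(\<integral>\<^sup>+p. ennreal (\<phi> p) \<partial>diagram F n w) = ennreal (\<integral>p. \<phi> p \<partial>diagram F n w)" for w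
    unfolding I using le_less_trans[OF le ennreal_less_top] by simp
  have m: "(\<lambda>w. \<integral>p. \<phi> p \<partial>diagram F n w) \<in> borel_measurable M"
    unfolding I using nn_integral_random_measure_measurable[OF rm em] by simp
  have nn: "0 \<le> (\<integral>p. \<phi> p \<partial>diagram F n w)" for w unfolding I by simp
  have "(\<integral>p. \<phi> p \<partial>?N) = enn2real (\<integral>\<^sup>+p. ennreal (\<phi> p) \<partial>?N)"
    by (rule integral_eq_nn_integral) (use test_measurable nonneg spN in \<open>auto simp: measurable_cong_sets[OF sN refl]\<close>)
  also have "\<dots> = enn2real (\<integral>\<^sup>+w. ennreal (\<integral>p. \<phi> p \<partial>diagram F n w) \<partial>M)"
    unfolding nn_integral_mean_measure[OF rm em] fin ..
  also have "\<dots> = expectation (\<lambda>w. \<integral>p. \<phi> p \<partial>diagram F n w)"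
    by (rule integral_eq_nn_integral[symmetric, OF m]) (use nn in auto)
  finally show "(\<integral>p. \<phi> p \<partial>?N) = expectation (\<lambda>w. \<integral>p. \<phi> p \<partial>diagram F n w)" .
  show "integrable M (\<lambda>w. \<integral>p. \<phi> p \<partial>diagram F n w)"
  proof (rule integrable_const_bound[OF _ m])
    have "(\<integral>p. \<phi> p \<partial>diagram F n w) \<le> B * 2 ^ n" for w
      using le[of w] unfolding fin using B by (subst (asm) ennreal_le_iff) auto
    then show "AE w in M. norm (\<integral>p. \<phi> p \<partial>diagram F n w) \<le> B * 2 ^ n" using nn by simp
  qed
qed

lemma mean_diagram_limit:
  "(\<lambda>n. 1 / scaling DIM('a) k n (r n) * (\<integral>p. \<phi> p \<partial>mean_diagram F n)) \<longlonglongrightarrow> limit_integral (plane_function \<phi>)"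
proof -
  \<comment> \<open>The convergence of means was proved for functions between 0 and 1.\<close>
  let ?\<psi> = "\<lambda>p. plane_function \<phi> p / B"
  have T': "real T > 0" "5 * real T > 0" using T by auto
  have \<psi>': "?\<psi> \<in> borel_measurable borel" "\<And>p. 0 \<le> ?\<psi> p \<and> ?\<psi> p \<le> 1" "\<And>b d. ?\<psi> (b, d) \<noteq> 0 \<Longrightarrow> b \<le> real T"
    using \<psi> B by (auto simp: divide_le_eq_1)
  have ts: "time_sum (plane_function \<phi>) n = (\<lambda>w. B * time_sum ?\<psi> n w)" for n
    using B by (simp add: fun_eq_iff time_sum_def sum_distrib_left)
  have int: "integrable M (time_sum (plane_function \<phi>) n)" if "n \<ge> 1" for n
    unfolding ts by (intro integrable_mult_right time_sum_mean(2)[OF T'(1) \<psi>' that])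
  have "(\<lambda>n. B * (expectation (time_sum ?\<psi> n) / scaling DIM('a) k n (r n))) \<longlonglongrightarrow> B * (C_const f k * enn2real (time_integral TYPE('a) (k + 1) ?\<psi>))"
    by (rule tendsto_mult[OF tendsto_const time_sum_mean(1)[OF T'(1) \<psi>']])
  moreover have "B * (C_const f k * enn2real (time_integral TYPE('a) (k + 1) ?\<psi>)) = limit_integral (plane_function \<phi>)"
  proof -
    have "enn2real (time_integral TYPE('a) (k + 1) ?\<psi>) = (\<integral>y. ?\<psi> (origin_birth k y, origin_death k y) \<partial>tuple_space TYPE('a) k)"
      by (rule time_integral_eq_integral(1)[OF k \<psi>'])
    moreover have "enn2real (time_integral TYPE('a) (k + 1) (plane_function \<phi>)) =
        (\<integral>y. plane_function \<phi> (origin_birth k y, origin_death k y) \<partial>tuple_space TYPE('a) k)"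
      by (rule time_integral_eq_integral(1)[OF k \<psi>(1,3,4)])
    ultimately show ?thesis using B unfolding limit_integral_def by simp
  qed
  moreover have "B * (expectation (time_sum ?\<psi> n) / scaling DIM('a) k n (r n)) = expectation (time_sum (plane_function \<phi>) n) / scaling DIM('a) k n (r n)" for n
    unfolding ts by simp
  ultimately have lim: "(\<lambda>n. expectation (time_sum (plane_function \<phi>) n) / scaling DIM('a) k n (r n)) \<longlonglongrightarrow> limit_integral (plane_function \<phi>)" by (simp only:)
  have app: "\<bar>(\<integral>p. \<phi> p \<partial>mean_diagram F n) - expectation (time_sum (plane_function \<phi>) n)\<bar>
      \<le> B * 2 ^ (k + 4) * expectation (crowd_count (5 * real T) n)" if n: "n \<ge> 1" for n
  proof -
    note i = mean_integral(2)[of F n] int[OF n] crowd_count_mean(2)[OF T'(2) n]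
    have "(\<integral>p. \<phi> p \<partial>mean_diagram F n) - expectation (time_sum (plane_function \<phi>) n) =
        expectation (\<lambda>w. (\<integral>p. \<phi> p \<partial>diagram F n w) - time_sum (plane_function \<phi>) n w)"
      unfolding mean_integral(1) using i by simp
    also have "\<bar>\<dots>\<bar> \<le> expectation (\<lambda>w. \<bar>(\<integral>p. \<phi> p \<partial>diagram F n w) - time_sum (plane_function \<phi>) n w\<bar>)"
      by (rule integral_abs_bound)
    also have "\<dots> \<le> expectation (\<lambda>w. B * 2 ^ (k + 4) * crowd_count (5 * real T) n w)"
    proof (rule integral_mono_AE)
      show "AE w in M. \<bar>(\<integral>p. \<phi> p \<partial>diagram F n w) - time_sum (plane_function \<phi>) n w\<bar> \<le> B * 2 ^ (k + 4) * crowd_count (5 * real T) n w"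
        using AE_distinct by (rule AE_mp) (intro AE_I2 impI diagram_integral_approx[OF n], blast)
    qed (use i in \<open>auto intro: integrable_abs Bochner_Integration.integrable_diff integrable_mult_right\<close>)
    finally show ?thesis by simp
  qed
  show ?thesis by (rule perturbed_limit[OF app lim crowd_count_mean(1)[OF T'(2)]])
qed

end

abbreviation limit_diagram :: "(real \<times> ereal) measure" where
  "limit_diagram \<equiv> limit_measure TYPE('a) k (C_const f k)"

lemma time_integral_bounded_birth: "time_integral TYPE('a) (k + 1) (\<lambda>(b, d). if b \<le> T then 1 else 0) < \<infinity>"
  using k by (intro time_integral_finite[where T = T]) (auto split: if_splits)

lemma radon_limit_diagram: "radon_measure_on Delta_L limit_diagram"
  by (rule radon_limit_measure[OF k time_integral_bounded_birth])

text \<open>The null set must not depend on the test function. It is fixed beforehand by countably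
  many events: distinct points, convergence for quadrants with rational corners, and negligible
  crowding for each integral radius.\<close>

lemma AE_vague_diagram:
  "AE w in M. vague_tendsto Delta_L (\<lambda>n. scale_measure (ennreal (1 / scaling DIM('a) k n (r n))) (diagram F n w)) limit_diagram"
proof -
  have q: "AE w in M. \<forall>i l j :: nat. (\<lambda>n. time_sum (quadrant (real i / real j) (real l / real j)) n w / scaling DIM('a) k n (r n))
      \<longlonglongrightarrow> limit_integral (quadrant (real i / real j) (real l / real j))"
    unfolding AE_all_countable limit_integral_def by (intro allI quadrant_strong_law) auto
  have c: "AE w in M. \<forall>T :: nat. (\<lambda>n. crowd_count (5 * real (Suc T)) n w / scaling DIM('a) k n (r n)) \<longlonglongrightarrow> 0"
    unfolding AE_all_countable by (intro allI crowd_strong_law) simp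
  show ?thesis
    using AE_distinct q c
  proof eventually_elim
    case (elim w)
    show ?case
      unfolding vague_tendsto_def
    proof (intro allI impI, elim conjE exE)
      fix \<phi> :: "real \<times> ereal \<Rightarrow> real" and K
      assume \<phi>: "continuous_on Delta_L \<phi>" "\<forall>p\<in>Delta_L. 0 \<le> \<phi> p"
        and K: "compact K" "K \<subseteq> Delta_L" "\<forall>p\<in>Delta_L - K. \<phi> p = 0"
      have \<phi>': "\<And>p. p \<in> Delta_L \<Longrightarrow> 0 \<le> \<phi> p" "\<And>p. p \<in> Delta_L - K \<Longrightarrow> \<phi> p = 0" using \<phi> K by auto
      obtain B T where BT: "test_function \<phi> B T"
        by (rule compact_support_test_function[OF \<phi>(1) \<phi>'(1) K(1,2) \<phi>'(2)]) blast+
      obtain T' where T': "T = Suc T'" using T(1)[OF BT] by (cases T) auto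
      have "(\<lambda>n. 1 / scaling DIM('a) k n (r n) * (\<integral>p. \<phi> p \<partial>diagram F n w)) \<longlonglongrightarrow> limit_integral (plane_function \<phi>)"
        by (rule diagram_limit[OF BT]) (use elim T' in auto)
      moreover have "(\<integral>p. \<phi> p \<partial>limit_diagram) = limit_integral (plane_function \<phi>)"
        by (rule limit_measure_integral[OF BT])
      moreover have "eventually (\<lambda>n. 1 / scaling DIM('a) k n (r n) * (\<integral>p. \<phi> p \<partial>diagram F n w) =
          (\<integral>p. \<phi> p \<partial>scale_measure (ennreal (1 / scaling DIM('a) k n (r n))) (diagram F n w))) sequentially"
        using eventually_ge_at_top[of 1]
      proof eventually_elim
        case (elim n)
        have "0 < scaling DIM('a) k n (r n)" by (rule scaling_pos[OF elim r_pos[OF elim]])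
        then show ?case
          using borel_measurable_continuous_on_restrict[OF \<phi>(1)] \<phi>'(1)
          by (intro integral_scale_measure[symmetric]) auto
      qed
      ultimately show "(\<lambda>n. \<integral>p. \<phi> p \<partial>scale_measure (ennreal (1 / scaling DIM('a) k n (r n))) (diagram F n w)) \<longlonglongrightarrow> (\<integral>p. \<phi> p \<partial>limit_diagram)"
        by (simp add: Lim_transform_eventually)
    qed
  qed
qed

lemma vague_mean_diagram:
  "vague_tendsto Delta_L (\<lambda>n. scale_measure (ennreal (1 / scaling DIM('a) k n (r n))) (mean_diagram F n)) limit_diagram"
  unfolding vague_tendsto_def
proof (intro allI impI, elim conjE exE)
  fix \<phi> :: "real \<times> ereal \<Rightarrow> real" and K
  assume \<phi>: "continuous_on Delta_L \<phi>" "\<forall>p\<in>Delta_L. 0 \<le> \<phi> p"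
    and K: "compact K" "K \<subseteq> Delta_L" "\<forall>p\<in>Delta_L - K. \<phi> p = 0"
  have \<phi>': "\<And>p. p \<in> Delta_L \<Longrightarrow> 0 \<le> \<phi> p" "\<And>p. p \<in> Delta_L - K \<Longrightarrow> \<phi> p = 0" using \<phi> K by auto
  obtain B T where BT: "test_function \<phi> B T"
    by (rule compact_support_test_function[OF \<phi>(1) \<phi>'(1) K(1,2) \<phi>'(2)]) blast+
  have "(\<lambda>n. 1 / scaling DIM('a) k n (r n) * (\<integral>p. \<phi> p \<partial>mean_diagram F n)) \<longlonglongrightarrow> limit_integral (plane_function \<phi>)"
    by (rule mean_diagram_limit[OF BT])
  moreover have "(\<integral>p. \<phi> p \<partial>limit_diagram) = limit_integral (plane_function \<phi>)"
    by (rule limit_measure_integral[OF BT])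
  moreover have "eventually (\<lambda>n. 1 / scaling DIM('a) k n (r n) * (\<integral>p. \<phi> p \<partial>mean_diagram F n) =
      (\<integral>p. \<phi> p \<partial>scale_measure (ennreal (1 / scaling DIM('a) k n (r n))) (mean_diagram F n))) sequentially"
    using eventually_ge_at_top[of 1]
  proof eventually_elim
    case (elim n)
    have s: "0 < scaling DIM('a) k n (r n)" by (rule scaling_pos[OF elim r_pos[OF elim]])
    have sN: "sets (mean_diagram F n) = sets (restrict_space borel Delta_L)"
      by (rule sets_mean_measure[OF random_measure_diagram])
    then have spN: "space (mean_diagram F n) = Delta_L"
      using sets_eq_imp_space_eq[OF sN] by (simp add: space_restrict_space)
    show ?case
      using borel_measurable_continuous_on_restrict[OF \<phi>(1)] \<phi>'(1) s
      by (intro integral_scale_measure[symmetric]) (auto simp: spN measurable_cong_sets[OF sN refl])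
  qed
  ultimately show "(\<lambda>n. \<integral>p. \<phi> p \<partial>scale_measure (ennreal (1 / scaling DIM('a) k n (r n))) (mean_diagram F n)) \<longlonglongrightarrow> (\<integral>p. \<phi> p \<partial>limit_diagram)"
    by (simp add: Lim_transform_eventually)
qed

end

lemma vague_limit_unique:
  fixes \<mu> \<nu> :: "(real \<times> ereal) measure"
  assumes "radon_measure_on Delta_L \<mu>" "radon_measure_on Delta_L \<nu>"
    and "vague_tendsto Delta_L \<nu>s \<mu>" "vague_tendsto Delta_L \<nu>s \<nu>"
  shows "\<mu> = \<nu>"
proof (rule radon_measure_eqI[OF assms(1,2)])
  fix \<phi> :: "real \<times> ereal \<Rightarrow> real"
  assume "continuous_on Delta_L \<phi>" "\<forall>p\<in>Delta_L. 0 \<le> \<phi> p"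
    "\<exists>K. compact K \<and> K \<subseteq> Delta_L \<and> (\<forall>p\<in>Delta_L - K. \<phi> p = 0)"
  then show "(\<integral>p. \<phi> p \<partial>\<mu>) = (\<integral>p. \<phi> p \<partial>\<nu>)"
    using assms(3,4) unfolding vague_tendsto_def by (intro LIMSEQ_unique[of "\<lambda>n. \<integral>p. \<phi> p \<partial>\<nu>s n"]) auto
qed

theorem theorem3p2:
  fixes M :: "'w measure" and X :: "nat \<Rightarrow> 'w \<Rightarrow> 'a::euclidean_space"
    and f :: "'a \<Rightarrow> real" and r :: "nat \<Rightarrow> real" and k :: nat and \<rho> \<eta> C :: real
  defines "a \<equiv> \<lambda>n. real n ^ (k + 2) * r n ^ (DIM('a) * (k + 1))"
    and "\<xi> \<equiv> \<lambda>n \<omega>. cech_diagram TYPE('f::field) k ((\<lambda>i. X i \<omega>) ` {1..n}) (r n)"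
  assumes "k \<ge> 1"
    and "prob_space M"
    and "prob_space.indep_vars M (\<lambda>_. borel) X {1..}"
    and "\<And>i. i \<ge> 1 \<Longrightarrow> distributed M lborel (X i) (\<lambda>x. ennreal (f x))"
    and "\<And>x. 0 \<le> f x"
    and "AE x in lborel. isCont f x"
    and "bounded (range f)"
    and "\<And>n. n \<ge> 1 \<Longrightarrow> 0 < r n"
    and "(\<lambda>n. real n * r n ^ DIM('a)) \<longlonglongrightarrow> 0"
    and "filterlim a at_top sequentially"
    and "\<rho> < 0"
    and "\<And>c. c > 0 \<Longrightarrow> (\<lambda>n. r (nat \<lfloor>c * real n\<rfloor>) / r n) \<longlonglongrightarrow> c powr \<rho>"
    and "\<eta> > 0" and "C > 0"
    and "\<And>n. n \<ge> 1 \<Longrightarrow> a n \<ge> C * ln (real n) powr \<eta>"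
  defines "is_limit \<equiv> \<lambda>\<mu>. radon_measure_on Delta_L \<mu> \<and>
      (AE \<omega> in M. vague_tendsto Delta_L (\<lambda>n. scale_measure (ennreal (1 / a n)) (\<xi> n \<omega>)) \<mu>) \<and>
      vague_tendsto Delta_L
        (\<lambda>n. scale_measure (ennreal (1 / a n)) (mean_measure M Delta_L (\<xi> n))) \<mu>"
  shows "(\<forall>n. random_measure_on M Delta_L (\<xi> n) \<and>
            radon_measure_on Delta_L (mean_measure M Delta_L (\<xi> n))) \<and>
    (\<exists>!\<mu>. is_limit \<mu>) \<and>
    (\<forall>\<mu>. is_limit \<mu> \<longrightarrow>
       countable {R. \<exists>s t u v. is_rectangle s t u v R \<and>
         emeasure \<mu> R \<noteq> ennreal (C_const f k *
           (\<integral>y. H_ind TYPE('f) k (ereal s) (ereal t) u v (y(0 := 0))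
              \<partial>(\<Pi>\<^sub>M i\<in>{1..k+1}. (lborel :: 'a measure))))})"
proof -
  interpret prob_space M by fact
  obtain Bf where Bf: "\<And>x. f x \<le> Bf"
  proof -
    from \<open>bounded (range f)\<close> obtain b where "\<And>x. norm (f x) \<le> b" by (auto simp: bounded_iff)
    then have "f x \<le> b" for x using abs_le_D1[of "f x" b] by simp
    then show ?thesis using that by blast
  qed
  have d1: "distributed M lborel (X 1) (\<lambda>x. ennreal (f x))" by (rule assms) simp
  \<comment> \<open>\<open>distributed\<close> provides measurability of the density with values in
    \<open>ennreal\<close>; it passes to \<open>f\<close> because \<open>f\<close> is
    nonnegative.\<close>
  have "(\<lambda>x. ennreal (f x)) \<in> borel_measurable lborel" using d1 by (simp add: distributed_def)
  then have "(\<lambda>x. enn2real (ennreal (f x))) \<in> borel_measurable lborel" by simp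
  then have fm: "f \<in> borel_measurable borel" using assms(7) by simp
  have "(\<integral>\<^sup>+x. ennreal (f x) \<partial>lborel) = emeasure (density lborel (\<lambda>x. ennreal (f x))) UNIV"
    using fm by (simp add: emeasure_density)
  also have "\<dots> = emeasure (distr M lborel (X 1)) UNIV" using d1 by (simp add: distributed_def)
  also have "\<dots> = emeasure M (X 1 -` UNIV \<inter> space M)"
    by (rule emeasure_distr) (use d1 in \<open>auto simp: distributed_def\<close>)
  also have "\<dots> = 1" by (simp add: emeasure_space_1)
  finally have fp: "(\<integral>\<^sup>+x. ennreal (f x) \<partial>lborel) = 1" .
  have a: "a n = scaling DIM('a) k n (r n)" for n by (simp add: a_def scaling_def)
  interpret sparse_sample f Bf M X k r \<rho> \<eta> C
    by unfold_locales (use assms Bf fm fp in \<open>auto simp: a[symmetric]\<close>)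
  have \<xi>: "\<xi> = diagram TYPE('f)" by (intro ext) (simp add: \<xi>_def diagram_def)
  have lim: "is_limit limit_diagram"
    unfolding is_limit_def a \<xi> using radon_limit_diagram AE_vague_diagram vague_mean_diagram by blast
  have uniq: "\<mu> = limit_diagram" if "is_limit \<mu>" for \<mu>
    using that lim unfolding is_limit_def by (blast intro: vague_limit_unique)
  have rect: "emeasure limit_diagram R = ennreal (C_const f k *
           (\<integral>y. H_ind TYPE('f) k (ereal s) (ereal t) u v (y(0 := 0))
              \<partial>(\<Pi>\<^sub>M i\<in>{1..k+1}. (lborel :: 'a measure))))" if "is_rectangle s t u v R" for s t u v R
    by (rule limit_measure_rectangle[OF k that C_const_nonneg time_integral_bounded_birth])
  show ?thesis
  proof (intro conjI allI impI)
    show "random_measure_on M Delta_L (\<xi> n)" for n unfolding \<xi> by (rule random_measure_diagram)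
    show "radon_measure_on Delta_L (mean_measure M Delta_L (\<xi> n))" for n unfolding \<xi> by (rule radon_mean_diagram)
    show "\<exists>!\<mu>. is_limit \<mu>" using lim uniq by blast
    fix \<mu> assume "is_limit \<mu>"
    then have \<mu>: "\<mu> = limit_diagram" by (rule uniq)
    \<comment> \<open>The exceptional family is empty, since the formula for the limit measure
      covers every rectangle.\<close>
    have "{R. \<exists>s t u v. is_rectangle s t u v R \<and>
         emeasure \<mu> R \<noteq> ennreal (C_const f k *
           (\<integral>y. H_ind TYPE('f) k (ereal s) (ereal t) u v (y(0 := 0))
              \<partial>(\<Pi>\<^sub>M i\<in>{1..k+1}. (lborel :: 'a measure))))} = {}"
      unfolding \<mu> using rect by blast
    then show "countable {R. \<exists>s t u v. is_rectangle s t u v R \<and>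
         emeasure \<mu> R \<noteq> ennreal (C_const f k *
           (\<integral>y. H_ind TYPE('f) k (ereal s) (ereal t) u v (y(0 := 0))
              \<partial>(\<Pi>\<^sub>M i\<in>{1..k+1}. (lborel :: 'a measure))))}" by (simp only: countable_empty)
  qed
qed

end
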